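(* Let $\mathbf{S}$ be a symmetric monoidal category. Let $G$ be a group. Put $Q_{\mathcal{V}}=G\mathcal{F}\otimes_{\mathbb{P}\otimes\mathbb{G}}G\mathcal{F}(as)^{op}$, $Q_{\mathcal{H}}=G\mathcal{F}(as)\otimes_{\mathbb{P}\otimes\mathbb{G}}G\mathcal{F}^{op}$ and $Q_{G\mathcal{F}}=G\mathcal{F}\otimes_{\mathbb{P}\otimes\mathbb{G}}G\mathcal{F}^{op}$. (1) The category $\mathbf{Alg}(Q_{\mathcal{V}},\mathbf{S})$ is equivalent to the category of $G$-commutative bimonoids in $\mathbf{S}$. (2) The category $\mathbf{Alg}(Q_{\mathcal{H}},\mathbf{S})$ is equivalent to the category of $G$-cocommutative bimonoids in $\mathbf{S}$. (3) The category $\mathbf{Alg}(Q_{G\mathcal{F}},\mathbf{S})$ is equivalent to the category of $G$-commutative and cocommutative bimonoids in $\mathbf{S}$.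
   Context: For $n\geq 1$, $\underline{n}=\{1,\dots,n\}$, and $\underline{0}=\emptyset$. A PROP is a symmetric strict monoidal category whose objects are the sets $\underline{n}$, $n\ge 0$, with tensor product of objects given by addition. For a PROP $T$ and a symmetric monoidal category $\mathbf{S}$, $\mathbf{Alg}(T,\mathbf{S})$ is the category of symmetric strict monoidal functors $T\to\mathbf{S}$ and natural transformations. A $G$-commutative (resp. $G$-cocommutative, resp. $G$-commutative and cocommutative) bimonoid in $\mathbf{S}$ is a functor from $G$ (a one-object category) to the category of bimonoids in $\mathbf{S}$ whose underlying monoid is commutative (resp. whose underlying comonoid is cocommutative, resp. both); morphisms are natural transformations. A $G$-labelled set is a finite subset of some $\underline{n}$ with a label in $G$ on each element; it is an ordered $G$-labelled set if it also carries a total order. The PROP $G\mathcal{F}(as)$ has objects $\underline{n}$; a morphism $f:\underline{n}\to\underline{m}$ is a map of sets together with the structure of an ordered $G$-labelled set on each preimage $f^{-1}(i)$. The composite $f_2\bullet f_1$ is the composite of set maps with $(f_2\bullet f_1)^{-1}(i)=\coprod_{j^{\alpha_j}\in f_2^{-1}(i)}\alpha_j\ast f_1^{-1}(j)$, where $\alpha_j$ is the label of $j$, $\alpha_j\ast$ multiplies all labels by $\alpha_j$ on the left, and the disjoint union is ordered (blocks as in $f_2^{-1}(i)$, each block as in $f_1^{-1}(j)$). The PROP $G\mathcal{F}$ is defined in the same way with $G$-labelled sets in place of ordered ones (composition is composition of set maps and multiplication of labels). Tensor products are juxtaposition and symmetries are block permutations. In both PROPs the bijections are the labelled permutations $G^n\rtimes\Sigma_n$,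 i.e. the morphisms of the PROP $\mathbb{P}\otimes\mathbb{G}$. Let $(X,Y)$ be $(G\mathcal{F},G\mathcal{F}(as))$, $(G\mathcal{F}(as),G\mathcal{F})$ or $(G\mathcal{F},G\mathcal{F})$. Consider the double category with objects $\underline{n}$, with horizontal morphisms those of $X$ and vertical morphisms those of $Y$. A bimorphism is a (not necessarily commutative) square with horizontal morphisms $f_1:\underline{n}\to\underline{p}$ (top), $f:\underline{m}\to\underline{q}$ (bottom) and vertical morphisms $\phi_1:\underline{n}\to\underline{m}$ (left), $\phi:\underline{p}\to\underline{q}$ (right), such that: the underlying diagram of finite sets is a pullback square; for all $x\in\underline{m}$ the map $\phi_1^{-1}(x)\to\phi^{-1}(f(x))$ induced by $f_1$ is an isomorphism; and for all $y\in\underline{p}$ the map $f_1^{-1}(y)\to f^{-1}(\phi(y))$ induced by $\phi_1$ is an isomorphism. Here isomorphism means isomorphism of ordered $G$-labelled sets for preimages under morphisms of $G\mathcal{F}(as)$, and of $G$-labelled sets for preimages under morphisms of $G\mathcal{F}$. The star condition holds: a horizontal morphism $f:\underline{m}\to\underline{q}$ and a vertical morphism $\phi:\underline{p}\to\underline{q}$ determine a unique bimorphism (take the pullback of the underlying maps, with preimage data induced from $f$ and $\phi$). This defines a distributive law $Y^{op}\otimes X\to X\otimes Y^{op}$, sending the cospan $\underline{m}\xrightarrow{f}\underline{q}\xleftarrow{\phi}\underline{p}$ to the span $\underline{m}\xleftarrow{\phi_1}\underline{n}\xrightarrow{f_1}\underline{p}$. The morphisms $\underline{n}\to\underline{m}$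 of $X\otimes Y^{op}$ are the spans $\underline{n}\xleftarrow{\phi}\underline{p}\xrightarrow{f}\underline{m}$ with $\phi$ in $Y$ and $f$ in $X$; two spans are composed by replacing the inner cospan by a span by means of this distributive law and composing the legs. Two spans $(\phi,f)$, $(\phi_1,f_1)$ with middle object $\underline{p}$ are equivalent if $\phi_1\circ h=\phi$ and $f_1\circ h=f$ for some labelled permutation $h\in G^p\rtimes\Sigma_p$. The composite PROP $X\otimes_{\mathbb{P}\otimes\mathbb{G}}Y^{op}$ is the category obtained from $X\otimes Y^{op}$ by identifying equivalent spans, with the induced PROP structure.
   Formalization: For non-abelian G, labels in a bimorphism commute around the square, since the label-preserving law yields no category; for non-strict S, algebras are strong rather than strict symmetric monoidal functors; the natural transformations in Alg are monoidal. *)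

theory Defs
  imports "HOL-Algebra.Group" "HOL-Library.FuncSet"
begin

section \<open>Categories, functors, equivalences\<close>

record ('o, 'a) cat =
  Obj :: "'o set"
  Arr :: "'a set"
  Dom :: "'a \<Rightarrow> 'o"
  Cod :: "'a \<Rightarrow> 'o"
  Ident :: "'o \<Rightarrow> 'a"
  Comp :: "'a \<Rightarrow> 'a \<Rightarrow> 'a"  (infixr "\<cdot>\<index>" 60)

definition Hom :: "('o, 'a, 'z) cat_scheme \<Rightarrow> 'o \<Rightarrow> 'o \<Rightarrow> 'a set" where
  "Hom C a b = {f \<in> Arr C. Dom C f = a \<and> Cod C f = b}"

locale category =
  fixes C :: "('o, 'a, 'z) cat_scheme" (structure)
  assumes dom_closed: "f \<in> Arr C \<Longrightarrow> Dom C f \<in> Obj C"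
    and cod_closed: "f \<in> Arr C \<Longrightarrow> Cod C f \<in> Obj C"
    and ident_closed: "a \<in> Obj C \<Longrightarrow> Ident C a \<in> Hom C a a"
    and comp_closed: "\<lbrakk>f \<in> Hom C a b; g \<in> Hom C b c\<rbrakk> \<Longrightarrow> g \<cdot> f \<in> Hom C a c"
    and comp_assoc: "\<lbrakk>f \<in> Hom C a b; g \<in> Hom C b c; h \<in> Hom C c d\<rbrakk> \<Longrightarrow> (h \<cdot> g) \<cdot> f = h \<cdot> (g \<cdot> f)"
    and comp_ident_left: "f \<in> Hom C a b \<Longrightarrow> Ident C b \<cdot> f = f"
    and comp_ident_right: "f \<in> Hom C a b \<Longrightarrow> f \<cdot> Ident C a = f"

definition inverse_arrows :: "('o, 'a, 'z) cat_scheme \<Rightarrow> 'a \<Rightarrow> 'a \<Rightarrow> bool" where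
  "inverse_arrows C f g \<longleftrightarrow>
     f \<in> Arr C \<and> g \<in> Hom C (Cod C f) (Dom C f) \<and>
     Comp C g f = Ident C (Dom C f) \<and> Comp C f g = Ident C (Cod C f)"

definition iso_arrow :: "('o, 'a, 'z) cat_scheme \<Rightarrow> 'a \<Rightarrow> bool" where
  "iso_arrow C f \<longleftrightarrow> (\<exists>g. inverse_arrows C f g)"

definition inv_arrow :: "('o, 'a, 'z) cat_scheme \<Rightarrow> 'a \<Rightarrow> 'a" where
  "inv_arrow C f = (THE g. inverse_arrows C f g)"

definition full_subcategory ::
  "('o, 'a, 'z) cat_scheme \<Rightarrow> ('o \<Rightarrow> bool) \<Rightarrow> ('o, 'a) cat" where
  "full_subcategory C P =
     \<lparr>Obj = {a \<in> Obj C. P a}, Arr = {f \<in> Arr C. P (Dom C f) \<and> P (Cod C f)},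
      Dom = Dom C, Cod = Cod C, Ident = Ident C, Comp = Comp C\<rparr>"

record ('o, 'a, 'p, 'b) fnctr =
  omap :: "'o \<Rightarrow> 'p"
  amap :: "'a \<Rightarrow> 'b"

text \<open>
  The extensionality conditions make equality of functors (and, below, of transformations) mean
  equality on the objects and arrows of the source category.
\<close>

locale is_functor =
  fixes C :: "('o, 'a, 'y) cat_scheme" and D :: "('p, 'b, 'z) cat_scheme"
    and F :: "('o, 'a, 'p, 'b, 'w) fnctr_scheme"
  assumes omap_closed: "omap F \<in> Obj C \<rightarrow>\<^sub>E Obj D"
    and amap_extensional: "amap F \<in> extensional (Arr C)"
    and amap_closed: "f \<in> Hom C a b \<Longrightarrow> amap F f \<in> Hom D (omap F a) (omap F b)"
    and amap_ident: "a \<in> Obj C \<Longrightarrow> amap F (Ident C a) = Ident D (omap F a)"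
    and amap_comp: "\<lbrakk>f \<in> Hom C a b; g \<in> Hom C b c\<rbrakk> \<Longrightarrow>
                    amap F (Comp C g f) = Comp D (amap F g) (amap F f)"

definition nat_transf ::
  "('o, 'a, 'y) cat_scheme \<Rightarrow> ('p, 'b, 'z) cat_scheme \<Rightarrow>
   ('o, 'a, 'p, 'b, 'v) fnctr_scheme \<Rightarrow> ('o, 'a, 'p, 'b, 'w) fnctr_scheme \<Rightarrow> ('o \<Rightarrow> 'b) \<Rightarrow> bool" where
  "nat_transf C D F F' \<theta> \<longleftrightarrow>
     \<theta> \<in> extensional (Obj C) \<and>
     (\<forall>a\<in>Obj C. \<theta> a \<in> Hom D (omap F a) (omap F' a)) \<and>
     (\<forall>f\<in>Arr C. Comp D (\<theta> (Cod C f)) (amap F f) = Comp D (amap F' f) (\<theta> (Dom C f)))"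

text \<open>
  An arrow of a functor category is a triple: source functor, family of components, target functor.
\<close>

definition transf_category ::
  "('o, 'a, 'y) cat_scheme \<Rightarrow> ('p, 'b, 'z) cat_scheme \<Rightarrow> ('o, 'a, 'p, 'b, 'w) fnctr_scheme set \<Rightarrow>
   (('o, 'a, 'p, 'b, 'w) fnctr_scheme \<Rightarrow> ('o, 'a, 'p, 'b, 'w) fnctr_scheme \<Rightarrow> ('o \<Rightarrow> 'b) \<Rightarrow> bool) \<Rightarrow>
   (('o, 'a, 'p, 'b, 'w) fnctr_scheme,
    ('o, 'a, 'p, 'b, 'w) fnctr_scheme \<times> ('o \<Rightarrow> 'b) \<times> ('o, 'a, 'p, 'b, 'w) fnctr_scheme) cat" where
  "transf_category C D \<F> P =
     \<lparr>Obj = \<F>,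
      Arr = {(F, \<theta>, F'). F \<in> \<F> \<and> F' \<in> \<F> \<and> P F F' \<theta>},
      Dom = (\<lambda>(F, \<theta>, F'). F),
      Cod = (\<lambda>(F, \<theta>, F'). F'),
      Ident = (\<lambda>F. (F, \<lambda>a\<in>Obj C. Ident D (omap F a), F)),
      Comp = (\<lambda>(F', \<theta>', F'') (F, \<theta>, _). (F, \<lambda>a\<in>Obj C. Comp D (\<theta>' a) (\<theta> a), F''))\<rparr>"

definition functor_category ::
  "('o, 'a, 'y) cat_scheme \<Rightarrow> ('p, 'b, 'z) cat_scheme \<Rightarrow>
   (('o, 'a, 'p, 'b) fnctr, ('o, 'a, 'p, 'b) fnctr \<times> ('o \<Rightarrow> 'b) \<times> ('o, 'a, 'p, 'b) fnctr) cat" where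
  "functor_category C D = transf_category C D {F. is_functor C D F} (nat_transf C D)"

definition equivalent_categories ::
  "('o, 'a, 'y) cat_scheme \<Rightarrow> ('p, 'b, 'z) cat_scheme \<Rightarrow> bool" where
  "equivalent_categories C D \<longleftrightarrow>
     category C \<and> category D \<and>
     (\<exists>(F :: ('o, 'a, 'p, 'b) fnctr) (H :: ('p, 'b, 'o, 'a) fnctr) \<eta> \<epsilon>.
        is_functor C D F \<and> is_functor D C H \<and>
        (\<forall>a\<in>Obj C. \<eta> a \<in> Hom C a (omap H (omap F a)) \<and> iso_arrow C (\<eta> a)) \<and>
        (\<forall>f\<in>Arr C. Comp C (\<eta> (Cod C f)) f = Comp C (amap H (amap F f)) (\<eta> (Dom C f))) \<and>
        (\<forall>b\<in>Obj D. \<epsilon> b \<in> Hom D (omap F (omap H b)) b \<and> iso_arrow D (\<epsilon> b)) \<and>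
        (\<forall>g\<in>Arr D. Comp D (\<epsilon> (Cod D g)) (amap F (amap H g)) = Comp D g (\<epsilon> (Dom D g))))"


section \<open>Symmetric monoidal categories and functors\<close>

record ('o, 'a) smc = "('o, 'a) cat" +
  TenO :: "'o \<Rightarrow> 'o \<Rightarrow> 'o"  (infixr "\<boxdot>\<index>" 70)
  TenA :: "'a \<Rightarrow> 'a \<Rightarrow> 'a"  (infixr "\<boxtimes>\<index>" 70)
  TUnit :: "'o"
  Assoc :: "'o \<Rightarrow> 'o \<Rightarrow> 'o \<Rightarrow> 'a"
  LUnit :: "'o \<Rightarrow> 'a"
  RUnit :: "'o \<Rightarrow> 'a"
  Braid :: "'o \<Rightarrow> 'o \<Rightarrow> 'a"

locale symmetric_monoidal_category = category C
  for C :: "('o, 'a, 'z) smc_scheme" (structure) +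
  assumes unit_obj: "TUnit C \<in> Obj C"
    and ten_obj: "\<lbrakk>a \<in> Obj C; b \<in> Obj C\<rbrakk> \<Longrightarrow> a \<boxdot> b \<in> Obj C"
    and ten_arr: "\<lbrakk>f \<in> Hom C a b; g \<in> Hom C c d\<rbrakk> \<Longrightarrow> f \<boxtimes> g \<in> Hom C (a \<boxdot> c) (b \<boxdot> d)"
    and ten_ident: "\<lbrakk>a \<in> Obj C; b \<in> Obj C\<rbrakk> \<Longrightarrow> Ident C a \<boxtimes> Ident C b = Ident C (a \<boxdot> b)"
    and ten_comp: "\<lbrakk>f \<in> Hom C a b; f' \<in> Hom C b c; g \<in> Hom C d e; g' \<in> Hom C e k\<rbrakk> \<Longrightarrow>
                   (f' \<cdot> f) \<boxtimes> (g' \<cdot> g) = (f' \<boxtimes> g') \<cdot> (f \<boxtimes> g)"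
    and assoc_arr: "\<lbrakk>a \<in> Obj C; b \<in> Obj C; c \<in> Obj C\<rbrakk> \<Longrightarrow>
                    Assoc C a b c \<in> Hom C ((a \<boxdot> b) \<boxdot> c) (a \<boxdot> (b \<boxdot> c)) \<and> iso_arrow C (Assoc C a b c)"
    and assoc_natural: "\<lbrakk>f \<in> Hom C a a'; g \<in> Hom C b b'; h \<in> Hom C c c'\<rbrakk> \<Longrightarrow>
                    Assoc C a' b' c' \<cdot> ((f \<boxtimes> g) \<boxtimes> h) = (f \<boxtimes> (g \<boxtimes> h)) \<cdot> Assoc C a b c"
    and lunit_arr: "a \<in> Obj C \<Longrightarrow> LUnit C a \<in> Hom C (TUnit C \<boxdot> a) a \<and> iso_arrow C (LUnit C a)"
    and lunit_natural: "f \<in> Hom C a b \<Longrightarrow> LUnit C b \<cdot> (Ident C (TUnit C) \<boxtimes> f) = f \<cdot> LUnit C a"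
    and runit_arr: "a \<in> Obj C \<Longrightarrow> RUnit C a \<in> Hom C (a \<boxdot> TUnit C) a \<and> iso_arrow C (RUnit C a)"
    and runit_natural: "f \<in> Hom C a b \<Longrightarrow> RUnit C b \<cdot> (f \<boxtimes> Ident C (TUnit C)) = f \<cdot> RUnit C a"
    and pentagon: "\<lbrakk>a \<in> Obj C; b \<in> Obj C; c \<in> Obj C; d \<in> Obj C\<rbrakk> \<Longrightarrow>
                    (Ident C a \<boxtimes> Assoc C b c d) \<cdot> Assoc C a (b \<boxdot> c) d \<cdot> (Assoc C a b c \<boxtimes> Ident C d)
                    = Assoc C a b (c \<boxdot> d) \<cdot> Assoc C (a \<boxdot> b) c d"
    and triangle: "\<lbrakk>a \<in> Obj C; b \<in> Obj C\<rbrakk> \<Longrightarrow>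
                    (Ident C a \<boxtimes> LUnit C b) \<cdot> Assoc C a (TUnit C) b = RUnit C a \<boxtimes> Ident C b"
    and braid_arr: "\<lbrakk>a \<in> Obj C; b \<in> Obj C\<rbrakk> \<Longrightarrow> Braid C a b \<in> Hom C (a \<boxdot> b) (b \<boxdot> a)"
    and braid_natural: "\<lbrakk>f \<in> Hom C a a'; g \<in> Hom C b b'\<rbrakk> \<Longrightarrow>
                    Braid C a' b' \<cdot> (f \<boxtimes> g) = (g \<boxtimes> f) \<cdot> Braid C a b"
    and symmetry: "\<lbrakk>a \<in> Obj C; b \<in> Obj C\<rbrakk> \<Longrightarrow> Braid C b a \<cdot> Braid C a b = Ident C (a \<boxdot> b)"
    and hexagon: "\<lbrakk>a \<in> Obj C; b \<in> Obj C; c \<in> Obj C\<rbrakk> \<Longrightarrow>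
                    Assoc C b c a \<cdot> Braid C a (b \<boxdot> c) \<cdot> Assoc C a b c
                    = (Ident C b \<boxtimes> Braid C a c) \<cdot> Assoc C b a c \<cdot> (Braid C a b \<boxtimes> Ident C c)"

definition strict_smc :: "('o, 'a, 'z) smc_scheme \<Rightarrow> bool" where
  "strict_smc C \<longleftrightarrow>
     (\<forall>a\<in>Obj C. \<forall>b\<in>Obj C. \<forall>c\<in>Obj C.
        TenO C (TenO C a b) c = TenO C a (TenO C b c) \<and>
        Assoc C a b c = Ident C (TenO C a (TenO C b c))) \<and>
     (\<forall>a\<in>Obj C. TenO C (TUnit C) a = a \<and> TenO C a (TUnit C) = a \<and>
        LUnit C a = Ident C a \<and> RUnit C a = Ident C a)"

record ('o, 'a, 'p, 'b) mfnctr = "('o, 'a, 'p, 'b) fnctr" +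
  unit_map :: "'b"
  ten_map :: "'o \<Rightarrow> 'o \<Rightarrow> 'b"

locale symmetric_monoidal_functor = is_functor C D F
  for C :: "('o, 'a, 'y) smc_scheme" and D :: "('p, 'b, 'z) smc_scheme" (structure)
    and F :: "('o, 'a, 'p, 'b, 'w) mfnctr_scheme" +
  assumes unit_map: "unit_map F \<in> Hom D (TUnit D) (omap F (TUnit C))" "iso_arrow D (unit_map F)"
    and ten_map: "\<lbrakk>a \<in> Obj C; b \<in> Obj C\<rbrakk> \<Longrightarrow>
          ten_map F a b \<in> Hom D (omap F a \<boxdot> omap F b) (omap F (TenO C a b)) \<and>
          iso_arrow D (ten_map F a b)"
    and ten_map_extensional: "a \<notin> Obj C \<or> b \<notin> Obj C \<Longrightarrow> ten_map F a b = undefined"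
    and ten_map_natural: "\<lbrakk>f \<in> Hom C a a'; g \<in> Hom C b b'\<rbrakk> \<Longrightarrow>
          ten_map F a' b' \<cdot> (amap F f \<boxtimes> amap F g) = amap F (TenA C f g) \<cdot> ten_map F a b"
    and preserves_assoc: "\<lbrakk>a \<in> Obj C; b \<in> Obj C; c \<in> Obj C\<rbrakk> \<Longrightarrow>
          amap F (Assoc C a b c) \<cdot> ten_map F (TenO C a b) c \<cdot> (ten_map F a b \<boxtimes> Ident D (omap F c))
          = ten_map F a (TenO C b c) \<cdot> (Ident D (omap F a) \<boxtimes> ten_map F b c)
              \<cdot> Assoc D (omap F a) (omap F b) (omap F c)"
    and preserves_lunit: "a \<in> Obj C \<Longrightarrow>
          amap F (LUnit C a) \<cdot> ten_map F (TUnit C) a \<cdot> (unit_map F \<boxtimes> Ident D (omap F a))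
          = LUnit D (omap F a)"
    and preserves_runit: "a \<in> Obj C \<Longrightarrow>
          amap F (RUnit C a) \<cdot> ten_map F a (TUnit C) \<cdot> (Ident D (omap F a) \<boxtimes> unit_map F)
          = RUnit D (omap F a)"
    and preserves_braid: "\<lbrakk>a \<in> Obj C; b \<in> Obj C\<rbrakk> \<Longrightarrow>
          amap F (Braid C a b) \<cdot> ten_map F a b = ten_map F b a \<cdot> Braid D (omap F a) (omap F b)"

locale symmetric_strict_monoidal_functor = symmetric_monoidal_functor C D F
  for C :: "('o, 'a, 'y) smc_scheme" and D :: "('p, 'b, 'z) smc_scheme" (structure)
    and F :: "('o, 'a, 'p, 'b, 'w) mfnctr_scheme" +
  assumes unit_strict: "omap F (TUnit C) = TUnit D" "unit_map F = Ident D (TUnit D)"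
    and ten_strict: "\<lbrakk>a \<in> Obj C; b \<in> Obj C\<rbrakk> \<Longrightarrow>
          omap F (TenO C a b) = omap F a \<boxdot> omap F b \<and>
          ten_map F a b = Ident D (omap F a \<boxdot> omap F b)"

definition monoidal_nat_transf ::
  "('o, 'a, 'y) smc_scheme \<Rightarrow> ('p, 'b, 'z) smc_scheme \<Rightarrow>
   ('o, 'a, 'p, 'b, 'w) mfnctr_scheme \<Rightarrow> ('o, 'a, 'p, 'b, 'w) mfnctr_scheme \<Rightarrow> ('o \<Rightarrow> 'b) \<Rightarrow> bool" where
  "monoidal_nat_transf C D F F' \<theta> \<longleftrightarrow>
     nat_transf C D F F' \<theta> \<and>
     Comp D (\<theta> (TUnit C)) (unit_map F) = unit_map F' \<and>
     (\<forall>a\<in>Obj C. \<forall>b\<in>Obj C.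
        Comp D (\<theta> (TenO C a b)) (ten_map F a b) = Comp D (ten_map F' a b) (TenA D (\<theta> a) (\<theta> b)))"

text \<open>
  Algebras of a PROP \<open>T\<close> in \<open>S\<close>. \<open>strict_Alg\<close> uses strict monoidal functors, and is the
  intended notion when \<open>S\<close> is strict. If \<open>S\<close> is not strict then a functor that is strict on the
  nose is the wrong notion (its value \<open>A\<close> at 1 would have to satisfy \<open>I \<otimes> A = A\<close>), and
  \<open>Alg\<close> takes strong monoidal functors instead. The transformations are the monoidal ones.
\<close>

definition strict_Alg ::
  "('o, 'a, 'y) smc_scheme \<Rightarrow> ('p, 'b, 'z) smc_scheme \<Rightarrow>
   (('o, 'a, 'p, 'b) mfnctr, ('o, 'a, 'p, 'b) mfnctr \<times> ('o \<Rightarrow> 'b) \<times> ('o, 'a, 'p, 'b) mfnctr) cat" where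
  "strict_Alg T S =
     transf_category T S {F. symmetric_strict_monoidal_functor T S F} (monoidal_nat_transf T S)"

definition Alg ::
  "('o, 'a, 'y) smc_scheme \<Rightarrow> ('p, 'b, 'z) smc_scheme \<Rightarrow>
   (('o, 'a, 'p, 'b) mfnctr, ('o, 'a, 'p, 'b) mfnctr \<times> ('o \<Rightarrow> 'b) \<times> ('o, 'a, 'p, 'b) mfnctr) cat" where
  "Alg T S =
     transf_category T S {F. symmetric_monoidal_functor T S F} (monoidal_nat_transf T S)"


section \<open>Bimonoids\<close>

record ('o, 'a) bimon =
  bobj :: "'o"
  bmult :: "'a"
  bunit :: "'a"
  bcomult :: "'a"
  bcounit :: "'a"

definition middle_interchange :: "('o, 'a, 'z) smc_scheme \<Rightarrow> 'o \<Rightarrow> 'o \<Rightarrow> 'o \<Rightarrow> 'o \<Rightarrow> 'a" where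
  \<comment> \<open>the canonical arrow from \<open>(a \<otimes> b) \<otimes> (c \<otimes> d)\<close> to \<open>(a \<otimes> c) \<otimes> (b \<otimes> d)\<close>\<close>
  "middle_interchange S a b c d =
     Comp S (inv_arrow S (Assoc S a c (TenO S b d)))
      (Comp S (TenA S (Ident S a)
                (Comp S (Assoc S c b d)
                  (Comp S (TenA S (Braid S b c) (Ident S d)) (inv_arrow S (Assoc S b c d)))))
        (Assoc S a b (TenO S c d)))"

locale monoid_object =
  fixes S :: "('o, 'a, 'z) smc_scheme" (structure) and A :: 'o and \<mu> \<eta> :: 'a
  assumes mon_obj: "A \<in> Obj S"
    and mult_arr: "\<mu> \<in> Hom S (A \<boxdot> A) A"
    and unit_arr: "\<eta> \<in> Hom S (TUnit S) A"
    and mult_assoc: "\<mu> \<cdot> (\<mu> \<boxtimes> Ident S A) = \<mu> \<cdot> (Ident S A \<boxtimes> \<mu>) \<cdot> Assoc S A A A"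
    and mult_lunit: "\<mu> \<cdot> (\<eta> \<boxtimes> Ident S A) = LUnit S A"
    and mult_runit: "\<mu> \<cdot> (Ident S A \<boxtimes> \<eta>) = RUnit S A"

locale comonoid_object =
  fixes S :: "('o, 'a, 'z) smc_scheme" (structure) and A :: 'o and \<Delta> \<epsilon> :: 'a
  assumes comon_obj: "A \<in> Obj S"
    and comult_arr: "\<Delta> \<in> Hom S A (A \<boxdot> A)"
    and counit_arr: "\<epsilon> \<in> Hom S A (TUnit S)"
    and comult_coassoc: "Assoc S A A A \<cdot> (\<Delta> \<boxtimes> Ident S A) \<cdot> \<Delta> = (Ident S A \<boxtimes> \<Delta>) \<cdot> \<Delta>"
    and comult_lcounit: "LUnit S A \<cdot> (\<epsilon> \<boxtimes> Ident S A) \<cdot> \<Delta> = Ident S A"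
    and comult_rcounit: "RUnit S A \<cdot> (Ident S A \<boxtimes> \<epsilon>) \<cdot> \<Delta> = Ident S A"

locale bimonoid =
  monoid_object S "bobj B" "bmult B" "bunit B" + comonoid_object S "bobj B" "bcomult B" "bcounit B"
  for S :: "('o, 'a, 'z) smc_scheme" (structure) and B :: "('o, 'a) bimon" +
  assumes comult_mult: "bcomult B \<cdot> bmult B =
      (bmult B \<boxtimes> bmult B) \<cdot> middle_interchange S (bobj B) (bobj B) (bobj B) (bobj B)
        \<cdot> (bcomult B \<boxtimes> bcomult B)"
    and comult_unit: "bcomult B \<cdot> bunit B = (bunit B \<boxtimes> bunit B) \<cdot> inv_arrow S (LUnit S (TUnit S))"
    and counit_mult: "bcounit B \<cdot> bmult B = LUnit S (TUnit S) \<cdot> (bcounit B \<boxtimes> bcounit B)"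
    and counit_unit: "bcounit B \<cdot> bunit B = Ident S (TUnit S)"

definition bimonoid_morphism ::
  "('o, 'a, 'z) smc_scheme \<Rightarrow> ('o, 'a) bimon \<Rightarrow> ('o, 'a) bimon \<Rightarrow> 'a \<Rightarrow> bool" where
  "bimonoid_morphism S B B' f \<longleftrightarrow>
     f \<in> Hom S (bobj B) (bobj B') \<and>
     Comp S f (bmult B) = Comp S (bmult B') (TenA S f f) \<and>
     Comp S f (bunit B) = bunit B' \<and>
     Comp S (TenA S f f) (bcomult B) = Comp S (bcomult B') f \<and>
     Comp S (bcounit B') f = bcounit B"

definition bimonoid_category ::
  "('o, 'a, 'z) smc_scheme \<Rightarrow> (('o, 'a) bimon, ('o, 'a) bimon \<times> 'a \<times> ('o, 'a) bimon) cat" where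
  "bimonoid_category S =
     \<lparr>Obj = {B. bimonoid S B},
      Arr = {(B, f, B'). bimonoid S B \<and> bimonoid S B' \<and> bimonoid_morphism S B B' f},
      Dom = (\<lambda>(B, f, B'). B),
      Cod = (\<lambda>(B, f, B'). B'),
      Ident = (\<lambda>B. (B, Ident S (bobj B), B)),
      Comp = (\<lambda>(B', g, B'') (B, f, _). (B, Comp S g f, B''))\<rparr>"

definition commutative_bimonoid :: "('o, 'a, 'z) smc_scheme \<Rightarrow> ('o, 'a) bimon \<Rightarrow> bool" where
  "commutative_bimonoid S B \<longleftrightarrow> Comp S (bmult B) (Braid S (bobj B) (bobj B)) = bmult B"

definition cocommutative_bimonoid :: "('o, 'a, 'z) smc_scheme \<Rightarrow> ('o, 'a) bimon \<Rightarrow> bool" where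
  "cocommutative_bimonoid S B \<longleftrightarrow> Comp S (Braid S (bobj B) (bobj B)) (bcomult B) = bcomult B"

definition group_category :: "('g, 'y) monoid_scheme \<Rightarrow> (unit, 'g) cat" where
  "group_category G =
     \<lparr>Obj = {()}, Arr = carrier G, Dom = (\<lambda>_. ()), Cod = (\<lambda>_. ()),
      Ident = (\<lambda>_. \<one>\<^bsub>G\<^esub>), Comp = (\<lambda>g h. g \<otimes>\<^bsub>G\<^esub> h)\<rparr>"

definition "G_commutative_bimonoids G S =
  functor_category (group_category G)
    (full_subcategory (bimonoid_category S) (commutative_bimonoid S))"

definition "G_cocommutative_bimonoids G S =
  functor_category (group_category G)
    (full_subcategory (bimonoid_category S) (cocommutative_bimonoid S))"

definition "G_commutative_cocommutative_bimonoids G S =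
  functor_category (group_category G)
    (full_subcategory (bimonoid_category S)
       (\<lambda>B. commutative_bimonoid S B \<and> cocommutative_bimonoid S B))"


section \<open>The labelled maps\<close>

text \<open>
  The object \<open>{1, \<dots>, n}\<close> is encoded by the number \<open>n\<close>. A morphism of \<open>G\<F>\<close> or of \<open>G\<F>(as)\<close>
  is a record of type \<open>'g lmap\<close>: \<open>lfun\<close> is the map of sets, \<open>llab x\<close> is the label that
  \<open>x\<close> carries in its fibre, and \<open>lord i\<close> enumerates the fibre over \<open>i\<close> in its total order.
  In \<open>G\<F>\<close> there are no orders, and \<open>lord i\<close> is always the empty list.
\<close>

record 'g lmap =
  lsrc :: nat
  ltgt :: nat
  lfun :: "nat \<Rightarrow> nat"
  llab :: "nat \<Rightarrow> 'g"
  lord :: "nat \<Rightarrow> nat list"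

datatype fibre_kind = Unordered | Ordered

definition fibre :: "'g lmap \<Rightarrow> nat \<Rightarrow> nat set" where
  "fibre f i = {x \<in> {1..lsrc f}. lfun f x = i}"

definition lmaps :: "fibre_kind \<Rightarrow> ('g, 'y) monoid_scheme \<Rightarrow> nat \<Rightarrow> nat \<Rightarrow> 'g lmap set" where
  \<comment> \<open>the morphisms \<open>n \<rightarrow> m\<close> of \<open>G\<F>\<close> (kind \<open>Unordered\<close>) resp. of \<open>G\<F>(as)\<close> (kind \<open>Ordered\<close>)\<close>
  "lmaps k G n m =
     {f. lsrc f = n \<and> ltgt f = m \<and>
         lfun f \<in> {1..n} \<rightarrow>\<^sub>E {1..m} \<and> llab f \<in> {1..n} \<rightarrow>\<^sub>E carrier G \<and>
         (case k of
            Unordered \<Rightarrow> \<forall>i. lord f i = []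
          | Ordered \<Rightarrow> (\<forall>i\<in>{1..m}. distinct (lord f i) \<and> set (lord f i) = fibre f i) \<and>
                       (\<forall>i. i \<notin> {1..m} \<longrightarrow> lord f i = []))}"

definition lcomp :: "('g, 'y) monoid_scheme \<Rightarrow> 'g lmap \<Rightarrow> 'g lmap \<Rightarrow> 'g lmap" where
  "lcomp G f2 f1 =
     \<lparr>lsrc = lsrc f1, ltgt = ltgt f2,
      lfun = (\<lambda>x\<in>{1..lsrc f1}. lfun f2 (lfun f1 x)),
      llab = (\<lambda>x\<in>{1..lsrc f1}. llab f2 (lfun f1 x) \<otimes>\<^bsub>G\<^esub> llab f1 x),
      lord = (\<lambda>i. concat (map (lord f1) (lord f2 i)))\<rparr>"

definition ltensor :: "'g lmap \<Rightarrow> 'g lmap \<Rightarrow> 'g lmap" where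
  "ltensor f g =
     \<lparr>lsrc = lsrc f + lsrc g, ltgt = ltgt f + ltgt g,
      lfun = (\<lambda>x\<in>{1..lsrc f + lsrc g}.
                if x \<le> lsrc f then lfun f x else ltgt f + lfun g (x - lsrc f)),
      llab = (\<lambda>x\<in>{1..lsrc f + lsrc g}. if x \<le> lsrc f then llab f x else llab g (x - lsrc f)),
      lord = (\<lambda>i. if i \<le> ltgt f then lord f i
                   else map (\<lambda>x. lsrc f + x) (lord g (i - ltgt f)))\<rparr>"

definition lperm :: "fibre_kind \<Rightarrow> nat \<Rightarrow> (nat \<Rightarrow> nat) \<Rightarrow> (nat \<Rightarrow> 'g) \<Rightarrow> 'g lmap" where
  \<comment> \<open>the labelled permutation with underlying bijection \<open>\<sigma>\<close> and labels \<open>\<gamma>\<close>, as a morphism of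
    \<open>G\<F>\<close> or \<open>G\<F>(as)\<close>; its fibres are singletons, so there is only one way to order them\<close>
  "lperm k p \<sigma> \<gamma> =
     \<lparr>lsrc = p, ltgt = p, lfun = (\<lambda>x\<in>{1..p}. \<sigma> x), llab = (\<lambda>x\<in>{1..p}. \<gamma> x),
      lord = (\<lambda>i. if k = Ordered \<and> i \<in> {1..p} then [inv_into {1..p} \<sigma> i] else [])\<rparr>"

definition lident :: "fibre_kind \<Rightarrow> ('g, 'y) monoid_scheme \<Rightarrow> nat \<Rightarrow> 'g lmap" where
  "lident k G n = lperm k n (\<lambda>x. x) (\<lambda>_. \<one>\<^bsub>G\<^esub>)"

definition lbraid :: "fibre_kind \<Rightarrow> ('g, 'y) monoid_scheme \<Rightarrow> nat \<Rightarrow> nat \<Rightarrow> 'g lmap" where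
  "lbraid k G n m = lperm k (n + m) (\<lambda>x. if x \<le> n then x + m else x - n) (\<lambda>_. \<one>\<^bsub>G\<^esub>)"


section \<open>Bimorphisms and the composite PROPs\<close>

text \<open>
  Two label conditions for bimorphisms. \<open>Preserving\<close>: the induced maps of fibres preserve orders
  and labels. The classes of spans then form a category only if \<open>G\<close> is commutative, see
  \<open>preserving_composite_imp_comm_group\<close> below: the endomorphism \<open>(h, 1)\<close> is equivalent
  to \<open>(1, h\<^sup>-\<^sup>1)\<close>, but composing them with \<open>(1, g)\<close> gives \<open>(h, g)\<close> and \<open>(1, h\<^sup>-\<^sup>1 g)\<close>, which are
  equivalent only if \<open>g\<close> and \<open>h\<close> commute. \<open>Commuting\<close>: the induced maps of fibres preserve orders,
  and the labels commute around the square. The filler is then unique up to a labelled permutation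
  of the upper left corner, for every group \<open>G\<close>. If \<open>G\<close> is commutative, then a label preserving
  bimorphism is a commuting one, so both conditions give the same composition of classes of spans.
\<close>

datatype label_law = Preserving | Commuting

definition fibre_iso :: "label_law \<Rightarrow> (nat \<Rightarrow> nat) \<Rightarrow> 'g lmap \<Rightarrow> nat \<Rightarrow> 'g lmap \<Rightarrow> nat \<Rightarrow> bool" where
  \<comment> \<open>\<open>u\<close> is an isomorphism from the fibre of \<open>f\<close> over \<open>i\<close> to the fibre of \<open>g\<close> over \<open>j\<close>; in the
    unordered case the condition on the lists is void\<close>
  "fibre_iso L u f i g j \<longleftrightarrow>
     bij_betw u (fibre f i) (fibre g j) \<and> map u (lord f i) = lord g j \<and>
     (L = Preserving \<longrightarrow> (\<forall>z\<in>fibre f i. llab g (u z) = llab f z))"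

definition bimorphism ::
  "label_law \<Rightarrow> fibre_kind \<Rightarrow> fibre_kind \<Rightarrow> ('g, 'y) monoid_scheme \<Rightarrow>
   'g lmap \<Rightarrow> 'g lmap \<Rightarrow> 'g lmap \<Rightarrow> 'g lmap \<Rightarrow> bool" where
  \<comment> \<open>top \<open>f1 : n \<rightarrow> p\<close>, bottom \<open>f : m \<rightarrow> q\<close>, left \<open>\<phi>1 : n \<rightarrow> m\<close>, right \<open>\<phi> : p \<rightarrow> q\<close>\<close>
  "bimorphism L kX kY G f1 f \<phi>1 \<phi> \<longleftrightarrow>
     (\<exists>n m p q.
        f1 \<in> lmaps kX G n p \<and> f \<in> lmaps kX G m q \<and> \<phi>1 \<in> lmaps kY G n m \<and> \<phi> \<in> lmaps kY G p q \<and>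
        bij_betw (\<lambda>z. (lfun \<phi>1 z, lfun f1 z)) {1..n}
          {(x, y). x \<in> {1..m} \<and> y \<in> {1..p} \<and> lfun f x = lfun \<phi> y} \<and>
        (\<forall>x\<in>{1..m}. fibre_iso L (lfun f1) \<phi>1 x \<phi> (lfun f x)) \<and>
        (\<forall>y\<in>{1..p}. fibre_iso L (lfun \<phi>1) f1 y f (lfun \<phi> y)) \<and>
        (L = Commuting \<longrightarrow>
           (\<forall>z\<in>{1..n}. llab f (lfun \<phi>1 z) \<otimes>\<^bsub>G\<^esub> llab \<phi>1 z = llab \<phi> (lfun f1 z) \<otimes>\<^bsub>G\<^esub> llab f1 z)))"

type_synonym 'g span = "'g lmap \<times> 'g lmap"

definition spans ::
  "fibre_kind \<Rightarrow> fibre_kind \<Rightarrow> ('g, 'y) monoid_scheme \<Rightarrow> nat \<Rightarrow> nat \<Rightarrow> 'g span set" where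
  "spans kX kY G n m = {(\<phi>, f). \<exists>p. \<phi> \<in> lmaps kY G p n \<and> f \<in> lmaps kX G p m}"

definition span_equiv ::
  "fibre_kind \<Rightarrow> fibre_kind \<Rightarrow> ('g, 'y) monoid_scheme \<Rightarrow> nat \<Rightarrow> nat \<Rightarrow> ('g span \<times> 'g span) set" where
  "span_equiv kX kY G n m =
     {((\<phi>, f), (\<phi>1, f1)).
        (\<phi>, f) \<in> spans kX kY G n m \<and> (\<phi>1, f1) \<in> spans kX kY G n m \<and> lsrc \<phi> = lsrc \<phi>1 \<and>
        (\<exists>\<sigma> \<gamma>. bij_betw \<sigma> {1..lsrc \<phi>1} {1..lsrc \<phi>1} \<and> \<gamma> \<in> {1..lsrc \<phi>1} \<rightarrow> carrier G \<and>
               lcomp G \<phi>1 (lperm kY (lsrc \<phi>1) \<sigma> \<gamma>) = \<phi> \<and>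
               lcomp G f1 (lperm kX (lsrc \<phi>1) \<sigma> \<gamma>) = f)}"

definition span_composites ::
  "label_law \<Rightarrow> fibre_kind \<Rightarrow> fibre_kind \<Rightarrow> ('g, 'y) monoid_scheme \<Rightarrow>
   'g span \<Rightarrow> 'g span \<Rightarrow> 'g span set" where
  \<comment> \<open>all composites \<open>t \<circ> s\<close> in \<open>X \<otimes> Y\<^sup>o\<^sup>p\<close>; they differ by the choice of the bimorphism that fills
    the inner cospan\<close>
  "span_composites L kX kY G t s =
     {(lcomp G (fst s) \<psi>1, lcomp G (snd t) f1) | \<psi>1 f1. bimorphism L kX kY G f1 (snd s) \<psi>1 (fst t)}"

text \<open>
  An arrow \<open>n \<rightarrow> m\<close> of the composite PROP is a triple \<open>(n, K, m)\<close> where \<open>K\<close> is an equivalence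
  class of spans.
\<close>

type_synonym 'g span_class = "nat \<times> 'g span set \<times> nat"

definition composite_ident ::
  "fibre_kind \<Rightarrow> fibre_kind \<Rightarrow> ('g, 'y) monoid_scheme \<Rightarrow> nat \<Rightarrow> 'g span_class" where
  "composite_ident kX kY G n = (n, span_equiv kX kY G n n `` {(lident kY G n, lident kX G n)}, n)"

definition composite_prop ::
  "label_law \<Rightarrow> fibre_kind \<Rightarrow> fibre_kind \<Rightarrow> ('g, 'y) monoid_scheme \<Rightarrow> (nat, 'g span_class) smc" where
  "composite_prop L kX kY G =
     \<lparr>Obj = UNIV,
      Arr = {(n, K, m). K \<in> spans kX kY G n m // span_equiv kX kY G n m},
      Dom = (\<lambda>(n, K, m). n),
      Cod = (\<lambda>(n, K, m). m),
      Ident = composite_ident kX kY G,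
      Comp = (\<lambda>(_, K', m) (n, K, _).
        (n, \<Union>s\<in>K. \<Union>t\<in>K'. span_equiv kX kY G n m `` span_composites L kX kY G t s, m)),
      TenO = (+),
      TenA = (\<lambda>(n, K, m) (n', K', m').
        (n + n',
         \<Union>(\<phi>, f)\<in>K. \<Union>(\<phi>', f')\<in>K'.
           span_equiv kX kY G (n + n') (m + m') `` {(ltensor \<phi> \<phi>', ltensor f f')},
         m + m')),
      TUnit = 0,
      Assoc = (\<lambda>a b c. composite_ident kX kY G (a + b + c)),
      LUnit = composite_ident kX kY G,
      RUnit = composite_ident kX kY G,
      Braid = (\<lambda>n m.
        (n + m, span_equiv kX kY G (n + m) (m + n) `` {(lident kY G (n + m), lbraid kX G n m)}, m + n))\<rparr>"

definition Q_V :: "label_law \<Rightarrow> ('g, 'y) monoid_scheme \<Rightarrow> (nat, 'g span_class) smc" where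
  "Q_V L G = composite_prop L Unordered Ordered G"

definition Q_H :: "label_law \<Rightarrow> ('g, 'y) monoid_scheme \<Rightarrow> (nat, 'g span_class) smc" where
  "Q_H L G = composite_prop L Ordered Unordered G"

definition Q_GF :: "label_law \<Rightarrow> ('g, 'y) monoid_scheme \<Rightarrow> (nat, 'g span_class) smc" where
  "Q_GF L G = composite_prop L Unordered Unordered G"

subsection \<open>Label preserving bimorphisms need a commutative group\<close>

context
  fixes G :: "('g, 'y) monoid_scheme" and unl :: "fibre_kind \<Rightarrow> 'g \<Rightarrow> 'g lmap"
  assumes group_G: "group G"
  defines "unl \<equiv> \<lambda>k g. lperm k 1 (\<lambda>x. x) (\<lambda>_. g)"
begin

interpretation group G by (rule group_G)

lemma unl_simps:
  "lsrc (unl k g) = 1" "ltgt (unl k g) = 1" "lfun (unl k g) = (\<lambda>x\<in>{1}. x)"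
  "llab (unl k g) = (\<lambda>x\<in>{1}. g)" "lord (unl k g) = (\<lambda>i. if k = Ordered \<and> i = 1 then [1] else [])"
  by (auto simp: unl_def lperm_def fun_eq_iff inv_into_def)

lemma fibre_unl: "fibre (unl k g) i = (if i = 1 then {1} else {})"
  by (auto simp: fibre_def unl_simps)

lemma unl_in: "g \<in> carrier G \<Longrightarrow> unl k g \<in> lmaps k G 1 1"
  by (cases k) (auto simp: lmaps_def unl_simps fibre_unl)

lemma unl_span: "g \<in> carrier G \<Longrightarrow> h \<in> carrier G \<Longrightarrow> (unl kY g, unl kX h) \<in> spans kX kY G 1 1"
  using unl_in by (auto simp: spans_def)

lemma lcomp_unl: "lcomp G (unl k g) (unl k h) = unl k (g \<otimes>\<^bsub>G\<^esub> h)"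
  by (intro lmap.equality) (auto simp: lcomp_def unl_simps fun_eq_iff)

lemma lperm_eq_unl:
  assumes "bij_betw \<sigma> {1..1::nat} {1..1}"
  shows "lperm k 1 \<sigma> \<gamma> = unl k (\<gamma> 1)"
proof -
  have "\<sigma> 1 = 1" using assms by (simp add: bij_betw_def)
  then have "inv_into {1::nat} \<sigma> 1 = 1"
    by (metis inv_into_into image_insert insertI1 singletonD image_empty)
  with \<open>\<sigma> 1 = 1\<close> show ?thesis
    by (intro lmap.equality) (auto simp: lperm_def unl_simps fun_eq_iff)
qed

lemma unl_inject: "unl k a = unl k b \<Longrightarrow> a = b"
  by (drule arg_cong[where f = "\<lambda>f. llab f 1"]) (simp add: unl_simps)

lemma span_equiv_unlD:
  assumes "((\<phi>, f), (unl kY c, unl kX d)) \<in> span_equiv kX kY G 1 1"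
  shows "\<exists>x\<in>carrier G. \<phi> = unl kY (c \<otimes>\<^bsub>G\<^esub> x) \<and> f = unl kX (d \<otimes>\<^bsub>G\<^esub> x)"
proof -
  obtain \<sigma> \<gamma> where *: "bij_betw \<sigma> {1..1::nat} {1..1}" "\<gamma> \<in> {1..1::nat} \<rightarrow> carrier G"
    "lcomp G (unl kY c) (lperm kY 1 \<sigma> \<gamma>) = \<phi>" "lcomp G (unl kX d) (lperm kX 1 \<sigma> \<gamma>) = f"
    using assms unfolding span_equiv_def mem_Collect_eq prod.case unl_simps(1) by blast
  have "\<phi> = unl kY (c \<otimes>\<^bsub>G\<^esub> \<gamma> 1)" "f = unl kX (d \<otimes>\<^bsub>G\<^esub> \<gamma> 1)"
    using *(3,4)[symmetric] by (simp_all only: lperm_eq_unl[OF *(1)] lcomp_unl)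
  with *(2) show ?thesis by auto
qed

lemma span_equiv_unlI:
  assumes "c \<in> carrier G" "d \<in> carrier G" "x \<in> carrier G"
  shows "((unl kY (c \<otimes>\<^bsub>G\<^esub> x), unl kX (d \<otimes>\<^bsub>G\<^esub> x)), (unl kY c, unl kX d)) \<in> span_equiv kX kY G 1 1"
proof -
  have "bij_betw (\<lambda>x. x) {1..1::nat} {1..1}" "(\<lambda>_. x) \<in> {1..1::nat} \<rightarrow> carrier G"
    using assms by (auto simp: bij_betw_def)
  moreover have "lcomp G (unl k c) (lperm k 1 (\<lambda>x. x) (\<lambda>_. x)) = unl k (c \<otimes>\<^bsub>G\<^esub> x)" for k c
    using lcomp_unl[of k c x] by (simp add: unl_def)
  moreover have "(unl kY (c \<otimes>\<^bsub>G\<^esub> x), unl kX (d \<otimes>\<^bsub>G\<^esub> x)) \<in> spans kX kY G 1 1"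
    "(unl kY c, unl kX d) \<in> spans kX kY G 1 1"
    using unl_span[OF m_closed[OF assms(1,3)] m_closed[OF assms(2,3)]] unl_span[OF assms(1,2)]
    by blast+
  ultimately show ?thesis
    unfolding span_equiv_def mem_Collect_eq prod.case unl_simps(1) by blast
qed

lemma bimorphism_unl:
  "g \<in> carrier G \<Longrightarrow> h \<in> carrier G \<Longrightarrow>
   bimorphism Preserving kX kY G (unl kX g) (unl kX g) (unl kY h) (unl kY h)"
  unfolding bimorphism_def
  by (intro exI[of _ 1] conjI unl_in)
    (auto simp: fibre_iso_def fibre_unl unl_simps bij_betw_def)

end

lemma preserving_composite_imp_comm_group:
  assumes "group G" and "category (composite_prop Preserving kX kY G)"
  shows "comm_group G"
proof -
  interpret group G by fact
  let ?Q = "composite_prop Preserving kX kY G"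
  let ?R = "span_equiv kX kY G 1 1"
  let ?u = "\<lambda>k g. lperm k 1 (\<lambda>x. x) (\<lambda>_. g)"
  note in_R = span_equiv_unlI[OF assms(1), where kX = kX and kY = kY]
  have comm: "g \<otimes>\<^bsub>G\<^esub> h = h \<otimes>\<^bsub>G\<^esub> g" if g: "g \<in> carrier G" and h: "h \<in> carrier G" for g h
  proof -
    define K where "K = ?R `` {(?u kY \<one>\<^bsub>G\<^esub>, ?u kX g)}"
    define K' where "K' = ?R `` {(?u kY h, ?u kX \<one>\<^bsub>G\<^esub>)}"
    have arr: "(1, K, 1) \<in> Hom ?Q 1 1" "(1, K', 1) \<in> Hom ?Q 1 1"
      using unl_span[OF assms(1)] g h
      by (auto simp: Hom_def composite_prop_def K_def K'_def intro!: quotientI)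
    have refl: "(?u kY a, ?u kX b) \<in> ?R `` {(?u kY a, ?u kX b)}"
      if "a \<in> carrier G" "b \<in> carrier G" for a b
      using in_R[of a b "\<one>\<^bsub>G\<^esub>"] that by simp
    have s: "(?u kY \<one>\<^bsub>G\<^esub>, ?u kX g) \<in> K" and t: "(?u kY h, ?u kX \<one>\<^bsub>G\<^esub>) \<in> K'"
      using refl g h by (auto simp: K_def K'_def)
    have t': "(?u kY \<one>\<^bsub>G\<^esub>, ?u kX (inv\<^bsub>G\<^esub> h)) \<in> K'"
      using in_R[of "\<one>\<^bsub>G\<^esub>" "inv\<^bsub>G\<^esub> h" h] h by (simp add: K'_def)
    define M where "M = (\<Union>s\<in>K. \<Union>t\<in>K'. ?R `` span_composites Preserving kX kY G t s)"
    have "Comp ?Q (1, K', 1) (1, K, 1) = (1, M, 1)"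
      by (simp add: composite_prop_def M_def)
    moreover have "Comp ?Q (1, K', 1) (1, K, 1) \<in> Hom ?Q 1 1"
      using category.comp_closed[OF assms(2) arr] .
    ultimately have M: "M \<in> spans kX kY G 1 1 // ?R"
      by (simp add: Hom_def composite_prop_def)
    have comp: "(?u kY (a \<otimes>\<^bsub>G\<^esub> c), ?u kX (d \<otimes>\<^bsub>G\<^esub> b)) \<in> M"
      if "(?u kY a, ?u kX b) \<in> K" "(?u kY c, ?u kX d) \<in> K'"
        "a \<in> carrier G" "b \<in> carrier G" "c \<in> carrier G" "d \<in> carrier G" for a b c d
    proof -
      have "(lcomp G (?u kY a) (?u kY c), lcomp G (?u kX d) (?u kX b))
            \<in> span_composites Preserving kX kY G (?u kY c, ?u kX d) (?u kY a, ?u kX b)"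
        using bimorphism_unl[OF assms(1) that(4,5), of kX kY]
        by (auto simp: span_composites_def)
      then have "(?u kY (a \<otimes>\<^bsub>G\<^esub> c), ?u kX (d \<otimes>\<^bsub>G\<^esub> b))
            \<in> span_composites Preserving kX kY G (?u kY c, ?u kX d) (?u kY a, ?u kX b)"
        by (simp only: lcomp_unl[OF assms(1)])
      moreover have "(?u kY (a \<otimes>\<^bsub>G\<^esub> c), ?u kX (d \<otimes>\<^bsub>G\<^esub> b))
          \<in> ?R `` {(?u kY (a \<otimes>\<^bsub>G\<^esub> c), ?u kX (d \<otimes>\<^bsub>G\<^esub> b))}"
        using refl that by simp
      ultimately show ?thesis
        using that(1,2) unfolding M_def by blast
    qed
    have m1: "(?u kY h, ?u kX g) \<in> M"
      using comp[OF s t] g h by simp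
    have m2: "(?u kY \<one>\<^bsub>G\<^esub>, ?u kX (inv\<^bsub>G\<^esub> h \<otimes>\<^bsub>G\<^esub> g)) \<in> M"
      using comp[OF s t'] g h by simp
    obtain \<phi> f where r: "M = ?R `` {(\<phi>, f)}"
      using M by (auto elim!: quotientE)
    obtain x where x: "x \<in> carrier G" "\<phi> = ?u kY (h \<otimes>\<^bsub>G\<^esub> x)" "f = ?u kX (g \<otimes>\<^bsub>G\<^esub> x)"
      using span_equiv_unlD[OF assms(1)] m1 r by blast
    obtain y where y: "y \<in> carrier G" "\<phi> = ?u kY (\<one>\<^bsub>G\<^esub> \<otimes>\<^bsub>G\<^esub> y)"
      "f = ?u kX (inv\<^bsub>G\<^esub> h \<otimes>\<^bsub>G\<^esub> g \<otimes>\<^bsub>G\<^esub> y)"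
      using span_equiv_unlD[OF assms(1)] m2 r by blast
    have "h \<otimes>\<^bsub>G\<^esub> x = y" "g \<otimes>\<^bsub>G\<^esub> x = inv\<^bsub>G\<^esub> h \<otimes>\<^bsub>G\<^esub> g \<otimes>\<^bsub>G\<^esub> y"
      using unl_inject[OF assms(1)] x y by (metis l_one)+
    then have "h \<otimes>\<^bsub>G\<^esub> (g \<otimes>\<^bsub>G\<^esub> x) = h \<otimes>\<^bsub>G\<^esub> (inv\<^bsub>G\<^esub> h \<otimes>\<^bsub>G\<^esub> g \<otimes>\<^bsub>G\<^esub> (h \<otimes>\<^bsub>G\<^esub> x))"
      by simp
    also have "\<dots> = (h \<otimes>\<^bsub>G\<^esub> inv\<^bsub>G\<^esub> h) \<otimes>\<^bsub>G\<^esub> (g \<otimes>\<^bsub>G\<^esub> h \<otimes>\<^bsub>G\<^esub> x)"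
      using g h x(1) by (simp only: m_assoc m_closed inv_closed)
    finally have "(h \<otimes>\<^bsub>G\<^esub> g) \<otimes>\<^bsub>G\<^esub> x = (g \<otimes>\<^bsub>G\<^esub> h) \<otimes>\<^bsub>G\<^esub> x"
      using g h x(1) by (simp add: m_assoc)
    then show ?thesis
      using g h x(1) by simp
  qed
  then show ?thesis
    by (intro group.group_comm_groupI[OF assms(1)])
qed

end

theory Submission
  imports Defs "HOL-Library.Multiset"
begin

text \<open>
  The class of a span \<open>(\<phi>, f)\<close> is the composite of the class of \<open>f\<close> with the class of \<open>\<phi>\<close> read backwards.
  Every labelled map is obtained by composition and juxtaposition from block permutations, the maps
  \<open>2 \<rightarrow> 1\<close> and \<open>0 \<rightarrow> 1\<close>, and the labelled identities of \<open>1\<close>. Hence an algebra is determined by its value at \<open>1\<close>,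
  and the pullbacks of pairs of these generators are exactly the bimonoid axioms; a permutation of a
  fibre is invisible in the unordered case, which gives (co)commutativity.

  Conversely, a monoid with an action of \<open>G\<close> evaluates a labelled map by permuting the inputs into the
  order of the fibres, letting the labels act, and multiplying each fibre. For a filler of a cospan the
  two evaluations agree because a product of \<open>m\<close> factors followed by a coproduct with \<open>n\<close> factors is
  \<open>m\<close> coproducts, a transposition of an \<open>m \<times> n\<close> array, and \<open>n\<close> products.

  Coherence is dealt with once and for all: if \<open>T\<close> is a family of objects with coherent isomorphisms
  \<open>T m \<otimes> T n \<cong> T (m + n)\<close>, as for an algebra or for the tensor powers of an object, then conjugation with
  these isomorphisms makes the arrows \<open>T n \<rightarrow> T m\<close> into a strict PROP, and all diagrams are computed there.
\<close>

text \<open>\<open>Comp\<close> of the composite PROP unites the composites over all representatives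
  and all bimorphisms. That this union is a single class rests on fillers being unique up to a
  labelled permutation of the corner. Both label laws are reduced to the commuting one; for label
  preserving squares this is where commutativity of \<open>G\<close> enters.

  Only the monoid half is computed. The comonoid half is the same development in the opposite PROP,
  with \<open>g\<close> acting through \<open>rho (inv g)\<close>: reversing composition turns the
  action around, the inverse turns it back, and among spans a label read backwards is indeed the
  inverse label.

  Permutations are neither functions nor words in transpositions but pairs of enumerations of the
  same named wires. Names may be numbers, points marked by a Boolean, or pairs of points, so sorting
  inputs into fibres, shuffling two coproducts and transposing an array are one notion, and
  composites are compared by their outer orders alone.

  The equivalence is a fully faithful, essentially surjective functor on an abstract set of monoidal
  functors, which covers strong and strict algebras together.\<close>

section \<open>Strict PROPs\<close>

locale strict_prop =
  fixes ar :: "'e \<Rightarrow> bool" and dm cd :: "'e \<Rightarrow> nat"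
    and cmp :: "'e \<Rightarrow> 'e \<Rightarrow> 'e" (infixr "\<odot>" 60)
    and ten :: "'e \<Rightarrow> 'e \<Rightarrow> 'e" (infixr "\<oslash>" 70)
    and idn :: "nat \<Rightarrow> 'e" and br :: "nat \<Rightarrow> nat \<Rightarrow> 'e"
  assumes ar_idn [simp]: "ar (idn n)" and dm_idn [simp]: "dm (idn n) = n" and cd_idn [simp]: "cd (idn n) = n"
    and ar_cmp [simp]: "\<lbrakk>ar f; ar g; cd f = dm g\<rbrakk> \<Longrightarrow> ar (g \<odot> f)"
    and dm_cmp [simp]: "\<lbrakk>ar f; ar g; cd f = dm g\<rbrakk> \<Longrightarrow> dm (g \<odot> f) = dm f"
    and cd_cmp [simp]: "\<lbrakk>ar f; ar g; cd f = dm g\<rbrakk> \<Longrightarrow> cd (g \<odot> f) = cd g"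
    and cmp_assoc: "\<lbrakk>ar f; ar g; ar h; cd f = dm g; cd g = dm h\<rbrakk> \<Longrightarrow> (h \<odot> g) \<odot> f = h \<odot> g \<odot> f"
    and idn_cmp: "\<lbrakk>ar f; cd f = n\<rbrakk> \<Longrightarrow> idn n \<odot> f = f"
    and cmp_idn: "\<lbrakk>ar f; dm f = n\<rbrakk> \<Longrightarrow> f \<odot> idn n = f"
    and ar_ten [simp]: "\<lbrakk>ar f; ar g\<rbrakk> \<Longrightarrow> ar (f \<oslash> g)"
    and dm_ten [simp]: "\<lbrakk>ar f; ar g\<rbrakk> \<Longrightarrow> dm (f \<oslash> g) = dm f + dm g"
    and cd_ten [simp]: "\<lbrakk>ar f; ar g\<rbrakk> \<Longrightarrow> cd (f \<oslash> g) = cd f + cd g"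
    and ten_assoc: "\<lbrakk>ar f; ar g; ar h\<rbrakk> \<Longrightarrow> (f \<oslash> g) \<oslash> h = f \<oslash> g \<oslash> h"
    and idn0_ten: "ar f \<Longrightarrow> idn 0 \<oslash> f = f" and ten_idn0: "ar f \<Longrightarrow> f \<oslash> idn 0 = f"
    and ten_idn: "idn m \<oslash> idn n = idn (m + n)"
    and interchange: "\<lbrakk>ar f; ar f'; ar g; ar g'; cd f = dm f'; cd g = dm g'\<rbrakk> \<Longrightarrow>
       (f' \<oslash> g') \<odot> (f \<oslash> g) = (f' \<odot> f) \<oslash> (g' \<odot> g)"
    and ar_br [simp]: "ar (br m n)" and dm_br [simp]: "dm (br m n) = m + n" and cd_br [simp]: "cd (br m n) = n + m"
    and br_nat: "\<lbrakk>ar f; ar g; dm f = a; cd f = a'; dm g = b; cd g = b'\<rbrakk> \<Longrightarrow>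
       br a' b' \<odot> (f \<oslash> g) = (g \<oslash> f) \<odot> br a b"
    and br_br: "br n m \<odot> br m n = idn (m + n)"
    and br_add_right: "br a (b + c) = (idn b \<oslash> br a c) \<odot> (br a b \<oslash> idn c)"
begin

definition hom :: "'e \<Rightarrow> nat \<Rightarrow> nat \<Rightarrow> bool" where "hom f n m \<longleftrightarrow> ar f \<and> dm f = n \<and> cd f = m"

lemma idn_ten_cmp: "\<lbrakk>ar f; ar g; cd f = dm g\<rbrakk> \<Longrightarrow> idn n \<oslash> (g \<odot> f) = (idn n \<oslash> g) \<odot> (idn n \<oslash> f)"
  by (simp add: interchange idn_cmp)
lemma cmp_ten_idn: "\<lbrakk>ar f; ar g; cd f = dm g\<rbrakk> \<Longrightarrow> (g \<odot> f) \<oslash> idn n = (g \<oslash> idn n) \<odot> (f \<oslash> idn n)"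
  by (simp add: interchange idn_cmp)

lemma inverse_unique:
  assumes "ar f" "ar g" "ar h" "cd f = dm g" "cd g = dm f" "cd h = dm f" "dm h = cd f"
    "g \<odot> f = idn (dm f)" "f \<odot> h = idn (cd f)"
  shows "g = h"
  using assms by (metis cmp_assoc cmp_idn idn_cmp)

text \<open>The hexagon at \<open>b = c = 0\<close> says that \<open>br a 0\<close> is idempotent,
  and \<open>br_br\<close> says that it is invertible; an invertible idempotent is the
  identity.\<close>

lemma br_0_right [simp]: "br a 0 = idn a"
proof -
  have e: "br a 0 = br a 0 \<odot> br a 0"
    using br_add_right[of a 0 0] by (simp add: idn0_ten ten_idn0)
  have i: "br 0 a \<odot> br a 0 = idn a" using br_br[of 0 a] by simp
  have "br a 0 = (br 0 a \<odot> br a 0) \<odot> br a 0" by (simp add: i idn_cmp)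
  also have "\<dots> = br 0 a \<odot> br a 0" by (subst cmp_assoc) (use e in simp_all)
  finally show ?thesis by (simp add: i)
qed

lemma br_0_left [simp]: "br 0 a = idn a"
  using br_br[of 0 a] by (simp add: cmp_idn)

text \<open>The second hexagon is the first one inverted: the right hand side is a right inverse of
  \<open>br c (a + b)\<close>, while \<open>br (a + b) c\<close> is a left inverse of it.\<close>

lemma br_add_left: "br (a + b) c = (br a c \<oslash> idn b) \<odot> (idn a \<oslash> br b c)"
proof (rule inverse_unique[where f = "br c (a + b)"])
  show "br (a + b) c \<odot> br c (a + b) = idn (dm (br c (a + b)))" by (simp add: br_br)
  have "br c (a + b) \<odot> (br a c \<oslash> idn b) \<odot> (idn a \<oslash> br b c)
     = (idn a \<oslash> br c b) \<odot> ((br c a \<oslash> idn b) \<odot> (br a c \<oslash> idn b)) \<odot> (idn a \<oslash> br b c)"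
    by (simp add: br_add_right cmp_assoc)
  then show "br c (a + b) \<odot> ((br a c \<oslash> idn b) \<odot> (idn a \<oslash> br b c)) = idn (cd (br c (a + b)))"
    by (simp add: interchange br_br idn_cmp ten_idn add.assoc flip: cmp_assoc)
qed (simp_all add: ac_simps)

subsection \<open>Tensors of lists\<close>

definition tens :: "'e list \<Rightarrow> 'e" where "tens fs = foldr (\<oslash>) fs (idn 0)"

lemma tens_simps [simp]: "tens [] = idn 0" "tens (f # fs) = f \<oslash> tens fs"
  by (simp_all add: tens_def)

lemma tens_ar [simp]:
  assumes "\<And>f. f \<in> set fs \<Longrightarrow> ar f"
  shows "ar (tens fs)" "dm (tens fs) = sum_list (map dm fs)" "cd (tens fs) = sum_list (map cd fs)"
  using assms by (induction fs) auto

lemma tens_map_ar [simp]: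
  assumes "\<And>x. x \<in> set xs \<Longrightarrow> ar (f x)"
  shows "ar (tens (map f xs))" "dm (tens (map f xs)) = (\<Sum>x\<leftarrow>xs. dm (f x))" "cd (tens (map f xs)) = (\<Sum>x\<leftarrow>xs. cd (f x))"
  using assms by (induction xs) auto

lemma tens_append [simp]: "(\<And>f. f \<in> set fs \<union> set gs \<Longrightarrow> ar f) \<Longrightarrow> tens (fs @ gs) = tens fs \<oslash> tens gs"
  by (induction fs) (auto simp: idn0_ten ten_assoc)

lemma tens_cmp:
  "\<lbrakk>\<And>x. x \<in> set xs \<Longrightarrow> ar (f x) \<and> ar (g x) \<and> cd (f x) = dm (g x)\<rbrakk> \<Longrightarrow>
   tens (map g xs) \<odot> tens (map f xs) = tens (map (\<lambda>x. g x \<odot> f x) xs)"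
proof (induction xs)
  case (Cons x xs)
  have "sum_list (map (\<lambda>x. cd (f x)) xs) = sum_list (map (\<lambda>x. dm (g x)) xs)"
    using Cons.prems by (intro arg_cong[where f = sum_list] map_cong) auto
  then show ?case using Cons by (auto simp: interchange o_def)
qed (simp add: idn_cmp)

lemma tens_idn: "tens (map (\<lambda>x. idn (w x)) xs) = idn (sum_list (map w xs))"
  by (induction xs) (auto simp: ten_idn)

lemma tens_concat:
  "(\<And>x f. x \<in> set xs \<Longrightarrow> f \<in> set (F x) \<Longrightarrow> ar f) \<Longrightarrow>
   tens (map (\<lambda>x. tens (F x)) xs) = tens (concat (map F xs))"
proof (induction xs)
  case (Cons x xs)
  have "tens (F x @ concat (map F xs)) = tens (F x) \<oslash> tens (concat (map F xs))"
    by (rule tens_append) (use Cons.prems in auto)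
  moreover have "tens (map (\<lambda>x. tens (F x)) xs) = tens (concat (map F xs))"
    by (rule Cons.IH) (use Cons.prems in auto)
  ultimately show ?case by simp
qed simp

subsection \<open>Permutations of named wires\<close>

text \<open>The wires that \<open>y\<close> has to cross when it is pulled to the front.\<close>

definition befr :: "'n \<Rightarrow> 'n list \<Rightarrow> 'n list" where
  "befr y xs = takeWhile (\<lambda>x. x \<noteq> y) xs"

definition wd :: "('n \<Rightarrow> nat) \<Rightarrow> 'n list \<Rightarrow> nat" where "wd w xs = sum_list (map w xs)"

lemma wd_simps [simp]: "wd w [] = 0" "wd w (x # xs) = w x + wd w xs" "wd w (xs @ ys) = wd w xs + wd w ys"
  by (simp_all add: wd_def)

lemma wd_mset: "mset xs = mset ys \<Longrightarrow> wd w xs = wd w ys"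
  unfolding wd_def by (metis mset_map sum_mset_sum_list)

lemma wd_1 [simp]: "wd (\<lambda>_. Suc 0) xs = length xs"
  by (induction xs) auto

text \<open>A symmetry given by two enumerations of the same named wires, \<open>xs\<close> at the
  input and \<open>ys\<close> at the output; the wire \<open>x\<close> is a cable of
  \<open>w x\<close> strands. It is a selection sort: the cable of the next output name is pulled to
  the front by one block braiding, and the rest is sorted recursively. The difference of naturals is
  the width of what stood behind \<open>y\<close>.\<close>

fun wp :: "('n \<Rightarrow> nat) \<Rightarrow> 'n list \<Rightarrow> 'n list \<Rightarrow> 'e" where
  "wp w xs [] = idn 0"
| "wp w xs (y # ys) = (idn (w y) \<oslash> wp w (remove1 y xs) ys) \<odot>
     (br (wd w (befr y xs)) (w y) \<oslash> idn (wd w (remove1 y xs) - wd w (befr y xs)))"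

lemma befr_eq: "y \<notin> set us \<Longrightarrow> befr y (us @ y # vs) = us"
  unfolding befr_def by (induction us) auto

lemma wp_Cons: "y \<notin> set us \<Longrightarrow>
  wp w (us @ y # vs) (y # ys) = (idn (w y) \<oslash> wp w (us @ vs) ys) \<odot> (br (wd w us) (w y) \<oslash> idn (wd w vs))"
  by (simp add: remove1_append befr_eq)

declare wp.simps(2) [simp del]

lemma wp_split:
  assumes "mset xs = mset (y # ys)"
  obtains us vs where "xs = us @ y # vs" "y \<notin> set us" "mset (us @ vs) = mset ys"
proof -
  have "y \<in> set xs" using assms by (metis list.set_intros(1) set_mset_mset)
  then obtain us vs where *: "xs = us @ y # vs" "y \<notin> set us" by (meson split_list_first)
  then have "mset (us @ vs) = mset ys" using assms by simp
  with * that show ?thesis by blast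
qed

lemma wp_hom:
  "mset xs = mset ys \<Longrightarrow> ar (wp w xs ys) \<and> dm (wp w xs ys) = wd w xs \<and> cd (wp w xs ys) = wd w ys"
proof (induction ys arbitrary: xs)
  case (Cons y ys)
  obtain us vs where xs: "xs = us @ y # vs" "y \<notin> set us" "mset (us @ vs) = mset ys"
    using Cons.prems by (rule wp_split)
  show ?case using Cons.IH[OF xs(3)] xs wd_mset[OF xs(3), of w] by (simp add: wp_Cons)
qed simp

lemma wp_ar [simp]:
  assumes "mset xs = mset ys"
  shows "ar (wp w xs ys)" "dm (wp w xs ys) = wd w xs" "cd (wp w xs ys) = wd w ys"
  using wp_hom[OF assms, of w] by simp_all

lemma wp_refl [simp]: "wp w xs xs = idn (wd w xs)"
proof (induction xs)
  case (Cons x xs) then show ?case using wp_Cons[of x "[]" w xs xs] by (simp add: ten_idn idn_cmp)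
qed simp

text \<open>Wires of different groups never cross: an extraction in the first group leaves the
  second group in place, which adds an identity factor on the right.\<close>

lemma wp_append:
  "\<lbrakk>mset xs = mset ys; mset xs' = mset ys'; distinct (xs @ xs')\<rbrakk> \<Longrightarrow>
   wp w (xs @ xs') (ys @ ys') = wp w xs ys \<oslash> wp w xs' ys'"
proof (induction ys arbitrary: xs)
  case (Cons y ys)
  obtain us vs where xs: "xs = us @ y # vs" "y \<notin> set us" "mset (us @ vs) = mset ys"
    using Cons.prems(1) by (rule wp_split)
  have IH: "wp w (us @ vs @ xs') (ys @ ys') = wp w (us @ vs) ys \<oslash> wp w xs' ys'"
    using Cons.IH[OF xs(3)] Cons.prems xs by auto
  have d: "wd w us + wd w vs = wd w ys" using wd_mset[OF xs(3), of w] by simp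
  have "wp w (xs @ xs') ((y # ys) @ ys') =
     (idn (w y) \<oslash> wp w (us @ vs) ys \<oslash> wp w xs' ys') \<odot> (br (wd w us) (w y) \<oslash> idn (wd w vs) \<oslash> idn (wd w xs'))"
    using wp_Cons[of y us w "vs @ xs'" "ys @ ys'"] xs by (simp add: IH ten_idn)
  also have "\<dots> = ((idn (w y) \<oslash> wp w (us @ vs) ys) \<oslash> wp w xs' ys') \<odot>
     ((br (wd w us) (w y) \<oslash> idn (wd w vs)) \<oslash> idn (wd w xs'))"
    using xs(3) Cons.prems by (simp add: ten_assoc)
  also have "\<dots> = wp w xs (y # ys) \<oslash> wp w xs' ys'"
    using xs Cons.prems by (simp add: interchange wp_Cons cmp_idn d)
  finally show ?case .
qed (simp add: idn0_ten)

text \<open>Extracting the names of \<open>ys\<close> one at a time past all of \<open>xs\<close>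
  builds up the block braiding by the hexagon.\<close>

lemma wp_swap_append: "distinct (xs @ ys) \<Longrightarrow> wp w (xs @ ys) (ys @ xs) = br (wd w xs) (wd w ys)"
proof (induction ys)
  case (Cons y ys)
  then show ?case using wp_Cons[of y xs w ys "ys @ xs"] by (simp add: br_add_right)
qed simp

lemma swap_aux1:
  "(idn z \<oslash> br p a \<oslash> idn q) \<odot> br (p + a + q) z = br (a + p + q) z \<odot> (br p a \<oslash> idn q \<oslash> idn z)"
  using br_nat[of "br p a \<oslash> idn q" "idn z" "p + a + q" "a + p + q" z z] by (simp add: ten_assoc)

text \<open>Wires in the order \<open>p a q z r\<close>. On the left \<open>a\<close> goes to the
  front, then \<open>z\<close> goes next to it and past it; on the right \<open>z\<close> goes
  before \<open>a\<close>. The hexagon merges the two moves of \<open>z\<close>, and naturality of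
  the braiding exchanges the result with the move of \<open>a\<close>.\<close>

lemma swap_case1:
  "(br a z \<oslash> idn (p + q + r)) \<odot> (idn a \<oslash> br (p + q) z \<oslash> idn r) \<odot> (br p a \<oslash> idn (q + z + r))
   = (idn z \<oslash> br p a \<oslash> idn (q + r)) \<odot> (br (p + a + q) z \<oslash> idn r)"
proof -
  have "(br a z \<oslash> idn (p + q + r)) \<odot> (idn a \<oslash> br (p + q) z \<oslash> idn r) \<odot> (br p a \<oslash> idn (q + z + r))
     = ((br a z \<oslash> idn (p + q)) \<oslash> idn r) \<odot> ((idn a \<oslash> br (p + q) z) \<oslash> idn r) \<odot> ((br p a \<oslash> idn q \<oslash> idn z) \<oslash> idn r)"
    by (simp add: ten_assoc ten_idn)
  also have "\<dots> = (((br a z \<oslash> idn (p + q)) \<odot> (idn a \<oslash> br (p + q) z)) \<odot> (br p a \<oslash> idn q \<oslash> idn z)) \<oslash> idn r"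
    by (simp add: cmp_ten_idn cmp_assoc ac_simps)
  also have "\<dots> = (br (a + (p + q)) z \<odot> (br p a \<oslash> idn q \<oslash> idn z)) \<oslash> idn r"
    by (simp add: br_add_left[of a])
  also have "\<dots> = ((idn z \<oslash> br p a \<oslash> idn q) \<odot> br (p + a + q) z) \<oslash> idn r"
    by (simp add: swap_aux1[unfolded add.assoc] add.assoc)
  also have "\<dots> = (idn z \<oslash> br p a \<oslash> idn (q + r)) \<odot> (br (p + a + q) z \<oslash> idn r)"
    by (simp add: cmp_ten_idn ten_assoc ten_idn ac_simps)
  finally show ?thesis .
qed

text \<open>Wires in the order \<open>p z q a r\<close>. On the left \<open>a\<close> passes
  \<open>z\<close> and is then passed back by it. Naturality brings the two crossings together,
  where they cancel by \<open>br_br\<close>.\<close>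

lemma swap_case2:
  "(br a z \<oslash> idn (p + q + r)) \<odot> (idn a \<oslash> br p z \<oslash> idn (q + r)) \<odot> (br (p + z + q) a \<oslash> idn r)
   = (idn z \<oslash> br (p + q) a \<oslash> idn r) \<odot> (br p z \<oslash> idn (q + a + r))"
proof -
  have s: "(idn a \<oslash> br p z \<oslash> idn q) \<odot> br (p + z + q) a = br (z + p + q) a \<odot> (br p z \<oslash> idn q \<oslash> idn a)"
    using br_nat[of "br p z \<oslash> idn q" "idn a" "p + z + q" "z + p + q" a a] by (simp add: ten_assoc)
  have "(br a z \<oslash> idn (p + q + r)) \<odot> (idn a \<oslash> br p z \<oslash> idn (q + r)) \<odot> (br (p + z + q) a \<oslash> idn r)
     = ((br a z \<oslash> idn (p + q)) \<oslash> idn r) \<odot> ((idn a \<oslash> br p z \<oslash> idn q) \<oslash> idn r) \<odot> (br (p + z + q) a \<oslash> idn r)"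
    by (simp add: ten_assoc ten_idn)
  also have "\<dots> = ((br a z \<oslash> idn (p + q)) \<odot> (idn a \<oslash> br p z \<oslash> idn q) \<odot> br (p + z + q) a) \<oslash> idn r"
    by (simp add: cmp_ten_idn ac_simps)
  also have "\<dots> = ((br a z \<oslash> idn (p + q)) \<odot> br (z + (p + q)) a \<odot> (br p z \<oslash> idn q \<oslash> idn a)) \<oslash> idn r"
    by (simp add: s[unfolded add.assoc] add.assoc)
  also have "(br a z \<oslash> idn (p + q)) \<odot> br (z + (p + q)) a \<odot> (br p z \<oslash> idn q \<oslash> idn a)
      = ((br a z \<oslash> idn (p + q)) \<odot> (br z a \<oslash> idn (p + q))) \<odot> (idn z \<oslash> br (p + q) a) \<odot> (br p z \<oslash> idn q \<oslash> idn a)"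
    by (subst br_add_left[of z]) (simp add: cmp_assoc ac_simps)
  also have "\<dots> = (idn z \<oslash> br (p + q) a) \<odot> (br p z \<oslash> idn q \<oslash> idn a)"
    by (simp add: interchange br_br ten_idn idn_cmp ac_simps)
  also have "\<dots> \<oslash> idn r = (idn z \<oslash> br (p + q) a \<oslash> idn r) \<odot> (br p z \<oslash> idn (q + a + r))"
    by (simp add: cmp_ten_idn ten_assoc ten_idn ac_simps)
  finally show ?thesis .
qed

end

context strict_prop begin

text \<open>One extraction performed after a wire permutation can be absorbed into its target order.
  This is the core of \<open>wp_cmp\<close>, because the second factor there begins with such an
  extraction.\<close>

lemma wp_swap_to_front:
  "\<lbrakk>mset xs = mset (us @ z # vs); distinct xs\<rbrakk> \<Longrightarrow>
   (br (wd w us) (w z) \<oslash> idn (wd w vs)) \<odot> wp w xs (us @ z # vs) = wp w xs (z # us @ vs)"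
proof (induction us arbitrary: xs)
  case Nil then show ?case by (simp add: ten_idn idn_cmp)
next
  case (Cons a us)
  let ?a = "w a" and ?z = "w z" and ?W = "wd w"
  have az: "a \<noteq> z" "a \<in> set xs" "z \<in> set xs"
    using Cons.prems by (metis append_Cons distinct.simps(2) in_set_conv_decomp mset_eq_imp_distinct_iff,
      metis append_Cons list.set_intros(1) mset_eq_setD, metis in_set_conv_decomp mset_eq_setD)
  define A where "A xs' = br (?W (befr a xs')) ?a \<oslash> idn (?W (remove1 a xs') - ?W (befr a xs'))" for xs'
  define Z where "Z xs' = br (?W (befr z xs')) ?z \<oslash> idn (?W (remove1 z xs') - ?W (befr z xs'))" for xs'
  have wa: "wp w xs' (a # ys) = (idn ?a \<oslash> wp w (remove1 a xs') ys) \<odot> A xs'" for xs' ys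
    by (simp add: wp.simps(2) A_def)
  have wz: "wp w xs' (z # ys) = (idn ?z \<oslash> wp w (remove1 z xs') ys) \<odot> Z xs'" for xs' ys
    by (simp add: wp.simps(2) Z_def)
  define r where "r = remove1 z (remove1 a xs)"
  have r': "remove1 a (remove1 z xs) = r" by (simp add: r_def remove1_commute)
  have mr: "mset r = mset (us @ vs)"
    using Cons.prems(1) az by (simp add: r_def)
  have mra: "mset (remove1 a xs) = mset (us @ z # vs)" using Cons.prems(1) by simp
  have IH: "(br (?W us) ?z \<oslash> idn (?W vs)) \<odot> wp w (remove1 a xs) (us @ z # vs) = wp w (remove1 a xs) (z # us @ vs)"
    using Cons.IH[OF mra] Cons.prems(2) by simp
  \<comment> \<open>Extracting \<open>a\<close>, then \<open>z\<close>, and crossing the two equals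
    extracting \<open>z\<close> and then \<open>a\<close>. Which of the two names comes first in
    \<open>xs\<close> decides between \<open>swap_case1\<close> and
    \<open>swap_case2\<close>.\<close>
  have key: "hom (A xs) (?W xs) (?a + ?z + ?W r) \<and> hom (Z xs) (?W xs) (?z + ?a + ?W r) \<and>
    hom (Z (remove1 a xs)) (?z + ?W r) (?z + ?W r) \<and> hom (A (remove1 z xs)) (?a + ?W r) (?a + ?W r) \<and>
    (br ?a ?z \<oslash> idn (?W r)) \<odot> (idn ?a \<oslash> Z (remove1 a xs)) \<odot> A xs
     = (idn ?z \<oslash> A (remove1 z xs)) \<odot> Z xs"
  proof -
    consider p q s where "xs = p @ a # q @ z # s" | p q s where "xs = p @ z # q @ a # s"
      using az by (metis split_list append_Cons append_assoc Un_iff set_append set_ConsD)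
    then show ?thesis
    proof cases
      case 1
      then have "a \<notin> set p" "z \<notin> set p" "a \<notin> set q" "z \<notin> set q" using Cons.prems(2) by auto
      then have e: "remove1 a xs = (p @ q) @ z # s" "remove1 z xs = p @ a # q @ s" "r = p @ q @ s"
         "befr a xs = p" "befr z xs = p @ a # q" "befr z ((p @ q) @ z # s) = p @ q" "befr a (p @ a # q @ s) = p"
         "remove1 z ((p @ q) @ z # s) = p @ q @ s" "remove1 a (p @ a # q @ s) = p @ q @ s"
        using az 1 befr_eq[of a p] befr_eq[of z "p @ q"] befr_eq[of z "p @ a # q"]
        by (auto simp: remove1_append r_def)
      show ?thesis using swap_case1[of ?a ?z "?W p" "?W q" "?W s"] unfolding A_def Z_def e
        unfolding 1 by (simp add: hom_def ac_simps)
    next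
      case 2
      then have "a \<notin> set p" "z \<notin> set p" "a \<notin> set q" "z \<notin> set q" using Cons.prems(2) by auto
      then have e: "remove1 a xs = p @ z # q @ s" "remove1 z xs = (p @ q) @ a # s" "r = p @ q @ s"
         "befr z xs = p" "befr a xs = p @ z # q" "befr a ((p @ q) @ a # s) = p @ q" "befr z (p @ z # q @ s) = p"
         "remove1 a ((p @ q) @ a # s) = p @ q @ s" "remove1 z (p @ z # q @ s) = p @ q @ s"
        using az 2 befr_eq[of z p] befr_eq[of a "p @ q"] befr_eq[of a "p @ z # q"]
        by (auto simp: remove1_append r_def)
      show ?thesis using swap_case2[of ?a ?z "?W p" "?W q" "?W s"] unfolding A_def Z_def e
        unfolding 2 by (simp add: hom_def ac_simps)
    qed
  qed
  have wr: "?W r = ?W us + ?W vs" using wd_mset[OF mr, of w] by simp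
  have wra: "?W (remove1 a xs) = ?z + ?W r" using wd_mset[OF mra, of w] wr by simp
  have "(br (?W (a # us)) ?z \<oslash> idn (?W vs)) \<odot> wp w xs (a # us @ z # vs)
    = (br ?a ?z \<oslash> idn (?W r)) \<odot> ((idn ?a \<oslash> (br (?W us) ?z \<oslash> idn (?W vs))) \<odot> (idn ?a \<oslash> wp w (remove1 a xs) (us @ z # vs))) \<odot> A xs"
    using key mra wra wr by (simp add: wa br_add_left cmp_ten_idn ten_assoc ten_idn cmp_assoc hom_def ac_simps)
  also have "\<dots> = (br ?a ?z \<oslash> idn (?W r)) \<odot> (idn ?a \<oslash> wp w (remove1 a xs) (z # us @ vs)) \<odot> A xs"
    using mra wra wr by (simp add: IH ac_simps flip: idn_ten_cmp)
  also have "\<dots> = ((br ?a ?z \<oslash> idn (?W r)) \<odot> ((idn ?a \<oslash> idn ?z) \<oslash> wp w r (us @ vs))) \<odot> (idn ?a \<oslash> Z (remove1 a xs)) \<odot> A xs"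
    using key mr wra wr by (simp add: wz r_def[symmetric] idn_ten_cmp cmp_assoc ten_assoc hom_def ac_simps)
  also have "(br ?a ?z \<oslash> idn (?W r)) \<odot> ((idn ?a \<oslash> idn ?z) \<oslash> wp w r (us @ vs)) = ((idn ?z \<oslash> idn ?a) \<oslash> wp w r (us @ vs)) \<odot> (br ?a ?z \<oslash> idn (?W r))"
    using mr wr by (simp add: interchange ten_idn idn_cmp cmp_idn ac_simps)
  also have "\<dots> \<odot> (idn ?a \<oslash> Z (remove1 a xs)) \<odot> A xs
     = (idn ?z \<oslash> idn ?a \<oslash> wp w r (us @ vs)) \<odot> (idn ?z \<oslash> A (remove1 z xs)) \<odot> Z xs"
    using key mr wr by (simp add: cmp_assoc ten_assoc hom_def ac_simps)
  also have "\<dots> = wp w xs (z # a # us @ vs)"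
    using key mr wr az by (simp add: wz wa r' idn_ten_cmp cmp_assoc hom_def ac_simps)
  finally show ?case by simp
qed

text \<open>Coherence of symmetries in the form used throughout: composites of wire permutations
  agree as soon as their outer orders do. Induction over \<open>zs\<close>, the first extraction
  being absorbed by \<open>wp_swap_to_front\<close>.\<close>

lemma wp_cmp:
  "\<lbrakk>mset xs = mset ys; mset ys = mset zs; distinct xs\<rbrakk> \<Longrightarrow> wp w ys zs \<odot> wp w xs ys = wp w xs zs"
proof (induction zs arbitrary: xs ys)
  case (Cons z zs)
  obtain us vs where ys: "ys = us @ z # vs" "z \<notin> set us" "mset (us @ vs) = mset zs"
    using Cons.prems(2) by (rule wp_split)
  have m: "mset xs = mset (z # zs)" "mset xs = mset (z # us @ vs)" using Cons.prems ys by simp_all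
  obtain us' vs' where xs: "xs = us' @ z # vs'" "z \<notin> set us'" "mset (us' @ vs') = mset zs"
    using m(1) by (rule wp_split)
  have d: "wd w us + wd w vs = wd w zs" "wd w us' + wd w vs' = wd w zs"
    using wd_mset[OF ys(3), of w] wd_mset[OF xs(3), of w] by simp_all
  have "wp w ys (z # zs) \<odot> wp w xs ys = (idn (w z) \<oslash> wp w (us @ vs) zs) \<odot> wp w xs (z # us @ vs)"
    using ys Cons.prems d m wp_swap_to_front[of xs us z vs w] by (simp add: wp_Cons cmp_assoc)
  also have "\<dots> = (idn (w z) \<oslash> (wp w (us @ vs) zs \<odot> wp w (us' @ vs') (us @ vs))) \<odot> (br (wd w us') (w z) \<oslash> idn (wd w vs'))"
    using ys xs d by (simp add: wp_Cons idn_ten_cmp cmp_assoc)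
  also have "wp w (us @ vs) zs \<odot> wp w (us' @ vs') (us @ vs) = wp w (us' @ vs') zs"
    by (rule Cons.IH) (use xs ys Cons.prems in auto)
  finally show ?case using xs by (simp add: wp_Cons)
qed (simp add: idn_cmp)

text \<open>Naturality of symmetries: boxes \<open>f x\<close> sitting on the cables slide through a
  permutation, and the cables change their width from \<open>w\<close> to \<open>w'\<close> on the
  way. Each extraction passes the boxes by \<open>br_nat\<close>.\<close>

lemma tens_wp:
  assumes f: "\<And>x. x \<in> set xs \<Longrightarrow> hom (f x) (w x) (w' x)"
  shows "mset xs = mset ys \<Longrightarrow> wp w' xs ys \<odot> tens (map f xs) = tens (map f ys) \<odot> wp w xs ys"
  using f
proof (induction ys arbitrary: xs)
  case (Cons y ys)
  obtain us vs where xs: "xs = us @ y # vs" "y \<notin> set us" "mset (us @ vs) = mset ys"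
    using Cons.prems(1) by (rule wp_split)
  have h: "ar (f x)" "dm (f x) = w x" "cd (f x) = w' x" if "x \<in> set xs" for x using Cons.prems(2)[OF that] by (auto simp: hom_def)
  have th: "hom (tens (map f zs)) (wd w zs) (wd w' zs)" if "set zs \<subseteq> set xs" for zs
    using h that by (induction zs) (auto simp: hom_def)
  have sy: "set ys \<subseteq> set xs" using mset_eq_setD[OF xs(3)] xs by auto
  have t: "hom (tens (map f us)) (wd w us) (wd w' us)" "hom (tens (map f vs)) (wd w vs) (wd w' vs)"
    "hom (tens (map f ys)) (wd w ys) (wd w' ys)" "hom (f y) (w y) (w' y)"
    using th[of us] th[of vs] th[OF sy] h[of y] xs by (auto simp: hom_def)
  have IH: "wp w' (us @ vs) ys \<odot> (tens (map f us) \<oslash> tens (map f vs)) = tens (map f ys) \<odot> wp w (us @ vs) ys"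
  proof -
    have "wp w' (us @ vs) ys \<odot> tens (map f (us @ vs)) = tens (map f ys) \<odot> wp w (us @ vs) ys"
      by (rule Cons.IH[OF xs(3)]) (use Cons.prems(2) xs in auto)
    moreover have "tens (map f (us @ vs)) = tens (map f us) \<oslash> tens (map f vs)"
      unfolding map_append by (rule tens_append) (use h xs in auto)
    ultimately show ?thesis by simp
  qed
  have d: "wd w ys = wd w us + wd w vs" "wd w' ys = wd w' us + wd w' vs" using wd_mset[OF xs(3)] by simp_all
  have e: "tens (map f xs) = tens (map f us) \<oslash> f y \<oslash> tens (map f vs)"
    unfolding xs(1) map_append by (subst tens_append) (use h xs in auto)
  have "wp w' xs (y # ys) \<odot> tens (map f xs) = (idn (w' y) \<oslash> wp w' (us @ vs) ys) \<odot>
     ((br (wd w' us) (w' y) \<oslash> idn (wd w' vs)) \<odot> ((tens (map f us) \<oslash> f y) \<oslash> tens (map f vs)))"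
    unfolding e using t xs d by (simp add: wp_Cons cmp_assoc hom_def ten_assoc)
  also have "(br (wd w' us) (w' y) \<oslash> idn (wd w' vs)) \<odot> ((tens (map f us) \<oslash> f y) \<oslash> tens (map f vs))
     = ((f y \<oslash> tens (map f us)) \<odot> br (wd w us) (w y)) \<oslash> (tens (map f vs) \<odot> idn (wd w vs))"
    using t by (simp add: interchange hom_def idn_cmp cmp_idn br_nat)
  also have "\<dots> = (f y \<oslash> (tens (map f us) \<oslash> tens (map f vs))) \<odot> (br (wd w us) (w y) \<oslash> idn (wd w vs))"
    using t by (simp add: interchange hom_def flip: ten_assoc)
  also have "(idn (w' y) \<oslash> wp w' (us @ vs) ys) \<odot> \<dots> =
     ((idn (w' y) \<odot> f y) \<oslash> (wp w' (us @ vs) ys \<odot> (tens (map f us) \<oslash> tens (map f vs)))) \<odot> (br (wd w us) (w y) \<oslash> idn (wd w vs))"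
    using t xs d by (simp add: hom_def flip: cmp_assoc interchange)
  also have "\<dots> = ((f y \<odot> idn (w y)) \<oslash> (tens (map f ys) \<odot> wp w (us @ vs) ys)) \<odot> (br (wd w us) (w y) \<oslash> idn (wd w vs))"
    using t by (simp add: IH idn_cmp cmp_idn hom_def)
  also have "\<dots> = tens (map f (y # ys)) \<odot> wp w xs (y # ys)"
    using t xs d by (simp add: wp_Cons hom_def cmp_assoc flip: interchange)
  finally show ?case .
qed (simp add: idn_cmp)

text \<open>Cutting every cable into a bundle \<open>l x\<close> of thinner wires refines a
  permutation of cables. It is needed after \<open>tens_wp\<close>, which leaves a permutation of
  cables of width \<open>length (l x)\<close>, whereas sortings are composed on single
  strands.\<close>

lemma wp_concat:
  "\<lbrakk>mset xs = mset ys; distinct (concat (map l xs)); distinct xs; \<And>x. x \<in> set xs \<Longrightarrow> w' x = wd w (l x)\<rbrakk> \<Longrightarrow>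
   wp w' xs ys = wp w (concat (map l xs)) (concat (map l ys))"
proof (induction ys arbitrary: xs)
  case (Cons y ys)
  obtain us vs where xs: "xs = us @ y # vs" "y \<notin> set us" "mset (us @ vs) = mset ys"
    using Cons.prems(1) by (rule wp_split)
  let ?c = "\<lambda>xs. concat (map l xs)"
  have "mset (?c xs) = sum_mset (image_mset (\<lambda>x. mset (l x)) (mset xs))" for xs
    by (induction xs) auto
  then have mc: "mset (?c xs) = mset (?c ys)" if "mset xs = mset ys" for xs ys
    using that by simp
  have wc: "wd w (?c zs) = wd w' zs" if "set zs \<subseteq> set xs" for zs
    using that Cons.prems(4) by (induction zs) auto
  have m: "mset (?c us @ ?c vs) = mset (?c ys)" using mc[OF xs(3)] by simp
  have IH: "wp w' (us @ vs) ys = wp w (?c us @ ?c vs) (?c ys)"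
    using Cons.IH[OF xs(3)] Cons.prems xs by (auto simp: Int_Un_distrib)
  have w: "wd w (?c us) = wd w' us" "wd w (?c vs) = wd w' vs" "wd w (l y) = w' y"
    using wc[of us] wc[of vs] Cons.prems(4)[of y] xs by auto
  have d: "wd w' us + wd w' vs = wd w' ys" using wd_mset[OF xs(3), of w'] by simp
  have "wp w (?c xs) (l y @ ?c ys) = wp w (l y @ ?c us @ ?c vs) (l y @ ?c ys) \<odot> wp w (?c xs) (l y @ ?c us @ ?c vs)"
  proof (rule wp_cmp[symmetric])
    show "mset (?c xs) = mset (l y @ ?c us @ ?c vs)" using xs(1) by simp
    show "mset (l y @ ?c us @ ?c vs) = mset (l y @ ?c ys)" using m by simp
  qed (rule Cons.prems(2))
  also have "wp w (l y @ ?c us @ ?c vs) (l y @ ?c ys) = idn (w' y) \<oslash> wp w' (us @ vs) ys"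
    using xs(1) m Cons.prems(2) by (subst wp_append) (auto simp: IH w)
  also have "wp w (?c xs) (l y @ ?c us @ ?c vs) = wp w ((?c us @ l y) @ ?c vs) ((l y @ ?c us) @ ?c vs)"
    using xs by simp
  also have "\<dots> = br (wd w' us) (w' y) \<oslash> idn (wd w' vs)"
  proof -
    have "distinct (?c us @ l y)" using xs(1) Cons.prems(2) by auto
    from wp_swap_append[OF this, of w] show ?thesis using xs(1) Cons.prems(2) by (subst wp_append) (auto simp: w)
  qed
  finally show ?case using xs by (simp add: wp_Cons)
qed simp

lemma wp_map: "inj_on h (set xs) \<Longrightarrow> mset xs = mset ys \<Longrightarrow> wp w (map h xs) (map h ys) = wp (\<lambda>x. w (h x)) xs ys"
proof (induction ys arbitrary: xs)
  case (Cons y ys)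
  obtain us vs where xs: "xs = us @ y # vs" "y \<notin> set us" "mset (us @ vs) = mset ys"
    using Cons.prems(2) by (rule wp_split)
  have "h y \<notin> set (map h us)" using Cons.prems(1) xs by (auto simp: inj_on_def)
  moreover have "wp w (map h us @ map h vs) (map h ys) = wp (\<lambda>x. w (h x)) (us @ vs) ys"
    using Cons.IH[OF _ xs(3)] Cons.prems(1) xs by (simp add: inj_on_def)
  ultimately show ?case using xs by (simp add: wp_Cons wd_def o_def)
qed simp

end

section \<open>Monoids with an action of G: products of labelled fibres\<close>

locale gmon = strict_prop ar dm cd cmp ten idn br + group G
  for ar :: "'e \<Rightarrow> bool" and dm cd :: "'e \<Rightarrow> nat"
    and cmp :: "'e \<Rightarrow> 'e \<Rightarrow> 'e" (infixr "\<odot>" 60)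
    and ten :: "'e \<Rightarrow> 'e \<Rightarrow> 'e" (infixr "\<oslash>" 70)
    and idn :: "nat \<Rightarrow> 'e" and br :: "nat \<Rightarrow> nat \<Rightarrow> 'e"
    and G :: "('g, 'y) monoid_scheme" (structure) +
  fixes mu eta :: 'e and rho :: "'g \<Rightarrow> 'e"
  assumes mu_ar [simp]: "ar mu" "dm mu = Suc (Suc 0)" "cd mu = Suc 0"
    and eta_ar [simp]: "ar eta" "dm eta = 0" "cd eta = Suc 0"
    and rho_ar [simp]: "g \<in> carrier G \<Longrightarrow> ar (rho g)" "g \<in> carrier G \<Longrightarrow> dm (rho g) = Suc 0"
      "g \<in> carrier G \<Longrightarrow> cd (rho g) = Suc 0"
    and mu_assoc: "mu \<odot> (mu \<oslash> idn (Suc 0)) = mu \<odot> (idn (Suc 0) \<oslash> mu)"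
    and mu_unit: "mu \<odot> (eta \<oslash> idn (Suc 0)) = idn (Suc 0)" "mu \<odot> (idn (Suc 0) \<oslash> eta) = idn (Suc 0)"
    and rho_rho: "\<lbrakk>g \<in> carrier G; h \<in> carrier G\<rbrakk> \<Longrightarrow> rho g \<odot> rho h = rho (g \<otimes> h)"
    and rho_one: "rho \<one> = idn (Suc 0)"
    and rho_mu: "g \<in> carrier G \<Longrightarrow> rho g \<odot> mu = mu \<odot> (rho g \<oslash> rho g)"
    and rho_eta: "g \<in> carrier G \<Longrightarrow> rho g \<odot> eta = eta"
begin

lemma mu_assoc_cmp:
  assumes "ar a" "ar b" "ar c" "cd a = Suc 0" "cd b = Suc 0" "cd c = Suc 0"
  shows "mu \<odot> ((mu \<odot> (a \<oslash> b)) \<oslash> c) = mu \<odot> (a \<oslash> (mu \<odot> (b \<oslash> c)))"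
proof -
  have "mu \<odot> ((mu \<odot> (a \<oslash> b)) \<oslash> c) = mu \<odot> (mu \<oslash> idn (Suc 0)) \<odot> ((a \<oslash> b) \<oslash> c)"
    using assms by (simp add: interchange idn_cmp)
  also have "\<dots> = (mu \<odot> (mu \<oslash> idn (Suc 0))) \<odot> (a \<oslash> b \<oslash> c)"
    using assms by (simp add: ten_assoc cmp_assoc)
  also have "\<dots> = mu \<odot> (idn (Suc 0) \<oslash> mu) \<odot> (a \<oslash> b \<oslash> c)"
    using assms by (simp add: mu_assoc cmp_assoc)
  also have "\<dots> = mu \<odot> (a \<oslash> (mu \<odot> (b \<oslash> c)))"
    using assms by (simp add: interchange idn_cmp)
  finally show ?thesis .
qed

lemma mu_eta_cmp:
  assumes "ar a" "cd a = Suc 0"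
  shows "mu \<odot> (eta \<oslash> a) = a" "mu \<odot> (a \<oslash> eta) = a"
proof -
  have "mu \<odot> (eta \<oslash> a) = (mu \<odot> (eta \<oslash> idn (Suc 0))) \<odot> (idn 0 \<oslash> a)"
    using assms by (simp add: cmp_assoc interchange cmp_idn idn_cmp)
  then show "mu \<odot> (eta \<oslash> a) = a" using assms by (simp add: mu_unit idn_cmp idn0_ten)
  have "mu \<odot> (a \<oslash> eta) = (mu \<odot> (idn (Suc 0) \<oslash> eta)) \<odot> (a \<oslash> idn 0)"
    using assms by (simp add: cmp_assoc interchange cmp_idn idn_cmp)
  then show "mu \<odot> (a \<oslash> eta) = a" using assms by (simp add: mu_unit idn_cmp ten_idn0)
qed

text \<open>The operation that sends \<open>x1, ..., xk\<close> to
  \<open>(g1 x1) (g2 x2) ... (gk xk)\<close>: every input is moved by its label, and the results are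
  multiplied in order. The final factor is a unit, which \<open>mu_unit\<close> removes.\<close>

primrec mulw :: "'g list \<Rightarrow> 'e" where
  "mulw [] = eta"
| "mulw (g # gs) = mu \<odot> (rho g \<oslash> mulw gs)"

lemma mulw_hom: "set gs \<subseteq> carrier G \<Longrightarrow> ar (mulw gs) \<and> dm (mulw gs) = length gs \<and> cd (mulw gs) = Suc 0"
  by (induction gs) auto

lemma mulw_ar [simp]:
  assumes "set gs \<subseteq> carrier G"
  shows "ar (mulw gs)" "dm (mulw gs) = length gs" "cd (mulw gs) = Suc 0"
  using mulw_hom[OF assms] by auto

lemma mulw_append:
  "\<lbrakk>set gs \<subseteq> carrier G; set hs \<subseteq> carrier G\<rbrakk> \<Longrightarrow> mulw (gs @ hs) = mu \<odot> (mulw gs \<oslash> mulw hs)"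
  by (induction gs) (auto simp: mu_eta_cmp mu_assoc_cmp)

lemma mulw_single: "g \<in> carrier G \<Longrightarrow> mulw [g] = rho g"
  by (simp add: mu_eta_cmp)

lemma rho_mulw:
  "\<lbrakk>g \<in> carrier G; set gs \<subseteq> carrier G\<rbrakk> \<Longrightarrow> rho g \<odot> mulw gs = mulw (map (\<lambda>h. g \<otimes> h) gs)"
proof (induction gs)
  case (Cons h gs)
  have "rho g \<odot> mulw (h # gs) = (rho g \<odot> mu) \<odot> (rho h \<oslash> mulw gs)"
    using Cons.prems by (simp add: cmp_assoc)
  also have "\<dots> = mu \<odot> ((rho g \<odot> rho h) \<oslash> (rho g \<odot> mulw gs))"
    using Cons.prems by (simp add: rho_mu cmp_assoc interchange)
  finally show ?case using Cons by (simp add: rho_rho)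
qed (simp add: rho_eta)

text \<open>This is the composition rule of ordered labelled fibres: blocks are concatenated, and
  the label \<open>a x\<close> multiplies the labels of its block from the left because
  \<open>rho (a x)\<close> is multiplicative.\<close>

lemma mulw_tens:
  "\<lbrakk>\<And>x. x \<in> set xs \<Longrightarrow> a x \<in> carrier G \<and> set (l x) \<subseteq> carrier G\<rbrakk> \<Longrightarrow>
   mulw (map a xs) \<odot> tens (map (\<lambda>x. mulw (l x)) xs) = mulw (concat (map (\<lambda>x. map (\<lambda>h. a x \<otimes> h) (l x)) xs))"
proof (induction xs)
  case (Cons x xs)
  have c: "set (map a xs) \<subseteq> carrier G" "\<And>y. y \<in> set xs \<Longrightarrow> set (l y) \<subseteq> carrier G" "a x \<in> carrier G" "set (l x) \<subseteq> carrier G"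
    using Cons.prems by auto
  have s: "(\<Sum>x\<leftarrow>xs. cd (mulw (l x))) = length xs" using c(2) by (induction xs) auto
  have "mulw (map a (x # xs)) \<odot> tens (map (\<lambda>x. mulw (l x)) (x # xs)) =
     mu \<odot> ((rho (a x) \<odot> mulw (l x)) \<oslash> (mulw (map a xs) \<odot> tens (map (\<lambda>x. mulw (l x)) xs)))"
    using c s by (simp add: cmp_assoc interchange)
  also have "mulw (map a xs) \<odot> tens (map (\<lambda>x. mulw (l x)) xs) = mulw (concat (map (\<lambda>x. map (\<lambda>h. a x \<otimes> h) (l x)) xs))"
    by (rule Cons.IH) (use Cons.prems in auto)
  also have "mu \<odot> ((rho (a x) \<odot> mulw (l x)) \<oslash> \<dots>) = mulw (map (\<lambda>h. a x \<otimes> h) (l x) @ concat (map (\<lambda>x. map (\<lambda>h. a x \<otimes> h) (l x)) xs))"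
    using Cons.prems c by (subst mulw_append) (auto simp: rho_mulw subset_iff)
  finally show ?case by simp
qed (simp add: cmp_idn)

abbreviation wp1 :: "'n list \<Rightarrow> 'n list \<Rightarrow> 'e" where "wp1 \<equiv> wp (\<lambda>_. Suc 0)"

text \<open>Evaluation of a labelled map with inputs named by \<open>xs\<close> and outputs named by
  \<open>is\<close>: the inputs are sorted into the concatenated fibres \<open>l i\<close>, and
  every fibre is multiplied with its labels \<open>a\<close>. The names are arbitrary rather than
  numbers, so that the corner of a square can be named by pairs.\<close>

definition Mn :: "'n list \<Rightarrow> 'i list \<Rightarrow> ('i \<Rightarrow> 'n list) \<Rightarrow> ('n \<Rightarrow> 'g) \<Rightarrow> 'e" where
  "Mn xs is l a = tens (map (\<lambda>i. mulw (map a (l i))) is) \<odot> wp1 xs (concat (map l is))"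

lemma tens_mulw [simp]:
  assumes "\<And>i. i \<in> set is \<Longrightarrow> set (l i) \<subseteq> carrier G"
  shows "ar (tens (map (\<lambda>i. mulw (l i)) is))" "dm (tens (map (\<lambda>i. mulw (l i)) is)) = length (concat (map l is))"
    "cd (tens (map (\<lambda>i. mulw (l i)) is)) = length is"
  using assms by (induction "is") auto

lemma Mn_ar:
  assumes "mset xs = mset (concat (map l is))" "\<And>x. x \<in> set xs \<Longrightarrow> a x \<in> carrier G"
  shows "ar (Mn xs is l a)" "dm (Mn xs is l a) = length xs" "cd (Mn xs is l a) = length is"
proof -
  have "set (map a (l i)) \<subseteq> carrier G" if "i \<in> set is" for i
    using mset_eq_setD[OF assms(1)] assms(2) that by auto
  note * = tens_mulw[of "is" "\<lambda>i. map a (l i)", OF this]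
  have "length xs = length (concat (map l is))" using assms(1) by (rule mset_eq_length)
  moreover have "length (concat (map (\<lambda>i. map a (l i)) is)) = length (concat (map l is))"
    by (simp add: length_concat o_def)
  ultimately show "ar (Mn xs is l a)" "dm (Mn xs is l a) = length xs" "cd (Mn xs is l a) = length is"
    using * assms(1) by (simp_all add: Mn_def)
qed

lemma Mn_cong:
  assumes "\<And>i. i \<in> set is \<Longrightarrow> l i = l' i" "\<And>i x. \<lbrakk>i \<in> set is; x \<in> set (l i)\<rbrakk> \<Longrightarrow> a x = a' x"
  shows "Mn xs is l a = Mn xs is l' a'"
proof -
  have "map l is = map l' is" "map (\<lambda>i. mulw (map a (l i))) is = map (\<lambda>i. mulw (map a' (l' i))) is"
    using assms by (auto intro!: arg_cong[where f = mulw] map_cong)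
  then show ?thesis by (simp only: Mn_def)
qed

text \<open>Sliding the fibre products through a reordering of the outputs moves whole fibres;
  \<open>wp_concat\<close> expresses this move on single inputs.\<close>

lemma tens_mulw_wp:
  assumes "mset is = mset js" "distinct is" "distinct (concat (map l is))"
    and "\<And>i. i \<in> set is \<Longrightarrow> set (map a (l i)) \<subseteq> carrier G"
  shows "wp1 is js \<odot> tens (map (\<lambda>i. mulw (map a (l i))) is) =
    tens (map (\<lambda>i. mulw (map a (l i))) js) \<odot> wp1 (concat (map l is)) (concat (map l js))"
  using tens_wp[of "is" "\<lambda>i. mulw (map a (l i))" "\<lambda>i. length (l i)" "\<lambda>_. Suc 0" js]
    wp_concat[of "is" js l "\<lambda>i. length (l i)" "\<lambda>_. Suc 0"] assms
  by (simp add: hom_def)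

text \<open>Functoriality of the evaluation: the products of the first map slide through the sorting
  of the second, the two sortings merge by \<open>wp_cmp\<close>, and the two layers of products
  merge by \<open>mulw_tens\<close>. The condition on \<open>a\<close> is the label of a
  composite.\<close>

lemma Mn_cmp:
  assumes m: "mset xs = mset (concat (map l1 is))" "mset is = mset (concat (map l2 ks))"
    and d: "distinct xs" "distinct is"
    and a1: "\<And>x. x \<in> set xs \<Longrightarrow> a1 x \<in> carrier G" and a2: "\<And>i. i \<in> set is \<Longrightarrow> a2 i \<in> carrier G"
    and a: "\<And>i x. \<lbrakk>i \<in> set is; x \<in> set (l1 i)\<rbrakk> \<Longrightarrow> a x = a2 i \<otimes> a1 x"
  shows "Mn is ks l2 a2 \<odot> Mn xs is l1 a1 = Mn xs ks (\<lambda>k. concat (map l1 (l2 k))) a"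
proof -
  let ?js = "concat (map l2 ks)"
  let ?f = "\<lambda>i. mulw (map a1 (l1 i))"
  let ?g = "\<lambda>k. mulw (map a2 (l2 k))"
  have c1: "set (map a1 (l1 i)) \<subseteq> carrier G" if "i \<in> set is" for i
    using mset_eq_setD[OF m(1)] a1 that by auto
  have sj: "set ?js = set is" using mset_eq_setD[OF m(2)] by simp
  have c2: "set (map a2 (l2 k)) \<subseteq> carrier G" if "k \<in> set ks" for k
    using sj a2 that by auto
  have cs: "set (map a1 (l1 i)) \<subseteq> carrier G" if "k \<in> set ks" "i \<in> set (l2 k)" for k i
    using sj that by (intro c1) auto
  have dj: "distinct ?js" using d(2) m(2) by (metis mset_eq_imp_distinct_iff)
  have dc: "distinct (concat (map l1 is))" using d(1) m(1) by (metis mset_eq_imp_distinct_iff)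
  have "mset (concat (map l1 xs)) = sum_mset (image_mset (\<lambda>x. mset (l1 x)) (mset xs))" for xs
    by (induction xs) auto
  then have mc: "mset (concat (map l1 is)) = mset (concat (map l1 ?js))" using m(2) by simp
  have lf: "length (concat (map (\<lambda>i. map b (l i)) is)) = length (concat (map l is))" for b :: "'x \<Rightarrow> 'g" and l and "is" :: "'z list"
    by (simp add: length_concat o_def)
  note tf = tens_mulw[of "is" "\<lambda>i. map a1 (l1 i)", OF c1, unfolded lf]
  note tj = tens_mulw[of ?js "\<lambda>i. map a1 (l1 i)", OF c1[folded sj], unfolded lf]
  note tg = tens_mulw[of ks "\<lambda>i. map a2 (l2 i)", OF c2, unfolded lf]
  have lens: "length is = length ?js" "length (concat (map l1 is)) = length (concat (map l1 ?js))"
    using m(2) mc by (metis mset_eq_length)+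
  have sw: "wp1 is ?js \<odot> tens (map ?f is) = tens (map ?f ?js) \<odot> wp1 (concat (map l1 is)) (concat (map l1 ?js))"
    by (rule tens_mulw_wp) (use c1 m(2) dc d(2) in auto)
  have "Mn is ks l2 a2 \<odot> Mn xs is l1 a1 = tens (map ?g ks) \<odot> (wp1 is ?js \<odot> tens (map ?f is)) \<odot> wp1 xs (concat (map l1 is))"
    using tf tg m lens by (simp add: Mn_def cmp_assoc)
  also have "\<dots> = (tens (map ?g ks) \<odot> tens (map ?f ?js)) \<odot> wp1 (concat (map l1 is)) (concat (map l1 ?js)) \<odot> wp1 xs (concat (map l1 is))"
    unfolding sw using tj tg tf m mc lens by (simp add: cmp_assoc)
  also have "wp1 (concat (map l1 is)) (concat (map l1 ?js)) \<odot> wp1 xs (concat (map l1 is)) = wp1 xs (concat (map l1 ?js))"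
    using m mc d by (simp add: wp_cmp)
  also have "tens (map ?f ?js) = tens (map (\<lambda>k. tens (map ?f (l2 k))) ks)"
    using cs by (subst tens_concat) (auto simp: map_concat o_def)
  also have "tens (map ?g ks) \<odot> \<dots> = tens (map (\<lambda>k. ?g k \<odot> tens (map ?f (l2 k))) ks)"
  proof (intro tens_cmp conjI)
    fix k assume k: "k \<in> set ks"
    show "ar (?g k)" using c2[OF k] by (rule mulw_ar)
    show "ar (tens (map ?f (l2 k)))" using cs[OF k] by (intro tens_map_ar mulw_ar)
    have "cd (tens (map ?f (l2 k))) = (\<Sum>i\<leftarrow>l2 k. cd (?f i))" using cs[OF k] by (intro tens_map_ar mulw_ar)
    also have "\<dots> = (\<Sum>i\<leftarrow>l2 k. Suc 0)" using cs[OF k] by (intro arg_cong[where f = sum_list] map_cong refl mulw_ar)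
    finally show "cd (tens (map ?f (l2 k))) = dm (?g k)" using mulw_ar(2)[OF c2[OF k]] by (simp add: sum_list_triv)
  qed
  also have "\<dots> = tens (map (\<lambda>k. mulw (map a (concat (map l1 (l2 k))))) ks)"
  proof (intro arg_cong[where f = tens] map_cong refl)
    fix k assume k: "k \<in> set ks"
    then have ks: "i \<in> set is" if "i \<in> set (l2 k)" for i using that sj by auto
    have "?g k \<odot> tens (map ?f (l2 k)) = mulw (concat (map (\<lambda>i. map (\<lambda>h. a2 i \<otimes> h) (map a1 (l1 i))) (l2 k)))"
      by (rule mulw_tens) (use ks c1 a2 in auto)
    also have "map (\<lambda>i. map (\<lambda>h. a2 i \<otimes> h) (map a1 (l1 i))) (l2 k) = map (\<lambda>i. map a (l1 i)) (l2 k)"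
      using ks by (intro map_cong refl) (simp add: a[symmetric])
    finally show "?g k \<odot> tens (map ?f (l2 k)) = mulw (map a (concat (map l1 (l2 k))))"
      by (simp add: map_concat o_def)
  qed
  also have "concat (map l1 ?js) = concat (map (\<lambda>k. concat (map l1 (l2 k))) ks)"
    by (induction ks) auto
  finally show ?thesis by (simp add: Mn_def)
qed

lemma Mn_append:
  assumes m: "mset xs = mset (concat (map l is))" "mset xs' = mset (concat (map l is'))"
    and d: "distinct (xs @ xs')"
    and a: "\<And>x. x \<in> set (xs @ xs') \<Longrightarrow> a x \<in> carrier G"
  shows "Mn (xs @ xs') (is @ is') l a = Mn xs is l a \<oslash> Mn xs' is' l a"
proof -
  have c: "set (map a (l i)) \<subseteq> carrier G" if "i \<in> set is \<union> set is'" for i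
  proof -
    have "set (l i) \<subseteq> set (xs @ xs')"
      using mset_eq_setD[OF m(1)] mset_eq_setD[OF m(2)] that by auto
    then show ?thesis using a by auto
  qed
  have lf: "length (concat (map (\<lambda>i. map a (l i)) is)) = length (concat (map l is))" for "is"
    by (simp add: length_concat o_def)
  have c': "i \<in> set is \<Longrightarrow> set (map a (l i)) \<subseteq> carrier G" "i \<in> set is' \<Longrightarrow> set (map a (l i)) \<subseteq> carrier G" for i
    using c by auto
  note t = tens_mulw[of "is" "\<lambda>i. map a (l i)", unfolded lf, OF c'(1)] tens_mulw[of "is'" "\<lambda>i. map a (l i)", unfolded lf, OF c'(2)]
  have "tens (map (\<lambda>i. mulw (map a (l i))) (is @ is')) =
    tens (map (\<lambda>i. mulw (map a (l i))) is) \<oslash> tens (map (\<lambda>i. mulw (map a (l i))) is')"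
    unfolding map_append by (rule tens_append) (use c in auto)
  moreover have "wp1 (xs @ xs') (concat (map l (is @ is'))) = wp1 xs (concat (map l is)) \<oslash> wp1 xs' (concat (map l is'))"
    using m d by (simp add: wp_append)
  ultimately show ?thesis
    using m by (simp add: Mn_def interchange t del: tens_map_ar tens_ar tens_mulw)
qed

lemma Mn_map_in:
  assumes "mset xs = mset (concat (map l is))" "inj_on h (set xs)"
  shows "Mn (map h xs) is (\<lambda>i. map h (l i)) a = Mn xs is l (\<lambda>x. a (h x))"
proof -
  have "concat (map (\<lambda>i. map h (l i)) is) = map h (concat (map l is))" by (simp add: map_concat o_def)
  then show ?thesis using assms by (simp add: Mn_def o_def wp_map)
qed

lemma Mn_map_out: "Mn xs (map h is) l a = Mn xs is (\<lambda>i. l (h i)) a"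
  by (simp add: Mn_def o_def)

lemma Mn_id: "distinct xs \<Longrightarrow> Mn xs xs (\<lambda>x. [x]) (\<lambda>_. \<one>) = idn (length xs)"
proof -
  have "map (\<lambda>i. mulw (map (\<lambda>_. \<one>) [i])) xs = map (\<lambda>i. idn (Suc 0)) xs"
    by (simp add: rho_one mu_unit)
  moreover have "concat (map (\<lambda>x. [x]) xs) = xs" by (induction xs) auto
  ultimately show ?thesis unfolding Mn_def by (simp only: tens_idn) (simp add: cmp_idn sum_list_triv)
qed

end

section \<open>Commutative monoids and the order of fibres\<close>

locale comm_gmon = gmon +
  assumes mu_comm: "mu \<odot> br (Suc 0) (Suc 0) = mu"
begin

lemma mu_comm_cmp:
  assumes "ar a" "ar b" "cd a = Suc 0" "cd b = Suc 0"
  shows "mu \<odot> (b \<oslash> a) \<odot> br (dm a) (dm b) = mu \<odot> (a \<oslash> b)"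
proof -
  have "mu \<odot> (b \<oslash> a) \<odot> br (dm a) (dm b) = (mu \<odot> br (Suc 0) (Suc 0)) \<odot> (a \<oslash> b)"
    using assms br_nat[of a b "dm a" "Suc 0" "dm b" "Suc 0"] by (simp add: cmp_assoc)
  then show ?thesis by (simp add: mu_comm)
qed

text \<open>A commutative product absorbs every permutation of its inputs: after reassociation, the
  extraction of \<open>y\<close> past \<open>us\<close> is a braiding in front of a single
  \<open>mu\<close>.\<close>

lemma mulw_wp:
  "\<lbrakk>mset xs = mset ys; \<And>x. x \<in> set xs \<Longrightarrow> a x \<in> carrier G\<rbrakk> \<Longrightarrow>
   mulw (map a ys) \<odot> wp1 xs ys = mulw (map a xs)"
proof (induction ys arbitrary: xs)
  case (Cons y ys)
  obtain us vs where xs: "xs = us @ y # vs" "y \<notin> set us" "mset (us @ vs) = mset ys"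
    using Cons.prems(1) by (rule wp_split)
  have IH: "mulw (map a ys) \<odot> wp1 (us @ vs) ys = mulw (map a (us @ vs))"
    by (rule Cons.IH) (use Cons.prems xs in auto)
  have c: "a y \<in> carrier G" "set (map a us) \<subseteq> carrier G" "set (map a vs) \<subseteq> carrier G" "set (map a ys) \<subseteq> carrier G"
    using Cons.prems xs mset_eq_setD[OF xs(3)] by auto
  have l: "length ys = length us + length vs" using mset_eq_length[OF xs(3)] by simp
  let ?u = "mulw (map a us)" and ?v = "mulw (map a vs)" and ?y = "rho (a y)"
  have "mulw (map a (y # ys)) \<odot> wp1 xs (y # ys) = mu \<odot> ((?y \<oslash> mulw (map a ys)) \<odot> (idn (Suc 0) \<oslash> wp1 (us @ vs) ys)) \<odot> (br (length us) (Suc 0) \<oslash> idn (length vs))"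
    using xs c l by (simp add: wp_Cons cmp_assoc)
  also have "\<dots> = mu \<odot> (?y \<oslash> (mu \<odot> (?u \<oslash> ?v))) \<odot> (br (length us) (Suc 0) \<oslash> idn (length vs))"
    using xs c l IH by (simp add: interchange cmp_idn mulw_append)
  also have "\<dots> = (mu \<odot> (?y \<oslash> (mu \<odot> (?u \<oslash> ?v)))) \<odot> (br (length us) (Suc 0) \<oslash> idn (length vs))"
    using c by (simp add: cmp_assoc)
  also have "\<dots> = mu \<odot> ((mu \<odot> (?y \<oslash> ?u)) \<oslash> ?v) \<odot> (br (length us) (Suc 0) \<oslash> idn (length vs))"
    using c by (simp add: mu_assoc_cmp[symmetric] cmp_assoc)
  also have "\<dots> = mu \<odot> ((mu \<odot> (?y \<oslash> ?u) \<odot> br (dm ?u) (dm ?y)) \<oslash> ?v)"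
    using c by (simp add: interchange cmp_idn cmp_assoc)
  also have "\<dots> = mu \<odot> ((mu \<odot> (?u \<oslash> ?y)) \<oslash> ?v)"
    using c mu_comm_cmp[of ?u ?y] by simp
  also have "\<dots> = mulw (map a xs)"
    using xs c by (simp add: mulw_append mu_assoc_cmp)
  finally show ?case .
qed (simp add: cmp_idn)

text \<open>A change of order inside the fibres inserts one permutation per fibre, and the product
  of the fibre absorbs it. Hence labelled maps without orders have a value in a commutative
  monoid.\<close>

lemma Mn_perm:
  assumes m: "mset xs = mset (concat (map l is))" and ll: "\<And>i. i \<in> set is \<Longrightarrow> mset (l i) = mset (l' i)"
    and d: "distinct xs"
    and a: "\<And>x. x \<in> set xs \<Longrightarrow> a x \<in> carrier G"
  shows "Mn xs is l a = Mn xs is l' a"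
proof -
  have c: "set (map a (l i)) \<subseteq> carrier G" "set (map a (l' i)) \<subseteq> carrier G" "length (l i) = length (l' i)" if "i \<in> set is" for i
  proof -
    have "set (l i) \<subseteq> set xs" "set (l' i) = set (l i)"
      using mset_eq_setD[OF m(1)] that mset_eq_setD[OF ll[OF that]] by auto
    then show "set (map a (l i)) \<subseteq> carrier G" "set (map a (l' i)) \<subseteq> carrier G" using a by auto
    show "length (l i) = length (l' i)" using ll[OF that] by (rule mset_eq_length)
  qed
  have lf: "length (concat (map (\<lambda>i. map a (l i)) is)) = length (concat (map l is))" for "is" l
    by (simp add: length_concat o_def)
  note t = tens_mulw[of "is" "\<lambda>i. map a (l i)", unfolded lf, OF c(1)] tens_mulw[of "is" "\<lambda>i. map a (l' i)", unfolded lf, OF c(2)]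
  have mm: "mset (concat (map l is)) = mset (concat (map l' is))"
    using ll by (induction "is") auto
  \<comment> \<open>The absorbed permutation is made visible, fibre by fibre, so that it can be
    merged with the sorting of the inputs.\<close>
  have "map (\<lambda>i. mulw (map a (l' i))) is = map (\<lambda>i. mulw (map a (l i)) \<odot> wp1 (l' i) (l i)) is"
  proof (intro map_cong refl mulw_wp[symmetric])
    fix i x assume "i \<in> set is" "x \<in> set (l' i)"
    then show "a x \<in> carrier G" using c(2)[of i] by auto
  qed (simp add: ll)
  then have "Mn xs is l' a = tens (map (\<lambda>i. mulw (map a (l i)) \<odot> wp1 (l' i) (l i)) is) \<odot> wp1 xs (concat (map l' is))"
    by (simp only: Mn_def)
  also have "tens (map (\<lambda>i. mulw (map a (l i)) \<odot> wp1 (l' i) (l i)) is) =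
    tens (map (\<lambda>i. mulw (map a (l i))) is) \<odot> tens (map (\<lambda>i. wp1 (l' i) (l i)) is)"
    by (rule tens_cmp[symmetric]) (use ll c in auto)
  also have "tens (map (\<lambda>i. wp1 (l' i) (l i)) is) = wp1 (concat (map l' is)) (concat (map l is))"
  proof -
    have "distinct (concat (map l is))" using d m by (metis mset_eq_imp_distinct_iff)
    then have "distinct (concat (map l' is))" using mm by (metis mset_eq_imp_distinct_iff)
    then show ?thesis using ll
    proof (induction "is")
      case (Cons i "is")
      have "mset (concat (map l' is)) = mset (concat (map l is))" using Cons.prems by (induction "is") auto
      then show ?case using Cons by (simp add: wp_append)
    qed simp
  qed
  also have "(tens (map (\<lambda>i. mulw (map a (l i))) is) \<odot> wp1 (concat (map l' is)) (concat (map l is))) \<odot> wp1 xs (concat (map l' is)) = Mn xs is l a"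
    using t mm m d mset_eq_length[OF mm] by (simp add: Mn_def cmp_assoc wp_cmp)
  finally show ?thesis by simp
qed

end

section \<open>Duality\<close>

context strict_prop begin

text \<open>Reversing arrows exchanges the two hexagons, and the braiding with exchanged indices has
  the right source. Results on monoids thereby acquire comonoid versions.\<close>

lemma strict_prop_op: "strict_prop ar cd dm (\<lambda>f g. g \<odot> f) (\<oslash>) idn (\<lambda>m n. br n m)"
proof
  fix f g h a b a' b'
  assume *: "ar f" "ar g" "cd f = a" "dm f = a'" "cd g = b" "dm g = b'"
  show "(f \<oslash> g) \<odot> br b' a' = br b a \<odot> (g \<oslash> f)"
    using br_nat[of g f b' b a' a] * by simp
qed (simp_all add: cmp_assoc idn_cmp cmp_idn ten_assoc idn0_ten ten_idn0 ten_idn interchange br_br br_add_left add.commute)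

text \<open>Both sides are inverse to \<open>wp w xs ys\<close>: the right one by
  \<open>wp_cmp\<close>, the left one because the dual recursion performs the inverse braidings in
  reverse order. Products and coproducts can therefore share one calculus of permutations.\<close>

lemma wp_op:
  assumes "mset xs = mset ys" "distinct xs"
  shows "strict_prop.wp (\<lambda>f g. g \<odot> f) (\<oslash>) idn (\<lambda>m n. br n m) w xs ys = wp w ys xs"
proof -
  interpret op: strict_prop ar cd dm "\<lambda>f g. g \<odot> f" "(\<oslash>)" idn "\<lambda>m n. br n m" by (rule strict_prop_op)
  note [simp del] = op.ar_cmp op.dm_cmp op.cd_cmp
  have inv: "wp w xs ys \<odot> op.wp w xs ys = idn (wd w ys)" using assms
  proof (induction ys arbitrary: xs)
    case (Cons y ys)
    obtain us vs where xs: "xs = us @ y # vs" "y \<notin> set us" "mset (us @ vs) = mset ys"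
      using Cons.prems(1) by (rule wp_split)
    have IH: "wp w (us @ vs) ys \<odot> op.wp w (us @ vs) ys = idn (wd w ys)"
      by (rule Cons.IH) (use xs Cons.prems in auto)
    have d: "wd w ys = wd w us + wd w vs" using wd_mset[OF xs(3), of w] by simp
    note o = op.wp_ar[OF xs(3), of w]
    have "wp w xs (y # ys) \<odot> op.wp w xs (y # ys) = (idn (w y) \<oslash> wp w (us @ vs) ys) \<odot>
      ((br (wd w us) (w y) \<oslash> idn (wd w vs)) \<odot> (br (w y) (wd w us) \<oslash> idn (wd w vs))) \<odot> (idn (w y) \<oslash> op.wp w (us @ vs) ys)"
      using xs d o by (simp add: wp_Cons op.wp_Cons cmp_assoc)
    also have "(br (wd w us) (w y) \<oslash> idn (wd w vs)) \<odot> (br (w y) (wd w us) \<oslash> idn (wd w vs)) = idn (w y + wd w us + wd w vs)"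
      by (simp add: interchange br_br idn_cmp ten_idn)
    also have "(idn (w y) \<oslash> wp w (us @ vs) ys) \<odot> \<dots> \<odot> (idn (w y) \<oslash> op.wp w (us @ vs) ys) = idn (w y) \<oslash> idn (wd w ys)"
      using IH o d xs(3) by (simp add: idn_cmp interchange)
    finally show ?case by (simp add: ten_idn)
  qed (simp add: idn_cmp)
  have d: "distinct ys" using assms by (metis mset_eq_imp_distinct_iff)
  show ?thesis
    by (rule inverse_unique[where f = "wp w xs ys", symmetric])
      (use inv assms d op.wp_ar[OF assms(1), of w] in \<open>simp_all add: wp_cmp\<close>)
qed

end

section \<open>Bimonoids with a group action: coproducts of products\<close>

text \<open>The comonoid is a monoid of the opposite PROP. For reversed composition
  \<open>rho\<close> is an antihomomorphism, so the dual action is \<open>rho (inv g)\<close>; this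
  is also the label that a unary map acquires when it is read backwards.\<close>

locale gbim = gmon ar dm cd cmp ten idn br G mu eta rho
  for ar :: "'e \<Rightarrow> bool" and dm cd :: "'e \<Rightarrow> nat"
    and cmp :: "'e \<Rightarrow> 'e \<Rightarrow> 'e" (infixr "\<odot>" 60)
    and ten :: "'e \<Rightarrow> 'e \<Rightarrow> 'e" (infixr "\<oslash>" 70)
    and idn :: "nat \<Rightarrow> 'e" and br :: "nat \<Rightarrow> nat \<Rightarrow> 'e"
    and G :: "('g, 'y) monoid_scheme" (structure) and mu eta :: 'e and rho :: "'g \<Rightarrow> 'e" +
  fixes del eps :: 'e
  assumes op_gmon: "gmon ar cd dm (\<lambda>f g. g \<odot> f) (\<oslash>) idn (\<lambda>m n. br n m) G del eps (\<lambda>g. rho (inv g))"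
    and del_mu: "del \<odot> mu = (mu \<oslash> mu) \<odot> (idn (Suc 0) \<oslash> br (Suc 0) (Suc 0) \<oslash> idn (Suc 0)) \<odot> (del \<oslash> del)"
    and del_eta: "del \<odot> eta = eta \<oslash> eta"
    and eps_mu: "eps \<odot> mu = eps \<oslash> eps"
    and eps_eta: "eps \<odot> eta = idn 0"
begin

sublocale op: gmon ar cd dm "\<lambda>f g. g \<odot> f" "(\<oslash>)" idn "\<lambda>m n. br n m" G del eps "\<lambda>g. rho (inv g)"
  by (rule op_gmon)

declare op.ar_cmp [simp del] op.dm_cmp [simp del] op.cd_cmp [simp del]

abbreviation "comulw \<equiv> op.mulw"

text \<open>The iterated form of \<open>del_mu\<close>: the coproduct of a product of two is
  obtained from two coproducts by a perfect shuffle and pairwise products. The names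
  \<open>(False, y)\<close> and \<open>(True, y)\<close> record from which factor a strand comes.
  Labels are duplicated because \<open>rho\<close> is multiplicative.\<close>

lemma comulw_mu:
  assumes "distinct ys" "\<And>y. y \<in> set ys \<Longrightarrow> c y \<in> carrier G"
  shows "comulw (map c ys) \<odot> mu = tens (map (\<lambda>_. mu) ys) \<odot>
    wp1 (map (Pair False) ys @ map (Pair True) ys) (concat (map (\<lambda>y. [(False, y), (True, y)]) ys)) \<odot>
    (comulw (map c ys) \<oslash> comulw (map c ys))"
  using assms
proof (induction ys)
  case Nil then show ?case by (simp add: eps_mu idn_cmp)
next
  case (Cons y ys)
  let ?A = "map (Pair False) ys" and ?B = "map (Pair True) ys"
    and ?C = "concat (map (\<lambda>y. [(False, y), (True, y)]) ys)"
  let ?r = "rho (inv (c y))" and ?w = "comulw (map c ys)" and ?m = "tens (map (\<lambda>_. mu) ys)"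
  have IH: "?w \<odot> mu = ?m \<odot> wp1 (?A @ ?B) ?C \<odot> (?w \<oslash> ?w)"
    by (rule Cons.IH) (use Cons.prems in auto)
  have c: "c y \<in> carrier G" "set (map c ys) \<subseteq> carrier G" using Cons.prems by auto
  have m: "mset (?A @ ?B) = mset ?C" by (induction ys) auto
  have l: "length ?C = length ys + length ys" by (induction ys) auto
  have t: "ar ?m" "dm ?m = length ys + length ys" "cd ?m = length ys" by (induction ys) auto
  \<comment> \<open>Naturality of the braiding moves the actions and the remaining coproducts across
    the middle crossing, turning a crossing of two strands into one of \<open>length ys\<close>
    strands with one.\<close>
  have br: "(idn (Suc 0) \<oslash> br (length ys) (Suc 0) \<oslash> idn (length ys)) \<odot> ((?r \<oslash> ?w) \<oslash> (?r \<oslash> ?w)) =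
     ((?r \<oslash> ?r) \<oslash> (?w \<oslash> ?w)) \<odot> (idn (Suc 0) \<oslash> br (Suc 0) (Suc 0) \<oslash> idn (Suc 0))"
    using c br_nat[of ?w ?r "Suc 0" "length ys" "Suc 0" "Suc 0"]
    by (simp add: ten_assoc interchange idn_cmp cmp_idn)
       (simp add: interchange idn_cmp cmp_idn flip: ten_assoc)
  \<comment> \<open>Of the outputs \<open>(False, y)\<close> and \<open>(True, y)\<close> the former
    is already in front, and the latter has to cross the remaining strands of the first
    factor.\<close>
  have wpe: "(idn (Suc (Suc 0)) \<oslash> wp1 (?A @ ?B) ?C) \<odot> (idn (Suc 0) \<oslash> br (length ys) (Suc 0) \<oslash> idn (length ys)) =
    wp1 (map (Pair False) (y # ys) @ map (Pair True) (y # ys)) (concat (map (\<lambda>y. [(False, y), (True, y)]) (y # ys)))"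
  proof -
    have "wp1 ((False, y) # ?A @ (True, y) # ?B) ((False, y) # (True, y) # ?C) =
       idn (Suc 0) \<oslash> wp1 (?A @ (True, y) # ?B) ((True, y) # ?C)"
      using wp_Cons[of "(False, y)" "[]" "\<lambda>_. Suc 0" "?A @ (True, y) # ?B"] m l
      by (simp add: ten_idn cmp_idn)
    also have "wp1 (?A @ (True, y) # ?B) ((True, y) # ?C) = (idn (Suc 0) \<oslash> wp1 (?A @ ?B) ?C) \<odot> (br (length ys) (Suc 0) \<oslash> idn (length ys))"
      by (subst wp_Cons) auto
    also have "idn (Suc 0) \<oslash> \<dots> = ((idn (Suc 0) \<oslash> idn (Suc 0)) \<oslash> wp1 (?A @ ?B) ?C) \<odot> (idn (Suc 0) \<oslash> br (length ys) (Suc 0) \<oslash> idn (length ys))"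
      using m by (subst idn_ten_cmp) (auto simp: ten_assoc)
    finally show ?thesis by (simp add: ten_idn)
  qed
  have "comulw (map c (y # ys)) \<odot> mu = (?r \<oslash> ?w) \<odot> del \<odot> mu"
    using c by (simp add: cmp_assoc)
  also have "\<dots> = ((?r \<odot> mu) \<oslash> (?w \<odot> mu)) \<odot> (idn (Suc 0) \<oslash> br (Suc 0) (Suc 0) \<oslash> idn (Suc 0)) \<odot> (del \<oslash> del)"
    using c by (simp add: del_mu interchange flip: cmp_assoc)
  also have "(?r \<odot> mu) \<oslash> (?w \<odot> mu) = (mu \<oslash> ?m) \<odot> (idn (Suc (Suc 0)) \<oslash> wp1 (?A @ ?B) ?C) \<odot> ((?r \<oslash> ?r) \<oslash> (?w \<oslash> ?w))"
    using c t m l by (simp add: IH rho_mu interchange idn_cmp)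
  also have "((mu \<oslash> ?m) \<odot> (idn (Suc (Suc 0)) \<oslash> wp1 (?A @ ?B) ?C) \<odot> ((?r \<oslash> ?r) \<oslash> (?w \<oslash> ?w))) \<odot>
      (idn (Suc 0) \<oslash> br (Suc 0) (Suc 0) \<oslash> idn (Suc 0)) \<odot> (del \<oslash> del)
    = (mu \<oslash> ?m) \<odot> (idn (Suc (Suc 0)) \<oslash> wp1 (?A @ ?B) ?C) \<odot> (((?r \<oslash> ?r) \<oslash> (?w \<oslash> ?w)) \<odot>
      (idn (Suc 0) \<oslash> br (Suc 0) (Suc 0) \<oslash> idn (Suc 0))) \<odot> (del \<oslash> del)"
    using c t m l by (simp add: cmp_assoc)
  also have "\<dots> = (mu \<oslash> ?m) \<odot> ((idn (Suc (Suc 0)) \<oslash> wp1 (?A @ ?B) ?C) \<odot> (idn (Suc 0) \<oslash> br (length ys) (Suc 0) \<oslash> idn (length ys)))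
     \<odot> ((?r \<oslash> ?w) \<oslash> (?r \<oslash> ?w)) \<odot> (del \<oslash> del)"
    unfolding br[symmetric] using c t m l by (simp add: cmp_assoc)
  also have "((?r \<oslash> ?w) \<oslash> (?r \<oslash> ?w)) \<odot> (del \<oslash> del) = comulw (map c (y # ys)) \<oslash> comulw (map c (y # ys))"
    using c by (simp add: interchange)
  finally show ?case unfolding wpe by simp
qed

lemma comulw_eta: "set gs \<subseteq> carrier G \<Longrightarrow> comulw gs \<odot> eta = tens (map (\<lambda>_. eta) gs)"
proof (induction gs)
  case (Cons g gs)
  have "comulw (g # gs) \<odot> eta = (rho (inv g) \<oslash> comulw gs) \<odot> del \<odot> eta"
    using Cons.prems by (simp add: cmp_assoc)
  also have "\<dots> = (rho (inv g) \<odot> eta) \<oslash> (comulw gs \<odot> eta)"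
    using Cons.prems by (simp add: del_eta interchange)
  finally show ?case using Cons by (simp add: rho_eta)
qed (simp add: eps_eta)

lemma mset_grid: "mset [(x, y). x \<leftarrow> xs, y \<leftarrow> ys] = mset [(x, y). y \<leftarrow> ys, x \<leftarrow> xs]"
proof (induction xs)
  case (Cons x xs)
  have "mset [(x', y). y \<leftarrow> ys, x' \<leftarrow> x # xs] = mset (map (Pair x) ys) + mset [(x, y). y \<leftarrow> ys, x \<leftarrow> xs]"
    by (induction ys) auto
  then show ?case using Cons by simp
qed simp

lemma distinct_grid: "distinct xs \<Longrightarrow> distinct ys \<Longrightarrow> distinct [(x, y). x \<leftarrow> xs, y \<leftarrow> ys]"
  by (induction xs) (auto simp: distinct_map inj_on_def)

lemma length_grid: "length [(x, y). x \<leftarrow> xs, y \<leftarrow> ys] = length xs * length ys"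
  by (induction xs) auto

end

context strict_prop begin

lemma hom_cmp: "\<lbrakk>hom f a b; hom g b c\<rbrakk> \<Longrightarrow> hom (g \<odot> f) a c"
  by (simp add: hom_def)

lemma slide_mid:
  assumes "hom t n k" "hom r n n" "hom r' n n" "hom w n n" "hom v l n" "w \<odot> r = r' \<odot> w"
  shows "t \<odot> w \<odot> r \<odot> v = (t \<odot> r') \<odot> w \<odot> v"
proof -
  have "t \<odot> w \<odot> r \<odot> v = t \<odot> (w \<odot> r) \<odot> v" using assms(1-5) by (simp add: hom_def cmp_assoc)
  then show ?thesis unfolding assms(6) using assms(1-5) by (simp add: hom_def cmp_assoc)
qed

end

context gmon begin

lemma mulw_map_ar [simp]:
  assumes "\<And>x. x \<in> set xs \<Longrightarrow> f x \<in> carrier G"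
  shows "ar (mulw (map f xs))" "dm (mulw (map f xs)) = length xs" "cd (mulw (map f xs)) = Suc 0"
proof -
  have "set (map f xs) \<subseteq> carrier G" using assms by auto
  note mulw_ar[OF this]
  then show "ar (mulw (map f xs))" "dm (mulw (map f xs)) = length xs" "cd (mulw (map f xs)) = Suc 0" by simp_all
qed

end

context gbim begin

text \<open>The labels of a coproduct are collected behind it as a row of unary actions, so that
  they can be moved through permutations independently of the coproduct.\<close>

lemma comulw_absorb:
  assumes "\<And>y. y \<in> set ys \<Longrightarrow> b y \<in> carrier G"
  shows "comulw (map b ys) = tens (map (\<lambda>y. rho (inv (b y))) ys) \<odot> comulw (map (\<lambda>_. \<one>) ys)"
proof -
  have "tens (map (\<lambda>y. comulw [b y]) ys) \<odot> comulw (map (\<lambda>_. \<one>) ys) = comulw (concat (map (\<lambda>y. map (\<lambda>h. \<one> \<otimes> h) [b y]) ys))"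
    by (rule op.mulw_tens) (use assms in auto)
  also have "map (\<lambda>y. comulw [b y]) ys = map (\<lambda>y. rho (inv (b y))) ys"
    using assms by (intro map_cong refl op.mulw_single) auto
  also have "concat (map (\<lambda>y. map (\<lambda>h. \<one> \<otimes> h) [b y]) ys) = map b ys"
    using assms by (induction ys) auto
  finally show ?thesis by simp
qed

lemma mulw_absorb:
  assumes "\<And>x. x \<in> set xs \<Longrightarrow> a x \<in> carrier G" "\<And>x. x \<in> set xs \<Longrightarrow> b x \<in> carrier G"
  shows "mulw (map (\<lambda>x. a x \<otimes> b x) xs) = mulw (map a xs) \<odot> tens (map (\<lambda>x. rho (b x)) xs)"
proof -
  have "mulw (map a xs) \<odot> tens (map (\<lambda>x. mulw [b x]) xs) = mulw (concat (map (\<lambda>x. map (\<lambda>h. a x \<otimes> h) [b x]) xs))"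
    by (rule mulw_tens) (use assms in auto)
  also have "map (\<lambda>x. mulw [b x]) xs = map (\<lambda>x. rho (b x)) xs"
    using assms by (intro map_cong refl mulw_single) auto
  also have "concat (map (\<lambda>x. map (\<lambda>h. a x \<otimes> h) [b x]) xs) = map (\<lambda>x. a x \<otimes> b x) xs"
    by (induction xs) auto
  finally show ?thesis by simp
qed

lemma concat_map_Nil: "concat (map (\<lambda>_. []) ys) = []"
  by simp

text \<open>The array identity with all labels gathered after the transposition: the entry
  \<open>(x, y)\<close> receives \<open>inv (c y) \<otimes> p x\<close>, and the coproducts carry
  \<open>\<one>\<close>. Induction over the factors \<open>xs\<close>: \<open>comulw_mu\<close>
  splits off one row, and the shuffle together with the transposition of the remaining rows is the
  transposition of the whole array.\<close>

lemma comulw_mulw_left: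
  fixes xs :: "'u list" and ys :: "'v list"
  assumes "distinct xs" "distinct ys"
    and "\<And>x. x \<in> set xs \<Longrightarrow> p x \<in> carrier G" "\<And>y. y \<in> set ys \<Longrightarrow> c y \<in> carrier G"
  shows "comulw (map c ys) \<odot> mulw (map p xs) =
    tens (map (\<lambda>y. mulw (map (\<lambda>x. inv (c y) \<otimes> p x) xs)) ys) \<odot>
    wp1 [(x, y). x \<leftarrow> xs, y \<leftarrow> ys] [(x, y). y \<leftarrow> ys, x \<leftarrow> xs] \<odot>
    tens (map (\<lambda>_. comulw (map (\<lambda>_. \<one>) ys)) xs)"
  using assms(1,3)
proof (induction xs)
  case Nil
  have "comulw (map c ys) \<odot> eta = tens (map (\<lambda>_. eta) (map c ys))"
    by (rule comulw_eta) (use assms(4) in auto)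
  then have "comulw (map c ys) \<odot> eta = tens (map (\<lambda>_. eta) ys)" by (simp add: o_def)
  moreover have "ar (tens (map (\<lambda>_. eta) ys))" "dm (tens (map (\<lambda>_. eta) ys)) = 0" by (induction ys) auto
  ultimately show ?case by (simp only: list.map mulw.simps concat.simps concat_map_Nil wp.simps tens_simps cmp_idn dm_idn ar_idn)
next
  case (Cons x xs)
  let ?W = "comulw (map c ys)" and ?w = "comulw (map (\<lambda>_. \<one>) ys)" and ?m = "tens (map (\<lambda>_. mu) ys)"
  let ?A = "map (Pair False) ys" and ?B = "map (Pair True) ys"
    and ?C = "concat (map (\<lambda>y. [(False, y), (True, y)]) ys)"
  let ?P = "[(x, y). x \<leftarrow> xs, y \<leftarrow> ys]" and ?Q = "[(x, y). y \<leftarrow> ys, x \<leftarrow> xs]" and ?Z = "[(x', y). y \<leftarrow> ys, x' \<leftarrow> x # xs]"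
  let ?X = "map (Pair x) ys"
  \<comment> \<open>\<open>f\<close> is the box on a cable of the shuffle and \<open>l\<close> lists
    its strands: \<open>(False, y)\<close> carries the entry of the new row \<open>x\<close> in
    column \<open>y\<close>, and \<open>(True, y)\<close> carries the product over the remaining
    rows of that column.\<close>
  define f where "f = (\<lambda>(t, y). if t then mulw (map (\<lambda>x. inv (c y) \<otimes> p x) xs) else rho (inv (c y) \<otimes> p x))"
  define l where "l = (\<lambda>(t, y :: 'v). if t then map (\<lambda>x. (x, y)) xs else [(x, y)])"
  let ?w' = "\<lambda>(t, y). if t then length xs else Suc 0"
  let ?tr = "tens (map (\<lambda>y. rho (inv (c y) \<otimes> p x)) ys)"
  let ?tm = "tens (map (\<lambda>y. mulw (map (\<lambda>x. inv (c y) \<otimes> p x) xs)) ys)"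
  have IH: "?W \<odot> mulw (map p xs) = ?tm \<odot> wp1 ?P ?Q \<odot> tens (map (\<lambda>_. ?w) xs)"
    by (rule Cons.IH) (use Cons.prems in auto)
  have c: "set (map c ys) \<subseteq> carrier G" "p x \<in> carrier G" "set (map p xs) \<subseteq> carrier G" "\<And>y. y \<in> set ys \<Longrightarrow> c y \<in> carrier G"
    "\<And>x. x \<in> set xs \<Longrightarrow> p x \<in> carrier G"
    using Cons.prems assms(4) by auto
  have mAB: "mset (?A @ ?B) = mset ?C" by (induction ys) auto
  have dAB: "distinct (?A @ ?B)" using assms(2) by (auto simp: distinct_map inj_on_def)
  have lC: "length ?C = length ys + length ys" by (induction ys) auto
  have mPQ: "mset ?P = mset ?Q" by (rule mset_grid)
  have mZ: "mset (?X @ ?P) = mset ?Z" "mset (?X @ ?Q) = mset ?Z"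
    using mset_grid[where xs = "x # xs" and ys = ys] mPQ by simp_all
  have dP: "distinct (?X @ ?P)" using distinct_grid[OF Cons.prems(1) assms(2)] by simp
  have dQ: "distinct (?X @ ?Q)" using dP mset_eq_imp_distinct_iff[of "?X @ ?P" "?X @ ?Q"] mPQ by simp
  have lP: "length ?P = length xs * length ys" by (rule length_grid)
  then have lQ: "length ?Q = length xs * length ys" using mset_eq_length[OF mPQ] by simp
  have lZ: "length ?Z = length ys + length xs * length ys" using mset_eq_length[OF mZ(2)] lQ by simp
  have am: "ar ?m" "dm ?m = length ys + length ys" "cd ?m = length ys" by (induction ys) auto
  have aw: "ar ?w" "dm ?w = Suc 0" "cd ?w = length ys" 
  proof -
    have "set (map (\<lambda>_. \<one>) ys) \<subseteq> carrier G" by auto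
    note op.mulw_ar[OF this]
    then show "ar ?w" "dm ?w = Suc 0" "cd ?w = length ys" by simp_all
  qed
  have at: "ar (tens (map (\<lambda>_. ?w) xs))" "dm (tens (map (\<lambda>_. ?w) xs)) = length xs" "cd (tens (map (\<lambda>_. ?w) xs)) = length xs * length ys"
    using aw by (induction xs) auto
  have atr: "ar ?tr" "dm ?tr = length ys" "cd ?tr = length ys" using c(2,4) by (induction ys) auto
  have atm: "ar ?tm" "dm ?tm = length xs * length ys" "cd ?tm = length ys"
    using c(4,5) by (induction ys) auto
  \<comment> \<open>An action in front of the coproduct is the dual action of
    \<open>inv (p x)\<close>, which multiplies every label of the coproduct; the inverse of
    \<open>inv (p x) \<otimes> c y\<close> is the wanted entry.\<close>
  have W: "?W \<odot> rho (p x) = ?tr \<odot> ?w"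
  proof -
    have "?W \<odot> rho (inv (inv (p x))) = comulw (map (\<lambda>h. inv (p x) \<otimes> h) (map c ys))"
      using c op.rho_mulw[of "inv (p x)" "map c ys"] by simp
    also have "map (\<lambda>h. inv (p x) \<otimes> h) (map c ys) = map (\<lambda>y. inv (p x) \<otimes> c y) ys" by simp
    also have "comulw \<dots> = tens (map (\<lambda>y. rho (inv (inv (p x) \<otimes> c y))) ys) \<odot> ?w"
      by (rule comulw_absorb) (use c in auto)
    also have "map (\<lambda>y. rho (inv (inv (p x) \<otimes> c y))) ys = map (\<lambda>y. rho (inv (c y) \<otimes> p x)) ys"
      using c by (intro map_cong refl) (simp add: inv_mult_group)
    finally show ?thesis using c by simp
  qed
  have f: "hom (f z) (?w' z) (Suc 0)" if "z \<in> set (?A @ ?B)" for z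
    using that c by (auto simp: f_def hom_def)
  have tf: "tens (map f (?A @ ?B)) = ?tr \<oslash> ?tm"
  proof -
    have "tens (map f ?A @ map f ?B) = tens (map f ?A) \<oslash> tens (map f ?B)"
      by (rule tens_append) (use f in \<open>auto simp: hom_def\<close>)
    then show ?thesis by (simp add: f_def o_def)
  qed
  have tC: "?m \<odot> tens (map f ?C) = tens (map (\<lambda>y. mulw (map (\<lambda>x. inv (c y) \<otimes> p x) (x # xs))) ys)"
  proof -
    have "tens (map f ?C) = tens (map (\<lambda>y. tens [f (False, y), f (True, y)]) ys)"
      by (subst tens_concat) (use f in \<open>auto simp: hom_def map_concat o_def\<close>)
    then have "?m \<odot> tens (map f ?C) = tens (map (\<lambda>y. mu \<odot> tens [f (False, y), f (True, y)]) ys)"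
      using c by (simp only:, intro tens_cmp) (auto simp: f_def)
    also have "map (\<lambda>y. mu \<odot> tens [f (False, y), f (True, y)]) ys = map (\<lambda>y. mulw (map (\<lambda>x. inv (c y) \<otimes> p x) (x # xs))) ys"
      using c by (intro map_cong refl) (auto simp: f_def ten_idn0)
    finally show ?thesis .
  qed
  have lA: "concat (map l ?A) = ?X" "concat (map l ?B) = ?Q" "concat (map l ?C) = ?Z"
    by (induction ys) (auto simp: l_def)
  have lAB: "concat (map l (?A @ ?B)) = ?X @ ?Q" by (simp only: map_append concat_append lA)
  \<comment> \<open>The boxes slide through the shuffle of cables, which thereby becomes a
    permutation of single strands of the array.\<close>
  have sl: "wp1 (?A @ ?B) ?C \<odot> (?tr \<oslash> ?tm) = tens (map f ?C) \<odot> wp1 (?X @ ?Q) ?Z"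
  proof -
    have "wp1 (?A @ ?B) ?C \<odot> tens (map f (?A @ ?B)) = tens (map f ?C) \<odot> wp ?w' (?A @ ?B) ?C"
      by (rule tens_wp) (use f mAB in auto)
    also have "wp ?w' (?A @ ?B) ?C = wp1 (concat (map l (?A @ ?B))) (concat (map l ?C))"
    proof (rule wp_concat)
      show "distinct (concat (map l (?A @ ?B)))" using dQ by (simp only: map_append concat_append lA)
    qed (use mAB dAB in \<open>auto simp: l_def\<close>)
    finally show ?thesis unfolding tf lAB lA(3) .
  qed
  have wQ: "wp1 (?X @ ?Q) ?Z \<odot> (idn (length ys) \<oslash> wp1 ?P ?Q) = wp1 (?X @ ?P) ?Z"
  proof -
    have "wp1 (?X @ ?P) (?X @ ?Q) = idn (length ys) \<oslash> wp1 ?P ?Q"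
      using wp_append[of ?X ?X ?P ?Q "\<lambda>_. Suc 0"] mPQ dP by simp
    then show ?thesis using wp_cmp[of "?X @ ?P" "?X @ ?Q" ?Z "\<lambda>_. Suc 0"] mPQ mZ dP by simp
  qed
  have aC: "ar (tens (map f ?C))" "dm (tens (map f ?C)) = length ?Z" "cd (tens (map f ?C)) = length ?C"
  proof -
    have "ar (f z)" "dm (f z) = ?w' z" "cd (f z) = Suc 0" if "z \<in> set ?C" for z
      using f[of z] mset_eq_setD[OF mAB] that by (auto simp: hom_def)
    then have *: "ar (tens (map f zs)) \<and> dm (tens (map f zs)) = sum_list (map ?w' zs) \<and> cd (tens (map f zs)) = length zs"
      if "set zs \<subseteq> set ?C" for zs using that by (induction zs) auto
    have "sum_list (map ?w' ?C) = length ?Z" unfolding lZ by (induction ys) auto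
    then show "ar (tens (map f ?C))" "dm (tens (map f ?C)) = length ?Z" "cd (tens (map f ?C)) = length ?C"
      using *[OF subset_refl] by auto
  qed
  have "?W \<odot> mulw (map p (x # xs)) = (?W \<odot> mu) \<odot> (rho (p x) \<oslash> mulw (map p xs))"
    using c by (simp add: cmp_assoc)
  also have "\<dots> = (?m \<odot> wp1 (?A @ ?B) ?C \<odot> (?W \<oslash> ?W)) \<odot> (rho (p x) \<oslash> mulw (map p xs))"
    using comulw_mu[OF assms(2), of c] c by simp
  also have "\<dots> = ?m \<odot> wp1 (?A @ ?B) ?C \<odot> ((?tr \<odot> ?w) \<oslash> (?tm \<odot> wp1 ?P ?Q \<odot> tens (map (\<lambda>_. ?w) xs)))"
    using c am mAB lC by (simp add: cmp_assoc interchange W IH)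
  also have "\<dots> = ?m \<odot> (wp1 (?A @ ?B) ?C \<odot> (?tr \<oslash> ?tm)) \<odot> (idn (length ys) \<oslash> wp1 ?P ?Q) \<odot> (?w \<oslash> tens (map (\<lambda>_. ?w) xs))"
    using am mAB lC aw at atr atm mPQ lP lQ by (simp add: cmp_assoc interchange idn_cmp)
  also have "\<dots> = (?m \<odot> tens (map f ?C)) \<odot> (wp1 (?X @ ?Q) ?Z \<odot> (idn (length ys) \<oslash> wp1 ?P ?Q)) \<odot> (?w \<oslash> tens (map (\<lambda>_. ?w) xs))"
    unfolding sl using am aC lC aw at atr atm mPQ mZ lP lQ lZ by (simp add: cmp_assoc)
  finally show ?case unfolding tC wQ by simp
qed

text \<open>The labels \<open>a\<close> after the transposition and \<open>b\<close> before it enter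
  only through the commuting law at each entry. That law says that
  \<open>inv (c y) \<otimes> p x\<close> equals \<open>a x y \<otimes> inv (b x y)\<close>, and the
  row of actions of \<open>inv (b x y)\<close> slides through the transposition. This reduces the
  claim to \<open>comulw_mulw_left\<close>.\<close>

lemma comulw_mulw:
  assumes "distinct xs" "distinct ys"
    and p: "\<And>x. x \<in> set xs \<Longrightarrow> p x \<in> carrier G" and c: "\<And>y. y \<in> set ys \<Longrightarrow> c y \<in> carrier G"
    and a: "\<And>x y. \<lbrakk>x \<in> set xs; y \<in> set ys\<rbrakk> \<Longrightarrow> a x y \<in> carrier G"
    and b: "\<And>x y. \<lbrakk>x \<in> set xs; y \<in> set ys\<rbrakk> \<Longrightarrow> b x y \<in> carrier G"
    and ab: "\<And>x y. \<lbrakk>x \<in> set xs; y \<in> set ys\<rbrakk> \<Longrightarrow> p x \<otimes> b x y = c y \<otimes> a x y"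
  shows "comulw (map c ys) \<odot> mulw (map p xs) =
    tens (map (\<lambda>y. mulw (map (\<lambda>x. a x y) xs)) ys) \<odot>
    wp1 [(x, y). x \<leftarrow> xs, y \<leftarrow> ys] [(x, y). y \<leftarrow> ys, x \<leftarrow> xs] \<odot>
    tens (map (\<lambda>x. comulw (map (b x) ys)) xs)"
proof -
  let ?P = "[(x, y). x \<leftarrow> xs, y \<leftarrow> ys]" and ?Q = "[(x, y). y \<leftarrow> ys, x \<leftarrow> xs]"
  let ?r = "\<lambda>(x, y). rho (inv (b x y))"
  let ?w = "comulw (map (\<lambda>_. \<one>) ys)"
  have m: "mset ?P = mset ?Q" by (rule mset_grid)
  have eq: "inv (c y) \<otimes> p x = a x y \<otimes> inv (b x y)" if "x \<in> set xs" "y \<in> set ys" for x y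
  proof -
    have "p x = c y \<otimes> a x y \<otimes> inv (b x y)"
      using ab[OF that] p c a b that by (metis inv_solve_right m_closed)
    then show ?thesis using p c a b that by (simp add: m_assoc[symmetric])
  qed
  have "tens (map (\<lambda>y. mulw (map (\<lambda>x. inv (c y) \<otimes> p x) xs)) ys) =
     tens (map (\<lambda>y. mulw (map (\<lambda>x. a x y) xs) \<odot> tens (map (\<lambda>x. ?r (x, y)) xs)) ys)"
  proof (intro arg_cong[where f = tens] map_cong refl)
    fix y assume y: "y \<in> set ys"
    have "map (\<lambda>x. inv (c y) \<otimes> p x) xs = map (\<lambda>x. a x y \<otimes> inv (b x y)) xs" using eq y by simp
    then show "mulw (map (\<lambda>x. inv (c y) \<otimes> p x) xs) = mulw (map (\<lambda>x. a x y) xs) \<odot> tens (map (\<lambda>x. ?r (x, y)) xs)"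
      using mulw_absorb[of xs "\<lambda>x. a x y" "\<lambda>x. inv (b x y)"] a b y by (simp only: prod.case inv_closed)
  qed
  also have "\<dots> = tens (map (\<lambda>y. mulw (map (\<lambda>x. a x y) xs)) ys) \<odot> tens (map (\<lambda>y. tens (map (\<lambda>x. ?r (x, y)) xs)) ys)"
  proof (rule tens_cmp[symmetric])
    fix y assume y: "y \<in> set ys"
    have "cd (tens (map (\<lambda>x. ?r (x, y)) zs)) = length zs" "ar (tens (map (\<lambda>x. ?r (x, y)) zs))" if "set zs \<subseteq> set xs" for zs
      using that b y by (induction zs) auto
    moreover have "set (map (\<lambda>x. a x y) xs) \<subseteq> carrier G" using a y by auto
    note mulw_ar[OF this]
    ultimately show "ar (tens (map (\<lambda>x. ?r (x, y)) xs)) \<and> ar (mulw (map (\<lambda>x. a x y) xs)) \<and>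
        cd (tens (map (\<lambda>x. ?r (x, y)) xs)) = dm (mulw (map (\<lambda>x. a x y) xs))"
      by (simp add: subset_iff)
  qed
  also have "tens (map (\<lambda>y. tens (map (\<lambda>x. ?r (x, y)) xs)) ys) = tens (map ?r ?Q)"
    using b by (subst tens_concat) (auto simp: map_concat o_def)
  finally have t1: "tens (map (\<lambda>y. mulw (map (\<lambda>x. inv (c y) \<otimes> p x) xs)) ys) =
     tens (map (\<lambda>y. mulw (map (\<lambda>x. a x y) xs)) ys) \<odot> tens (map ?r ?Q)" .
  have t2: "tens (map (\<lambda>x. comulw (map (b x) ys)) xs) = tens (map ?r ?P) \<odot> tens (map (\<lambda>_. ?w) xs)"
  proof -
    have "map (\<lambda>x. comulw (map (b x) ys)) xs = map (\<lambda>x. tens (map (\<lambda>y. ?r (x, y)) ys) \<odot> ?w) xs"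
      using b by (intro map_cong refl) (simp add: comulw_absorb[of ys "b _"])
    moreover have "tens (map (\<lambda>x. tens (map (\<lambda>y. ?r (x, y)) ys)) xs) = tens (map ?r ?P)"
      using b by (subst tens_concat) (auto simp: map_concat o_def)
    moreover have "tens (map (\<lambda>x. tens (map (\<lambda>y. ?r (x, y)) ys)) xs) \<odot> tens (map (\<lambda>_. ?w) xs) =
        tens (map (\<lambda>x. tens (map (\<lambda>y. ?r (x, y)) ys) \<odot> ?w) xs)"
    proof (rule tens_cmp)
      fix x assume x: "x \<in> set xs"
      have "dm (tens (map (\<lambda>y. ?r (x, y)) zs)) = length zs" "ar (tens (map (\<lambda>y. ?r (x, y)) zs))" if "set zs \<subseteq> set ys" for zs
        using that b x by (induction zs) auto
      moreover have "set (map (\<lambda>_. \<one>) ys) \<subseteq> carrier G" by auto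
      note op.mulw_ar[OF this]
      ultimately show "ar ?w \<and> ar (tens (map (\<lambda>y. ?r (x, y)) ys)) \<and> cd ?w = dm (tens (map (\<lambda>y. ?r (x, y)) ys))"
        by (simp add: subset_iff)
    qed
    ultimately show ?thesis by (simp only:)
  qed
  have sP: "set ?P = set xs \<times> set ys" by auto
  have r: "hom (?r z) (Suc 0) (Suc 0)" if "z \<in> set ?P" for z
    using that b unfolding sP by (auto simp: hom_def)
  have sl: "wp1 ?P ?Q \<odot> tens (map ?r ?P) = tens (map ?r ?Q) \<odot> wp1 ?P ?Q"
    by (rule tens_wp) (use r m in auto)
  have ar: "hom (tens (map ?r zs)) (length zs) (length zs)" if "set zs \<subseteq> set ?P" for zs
    using that r by (induction zs) (auto simp: hom_def)
  have arP: "hom (tens (map ?r ?P)) (length ?P) (length ?P)" "hom (tens (map ?r ?Q)) (length ?P) (length ?P)"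
    using ar[of ?P] ar[of ?Q] mset_eq_setD[OF m] mset_eq_length[OF m] by auto
  have aw: "hom (tens (map (\<lambda>_. ?w) xs)) (length xs) (length ?P)"
  proof -
    have "set (map (\<lambda>_. \<one>) ys) \<subseteq> carrier G" by auto
    note op.mulw_ar[OF this]
    then show ?thesis unfolding length_grid by (induction xs) (auto simp: hom_def)
  qed
  have at: "hom (tens (map (\<lambda>y. mulw (map (\<lambda>x. a x y) xs)) ys)) (length ?P) (length ys)"
    using a unfolding length_grid by (induction ys) (auto simp: hom_def subset_iff)
  have hX: "hom (wp1 ?P ?Q) (length ?P) (length ?P)"
    using wp_hom[OF m, of "\<lambda>_. Suc 0"] mset_eq_length[OF m] unfolding hom_def wd_1 by simp
  show ?thesis
    unfolding t2 slide_mid[OF at arP(1,2) hX aw sl] t1[symmetric] by (rule comulw_mulw_left[OF assms(1,2) p c])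
qed

abbreviation Cn :: "'n list \<Rightarrow> 'i list \<Rightarrow> ('i \<Rightarrow> 'n list) \<Rightarrow> ('n \<Rightarrow> 'g) \<Rightarrow> 'e" where "Cn \<equiv> op.Mn"

lemma Cn_eq:
  assumes "mset xs = mset (concat (map l is))" "distinct xs"
  shows "Cn xs is l a = wp1 (concat (map l is)) xs \<odot> tens (map (\<lambda>i. comulw (map a (l i))) is)"
  using assms by (simp add: op.Mn_def wp_op)

lemma tens_comulw_wp:
  assumes "mset is = mset js" "distinct is" "distinct (concat (map l is))"
    and "\<And>i. i \<in> set is \<Longrightarrow> set (map a (l i)) \<subseteq> carrier G"
  shows "tens (map (\<lambda>i. comulw (map a (l i))) is) \<odot> wp1 js is =
    wp1 (concat (map l js)) (concat (map l is)) \<odot> tens (map (\<lambda>i. comulw (map a (l i))) js)"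
proof -
  have "mset (concat (map l xs)) = sum_mset (image_mset (\<lambda>x. mset (l x)) (mset xs))" for xs
    by (induction xs) auto
  then have "mset (concat (map l is)) = mset (concat (map l js))" using assms(1) by simp
  then show ?thesis using op.tens_mulw_wp[OF assms] assms(1-3) by (simp add: wp_op)
qed

lemma tens_wp_const:
  "\<lbrakk>\<And>i. i \<in> set is \<Longrightarrow> mset (k i) = mset (l i); distinct (concat (map k is))\<rbrakk> \<Longrightarrow>
   tens (map (\<lambda>i. wp1 (k i) (l i)) is) = wp1 (concat (map k is)) (concat (map l is))"
proof (induction "is")
  case (Cons i "is")
  have "mset (concat (map k is)) = mset (concat (map l is))" using Cons.prems by (induction "is") auto
  then show ?case using Cons by (simp add: wp_append)
qed simp

text \<open>Naming the wires of the corner by pairs makes the two legs of the filler literally the two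
  lexicographic enumerations of the blocks \<open>k i \<times> l i\<close>.\<close>

lemma Cn_Mn_pairs:
  assumes mk: "mset ms = mset (concat (map k qs))" and ml: "mset ps = mset (concat (map l qs))"
    and d: "distinct ms" "distinct ps"
    and mz: "mset zs = mset (concat (map k' ps))" "mset zs = mset (concat (map l' ms))" and dz: "distinct zs"
    and k': "\<And>i y. \<lbrakk>i \<in> set qs; y \<in> set (l i)\<rbrakk> \<Longrightarrow> k' y = map (\<lambda>x. (x, y)) (k i)"
    and l': "\<And>i x. \<lbrakk>i \<in> set qs; x \<in> set (k i)\<rbrakk> \<Longrightarrow> l' x = map (\<lambda>y. (x, y)) (l i)"
    and p: "\<And>x. x \<in> set ms \<Longrightarrow> p x \<in> carrier G" and c: "\<And>y. y \<in> set ps \<Longrightarrow> c y \<in> carrier G"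
    and a: "\<And>z. z \<in> set zs \<Longrightarrow> a z \<in> carrier G" and b: "\<And>z. z \<in> set zs \<Longrightarrow> b z \<in> carrier G"
    and ab: "\<And>x y. (x, y) \<in> set zs \<Longrightarrow> p x \<otimes> b (x, y) = c y \<otimes> a (x, y)"
  shows "Cn ps qs l c \<odot> Mn ms qs k p = Mn zs ps k' a \<odot> Cn zs ms l' b"
proof -
  let ?J = "concat (map l qs)" and ?I = "concat (map k qs)"
  let ?t = "\<lambda>y. mulw (map a (k' y))" and ?u = "\<lambda>x. comulw (map b (l' x))"
  let ?P = "\<lambda>i. [(x, y). x \<leftarrow> k i, y \<leftarrow> l i]" and ?Q = "\<lambda>i. [(x, y). y \<leftarrow> l i, x \<leftarrow> k i]"
  let ?T = "\<lambda>i. tens (map ?t (l i))" and ?U = "\<lambda>i. tens (map ?u (k i))" and ?X = "\<lambda>i. wp1 (?P i) (?Q i)"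
  have sJ: "set ?J = set ps" "set ?I = set ms" using mset_eq_setD[OF mk] mset_eq_setD[OF ml] by auto
  have dJ: "distinct ?J" "distinct ?I" using d mk ml by (metis mset_eq_imp_distinct_iff)+
  have sub: "set (k i) \<subseteq> set ms" "set (l i) \<subseteq> set ps" "distinct (k i)" "distinct (l i)" if "i \<in> set qs" for i
    using that sJ dJ by (auto simp: distinct_concat_iff)
  have cP: "concat (map l' ?I) = concat (map ?P qs)" "concat (map k' ?J) = concat (map ?Q qs)"
  proof -
    have "concat (map l' (k i)) = ?P i" if "i \<in> set qs" for i
      using l'[OF that] by (intro arg_cong[where f = concat] map_cong) auto
    then have "map (\<lambda>i. concat (map l' (k i))) qs = map ?P qs" by (intro map_cong) auto
    moreover have "concat (map l' ?I) = concat (map (\<lambda>i. concat (map l' (k i))) qs)" by (induction qs) auto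
    ultimately show "concat (map l' ?I) = concat (map ?P qs)" by (simp only:)
    have "concat (map k' (l i)) = ?Q i" if "i \<in> set qs" for i
      using k'[OF that] by (intro arg_cong[where f = concat] map_cong) auto
    then have "map (\<lambda>i. concat (map k' (l i))) qs = map ?Q qs" by (intro map_cong) auto
    moreover have "concat (map k' ?J) = concat (map (\<lambda>i. concat (map k' (l i))) qs)" by (induction qs) auto
    ultimately show "concat (map k' ?J) = concat (map ?Q qs)" by (simp only:)
  qed
  have mc: "mset (concat (map h xs)) = mset (concat (map h ys))" if "mset xs = mset ys" for h :: "'i \<Rightarrow> 'j list" and xs ys
  proof -
    have "mset (concat (map h xs)) = sum_mset (image_mset (\<lambda>x. mset (h x)) (mset xs))" for xs
      by (induction xs) auto
    then show ?thesis using that by simp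
  qed
  have mP: "mset zs = mset (concat (map ?P qs))" unfolding cP(1)[symmetric] mz(2) by (rule mc[OF mk])
  have mQ: "mset zs = mset (concat (map ?Q qs))" unfolding cP(2)[symmetric] mz(1) by (rule mc[OF ml])
  have dP: "distinct (concat (map ?P qs))" "distinct (concat (map ?Q qs))"
    "distinct (concat (map k' ps))" "distinct (concat (map l' ms))"
    using dz mset_eq_imp_distinct_iff[OF mP] mset_eq_imp_distinct_iff[OF mQ]
      mset_eq_imp_distinct_iff[OF mz(1)] mset_eq_imp_distinct_iff[OF mz(2)] by blast+
  have zs: "(x, y) \<in> set zs" if "i \<in> set qs" "x \<in> set (k i)" "y \<in> set (l i)" for i x y
    using mset_eq_setD[OF mP] that by auto
  have k'z: "set (k' y) \<subseteq> set zs" if "y \<in> set ps" for y using mset_eq_setD[OF mz(1)] that by auto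
  have l'z: "set (l' x) \<subseteq> set zs" if "x \<in> set ms" for x using mset_eq_setD[OF mz(2)] that by auto
  have ck: "set (map a (k' y)) \<subseteq> carrier G" if "y \<in> set ps" for y using k'z[OF that] a by auto
  have cl: "set (map b (l' x)) \<subseteq> carrier G" if "x \<in> set ms" for x using l'z[OF that] b by auto
  \<comment> \<open>Above a single point \<open>i\<close> the pullback is the full array
    \<open>k i\<close> times \<open>l i\<close>, so the array identity applies there.\<close>
  have core: "comulw (map c (l i)) \<odot> mulw (map p (k i)) = ?T i \<odot> ?X i \<odot> ?U i" if i: "i \<in> set qs" for i
  proof -
    have "comulw (map c (l i)) \<odot> mulw (map p (k i)) = tens (map (\<lambda>y. mulw (map (\<lambda>x. a (x, y)) (k i))) (l i)) \<odot> ?X i \<odot>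
      tens (map (\<lambda>x. comulw (map (\<lambda>y. b (x, y)) (l i))) (k i))"
      by (rule comulw_mulw) (use sub[OF i] p c a b ab zs[OF i] in auto)
    also have "map (\<lambda>y. mulw (map (\<lambda>x. a (x, y)) (k i))) (l i) = map ?t (l i)"
      using k'[OF i] by (intro map_cong refl) (simp add: o_def)
    also have "map (\<lambda>x. comulw (map (\<lambda>y. b (x, y)) (l i))) (k i) = map ?u (k i)"
      using l'[OF i] by (intro map_cong refl) (simp add: o_def)
    finally show ?thesis .
  qed
  have hT: "hom (?T i) (length (?Q i)) (length (l i))" if "i \<in> set qs" for i
  proof -
    have "hom (tens (map ?t ys)) (length (concat (map k' ys))) (length ys)" if "set ys \<subseteq> set ps" for ys
      using that ck by (induction ys) (auto simp: hom_def)
    from this[of "l i"] show ?thesis using sub[OF that] k'[OF that]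
      by (simp add: length_concat cong: map_cong)
  qed
  have hU: "hom (?U i) (length (k i)) (length (?P i))" if "i \<in> set qs" for i
  proof -
    have "hom (tens (map ?u ys)) (length ys) (length (concat (map l' ys)))" if "set ys \<subseteq> set ms" for ys
      using that cl by (induction ys) (auto simp: hom_def)
    from this[of "k i"] show ?thesis using sub[OF that] l'[OF that]
      by (simp add: length_concat cong: map_cong)
  qed
  have hX: "hom (?X i) (length (?P i)) (length (?Q i))" for i
    using wp_hom[OF mset_grid, of "\<lambda>_. Suc 0"] unfolding hom_def wd_1 by blast
  have hp: "ar (mulw (map p (k i)))" "cd (mulw (map p (k i))) = Suc 0" "dm (mulw (map p (k i))) = length (k i)"
    "ar (comulw (map c (l i)))" "dm (comulw (map c (l i))) = Suc 0" "cd (comulw (map c (l i))) = length (l i)" if "i \<in> set qs" for i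
  proof -
    have *: "set (map p (k i)) \<subseteq> carrier G" "set (map c (l i)) \<subseteq> carrier G" using sub[OF that] p c by auto
    show "ar (mulw (map p (k i)))" "cd (mulw (map p (k i))) = Suc 0" "dm (mulw (map p (k i))) = length (k i)"
      "ar (comulw (map c (l i)))" "dm (comulw (map c (l i))) = Suc 0" "cd (comulw (map c (l i))) = length (l i)"
      using mulw_ar[OF *(1)] op.mulw_ar[OF *(2)] by simp_all
  qed
  let ?tp = "tens (map (\<lambda>i. mulw (map p (k i))) qs)" and ?tc = "tens (map (\<lambda>i. comulw (map c (l i))) qs)"
  have htp: "hom ?tp (length ?I) (length qs)" "hom ?tc (length qs) (length ?J)"
    using hp by (induction qs) (auto simp: hom_def)
  let ?TJ = "tens (map ?t ?J)" and ?UI = "tens (map ?u ?I)" and ?TP = "tens (map ?t ps)" and ?UM = "tens (map ?u ms)"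
  let ?XX = "wp1 (concat (map ?P qs)) (concat (map ?Q qs))"
  have h4: "hom ?TJ (length zs) (length ?J)" "hom ?UI (length ?I) (length zs)" "hom ?TP (length zs) (length ps)" "hom ?UM (length ms) (length zs)"
  proof -
    have "hom (tens (map ?t ys)) (length (concat (map k' ys))) (length ys)" if "set ys \<subseteq> set ps" for ys
      using that ck by (induction ys) (auto simp: hom_def)
    from this[of ?J] this[of ps] show "hom ?TJ (length zs) (length ?J)" "hom ?TP (length zs) (length ps)"
      using sJ mset_eq_length[OF mz(1)] mset_eq_length[OF mQ] by (simp_all add: cP)
    have "hom (tens (map ?u ys)) (length ys) (length (concat (map l' ys)))" if "set ys \<subseteq> set ms" for ys
      using that cl by (induction ys) (auto simp: hom_def)
    from this[of ?I] this[of ms] show "hom ?UI (length ?I) (length zs)" "hom ?UM (length ms) (length zs)"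
      using sJ mset_eq_length[OF mz(2)] mset_eq_length[OF mP] by (simp_all add: cP)
  qed
  have TX: "?tc \<odot> ?tp = ?TJ \<odot> ?XX \<odot> ?UI"
  proof -
    have "?tc \<odot> ?tp = tens (map (\<lambda>i. comulw (map c (l i)) \<odot> mulw (map p (k i))) qs)"
      by (rule tens_cmp) (use hp in auto)
    also have "\<dots> = tens (map (\<lambda>i. ?T i \<odot> ?X i \<odot> ?U i) qs)"
      using core by (intro arg_cong[where f = tens] map_cong) auto
    also have "\<dots> = tens (map ?T qs) \<odot> tens (map (\<lambda>i. ?X i \<odot> ?U i) qs)"
    proof (rule tens_cmp[symmetric])
      fix i assume i: "i \<in> set qs"
      then show "ar (?X i \<odot> ?U i) \<and> ar (?T i) \<and> cd (?X i \<odot> ?U i) = dm (?T i)"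
        using hT[OF i] hom_cmp[OF hU[OF i] hX[of i]] by (simp only: hom_def)
    qed
    also have "tens (map (\<lambda>i. ?X i \<odot> ?U i) qs) = tens (map ?X qs) \<odot> tens (map ?U qs)"
      using hU hX by (intro tens_cmp[symmetric]) (simp only: hom_def)
    also have "tens (map ?X qs) = ?XX"
      using mset_grid dP by (intro tens_wp_const) auto
    also have "tens (map ?T qs) = ?TJ"
      using mulw_ar(1)[OF ck] sub(2) by (subst tens_concat) (auto simp: map_concat o_def)
    also have "tens (map ?U qs) = ?UI"
      using op.mulw_ar(1)[OF cl] sub(1) by (subst tens_concat) (auto simp: map_concat o_def)
    finally show ?thesis .
  qed
  \<comment> \<open>The blocks come in the order of \<open>qs\<close>, whereas the legs of the
    filler are enumerated along \<open>ps\<close> and \<open>ms\<close>. Products and coproducts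
    slide through these reorderings, which then act on the strands of the arrays.\<close>
  have s1: "wp1 ?J ps \<odot> ?TJ = ?TP \<odot> wp1 (concat (map ?Q qs)) (concat (map k' ps))"
    by (rule tens_mulw_wp[OF ml[symmetric] dJ(1), of k' a, unfolded cP, OF dP(2) ck]) (simp only: sJ)
  have s2: "?UI \<odot> wp1 ms ?I = wp1 (concat (map l' ms)) (concat (map ?P qs)) \<odot> ?UM"
    by (rule tens_comulw_wp[OF mk[symmetric] dJ(2), of l' b, unfolded cP, OF dP(1) cl]) (simp only: sJ)
  have lens: "length ?I = length ms" "length ?J = length ps" using mset_eq_length[OF mk] mset_eq_length[OF ml] by simp_all
  have lz: "length (concat (map ?P qs)) = length zs" "length (concat (map ?Q qs)) = length zs"
     "length (concat (map k' ps)) = length zs" "length (concat (map l' ms)) = length zs"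
    using mset_eq_length[OF mP] mset_eq_length[OF mQ] mset_eq_length[OF mz(1)] mset_eq_length[OF mz(2)] by simp_all
  define W where "W xs ys = wp1 xs ys" for xs ys :: "('x \<times> 'z) list"
  let ?ZP = "concat (map ?P qs)" and ?ZQ = "concat (map ?Q qs)" and ?Zk = "concat (map k' ps)" and ?Zl = "concat (map l' ms)"
  have hW: "hom (wp1 ?ZQ ?Zk) (length zs) (length zs)" "hom (wp1 ?ZP ?ZQ) (length zs) (length zs)"
    "hom (wp1 ?Zl ?ZP) (length zs) (length zs)" "hom (wp1 zs ?Zk) (length zs) (length zs)"
    "hom (wp1 ?Zl zs) (length zs) (length zs)"
    using wp_hom[of ?ZQ ?Zk "\<lambda>_. Suc 0"] wp_hom[of ?ZP ?ZQ "\<lambda>_. Suc 0"] wp_hom[of ?Zl ?ZP "\<lambda>_. Suc 0"]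
      wp_hom[of zs ?Zk "\<lambda>_. Suc 0"] wp_hom[of ?Zl zs "\<lambda>_. Suc 0"] mP mQ mz
    unfolding hom_def wd_1 lz by simp_all
  \<comment> \<open>Both sides lead from the order along \<open>ms\<close> to the order along
    \<open>ps\<close>.\<close>
  have ww: "wp1 ?ZQ ?Zk \<odot> wp1 ?ZP ?ZQ \<odot> wp1 ?Zl ?ZP = wp1 zs ?Zk \<odot> wp1 ?Zl zs"
  proof -
    have "wp1 ?ZP ?ZQ \<odot> wp1 ?Zl ?ZP = wp1 ?Zl ?ZQ" by (rule wp_cmp) (use mP mQ mz dP in simp_all)
    moreover have "wp1 ?ZQ ?Zk \<odot> wp1 ?Zl ?ZQ = wp1 ?Zl ?Zk" by (rule wp_cmp) (use mP mQ mz dP in simp_all)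
    moreover have "wp1 zs ?Zk \<odot> wp1 ?Zl zs = wp1 ?Zl ?Zk" by (rule wp_cmp) (use mP mQ mz dP in simp_all)
    ultimately show ?thesis by simp
  qed
  have hw: "hom (wp1 ?J ps) (length ps) (length ps)" "hom (wp1 ms ?I) (length ms) (length ms)"
    using wp_hom[of ?J ps "\<lambda>_. Suc 0"] wp_hom[of ms ?I "\<lambda>_. Suc 0"] mk ml lens unfolding hom_def wd_1 by simp_all
  have "Cn ps qs l c \<odot> Mn ms qs k p = (wp1 ?J ps \<odot> ?tc) \<odot> (?tp \<odot> wp1 ms ?I)"
    using Cn_eq[OF ml d(2)] by (simp add: Mn_def)
  also have "\<dots> = wp1 ?J ps \<odot> (?tc \<odot> ?tp) \<odot> wp1 ms ?I"
    using htp hw lens unfolding hom_def by (simp add: cmp_assoc del: tens_map_ar tens_mulw tens_ar wp_ar)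
  also have "\<dots> = (wp1 ?J ps \<odot> ?TJ) \<odot> ?XX \<odot> (?UI \<odot> wp1 ms ?I)"
    unfolding TX using h4 hW hw lens unfolding hom_def by (simp add: cmp_assoc del: tens_map_ar tens_mulw tens_ar wp_ar)
  also have "\<dots> = ?TP \<odot> (wp1 ?ZQ ?Zk \<odot> ?XX \<odot> wp1 ?Zl ?ZP) \<odot> ?UM"
    unfolding s1 s2 using h4 hW unfolding hom_def by (simp add: cmp_assoc del: tens_map_ar tens_mulw tens_ar wp_ar)
  also have "\<dots> = (?TP \<odot> wp1 zs ?Zk) \<odot> (wp1 ?Zl zs \<odot> ?UM)"
    unfolding ww using h4 hW unfolding hom_def by (simp add: cmp_assoc del: tens_map_ar tens_mulw tens_ar wp_ar)
  also have "\<dots> = Mn zs ps k' a \<odot> Cn zs ms l' b"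
    using Cn_eq[OF mz(2) dz] by (simp add: Mn_def)
  finally show ?thesis .
qed

end

section \<open>Labelled maps: composition, tensor product and labelled permutations\<close>

lemma lmapsD:
  assumes "f \<in> lmaps k G n m"
  shows "lsrc f = n" "ltgt f = m" "lfun f \<in> {1..n} \<rightarrow>\<^sub>E {1..m}" "llab f \<in> {1..n} \<rightarrow>\<^sub>E carrier G"
  using assms by (auto simp: lmaps_def)

lemma lmaps_fun: "\<lbrakk>f \<in> lmaps k G n m; x \<in> {1..n}\<rbrakk> \<Longrightarrow> lfun f x \<in> {1..m}"
  and lmaps_lab: "\<lbrakk>f \<in> lmaps k G n m; x \<in> {1..n}\<rbrakk> \<Longrightarrow> llab f x \<in> carrier G"
  by (auto simp: lmaps_def PiE_iff)

lemma lmaps_ord: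
  assumes "f \<in> lmaps k G n m" "k = Ordered"
  shows "i \<in> {1..m} \<Longrightarrow> distinct (lord f i)" "i \<in> {1..m} \<Longrightarrow> set (lord f i) = {x \<in> {1..n}. lfun f x = i}"
    "i \<notin> {1..m} \<Longrightarrow> lord f i = []"
  using assms by (auto simp: lmaps_def fibre_def)

lemma lmaps_unord: "\<lbrakk>f \<in> lmaps k G n m; k = Unordered\<rbrakk> \<Longrightarrow> lord f i = []"
  by (simp add: lmaps_def)

lemma lmaps_ord_set: "f \<in> lmaps k G n m \<Longrightarrow> x \<in> set (lord f i) \<Longrightarrow> x \<in> {1..n} \<and> lfun f x = i \<and> i \<in> {1..m}"
  by (cases k; cases "i \<in> {1..m}") (auto simp: lmaps_ord lmaps_unord)

lemma lmapsI:
  assumes "lsrc f = n" "ltgt f = m" "lfun f \<in> {1..n} \<rightarrow>\<^sub>E {1..m}" "llab f \<in> {1..n} \<rightarrow>\<^sub>E carrier G"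
    and "k = Unordered \<Longrightarrow> lord f = (\<lambda>_. [])"
    and "\<And>i. k = Ordered \<Longrightarrow> i \<in> {1..m} \<Longrightarrow> distinct (lord f i) \<and> set (lord f i) = {x \<in> {1..n}. lfun f x = i}"
    and "\<And>i. k = Ordered \<Longrightarrow> i \<notin> {1..m} \<Longrightarrow> lord f i = []"
  shows "f \<in> lmaps k G n m"
  using assms by (cases k) (auto simp: lmaps_def fibre_def)

text \<open>The map and the labels are extensional, and the lists are empty outside the target and
  in the unordered case, so the records agree everywhere once they agree on the relevant
  points.\<close>

lemma lmaps_eqI:
  assumes f: "f \<in> lmaps k G n m" and g: "g \<in> lmaps k G n m"
    and "\<And>x. x \<in> {1..n} \<Longrightarrow> lfun f x = lfun g x" "\<And>x. x \<in> {1..n} \<Longrightarrow> llab f x = llab g x"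
    and o: "\<And>i. k = Ordered \<Longrightarrow> i \<in> {1..m} \<Longrightarrow> lord f i = lord g i"
  shows "f = g"
proof (rule lmap.equality)
  show "lfun f = lfun g" "llab f = llab g"
    using lmapsD[OF f] lmapsD[OF g] assms(3,4) by (auto simp: PiE_iff intro!: extensionalityI[of _ "{1..n}"])
  show "lord f = lord g"
  proof
    fix i show "lord f i = lord g i"
      using o[of i] lmaps_ord(3)[OF f, of i] lmaps_ord(3)[OF g, of i] lmaps_unord[OF f, of i] lmaps_unord[OF g, of i]
      by (cases k; cases "i \<in> {1..m}") (auto simp del: atLeastAtMost_iff)
  qed
qed (use lmapsD[OF f] lmapsD[OF g] in auto)

lemma concat_map_concat: "concat (map F (concat (map H xs))) = concat (map (\<lambda>x. concat (map F (H x))) xs)"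
  by (induction xs) auto

lemma inv_bij:
  assumes "bij_betw s {1..p} {1..p :: nat}" "i \<in> {1..p}"
  shows "inv_into {1..p} s i \<in> {1..p}" "s (inv_into {1..p} s i) = i" "{x \<in> {1..p}. s x = i} = {inv_into {1..p} s i}"
proof -
  show *: "inv_into {1..p} s i \<in> {1..p}" using bij_betw_inv_into[OF assms(1)] assms(2) by (rule bij_betw_apply)
  show "s (inv_into {1..p} s i) = i" using assms by (rule bij_betw_inv_into_right)
  then show "{x \<in> {1..p}. s x = i} = {inv_into {1..p} s i}"
    using * by (auto simp: bij_betw_inv_into_left[OF assms(1)] simp del: atLeastAtMost_iff One_nat_def)
qed

context group begin

lemma lcomp_lmaps:
  assumes f: "f \<in> lmaps k G n m" and g: "g \<in> lmaps k G m l"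
  shows "lcomp G g f \<in> lmaps k G n l"
proof (rule lmapsI)
  fix i assume k: "k = Ordered" and i: "i \<in> {1..l}"
  note og = lmaps_ord[OF g k] and of' = lmaps_ord[OF f k]
  have s: "j \<in> {1..m}" if "j \<in> set (lord g i)" for j using og(2)[OF i] that by auto
  have d: "distinct (concat (map (lord f) js))" if "distinct js" "set js \<subseteq> {1..m}" for js
    using that
  proof (induction js)
    case (Cons j js)
    then show ?case using of'(1,2) by fastforce
  qed simp
  have "set (concat (map (lord f) (lord g i))) = {x \<in> {1..n}. lfun g (lfun f x) = i}"
  proof (rule equalityI; rule subsetI)
    fix x assume "x \<in> set (concat (map (lord f) (lord g i)))"
    then obtain j where "j \<in> set (lord g i)" "x \<in> set (lord f j)" by auto
    then show "x \<in> {x \<in> {1..n}. lfun g (lfun f x) = i}"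
      using og(2)[OF i] of'(2)[OF s] by auto
  next
    fix x assume x: "x \<in> {x \<in> {1..n}. lfun g (lfun f x) = i}"
    then have "lfun f x \<in> {1..m}" using lmaps_fun[OF f] by blast
    then have "lfun f x \<in> set (lord g i)" "x \<in> set (lord f (lfun f x))" using og(2)[OF i] of'(2) x by auto
    then show "x \<in> set (concat (map (lord f) (lord g i)))" by auto
  qed
  then show "distinct (lord (lcomp G g f) i) \<and> set (lord (lcomp G g f) i) = {x \<in> {1..n}. lfun (lcomp G g f) x = i}"
    using d[OF og(1)[OF i] subsetI[OF s]] lmapsD(1)[OF f] by (auto simp: lcomp_def)
next
  fix i assume "k = Ordered" "i \<notin> {1..l}"
  then show "lord (lcomp G g f) i = []" using lmaps_ord(3)[OF g] by (simp add: lcomp_def)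
qed (use f g lmapsD[OF f] lmapsD[OF g] in \<open>auto simp: lcomp_def PiE_iff lmaps_unord[OF g] Pi_iff\<close>)

lemma lcomp_assoc:
  assumes f: "f \<in> lmaps k G n m" and g: "g \<in> lmaps k G m l" and h: "h \<in> lmaps k G l r"
  shows "lcomp G (lcomp G h g) f = lcomp G h (lcomp G g f)"
proof (rule lmaps_eqI)
  show "lcomp G (lcomp G h g) f \<in> lmaps k G n r" "lcomp G h (lcomp G g f) \<in> lmaps k G n r"
    using f g h by (meson lcomp_lmaps)+
  fix x assume x: "x \<in> {1..n}"
  then show "lfun (lcomp G (lcomp G h g) f) x = lfun (lcomp G h (lcomp G g f)) x"
    "llab (lcomp G (lcomp G h g) f) x = llab (lcomp G h (lcomp G g f)) x"
    using lmapsD[OF f] lmapsD[OF g] lmaps_fun[OF f x] lmaps_fun[OF g lmaps_fun[OF f x]]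
      lmaps_lab[OF f x] lmaps_lab[OF g lmaps_fun[OF f x]] lmaps_lab[OF h lmaps_fun[OF g lmaps_fun[OF f x]]]
    by (simp_all add: lcomp_def m_assoc)
next
  fix i show "lord (lcomp G (lcomp G h g) f) i = lord (lcomp G h (lcomp G g f)) i"
    by (simp add: lcomp_def concat_map_concat)
qed

lemma lperm_lmaps:
  assumes s: "bij_betw s {1..p} {1..p}" and c: "c \<in> {1..p} \<rightarrow> carrier G"
  shows "lperm k p s c \<in> lmaps k G p p"
proof (rule lmapsI)
  fix i assume i: "i \<in> {1..p}"
  then have "{x \<in> {1..p}. s x = i} = {inv_into {1..p} s i}"
    by (rule inv_bij[OF s])
  then show "distinct (lord (lperm k p s c) i) \<and> set (lord (lperm k p s c) i) = {x \<in> {1..p}. lfun (lperm k p s c) x = i}"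
    if "k = Ordered"
    using that i by (simp add: lperm_def cong: conj_cong)
qed (use s c in \<open>auto simp: lperm_def bij_betw_def\<close>)

text \<open>The fibres of a bijection are singletons, which leaves no choice of orders. Equations
  between labelled permutations can therefore be checked on maps and labels.\<close>

lemma lperm_of_bij:
  assumes h: "h \<in> lmaps k G p p" and b: "bij_betw (lfun h) {1..p} {1..p}"
  shows "h = lperm k p (lfun h) (llab h)"
proof (rule lmaps_eqI[OF h])
  show "lperm k p (lfun h) (llab h) \<in> lmaps k G p p"
    using h b by (intro lperm_lmaps) (auto simp: lmaps_def)
  fix i assume k: "k = Ordered" and i: "i \<in> {1..p}"
  have "set (lord h i) = {inv_into {1..p} (lfun h) i}"
    using lmaps_ord(2)[OF h k i] inv_bij(3)[OF b i] by simp
  then have "lord h i = [inv_into {1..p} (lfun h) i]"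
    using lmaps_ord(1)[OF h k i] by (cases "lord h i" rule: list.exhaust; cases "tl (lord h i)") auto
  then show "lord h i = lord (lperm k p (lfun h) (llab h)) i" using k i by (simp add: lperm_def)
qed (auto simp: lperm_def)

lemma lperm_cong:
  assumes "bij_betw s {1..p} {1..p}" "\<And>x. x \<in> {1..p} \<Longrightarrow> s x = s' x" "\<And>x. x \<in> {1..p} \<Longrightarrow> c x = c' x"
  shows "lperm k p s c = lperm k p s' c'"
proof -
  have "inv_into {1..p} s i = inv_into {1..p} s' i" for i
    using assms(2) by (auto simp: inv_into_def intro!: arg_cong[where f = Eps])
  then show ?thesis using assms by (auto simp: lperm_def fun_eq_iff)
qed

lemma lcomp_lperm_lperm:
  assumes s: "bij_betw s {1..p} {1..p}" "bij_betw t {1..p} {1..p}" and c: "c \<in> {1..p} \<rightarrow> carrier G" "d \<in> {1..p} \<rightarrow> carrier G"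
  shows "lcomp G (lperm k p t d) (lperm k p s c) = lperm k p (t \<circ> s) (\<lambda>x. d (s x) \<otimes> c x)"
proof -
  let ?h = "lcomp G (lperm k p t d) (lperm k p s c)"
  have h: "?h \<in> lmaps k G p p" using assms by (intro lcomp_lmaps[of _ _ p p] lperm_lmaps)
  have f: "lfun ?h x = (t \<circ> s) x" "llab ?h x = d (s x) \<otimes> c x" if "x \<in> {1..p}" for x
    using that s(1) by (auto simp: lcomp_def lperm_def bij_betw_def)
  have b: "bij_betw (t \<circ> s) {1..p} {1..p}" using s by (rule bij_betw_trans)
  then have "bij_betw (lfun ?h) {1..p} {1..p}" using bij_betw_cong[of "{1..p}" "lfun ?h" "t \<circ> s", OF f(1)] by blast
  from lperm_of_bij[OF h this] show ?thesis
    using lperm_cong[OF b, of "lfun ?h" "\<lambda>x. d (s x) \<otimes> c x" "llab ?h" k] f by simp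
qed

lemma lident_lmaps [simp]: "lident k G n \<in> lmaps k G n n"
  unfolding lident_def by (rule lperm_lmaps) (auto simp: bij_betw_def)

lemma lident_sel: "lsrc (lident k G n) = n" "ltgt (lident k G n) = n"
  "x \<in> {1..n} \<Longrightarrow> lfun (lident k G n) x = x" "x \<in> {1..n} \<Longrightarrow> llab (lident k G n) x = \<one>"
  "i \<in> {1..n} \<Longrightarrow> lord (lident k G n) i = (if k = Ordered then [i] else [])"
  using inv_into_f_f[of "\<lambda>x. x" "{1..n}" i] by (auto simp: lident_def lperm_def)

lemma lcomp_lident:
  assumes f: "f \<in> lmaps k G n m"
  shows "lcomp G (lident k G m) f = f" "lcomp G f (lident k G n) = f"
proof -
  show "lcomp G (lident k G m) f = f"
  proof (rule lmaps_eqI[OF lcomp_lmaps[OF f lident_lmaps] f])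
    show "lfun (lcomp G (lident k G m) f) x = lfun f x" "llab (lcomp G (lident k G m) f) x = llab f x" if "x \<in> {1..n}" for x
      using that lmapsD[OF f] lmaps_fun[OF f that] lmaps_lab[OF f that] lident_sel by (simp_all add: lcomp_def)
  qed (simp add: lcomp_def lident_sel)
  show "lcomp G f (lident k G n) = f"
  proof (rule lmaps_eqI[OF lcomp_lmaps[OF lident_lmaps f] f])
    show "lfun (lcomp G f (lident k G n)) x = lfun f x" "llab (lcomp G f (lident k G n)) x = llab f x" if "x \<in> {1..n}" for x
      using that lmapsD[OF f] lmaps_lab[OF f that] lident_sel by (simp_all add: lcomp_def)
    fix i assume k: "k = Ordered" and i: "i \<in> {1..m}"
    have "map (lord (lident k G n)) (lord f i) = map (\<lambda>x. [x]) (lord f i)"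
      using lmaps_ord(2)[OF f k i] k by (intro map_cong refl) (auto simp: lident_sel)
    then have "concat (map (lord (lident k G n)) (lord f i)) = lord f i"
      by (simp only: concat_map_singleton map_ident)
    then show "lord (lcomp G f (lident k G n)) i = lord f i" by (simp add: lcomp_def)
  qed
qed

lemma ltensor_lmaps:
  assumes f: "f \<in> lmaps k G n m" and g: "g \<in> lmaps k G n' m'"
  shows "ltensor f g \<in> lmaps k G (n + n') (m + m')"
proof (rule lmapsI)
  have s: "lsrc f = n" "lsrc g = n'" "ltgt f = m" "ltgt g = m'" using lmapsD[OF f] lmapsD[OF g] by auto
  then show "lsrc (ltensor f g) = n + n'" "ltgt (ltensor f g) = m + m'" by (auto simp: ltensor_def)
  have ff: "1 \<le> x \<Longrightarrow> x \<le> n \<Longrightarrow> 1 \<le> lfun f x \<and> lfun f x \<le> m \<and> llab f x \<in> carrier G" for x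
    using lmaps_fun[OF f, of x] lmaps_lab[OF f, of x] by auto
  have gg: "1 \<le> x \<Longrightarrow> x \<le> n' \<Longrightarrow> 1 \<le> lfun g x \<and> lfun g x \<le> m' \<and> llab g x \<in> carrier G" for x
    using lmaps_fun[OF g, of x] lmaps_lab[OF g, of x] by auto
  show "lfun (ltensor f g) \<in> {1..n + n'} \<rightarrow>\<^sub>E {1..m + m'}"
  proof (rule PiE_I)
    fix x assume "x \<in> {1..n + n'}"
    moreover have "x \<le> n \<or> 1 \<le> x - n \<and> x - n \<le> n' \<and> \<not> x \<le> n" using calculation by auto
    ultimately show "lfun (ltensor f g) x \<in> {1..m + m'}" using ff[of x] gg[of "x - n"] by (auto simp: ltensor_def s)
  qed (auto simp: ltensor_def s)
  show "llab (ltensor f g) \<in> {1..n + n'} \<rightarrow>\<^sub>E carrier G"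
  proof (rule PiE_I)
    fix x assume "x \<in> {1..n + n'}"
    moreover have "x \<le> n \<or> 1 \<le> x - n \<and> x - n \<le> n' \<and> \<not> x \<le> n" using calculation by auto
    ultimately show "llab (ltensor f g) x \<in> carrier G" using ff[of x] gg[of "x - n"] by (auto simp: ltensor_def s)
  qed (auto simp: ltensor_def s)
  show "lord (ltensor f g) = (\<lambda>_. [])" if "k = Unordered"
    using lmaps_unord[OF f that] lmaps_unord[OF g that] by (auto simp: ltensor_def)
  fix i assume k: "k = Ordered"
  note of' = lmaps_ord[OF f k] and og = lmaps_ord[OF g k]
  show "lord (ltensor f g) i = []" if "i \<notin> {1..m + m'}"
  proof (cases "i \<le> m")
    case True
    then have "i \<notin> {1..m}" using that by auto
    then show ?thesis using True of'(3)[of i] by (simp add: ltensor_def s)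
  next
    case False
    then have "i - m \<notin> {1..m'}" using that by auto
    then show ?thesis using False og(3)[of "i - m"] by (simp add: ltensor_def s)
  qed
  assume i: "i \<in> {1..m + m'}"
  show "distinct (lord (ltensor f g) i) \<and> set (lord (ltensor f g) i) = {x \<in> {1..n + n'}. lfun (ltensor f g) x = i}"
  proof (cases "i \<le> m")
    case True
    have "x \<le> n" if "x \<in> {1..n + n'}" "lfun (ltensor f g) x = i" for x
    proof (rule ccontr)
      assume nx: "\<not> x \<le> n"
      then have "1 \<le> x - n" "x - n \<le> n'" using that by auto
      from gg[OF this] show False using that True nx by (auto simp: ltensor_def s)
    qed
    then have "{x \<in> {1..n + n'}. lfun (ltensor f g) x = i} = {x \<in> {1..n}. lfun (ltensor f g) x = i}"
      by fastforce
    also have "\<dots> = {x \<in> {1..n}. lfun f x = i}" by (auto simp: ltensor_def s)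
    finally show ?thesis using of'(1,2)[of i] True i by (simp add: ltensor_def s)
  next
    case False
    have im: "i - m \<in> {1..m'}" using i False by auto
    have "n < x" if "x \<in> {1..n + n'}" "lfun (ltensor f g) x = i" for x
      using that ff[of x] False by (auto simp: ltensor_def s split: if_splits)
    note gt = this
    have lo: "lord (ltensor f g) i = map (\<lambda>x. n + x) (lord g (i - m))" using False by (simp add: ltensor_def s)
    have "set (lord (ltensor f g) i) = {x \<in> {1..n + n'}. lfun (ltensor f g) x = i}"
    proof (rule equalityI; rule subsetI)
      fix x assume "x \<in> set (lord (ltensor f g) i)"
      then obtain x' where x: "x = n + x'" "x' \<in> {1..n'}" "lfun g x' = i - m" using og(2)[OF im] lo by auto
      then show "x \<in> {x \<in> {1..n + n'}. lfun (ltensor f g) x = i}" using False by (simp add: ltensor_def s)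
    next
      fix x assume "x \<in> {x \<in> {1..n + n'}. lfun (ltensor f g) x = i}"
      then have x: "x \<in> {1..n + n'}" "lfun (ltensor f g) x = i" "n < x" using gt by blast+
      then have "x - n \<in> {1..n'}" "lfun g (x - n) = i - m" by (auto simp: ltensor_def s)
      then have "x - n \<in> set (lord g (i - m))" using og(2)[OF im] by simp
      then have "n + (x - n) \<in> set (lord (ltensor f g) i)" unfolding lo by simp
      then show "x \<in> set (lord (ltensor f g) i)" using \<open>n < x\<close> by simp
    qed
    moreover have "distinct (lord (ltensor f g) i)" using og(1)[OF im] unfolding lo by (simp add: distinct_map)
    ultimately show ?thesis by blast
  qed
qed

lemma ltensor_lcomp:
  assumes f: "f \<in> lmaps k G n m" "f' \<in> lmaps k G m l" and g: "g \<in> lmaps k G a b" "g' \<in> lmaps k G b c"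
  shows "ltensor (lcomp G f' f) (lcomp G g' g) = lcomp G (ltensor f' g') (ltensor f g)"
proof (rule lmaps_eqI[where n = "n + a" and m = "l + c"])
  show "ltensor (lcomp G f' f) (lcomp G g' g) \<in> lmaps k G (n + a) (l + c)"
    by (rule ltensor_lmaps[OF lcomp_lmaps[OF f] lcomp_lmaps[OF g]])
  show "lcomp G (ltensor f' g') (ltensor f g) \<in> lmaps k G (n + a) (l + c)"
    by (rule lcomp_lmaps[OF ltensor_lmaps[OF f(1) g(1)] ltensor_lmaps[OF f(2) g(2)]])
  note s = lmapsD(1,2)[OF f(1)] lmapsD(1,2)[OF f(2)] lmapsD(1,2)[OF g(1)] lmapsD(1,2)[OF g(2)]
  have ff: "1 \<le> x \<Longrightarrow> x \<le> n \<Longrightarrow> 1 \<le> lfun f x \<and> lfun f x \<le> m" for x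
    using lmaps_fun[OF f(1), of x] by auto
  have gg: "1 \<le> x \<Longrightarrow> x \<le> a \<Longrightarrow> 1 \<le> lfun g x \<and> lfun g x \<le> b" for x
    using lmaps_fun[OF g(1), of x] by auto
  fix x assume x: "x \<in> {1..n + a}"
  then show "lfun (ltensor (lcomp G f' f) (lcomp G g' g)) x = lfun (lcomp G (ltensor f' g') (ltensor f g)) x"
    "llab (ltensor (lcomp G f' f) (lcomp G g' g)) x = llab (lcomp G (ltensor f' g') (ltensor f g)) x"
    using ff[of x] gg[of "x - n"] by (auto simp: ltensor_def lcomp_def s)
next
  note s = lmapsD(1,2)[OF f(1)] lmapsD(1,2)[OF f(2)] lmapsD(1,2)[OF g(1)] lmapsD(1,2)[OF g(2)]
  fix i assume k: "k = Ordered" and i: "i \<in> {1..l + c}"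
  show "lord (ltensor (lcomp G f' f) (lcomp G g' g)) i = lord (lcomp G (ltensor f' g') (ltensor f g)) i"
  proof (cases "i \<le> l")
    case True
    then have "map (lord (ltensor f g)) (lord f' i) = map (lord f) (lord f' i)"
      using lmaps_ord(2)[OF f(2) k, of i] i by (intro map_cong refl) (auto simp: ltensor_def s)
    moreover have "lord (ltensor f' g') i = lord f' i" using True by (simp add: ltensor_def s)
    moreover have "lord (ltensor (lcomp G f' f) (lcomp G g' g)) i = concat (map (lord f) (lord f' i))"
      using True by (simp add: ltensor_def lcomp_def s)
    ultimately show ?thesis by (simp only: lcomp_def lmap.simps)
  next
    case False
    then have "map (\<lambda>j. lord (ltensor f g) (m + j)) (lord g' (i - l)) = map (\<lambda>j. map (\<lambda>x. n + x) (lord g j)) (lord g' (i - l))"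
    proof (intro map_cong refl)
      fix j assume "j \<in> set (lord g' (i - l))"
      moreover have "i - l \<in> {1..c}" using i False by auto
      ultimately show "lord (ltensor f g) (m + j) = map (\<lambda>x. n + x) (lord g j)"
        using lmaps_ord(2)[OF g(2) k] by (auto simp: ltensor_def s)
    qed
    moreover have "lord (ltensor f' g') i = map (\<lambda>x. m + x) (lord g' (i - l))" using False by (simp add: ltensor_def s)
    moreover have "lord (ltensor (lcomp G f' f) (lcomp G g' g)) i = concat (map (\<lambda>j. map (\<lambda>x. n + x) (lord g j)) (lord g' (i - l)))"
      using False by (simp add: ltensor_def lcomp_def s map_concat o_def)
    ultimately show ?thesis by (simp only: lcomp_def lmap.simps list.map_comp o_def)
  qed
qed

lemma lident_tensor: "ltensor (lident k G n) (lident k G m) = lident k G (n + m)"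
proof (rule lmaps_eqI[OF ltensor_lmaps[OF lident_lmaps lident_lmaps] lident_lmaps])
  fix x assume x: "x \<in> {1..n + m}"
  then have "x \<le> n \<or> x - n \<in> {1..m} \<and> n < x" by auto
  then show "lfun (ltensor (lident k G n) (lident k G m)) x = lfun (lident k G (n + m)) x"
    "llab (ltensor (lident k G n) (lident k G m)) x = llab (lident k G (n + m)) x"
    using x by (auto simp: ltensor_def lident_sel)
next
  fix i assume "k = Ordered" and i: "i \<in> {1..n + m}"
  then have "i \<le> n \<or> i - n \<in> {1..m} \<and> n < i" by auto
  then show "lord (ltensor (lident k G n) (lident k G m)) i = lord (lident k G (n + m)) i"
    using i by (auto simp: ltensor_def lident_sel)
qed

subsection \<open>Spans\<close>

text \<open>The data of an element of the semidirect product of \<open>G\<close>-labellings with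
  permutations, free of a fibre kind: an equivalence of spans applies one and the same element to
  both legs, whose kinds may differ.\<close>

definition lperms :: "nat \<Rightarrow> (nat \<Rightarrow> nat) \<Rightarrow> (nat \<Rightarrow> 'a) \<Rightarrow> bool" where
  "lperms p s c \<longleftrightarrow> bij_betw s {1..p} {1..p} \<and> c \<in> {1..p} \<rightarrow> carrier G"

lemma span_equivI:
  assumes "phi \<in> lmaps kY G p n" "f \<in> lmaps kX G p m" "lperms p s c"
  shows "((lcomp G phi (lperm kY p s c), lcomp G f (lperm kX p s c)), (phi, f)) \<in> span_equiv kX kY G n m"
proof -
  have "lperm kY p s c \<in> lmaps kY G p p" "lperm kX p s c \<in> lmaps kX G p p"
    using assms(3) by (auto simp: lperms_def intro!: lperm_lmaps)
  then have "lcomp G phi (lperm kY p s c) \<in> lmaps kY G p n" "lcomp G f (lperm kX p s c) \<in> lmaps kX G p m"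
    using assms by (meson lcomp_lmaps)+
  moreover have "lsrc (lcomp G phi (lperm kY p s c)) = p" by (simp add: lcomp_def lperm_def)
  ultimately show ?thesis
    using assms(1,2) assms(3)[unfolded lperms_def] lmapsD(1)[OF assms(1)]
    unfolding span_equiv_def spans_def mem_Collect_eq prod.case by auto
qed

lemma span_equivE:
  assumes "((phi, f), (phi', f')) \<in> span_equiv kX kY G n m"
  obtains p s c where "phi' \<in> lmaps kY G p n" "f' \<in> lmaps kX G p m" "phi \<in> lmaps kY G p n" "f \<in> lmaps kX G p m" "lperms p s c"
    "phi = lcomp G phi' (lperm kY p s c)" "f = lcomp G f' (lperm kX p s c)"
proof -
  obtain s c p p' where *: "phi' \<in> lmaps kY G p n" "f' \<in> lmaps kX G p m" "phi \<in> lmaps kY G p' n" "f \<in> lmaps kX G p' m"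
    "lsrc phi = lsrc phi'" "bij_betw s {1..lsrc phi'} {1..lsrc phi'}" "c \<in> {1..lsrc phi'} \<rightarrow> carrier G"
    "lcomp G phi' (lperm kY (lsrc phi') s c) = phi" "lcomp G f' (lperm kX (lsrc phi') s c) = f"
    using assms unfolding span_equiv_def spans_def by blast
  then have "lsrc phi' = p" "p' = p" by (auto dest: lmapsD(1))
  with * that show ?thesis unfolding lperms_def by blast
qed

text \<open>The relation is the orbit relation of the group of labelled permutations of the middle
  object, which acts on both legs by precomposition.\<close>

lemma span_equiv_equiv: "equiv (spans kX kY G n m) (span_equiv kX kY G n m)"
proof (rule equivI)
  show "span_equiv kX kY G n m \<subseteq> spans kX kY G n m \<times> spans kX kY G n m"
    by (auto simp: span_equiv_def)
  show "refl_on (spans kX kY G n m) (span_equiv kX kY G n m)"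
  proof (rule refl_onI)
    fix s assume "s \<in> spans kX kY G n m"
    then obtain phi f p where s: "s = (phi, f)" "phi \<in> lmaps kY G p n" "f \<in> lmaps kX G p m" by (auto simp: spans_def)
    have "lperms p (\<lambda>x. x) (\<lambda>_. \<one>)" by (auto simp: lperms_def bij_betw_def)
    from span_equivI[OF s(2,3) this] show "(s, s) \<in> span_equiv kX kY G n m"
      using lcomp_lident(2)[OF s(2)] lcomp_lident(2)[OF s(3)] s(1) by (simp add: lident_def)
  qed
  show "sym (span_equiv kX kY G n m)"
  proof (rule symI)
    fix a b assume "(a, b) \<in> span_equiv kX kY G n m"
    moreover obtain phi f phi' f' where ab: "a = (phi, f)" "b = (phi', f')" by (metis surj_pair)
    ultimately obtain p s c where *: "phi' \<in> lmaps kY G p n" "f' \<in> lmaps kX G p m" "phi \<in> lmaps kY G p n" "f \<in> lmaps kX G p m" "lperms p s c"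
      "phi = lcomp G phi' (lperm kY p s c)" "f = lcomp G f' (lperm kX p s c)"
      by (auto elim!: span_equivE)
    \<comment> \<open>The inverse in the semidirect product: the inverse permutation, with the
      inverse of the label found at the preimage.\<close>
    let ?t = "inv_into {1..p} s" and ?d = "\<lambda>x. inv (c (inv_into {1..p} s x))"
    have s: "bij_betw s {1..p} {1..p}" "c \<in> {1..p} \<rightarrow> carrier G" using *(5) by (auto simp: lperms_def)
    have t: "bij_betw ?t {1..p} {1..p}" using s(1) by (rule bij_betw_inv_into)
    have d: "?d \<in> {1..p} \<rightarrow> carrier G" using s(2) inv_bij(1)[OF s(1)] by (auto simp del: atLeastAtMost_iff)
    have e: "lcomp G (lperm k p s c) (lperm k p ?t ?d) = lident k G p" for k
    proof -
      have b: "bij_betw (s \<circ> ?t) {1..p} {1..p}" using t s(1) by (rule bij_betw_trans)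
      have "lcomp G (lperm k p s c) (lperm k p ?t ?d) = lperm k p (s \<circ> ?t) (\<lambda>x. c (?t x) \<otimes> ?d x)"
        using lcomp_lperm_lperm[OF t s(1) d s(2)] .
      also have "\<dots> = lident k G p" unfolding lident_def
        by (rule lperm_cong[OF b]) (use s(2) inv_bij(1,2)[OF s(1)] in \<open>auto simp: Pi_iff simp del: atLeastAtMost_iff One_nat_def\<close>)
      finally show ?thesis .
    qed
    have "lcomp G phi (lperm kY p ?t ?d) = phi'" "lcomp G f (lperm kX p ?t ?d) = f'"
      unfolding *(6,7) using lcomp_assoc[OF lperm_lmaps[OF t d] lperm_lmaps[OF s] *(1)]
        lcomp_assoc[OF lperm_lmaps[OF t d] lperm_lmaps[OF s] *(2)] lcomp_lident(2)[OF *(1)] lcomp_lident(2)[OF *(2)]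
      by (simp_all only: e)
    moreover have "lperms p ?t ?d" using t d by (simp add: lperms_def)
    ultimately show "(b, a) \<in> span_equiv kX kY G n m"
      using span_equivI[OF *(3,4)] ab by metis
  qed
  show "trans (span_equiv kX kY G n m)"
  proof (rule transI)
    fix a b e assume "(a, b) \<in> span_equiv kX kY G n m" "(b, e) \<in> span_equiv kX kY G n m"
    moreover obtain phi f phi' f' phi'' f'' where ab: "a = (phi, f)" "b = (phi', f')" "e = (phi'', f'')" by (metis surj_pair)
    ultimately obtain p s c p' t d where *: "phi' \<in> lmaps kY G p n" "f' \<in> lmaps kX G p m" "lperms p s c"
      "phi = lcomp G phi' (lperm kY p s c)" "f = lcomp G f' (lperm kX p s c)"
      and **: "phi'' \<in> lmaps kY G p' n" "f'' \<in> lmaps kX G p' m" "phi' \<in> lmaps kY G p' n" "lperms p' t d"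
      "phi' = lcomp G phi'' (lperm kY p' t d)" "f' = lcomp G f'' (lperm kX p' t d)"
      by (auto elim!: span_equivE)
    have p: "p' = p" using *(1) **(3) by (auto dest: lmapsD(1))
    have s: "bij_betw s {1..p} {1..p}" "c \<in> {1..p} \<rightarrow> carrier G" "bij_betw t {1..p} {1..p}" "d \<in> {1..p} \<rightarrow> carrier G"
      using *(3) **(4) by (auto simp: lperms_def p)
    have "phi = lcomp G phi'' (lperm kY p (t \<circ> s) (\<lambda>x. d (s x) \<otimes> c x))"
      "f = lcomp G f'' (lperm kX p (t \<circ> s) (\<lambda>x. d (s x) \<otimes> c x))"
      using lcomp_assoc[OF lperm_lmaps[OF s(1,2)] lperm_lmaps[OF s(3,4)] **(1)[unfolded p]]
        lcomp_assoc[OF lperm_lmaps[OF s(1,2)] lperm_lmaps[OF s(3,4)] **(2)[unfolded p]]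
      unfolding *(4,5) **(5,6) p lcomp_lperm_lperm[OF s(1,3,2,4)] by simp_all
    moreover have "lperms p (t \<circ> s) (\<lambda>x. d (s x) \<otimes> c x)"
      using s bij_betw_trans[OF s(1,3)] bij_betw_apply[OF s(1)] by (auto simp: lperms_def Pi_iff simp del: atLeastAtMost_iff One_nat_def)
    ultimately show "(a, e) \<in> span_equiv kX kY G n m"
      using span_equivI[OF **(1,2)[unfolded p]] ab by metis
  qed
qed

end

text \<open>A point of a pullback is determined by its two projections. The order on a fibre of one
  projection is therefore known from its image under the other, and equal images force the
  comparison bijection \<open>s\<close> to match the two orders.\<close>

lemma map_inv_transport:
  assumes s: "bij_betw s N N" and eq: "map u' A' = map u A"
    and A: "\<And>z. z \<in> set A \<Longrightarrow> z \<in> N \<and> v z = x" and A': "\<And>z. z \<in> set A' \<Longrightarrow> z \<in> N \<and> v' z = x"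
    and us: "\<And>z. z \<in> N \<Longrightarrow> u (s z) = u' z \<and> v (s z) = v' z"
    and inj: "\<And>z z'. \<lbrakk>z \<in> N; z' \<in> N; u z = u z'; v z = v z'\<rbrakk> \<Longrightarrow> z = z'"
  shows "map (inv_into N s) A = A'"
proof -
  have len: "length A' = length A" using eq by (rule map_eq_imp_length_eq)
  have "map s A' = A"
  proof (rule nth_equalityI)
    fix i assume "i < length (map s A')"
    then have i: "i < length A'" "i < length A" using len by simp_all
    have "u' (A' ! i) = u (A ! i)" using arg_cong[OF eq, of "\<lambda>l. l ! i"] i by simp
    then have "s (A' ! i) = A ! i"
      using inj[of "s (A' ! i)" "A ! i"] A[OF nth_mem[OF i(2)]] A'[OF nth_mem[OF i(1)]] us[of "A' ! i"]
        bij_betw_apply[OF s] by metis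
    then show "map s A' ! i = A ! i" using i by simp
  qed (simp add: len)
  then have "map (inv_into N s) A = map (\<lambda>z. inv_into N s (s z)) A'" by auto
  also have "\<dots> = A'" using A' bij_betw_inv_into_left[OF s] by (intro map_idI) blast
  finally show ?thesis .
qed

context group begin

subsection \<open>Fillers of cospans\<close>

text \<open>The corner is an arbitrary enumeration \<open>e\<close> of the pullback with inverse
  \<open>d\<close>. A fibre of either leg inherits its order along \<open>d\<close> from the
  corresponding fibre on the opposite side of the square.\<close>

lemma bimorphism_exists:
  assumes f: "f \<in> lmaps kX G m q" and phi: "phi \<in> lmaps kY G p q" and L: "L = Commuting \<or> L = Preserving \<and> comm_group G"
  obtains f1 phi1 where "bimorphism L kX kY G f1 f phi1 phi"
proof -
  let ?D = "{(x, y). x \<in> {1..m} \<and> y \<in> {1..p} \<and> lfun f x = lfun phi y}"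
  have "finite ?D" by (rule finite_subset[of _ "{1..m} \<times> {1..p}"]) auto
  then obtain e N where e: "bij_betw e {1..N :: nat} ?D" using ex_bij_betw_nat_finite_1 by blast
  define d where "d = inv_into {1..N} e"
  have d: "d (x, y) \<in> {1..N}" "e (d (x, y)) = (x, y)" if "(x, y) \<in> ?D" for x y
    using bij_betw_apply[OF bij_betw_inv_into[OF e] that] bij_betw_inv_into_right[OF e that] by (simp_all add: d_def)
  have de: "d (e z) = z" if "z \<in> {1..N}" for z using bij_betw_inv_into_left[OF e that] by (simp add: d_def)
  have eD: "fst (e z) \<in> {1..m}" "snd (e z) \<in> {1..p}" "lfun f (fst (e z)) = lfun phi (snd (e z))" if "z \<in> {1..N}" for z
    using bij_betw_apply[OF e that] by (auto simp: case_prod_beta)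
  \<comment> \<open>Under \<open>Commuting\<close> the left leg gets trivial labels, which forces
    the quotient of the labels of \<open>phi\<close> and \<open>f\<close> on the top leg. Under
    \<open>Preserving\<close> the labels of the opposite sides are copied.\<close>
  define phi1 where "phi1 = \<lparr>lsrc = N, ltgt = m, lfun = (\<lambda>z\<in>{1..N}. fst (e z)),
    llab = (\<lambda>z\<in>{1..N}. if L = Commuting then \<one> else llab phi (snd (e z))),
    lord = (\<lambda>x. if kY = Ordered \<and> x \<in> {1..m} then map (\<lambda>y. d (x, y)) (lord phi (lfun f x)) else [])\<rparr>"
  define f1 where "f1 = \<lparr>lsrc = N, ltgt = p, lfun = (\<lambda>z\<in>{1..N}. snd (e z)),
    llab = (\<lambda>z\<in>{1..N}. if L = Commuting then inv (llab phi (snd (e z))) \<otimes> llab f (fst (e z)) else llab f (fst (e z))),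
    lord = (\<lambda>y. if kX = Ordered \<and> y \<in> {1..p} then map (\<lambda>x. d (x, y)) (lord f (lfun phi y)) else [])\<rparr>"
  have phi1: "phi1 \<in> lmaps kY G N m"
  proof (rule lmapsI)
    show "lfun phi1 \<in> {1..N} \<rightarrow>\<^sub>E {1..m}" "llab phi1 \<in> {1..N} \<rightarrow>\<^sub>E carrier G"
      using eD lmaps_lab[OF phi] by (auto simp: phi1_def simp del: atLeastAtMost_iff One_nat_def)
    fix x assume k: "kY = Ordered" and x: "x \<in> {1..m}"
    note o = lmaps_ord[OF phi k, of "lfun f x"]
    have fx: "lfun f x \<in> {1..q}" using lmaps_fun[OF f x] .
    have "distinct (map (\<lambda>y. d (x, y)) (lord phi (lfun f x)))"
      unfolding distinct_map
    proof (intro conjI inj_onI)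
      fix y y' assume y: "y \<in> set (lord phi (lfun f x))" "y' \<in> set (lord phi (lfun f x))" "d (x, y) = d (x, y')"
      then have "(x, y) \<in> ?D" "(x, y') \<in> ?D" using o(2)[OF fx] x by auto
      from trans[OF d(2)[OF this(1), symmetric] trans[OF arg_cong[OF y(3), of e] d(2)[OF this(2)]]]
      show "y = y'" by (rule Pair_inject)
    qed (use o(1)[OF fx] in simp)
    moreover have "set (map (\<lambda>y. d (x, y)) (lord phi (lfun f x))) = {z \<in> {1..N}. fst (e z) = x}"
    proof (intro equalityI subsetI)
      fix z assume "z \<in> set (map (\<lambda>y. d (x, y)) (lord phi (lfun f x)))"
      then obtain y where y: "z = d (x, y)" "(x, y) \<in> ?D" using o(2)[OF fx] x by auto
      then show "z \<in> {z \<in> {1..N}. fst (e z) = x}" using d[OF y(2)] by simp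
    next
      fix z assume "z \<in> {z \<in> {1..N}. fst (e z) = x}"
      then have z: "z \<in> {1..N}" "fst (e z) = x" by auto
      then have "snd (e z) \<in> set (lord phi (lfun f x))" using o(2)[OF fx] eD[OF z(1)] by auto
      moreover have "z = d (x, snd (e z))" using de[OF z(1)] z(2) by auto
      ultimately show "z \<in> set (map (\<lambda>y. d (x, y)) (lord phi (lfun f x)))" by auto
    qed
    ultimately show "distinct (lord phi1 x) \<and> set (lord phi1 x) = {z \<in> {1..N}. lfun phi1 z = x}"
      using k x by (auto simp: phi1_def)
  qed (auto simp: phi1_def)
  have f1: "f1 \<in> lmaps kX G N p"
  proof (rule lmapsI)
    show "lfun f1 \<in> {1..N} \<rightarrow>\<^sub>E {1..p}" "llab f1 \<in> {1..N} \<rightarrow>\<^sub>E carrier G"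
      using eD lmaps_lab[OF phi] lmaps_lab[OF f] by (auto simp: f1_def simp del: atLeastAtMost_iff One_nat_def)
    fix y assume k: "kX = Ordered" and y: "y \<in> {1..p}"
    note o = lmaps_ord[OF f k, of "lfun phi y"]
    have fy: "lfun phi y \<in> {1..q}" using lmaps_fun[OF phi y] .
    have "distinct (map (\<lambda>x. d (x, y)) (lord f (lfun phi y)))"
      unfolding distinct_map
    proof (intro conjI inj_onI)
      fix x x' assume x: "x \<in> set (lord f (lfun phi y))" "x' \<in> set (lord f (lfun phi y))" "d (x, y) = d (x', y)"
      then have "(x, y) \<in> ?D" "(x', y) \<in> ?D" using o(2)[OF fy] y by auto
      from trans[OF d(2)[OF this(1), symmetric] trans[OF arg_cong[OF x(3), of e] d(2)[OF this(2)]]]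
      show "x = x'" by (rule Pair_inject)
    qed (use o(1)[OF fy] in simp)
    moreover have "set (map (\<lambda>x. d (x, y)) (lord f (lfun phi y))) = {z \<in> {1..N}. snd (e z) = y}"
    proof (intro equalityI subsetI)
      fix z assume "z \<in> set (map (\<lambda>x. d (x, y)) (lord f (lfun phi y)))"
      then obtain x where x: "z = d (x, y)" "(x, y) \<in> ?D" using o(2)[OF fy] y by auto
      then show "z \<in> {z \<in> {1..N}. snd (e z) = y}" using d[OF x(2)] by simp
    next
      fix z assume "z \<in> {z \<in> {1..N}. snd (e z) = y}"
      then have z: "z \<in> {1..N}" "snd (e z) = y" by auto
      then have "fst (e z) \<in> set (lord f (lfun phi y))" using o(2)[OF fy] eD[OF z(1)] by auto
      moreover have "z = d (fst (e z), y)" using de[OF z(1)] z(2) by auto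
      ultimately show "z \<in> set (map (\<lambda>x. d (x, y)) (lord f (lfun phi y)))" by auto
    qed
    ultimately show "distinct (lord f1 y) \<and> set (lord f1 y) = {z \<in> {1..N}. lfun f1 z = y}"
      using k y by (auto simp: f1_def)
  qed (auto simp: f1_def)
  have sel: "lfun phi1 z = fst (e z)" "lfun f1 z = snd (e z)"
    "llab phi1 z = (if L = Commuting then \<one> else llab phi (snd (e z)))"
    "llab f1 z = (if L = Commuting then inv (llab phi (snd (e z))) \<otimes> llab f (fst (e z)) else llab f (fst (e z)))" if "z \<in> {1..N}" for z
    using that by (simp_all add: phi1_def f1_def)
  have iso1: "fibre_iso L (lfun f1) phi1 x phi (lfun f x)" if x: "x \<in> {1..m}" for x
    unfolding fibre_iso_def
  proof (intro conjI impI ballI)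
    have F: "fibre phi1 x = {z \<in> {1..N}. fst (e z) = x}" using sel(1) lmapsD(1)[OF phi1] by (auto simp: fibre_def)
    have P: "fibre phi (lfun f x) = {y \<in> {1..p}. lfun phi y = lfun f x}" using lmapsD(1)[OF phi] by (auto simp: fibre_def)
    show "bij_betw (lfun f1) (fibre phi1 x) (fibre phi (lfun f x))"
    proof (rule bij_betwI[where g = "\<lambda>y. d (x, y)"])
      show "lfun f1 \<in> fibre phi1 x \<rightarrow> fibre phi (lfun f x)" unfolding F P using sel(2) eD by auto
      show "(\<lambda>y. d (x, y)) \<in> fibre phi (lfun f x) \<rightarrow> fibre phi1 x" unfolding F P using d x by fastforce
      show "d (x, lfun f1 z) = z" if "z \<in> fibre phi1 x" for z using that sel(2) de[of z] unfolding F by auto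
      show "lfun f1 (d (x, y)) = y" if "y \<in> fibre phi (lfun f x)" for y
        using that x d[of x y] sel(2)[of "d (x, y)"] unfolding P by auto
    qed
    show "map (lfun f1) (lord phi1 x) = lord phi (lfun f x)"
    proof (cases kY)
      case Ordered
      have "map (lfun f1) (map (\<lambda>y. d (x, y)) (lord phi (lfun f x))) = map (\<lambda>y. y) (lord phi (lfun f x))"
        unfolding map_map
      proof (intro map_cong refl)
        fix y assume "y \<in> set (lord phi (lfun f x))"
        then have "(x, y) \<in> ?D" using lmaps_ord(2)[OF phi Ordered lmaps_fun[OF f x]] x by auto
        then show "(lfun f1 \<circ> (\<lambda>y. d (x, y))) y = y" using d sel(2) by simp
      qed
      then show ?thesis using Ordered x by (simp add: phi1_def)
    qed (simp add: lmaps_unord[OF phi1] lmaps_unord[OF phi])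
    show "llab phi (lfun f1 z) = llab phi1 z" if "L = Preserving" "z \<in> fibre phi1 x" for z
      using that sel unfolding F by auto
  qed
  have iso2: "fibre_iso L (lfun phi1) f1 y f (lfun phi y)" if y: "y \<in> {1..p}" for y
    unfolding fibre_iso_def
  proof (intro conjI impI ballI)
    have F: "fibre f1 y = {z \<in> {1..N}. snd (e z) = y}" using sel(2) lmapsD(1)[OF f1] by (auto simp: fibre_def)
    have P: "fibre f (lfun phi y) = {x \<in> {1..m}. lfun f x = lfun phi y}" using lmapsD(1)[OF f] by (auto simp: fibre_def)
    show "bij_betw (lfun phi1) (fibre f1 y) (fibre f (lfun phi y))"
    proof (rule bij_betwI[where g = "\<lambda>x. d (x, y)"])
      show "lfun phi1 \<in> fibre f1 y \<rightarrow> fibre f (lfun phi y)" unfolding F P using sel(1) eD by auto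
      show "(\<lambda>x. d (x, y)) \<in> fibre f (lfun phi y) \<rightarrow> fibre f1 y" unfolding F P using d y by fastforce
      show "d (lfun phi1 z, y) = z" if "z \<in> fibre f1 y" for z using that sel(1) de[of z] unfolding F by auto
      show "lfun phi1 (d (x, y)) = x" if "x \<in> fibre f (lfun phi y)" for x
        using that y d[of x y] sel(1)[of "d (x, y)"] unfolding P by auto
    qed
    show "map (lfun phi1) (lord f1 y) = lord f (lfun phi y)"
    proof (cases kX)
      case Ordered
      have "map (lfun phi1) (map (\<lambda>x. d (x, y)) (lord f (lfun phi y))) = map (\<lambda>x. x) (lord f (lfun phi y))"
        unfolding map_map
      proof (intro map_cong refl)
        fix x assume "x \<in> set (lord f (lfun phi y))"
        then have "(x, y) \<in> ?D" using lmaps_ord(2)[OF f Ordered lmaps_fun[OF phi y]] y by auto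
        then show "(lfun phi1 \<circ> (\<lambda>x. d (x, y))) x = x" using d sel(1) by simp
      qed
      then show ?thesis using Ordered y by (simp add: f1_def)
    qed (simp add: lmaps_unord[OF f1] lmaps_unord[OF f])
    show "llab f (lfun phi1 z) = llab f1 z" if "L = Preserving" "z \<in> fibre f1 y" for z
      using that sel unfolding F by auto
  qed
  have "bij_betw (\<lambda>z. (lfun phi1 z, lfun f1 z)) {1..N} ?D"
    using bij_betw_cong[of "{1..N}" "\<lambda>z. (lfun phi1 z, lfun f1 z)" e ?D] sel(1,2) e by simp
  moreover have "llab f (lfun phi1 z) \<otimes> llab phi1 z = llab phi (lfun f1 z) \<otimes> llab f1 z" if "z \<in> {1..N}" "L = Commuting" for z
    using that sel eD[OF that(1)] lmaps_lab[OF f] lmaps_lab[OF phi] by (simp add: m_assoc[symmetric] del: atLeastAtMost_iff One_nat_def)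
  ultimately have "bimorphism L kX kY G f1 f phi1 phi"
    unfolding bimorphism_def using f1 f phi1 phi iso1 iso2 by blast
  then show ?thesis by (rule that)
qed

text \<open>The common consequence of both label laws, with the arities made explicit: a pullback
  whose fibre orders match and whose labels commute around the square.\<close>

definition filler :: "fibre_kind \<Rightarrow> fibre_kind \<Rightarrow> nat \<Rightarrow> nat \<Rightarrow> nat \<Rightarrow> nat \<Rightarrow> 'a lmap \<Rightarrow> 'a lmap \<Rightarrow> 'a lmap \<Rightarrow> 'a lmap \<Rightarrow> bool" where
  "filler kX kY n m p q f1 f phi1 phi \<longleftrightarrow>
     f1 \<in> lmaps kX G n p \<and> f \<in> lmaps kX G m q \<and> phi1 \<in> lmaps kY G n m \<and> phi \<in> lmaps kY G p q \<and>
     bij_betw (\<lambda>z. (lfun phi1 z, lfun f1 z)) {1..n} {(x, y). x \<in> {1..m} \<and> y \<in> {1..p} \<and> lfun f x = lfun phi y} \<and>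
     (\<forall>x\<in>{1..m}. map (lfun f1) (lord phi1 x) = lord phi (lfun f x)) \<and>
     (\<forall>y\<in>{1..p}. map (lfun phi1) (lord f1 y) = lord f (lfun phi y)) \<and>
     (\<forall>z\<in>{1..n}. llab f (lfun phi1 z) \<otimes> llab phi1 z = llab phi (lfun f1 z) \<otimes> llab f1 z)"

text \<open>In a label preserving square \<open>f1\<close> repeats the labels of \<open>f\<close>,
  and \<open>phi1\<close> those of \<open>phi\<close>. Commuting around the square then means that
  these two labels commute, which holds in a commutative group.\<close>

lemma bimorphism_imp_filler:
  assumes B: "bimorphism L kX kY G f1 f phi1 phi" and L: "L = Commuting \<or> L = Preserving \<and> comm_group G"
    and f: "f \<in> lmaps kX G m q" and phi: "phi \<in> lmaps kY G p q"
  obtains n where "filler kX kY n m p q f1 f phi1 phi"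
proof -
  obtain n m' p' q' where *: "f1 \<in> lmaps kX G n p'" "f \<in> lmaps kX G m' q'" "phi1 \<in> lmaps kY G n m'" "phi \<in> lmaps kY G p' q'"
    "bij_betw (\<lambda>z. (lfun phi1 z, lfun f1 z)) {1..n} {(x, y). x \<in> {1..m'} \<and> y \<in> {1..p'} \<and> lfun f x = lfun phi y}"
    "\<forall>x\<in>{1..m'}. fibre_iso L (lfun f1) phi1 x phi (lfun f x)" "\<forall>y\<in>{1..p'}. fibre_iso L (lfun phi1) f1 y f (lfun phi y)"
    "L = Commuting \<longrightarrow> (\<forall>z\<in>{1..n}. llab f (lfun phi1 z) \<otimes> llab phi1 z = llab phi (lfun f1 z) \<otimes> llab f1 z)"
    using B unfolding bimorphism_def by blast
  have e: "m' = m" "p' = p" "q' = q"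
    using lmapsD(1,2)[OF f] lmapsD(1,2)[OF *(2)] lmapsD(1)[OF phi] lmapsD(1)[OF *(4)] by simp_all
  have "llab f (lfun phi1 z) \<otimes> llab phi1 z = llab phi (lfun f1 z) \<otimes> llab f1 z" if z: "z \<in> {1..n}" for z
  proof (cases L)
    case Preserving
    then interpret comm_group G using L by simp
    have "z \<in> fibre phi1 (lfun phi1 z)" "z \<in> fibre f1 (lfun f1 z)"
      using z lmapsD(1)[OF *(1)] lmapsD(1)[OF *(3)] by (auto simp: fibre_def)
    then have "llab phi (lfun f1 z) = llab phi1 z" "llab f (lfun phi1 z) = llab f1 z"
      using *(6,7) Preserving lmaps_fun[OF *(1) z] lmaps_fun[OF *(3) z] unfolding fibre_iso_def by blast+
    then show ?thesis using lmaps_lab[OF *(1) z] lmaps_lab[OF *(3) z] by (simp add: m_comm)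
  qed (use *(8) z in blast)
  then have "filler kX kY n m p q f1 f phi1 phi"
    using * unfolding filler_def e fibre_iso_def by blast
  then show ?thesis by (rule that)
qed

text \<open>The permutation \<open>s\<close> compares the two enumerations of the pullback. The
  labels are dictated by the vertical legs, and the horizontal legs then agree by cancelling the
  label of \<open>phi\<close> in the two commutation equations. The orders agree by
  \<open>map_inv_transport\<close>.\<close>

lemma filler_unique:
  assumes F: "filler kX kY n m p q f1 f phi1 phi" and F': "filler kX kY n' m p q f1' f phi1' phi"
  obtains s c where "n' = n" "lperms n s c" "phi1' = lcomp G phi1 (lperm kY n s c)" "f1' = lcomp G f1 (lperm kX n s c)"
proof -
  let ?B = "\<lambda>z. (lfun phi1 z, lfun f1 z)" and ?B' = "\<lambda>z. (lfun phi1' z, lfun f1' z)"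
  let ?D = "{(x, y). x \<in> {1..m} \<and> y \<in> {1..p} \<and> lfun f x = lfun phi y}"
  note d = F[unfolded filler_def] and d' = F'[unfolded filler_def]
  have f1: "f1 \<in> lmaps kX G n p" and phi1: "phi1 \<in> lmaps kY G n m" and B: "bij_betw ?B {1..n} ?D"
    and f1': "f1' \<in> lmaps kX G n' p" and phi1': "phi1' \<in> lmaps kY G n' m" and B': "bij_betw ?B' {1..n'} ?D"
    and f: "f \<in> lmaps kX G m q" and phi: "phi \<in> lmaps kY G p q"
    using d d' by blast+
  have n: "n' = n" using bij_betw_same_card[OF B] bij_betw_same_card[OF B'] by simp
  note B' = B'[unfolded n] and f1' = f1'[unfolded n] and phi1' = phi1'[unfolded n]
  define s where "s = inv_into {1..n} ?B \<circ> ?B'"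
  have s: "bij_betw s {1..n} {1..n}" unfolding s_def using B' bij_betw_inv_into[OF B] by (rule bij_betw_trans)
  have s1: "lfun phi1 (s z) = lfun phi1' z" "lfun f1 (s z) = lfun f1' z" if "z \<in> {1..n}" for z
    using bij_betw_inv_into_right[OF B bij_betw_apply[OF B' that]] by (simp_all add: s_def)
  have sr: "s z \<in> {1..n}" if "z \<in> {1..n}" for z using s that by (rule bij_betw_apply)
  \<comment> \<open>The only label for which the labels of \<open>phi1\<close> at
    \<open>s z\<close>, multiplied by it, become those of \<open>phi1'\<close> at
    \<open>z\<close>.\<close>
  define c where "c z = inv (llab phi1 (s z)) \<otimes> llab phi1' z" for z
  have cc: "c z \<in> carrier G" if "z \<in> {1..n}" for z
    using lmaps_lab[OF phi1 sr[OF that]] lmaps_lab[OF phi1' that] by (simp add: c_def)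
  have P: "lperms n s c" using s cc by (simp add: lperms_def)
  have lp: "lperm k n s c \<in> lmaps k G n n" for k using P by (auto simp: lperms_def intro!: lperm_lmaps)
  have inj: "z = z'" if "z \<in> {1..n}" "z' \<in> {1..n}" "lfun phi1 z = lfun phi1 z'" "lfun f1 z = lfun f1 z'" for z z'
    using bij_betw_imp_inj_on[OF B] that by (auto simp: inj_on_def simp del: atLeastAtMost_iff)
  have e: "lfun (lcomp G u (lperm k n s c)) z = lfun u (s z)" "llab (lcomp G u (lperm k n s c)) z = llab u (s z) \<otimes> c z"
    if "z \<in> {1..n}" for u k z
    using that by (simp_all add: lcomp_def lperm_def)
  have eo: "lord (lcomp G u (lperm k n s c)) i = map (inv_into {1..n} s) (lord u i)" if "u \<in> lmaps k G n r" "k = Ordered" for u k i r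
  proof -
    have "map (lord (lperm k n s c)) (lord u i) = map (\<lambda>j. [inv_into {1..n} s j]) (lord u i)"
      using lmaps_ord_set[OF that(1)] that(2) by (intro map_cong refl) (auto simp: lperm_def)
    then have "concat (map (lord (lperm k n s c)) (lord u i)) = map (inv_into {1..n} s) (lord u i)"
      by (simp only: concat_map_singleton)
    then show ?thesis by (simp only: lcomp_def lmap.simps)
  qed
  have "phi1' = lcomp G phi1 (lperm kY n s c)"
  proof (rule lmaps_eqI[OF phi1' lcomp_lmaps[OF lp phi1]])
    fix z assume z: "z \<in> {1..n}"
    then show "lfun phi1' z = lfun (lcomp G phi1 (lperm kY n s c)) z" using s1 by (simp add: e)
    show "llab phi1' z = llab (lcomp G phi1 (lperm kY n s c)) z"
      unfolding e[OF z] c_def using lmaps_lab[OF phi1 sr[OF z]] lmaps_lab[OF phi1' z] by (simp add: m_assoc[symmetric])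
  next
    fix x assume k: "kY = Ordered" and x: "x \<in> {1..m}"
    have "map (inv_into {1..n} s) (lord phi1 x) = lord phi1' x"
    proof (rule map_inv_transport[OF s, where u = "lfun f1" and u' = "lfun f1'" and v = "lfun phi1" and v' = "lfun phi1'" and x = x])
      show "map (lfun f1') (lord phi1' x) = map (lfun f1) (lord phi1 x)" using d d' x by simp
    qed (use lmaps_ord_set[OF phi1] lmaps_ord_set[OF phi1'] s1 inj in blast)+
    then show "lord phi1' x = lord (lcomp G phi1 (lperm kY n s c)) x" unfolding eo[OF phi1 k] by simp
  qed
  moreover have "f1' = lcomp G f1 (lperm kX n s c)"
  proof (rule lmaps_eqI[OF f1' lcomp_lmaps[OF lp f1]])
    fix z assume z: "z \<in> {1..n}"
    then show "lfun f1' z = lfun (lcomp G f1 (lperm kX n s c)) z" using s1 by (simp add: e)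
    let ?x = "lfun phi1' z" and ?y = "lfun f1' z"
    have lab: "llab f ?x \<in> carrier G" "llab phi ?y \<in> carrier G" "llab phi1 (s z) \<in> carrier G" "llab phi1' z \<in> carrier G"
      "llab f1 (s z) \<in> carrier G" "llab f1' z \<in> carrier G"
      using lmaps_lab[OF f lmaps_fun[OF phi1' z]] lmaps_lab[OF phi lmaps_fun[OF f1' z]] lmaps_lab[OF phi1 sr[OF z]]
        lmaps_lab[OF phi1' z] lmaps_lab[OF f1 sr[OF z]] lmaps_lab[OF f1' z] by simp_all
    have e1: "llab f ?x \<otimes> llab phi1 (s z) = llab phi ?y \<otimes> llab f1 (s z)" using d s1[OF z] sr[OF z] by fastforce
    have e2: "llab f ?x \<otimes> llab phi1' z = llab phi ?y \<otimes> llab f1' z" using d' z n by blast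
    have "llab phi ?y \<otimes> (llab f1 (s z) \<otimes> c z) = (llab f ?x \<otimes> llab phi1 (s z)) \<otimes> c z"
      using lab cc[OF z] by (simp add: e1 m_assoc)
    also have "\<dots> = llab f ?x \<otimes> llab phi1' z" 
    proof -
      have "llab phi1 (s z) \<otimes> c z = llab phi1' z" using lab by (simp add: c_def m_assoc[symmetric])
      then show ?thesis using lab cc[OF z] by (simp add: m_assoc)
    qed
    finally have "llab f1 (s z) \<otimes> c z = llab f1' z" using lab cc[OF z] by (simp add: e2)
    then show "llab f1' z = llab (lcomp G f1 (lperm kX n s c)) z" by (simp add: e[OF z])
  next
    fix y assume k: "kX = Ordered" and y: "y \<in> {1..p}"
    have "map (inv_into {1..n} s) (lord f1 y) = lord f1' y"
    proof (rule map_inv_transport[OF s, where u = "lfun phi1" and u' = "lfun phi1'" and v = "lfun f1" and v' = "lfun f1'" and x = y])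
      show "map (lfun phi1') (lord f1' y) = map (lfun phi1) (lord f1 y)" using d d' y by simp
    qed (use lmaps_ord_set[OF f1] lmaps_ord_set[OF f1'] s1 inj in blast)+
    then show "lord f1' y = lord (lcomp G f1 (lperm kX n s c)) y" unfolding eo[OF f1 k] by simp
  qed
  ultimately show ?thesis using that n P by blast
qed

text \<open>Permutations on the legs of the cospan can be pushed around the square onto the legs of
  the span. Together with \<open>filler_unique\<close> this makes composition independent of
  representatives.\<close>

lemma filler_perm:
  assumes F: "filler kX kY n m p q f1 (lcomp G f (lperm kX m s c)) phi1 (lcomp G phi (lperm kY p t d))"
    and f: "f \<in> lmaps kX G m q" and phi: "phi \<in> lmaps kY G p q" and s: "lperms m s c" and t: "lperms p t d"
  shows "filler kX kY n m p q (lcomp G (lperm kX p t d) f1) f (lcomp G (lperm kY m s c) phi1) phi"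
proof -
  let ?fs = "lcomp G f (lperm kX m s c)" and ?ps = "lcomp G phi (lperm kY p t d)"
  let ?g = "lcomp G (lperm kX p t d) f1" and ?r = "lcomp G (lperm kY m s c) phi1"
  note F = F[unfolded filler_def]
  have f1: "f1 \<in> lmaps kX G n p" and phi1: "phi1 \<in> lmaps kY G n m" using F by blast+
  have sb: "bij_betw s {1..m} {1..m}" "c \<in> {1..m} \<rightarrow> carrier G" and tb: "bij_betw t {1..p} {1..p}" "d \<in> {1..p} \<rightarrow> carrier G"
    using s t by (simp_all add: lperms_def)
  have g: "?g \<in> lmaps kX G n p" by (rule lcomp_lmaps[OF f1 lperm_lmaps[OF tb]])
  have r: "?r \<in> lmaps kY G n m" by (rule lcomp_lmaps[OF phi1 lperm_lmaps[OF sb]])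
  have fr: "lfun phi1 z \<in> {1..m}" "lfun f1 z \<in> {1..p}" if "z \<in> {1..n}" for z
    using lmaps_fun[OF phi1 that] lmaps_fun[OF f1 that] by simp_all
  have gf: "lfun ?g z = t (lfun f1 z)" "llab ?g z = d (lfun f1 z) \<otimes> llab f1 z"
    "lfun ?r z = s (lfun phi1 z)" "llab ?r z = c (lfun phi1 z) \<otimes> llab phi1 z" if "z \<in> {1..n}" for z
    using that fr[OF that] lmapsD(1)[OF f1] lmapsD(1)[OF phi1] by (simp_all add: lcomp_def lperm_def)
  have ff: "lfun ?fs x = lfun f (s x)" "llab ?fs x = llab f (s x) \<otimes> c x" if "x \<in> {1..m}" for x
    using that by (simp_all add: lcomp_def lperm_def)
  have pf: "lfun ?ps y = lfun phi (t y)" "llab ?ps y = llab phi (t y) \<otimes> d y" if "y \<in> {1..p}" for y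
    using that by (simp_all add: lcomp_def lperm_def)
  let ?D' = "{(x, y). x \<in> {1..m} \<and> y \<in> {1..p} \<and> lfun ?fs x = lfun ?ps y}"
  let ?D = "{(x, y). x \<in> {1..m} \<and> y \<in> {1..p} \<and> lfun f x = lfun phi y}"
  have si: "inv_into {1..m} s x \<in> {1..m}" "s (inv_into {1..m} s x) = x" if "x \<in> {1..m}" for x
    using inv_bij(1,2)[OF sb(1) that] .
  have ti: "inv_into {1..p} t y \<in> {1..p}" "t (inv_into {1..p} t y) = y" if "y \<in> {1..p}" for y
    using inv_bij(1,2)[OF tb(1) that] .
  have sm: "s x \<in> {1..m}" "inv_into {1..m} s (s x) = x" if "x \<in> {1..m}" for x
    using bij_betw_apply[OF sb(1) that] bij_betw_inv_into_left[OF sb(1) that] .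
  have tm: "t y \<in> {1..p}" "inv_into {1..p} t (t y) = y" if "y \<in> {1..p}" for y
    using bij_betw_apply[OF tb(1) that] bij_betw_inv_into_left[OF tb(1) that] .
  have "bij_betw (\<lambda>(x, y). (s x, t y)) ?D' ?D"
    by (rule bij_betwI[where g = "\<lambda>(x, y). (inv_into {1..m} s x, inv_into {1..p} t y)"])
      (use si ti sm tm ff pf in \<open>auto simp del: atLeastAtMost_iff One_nat_def\<close>)
  then have "bij_betw ((\<lambda>(x, y). (s x, t y)) \<circ> (\<lambda>z. (lfun phi1 z, lfun f1 z))) {1..n} ?D"
    using F by (blast intro: bij_betw_trans)
  moreover have "((\<lambda>(x, y). (s x, t y)) \<circ> (\<lambda>z. (lfun phi1 z, lfun f1 z))) z = (lfun ?r z, lfun ?g z)" if "z \<in> {1..n}" for z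
    using gf[OF that] by simp
  ultimately have bij: "bij_betw (\<lambda>z. (lfun ?r z, lfun ?g z)) {1..n} ?D"
    using bij_betw_cong[of "{1..n}" _ "\<lambda>z. (lfun ?r z, lfun ?g z)" ?D] by blast
  have eo: "lord (lcomp G u (lperm k l s c)) i = map (inv_into {1..l} s) (lord u i)" if "u \<in> lmaps k G l r" "k = Ordered" for u k i r l s c
  proof -
    have "map (lord (lperm k l s c)) (lord u i) = map (\<lambda>j. [inv_into {1..l} s j]) (lord u i)"
      using lmaps_ord_set[OF that(1)] that(2) by (intro map_cong refl) (auto simp: lperm_def)
    then have "concat (map (lord (lperm k l s c)) (lord u i)) = map (inv_into {1..l} s) (lord u i)"
      by (simp only: concat_map_singleton)
    then show ?thesis by (simp only: lcomp_def lmap.simps)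
  qed
  have eo': "lord (lcomp G (lperm k l s c) u) i = lord u (inv_into {1..l} s i)" if "k = Ordered" "i \<in> {1..l}" for u k i l s c
    using that by (simp add: lcomp_def lperm_def)
  have o1: "map (lfun ?g) (lord ?r x) = lord phi (lfun f x)" if x: "x \<in> {1..m}" for x
  proof (cases kY)
    case Ordered
    let ?x = "inv_into {1..m} s x"
    have "map (lfun ?g) (lord phi1 ?x) = map (\<lambda>z. t (lfun f1 z)) (lord phi1 ?x)"
      using lmaps_ord_set[OF phi1] gf by (intro map_cong refl) blast
    also have "\<dots> = map t (map (lfun f1) (lord phi1 ?x))" by (simp add: o_def)
    also have "map (lfun f1) (lord phi1 ?x) = lord ?ps (lfun ?fs ?x)" using F si[OF x] by blast
    also have "\<dots> = map (inv_into {1..p} t) (lord phi (lfun f x))" using eo[OF phi Ordered] ff si[OF x] by simp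
    also have "map t \<dots> = map (\<lambda>y. y) (lord phi (lfun f x))"
      unfolding map_map o_def using lmaps_ord_set[OF phi] ti by (intro map_cong refl) blast
    finally show ?thesis using eo'[OF Ordered x, of s c phi1] by simp
  next
    case Unordered
    then show ?thesis using lmaps_unord[OF r Unordered] lmaps_unord[OF phi Unordered] by simp
  qed
  have o2: "map (lfun ?r) (lord ?g y) = lord f (lfun phi y)" if y: "y \<in> {1..p}" for y
  proof (cases kX)
    case Ordered
    let ?y = "inv_into {1..p} t y"
    have "map (lfun ?r) (lord f1 ?y) = map (\<lambda>z. s (lfun phi1 z)) (lord f1 ?y)"
      using lmaps_ord_set[OF f1] gf by (intro map_cong refl) blast
    also have "\<dots> = map s (map (lfun phi1) (lord f1 ?y))" by (simp add: o_def)
    also have "map (lfun phi1) (lord f1 ?y) = lord ?fs (lfun ?ps ?y)" using F ti[OF y] by blast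
    also have "\<dots> = map (inv_into {1..m} s) (lord f (lfun phi y))" using eo[OF f Ordered] pf ti[OF y] by simp
    also have "map s \<dots> = map (\<lambda>x. x) (lord f (lfun phi y))"
      unfolding map_map o_def using lmaps_ord_set[OF f] si by (intro map_cong refl) blast
    finally show ?thesis using eo'[OF Ordered y, of t d f1] by simp
  next
    case Unordered
    then show ?thesis using lmaps_unord[OF g Unordered] lmaps_unord[OF f Unordered] by simp
  qed
  have "llab f (lfun ?r z) \<otimes> llab ?r z = llab phi (lfun ?g z) \<otimes> llab ?g z" if z: "z \<in> {1..n}" for z
  proof -
    note fz = fr[OF z]
    have l: "llab f (s (lfun phi1 z)) \<in> carrier G" "c (lfun phi1 z) \<in> carrier G" "llab phi1 z \<in> carrier G"
      "llab phi (t (lfun f1 z)) \<in> carrier G" "d (lfun f1 z) \<in> carrier G" "llab f1 z \<in> carrier G"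
      using lmaps_lab[OF f sm(1)[OF fz(1)]] lmaps_lab[OF phi tm(1)[OF fz(2)]] lmaps_lab[OF phi1 z] lmaps_lab[OF f1 z] sb(2) tb(2) fz
      by auto
    have "llab ?fs (lfun phi1 z) \<otimes> llab phi1 z = llab ?ps (lfun f1 z) \<otimes> llab f1 z" using F z by blast
    then show ?thesis using ff(2)[OF fz(1)] pf(2)[OF fz(2)] l by (simp add: gf[OF z] m_assoc)
  qed
  then show ?thesis unfolding filler_def using f phi g r bij o1 o2 by blast
qed

end

section \<open>Classes of spans: composition, tensor product and the two inclusions\<close>

context group begin

lemma ltensor_lperm:
  assumes "lperms p s c" "lperms p' s' c'"
  obtains t d where "lperms (p + p') t d" "\<And>k. ltensor (lperm k p s c) (lperm k p' s' c') = lperm k (p + p') t d"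
proof -
  have h: "lperm k p s c \<in> lmaps k G p p" "lperm k p' s' c' \<in> lmaps k G p' p'" for k
    using assms by (auto simp: lperms_def intro!: lperm_lmaps)
  let ?t = "\<lambda>x. if x \<le> p then s x else p + s' (x - p)" and ?d = "\<lambda>x. if x \<le> p then c x else c' (x - p)"
  have sb: "s x \<in> {1..p}" if "x \<in> {1..p}" for x using assms(1) that by (auto simp: lperms_def dest: bij_betw_apply)
  have sb': "s' x \<in> {1..p'}" if "x \<in> {1..p'}" for x using assms(2) that by (auto simp: lperms_def dest: bij_betw_apply)
  have inj: "inj_on ?t {1..p + p'}"
  proof (rule inj_onI)
    fix x y assume x: "x \<in> {1..p + p'}" and y: "y \<in> {1..p + p'}" and e: "?t x = ?t y"
    have x': "\<not> x \<le> p \<Longrightarrow> x - p \<in> {1..p'}" and y': "\<not> y \<le> p \<Longrightarrow> y - p \<in> {1..p'}" using x y by auto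
    have i: "inj_on s {1..p}" "inj_on s' {1..p'}" using assms by (auto simp: lperms_def bij_betw_def)
    show "x = y"
    proof (cases "x \<le> p"; cases "y \<le> p")
      assume "x \<le> p" "y \<le> p"
      then show ?thesis using e x y i(1) by (auto dest: inj_onD)
    next
      assume "x \<le> p" "\<not> y \<le> p"
      then show ?thesis using e x sb[of x] sb'[OF y'] by auto
    next
      assume "\<not> x \<le> p" "y \<le> p"
      then show ?thesis using e y sb[of y] sb'[OF x'] by auto
    next
      assume c: "\<not> x \<le> p" "\<not> y \<le> p"
      then have "x - p = y - p" using e i(2) x' y' by (auto dest: inj_onD)
      then show ?thesis using c by simp
    qed
  qed
  have sub: "?t ` {1..p + p'} \<subseteq> {1..p + p'}"
  proof (rule image_subsetI)
    fix x assume x: "x \<in> {1..p + p'}"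
    then have "\<not> x \<le> p \<Longrightarrow> x - p \<in> {1..p'}" by auto
    then show "?t x \<in> {1..p + p'}" using x sb[of x] sb'[of "x - p"] by auto
  qed
  have b: "bij_betw ?t {1..p + p'} {1..p + p'}"
    unfolding bij_betw_def using inj endo_inj_surj[OF finite_atLeastAtMost sub inj] by blast
  have "?d x \<in> carrier G" if "x \<in> {1..p + p'}" for x
  proof -
    have "\<not> x \<le> p \<Longrightarrow> x - p \<in> {1..p'}" using that by auto
    then show ?thesis using assms that by (auto simp: lperms_def Pi_iff)
  qed
  then have P: "lperms (p + p') ?t ?d" using b by (simp add: lperms_def)
  have "ltensor (lperm k p s c) (lperm k p' s' c') = lperm k (p + p') ?t ?d" for k
  proof -
    let ?h = "ltensor (lperm k p s c) (lperm k p' s' c')"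
    have e: "lfun ?h x = ?t x" "llab ?h x = ?d x" if "x \<in> {1..p + p'}" for x
    proof -
      have "\<not> x \<le> p \<Longrightarrow> x - p \<in> {1..p'}" using that by auto
      then show "lfun ?h x = ?t x" "llab ?h x = ?d x" using that by (auto simp: ltensor_def lperm_def)
    qed
    have "bij_betw (lfun ?h) {1..p + p'} {1..p + p'}"
      using bij_betw_cong[of "{1..p + p'}" "lfun ?h" ?t, OF e(1)] b by blast
    from lperm_of_bij[OF ltensor_lmaps[OF h] this] lperm_cong[OF b, of "lfun ?h" ?d "llab ?h" k] e
    show ?thesis by simp
  qed
  with P that show ?thesis by blast
qed

definition cls :: "fibre_kind \<Rightarrow> fibre_kind \<Rightarrow> nat \<Rightarrow> nat \<Rightarrow> 'a span \<Rightarrow> 'a span_class" where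
  "cls kX kY n m s = (n, span_equiv kX kY G n m `` {s}, m)"

lemma cls_eq: "(s, t) \<in> span_equiv kX kY G n m \<Longrightarrow> cls kX kY n m s = cls kX kY n m t"
  using equiv_class_eq[OF span_equiv_equiv] by (simp add: cls_def)

lemma cls_arr:
  assumes "phi \<in> lmaps kY G p n" "f \<in> lmaps kX G p m"
  shows "cls kX kY n m (phi, f) \<in> Hom (composite_prop L kX kY G) n m"
proof -
  have "(phi, f) \<in> spans kX kY G n m" using assms by (auto simp: spans_def)
  then show ?thesis by (simp add: Hom_def composite_prop_def cls_def quotientI)
qed

lemma cls_exhaust:
  assumes "a \<in> Hom (composite_prop L kX kY G) n m"
  obtains p phi f where "phi \<in> lmaps kY G p n" "f \<in> lmaps kX G p m" "a = cls kX kY n m (phi, f)"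
proof -
  obtain K where "a = (n, K, m)" "K \<in> spans kX kY G n m // span_equiv kX kY G n m"
    using assms by (auto simp: Hom_def composite_prop_def)
  then obtain s where "s \<in> spans kX kY G n m" "a = cls kX kY n m s" by (auto simp: quotient_def cls_def)
  with that show ?thesis by (auto simp: spans_def)
qed

lemma in_cls:
  assumes "phi \<in> lmaps kY G p n" "f \<in> lmaps kX G p m"
  shows "(phi, f) \<in> span_equiv kX kY G n m `` {(phi, f)}"
  by (rule equiv_class_self[OF span_equiv_equiv]) (use assms in \<open>auto simp: spans_def\<close>)

lemma cls_memE:
  assumes "(phi', f') \<in> span_equiv kX kY G n m `` {(phi, f)}" "phi \<in> lmaps kY G p n" "f \<in> lmaps kX G p m"
  obtains s c where "lperms p s c" "phi' \<in> lmaps kY G p n" "f' \<in> lmaps kX G p m"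
    "phi' = lcomp G phi (lperm kY p s c)" "f' = lcomp G f (lperm kX p s c)"
proof -
  have "((phi', f'), (phi, f)) \<in> span_equiv kX kY G n m"
    using assms(1) span_equiv_equiv[of kX kY n m] by (auto simp: equiv_def dest: symD)
  then obtain p' s c where *: "phi \<in> lmaps kY G p' n" "phi' \<in> lmaps kY G p' n" "f' \<in> lmaps kX G p' m" "lperms p' s c"
    "phi' = lcomp G phi (lperm kY p' s c)" "f' = lcomp G f (lperm kX p' s c)"
    by (rule span_equivE)
  have "p' = p" using lmapsD(1)[OF *(1)] lmapsD(1)[OF assms(2)] by simp
  with * that show ?thesis by blast
qed

text \<open>The union in \<open>Comp\<close> ranges over all representatives and all bimorphisms. By
  \<open>filler_perm\<close> and \<open>filler_unique\<close> each of its members is equivalent to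
  the composite formed with the given filler.\<close>

lemma Comp_cls:
  assumes F: "filler kX kY r ps pt m f1 fs phi1 phit" and phis: "phis \<in> lmaps kY G ps n" and ft: "ft \<in> lmaps kX G pt l"
    and L: "L = Commuting \<or> L = Preserving \<and> comm_group G"
  shows "Comp (composite_prop L kX kY G) (cls kX kY m l (phit, ft)) (cls kX kY n m (phis, fs))
    = cls kX kY n l (lcomp G phis phi1, lcomp G ft f1)"
proof -
  let ?R = "span_equiv kX kY G n l" and ?r = "(lcomp G phis phi1, lcomp G ft f1)"
  let ?K = "span_equiv kX kY G n m `` {(phis, fs)}" and ?K' = "span_equiv kX kY G m l `` {(phit, ft)}"
  have fs: "fs \<in> lmaps kX G ps m" and phit: "phit \<in> lmaps kY G pt m" and f1: "f1 \<in> lmaps kX G r pt" and phi1: "phi1 \<in> lmaps kY G r ps"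
    using F by (auto simp: filler_def)
  have r: "lcomp G phis phi1 \<in> lmaps kY G r n" "lcomp G ft f1 \<in> lmaps kX G r l"
    by (rule lcomp_lmaps[OF phi1 phis], rule lcomp_lmaps[OF f1 ft])
  have all: "?R `` {u} = ?R `` {?r}"
    if s: "(phis', fs') \<in> ?K" and t: "(phit', ft') \<in> ?K'" and u: "u \<in> span_composites L kX kY G (phit', ft') (phis', fs')"
    for phis' fs' phit' ft' u
  proof -
    obtain s c where s: "lperms ps s c" "fs' \<in> lmaps kX G ps m"
      "phis' = lcomp G phis (lperm kY ps s c)" "fs' = lcomp G fs (lperm kX ps s c)"
      using cls_memE[OF s phis fs] by metis
    obtain t d where t: "lperms pt t d" "phit' \<in> lmaps kY G pt m"
      "phit' = lcomp G phit (lperm kY pt t d)" "ft' = lcomp G ft (lperm kX pt t d)"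
      using cls_memE[OF t phit ft] by metis
    obtain psi g where u: "u = (lcomp G phis' psi, lcomp G ft' g)" "bimorphism L kX kY G g fs' psi phit'"
      using u by (auto simp: span_composites_def)
    obtain r' where F': "filler kX kY r' ps pt m g fs' psi phit'"
      using bimorphism_imp_filler[OF u(2) L s(2) t(2)] .
    have g: "g \<in> lmaps kX G r' pt" "psi \<in> lmaps kY G r' ps" using F' by (auto simp: filler_def)
    have hp: "lperm k ps s c \<in> lmaps k G ps ps" "lperm k pt t d \<in> lmaps k G pt pt" for k
      using s(1) t(1) by (auto simp: lperms_def intro!: lperm_lmaps)
    have "filler kX kY r' ps pt m (lcomp G (lperm kX pt t d) g) fs (lcomp G (lperm kY ps s c) psi) phit"
      using filler_perm[OF F'[unfolded s(4) t(3)] fs phit s(1) t(1)] .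
    then obtain w e where w: "r' = r" "lperms r w e" "lcomp G (lperm kY ps s c) psi = lcomp G phi1 (lperm kY r w e)"
      "lcomp G (lperm kX pt t d) g = lcomp G f1 (lperm kX r w e)"
      using filler_unique[OF F] by metis
    have we: "lperm k r w e \<in> lmaps k G r r" for k using w(2) by (auto simp: lperms_def intro!: lperm_lmaps)
    have "lcomp G phis' psi = lcomp G (lcomp G phis phi1) (lperm kY r w e)"
      unfolding s(3) lcomp_assoc[OF g(2) hp(1) phis] w(3) lcomp_assoc[OF we phi1 phis] ..
    moreover have "lcomp G ft' g = lcomp G (lcomp G ft f1) (lperm kX r w e)"
      unfolding t(4) lcomp_assoc[OF g(1) hp(2) ft] w(4) lcomp_assoc[OF we f1 ft] ..
    ultimately have "(u, ?r) \<in> ?R" using span_equivI[OF r w(2)] u(1) by simp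
    then show ?thesis by (rule equiv_class_eq[OF span_equiv_equiv])
  qed
  \<comment> \<open>Conversely, the union has to be inhabited. The given filler satisfies the
    commuting law only, so under \<open>Preserving\<close> a genuine bimorphism must be
    supplied.\<close>
  obtain g psi where "bimorphism L kX kY G g fs psi phit" using bimorphism_exists[OF fs phit L] by metis
  then have ex: "(lcomp G phis psi, lcomp G ft g) \<in> span_composites L kX kY G (phit, ft) (phis, fs)"
    by (auto simp: span_composites_def)
  have "(\<Union>s\<in>?K. \<Union>t\<in>?K'. ?R `` span_composites L kX kY G t s) = ?R `` {?r}"
  proof (rule equalityI; rule subsetI)
    fix x assume "x \<in> (\<Union>s\<in>?K. \<Union>t\<in>?K'. ?R `` span_composites L kX kY G t s)"
    then obtain phis' fs' phit' ft' u where "(phis', fs') \<in> ?K" "(phit', ft') \<in> ?K'" "u \<in> span_composites L kX kY G (phit', ft') (phis', fs')" "(u, x) \<in> ?R"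
      by auto
    with all[OF this(1-3)] show "x \<in> ?R `` {?r}" by auto
  next
    fix x assume "x \<in> ?R `` {?r}"
    then have "(( lcomp G phis psi, lcomp G ft g), x) \<in> ?R"
      using all[OF in_cls[OF phis fs] in_cls[OF phit ft] ex] by auto
    then show "x \<in> (\<Union>s\<in>?K. \<Union>t\<in>?K'. ?R `` span_composites L kX kY G t s)"
      using in_cls[OF phis fs] in_cls[OF phit ft] ex by blast
  qed
  then show ?thesis by (simp add: composite_prop_def cls_def)
qed

lemma TenA_cls:
  assumes a: "phi \<in> lmaps kY G p n" "f \<in> lmaps kX G p m" and b: "phi' \<in> lmaps kY G p' n'" "f' \<in> lmaps kX G p' m'"
  shows "TenA (composite_prop L kX kY G) (cls kX kY n m (phi, f)) (cls kX kY n' m' (phi', f'))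
    = cls kX kY (n + n') (m + m') (ltensor phi phi', ltensor f f')"
proof -
  let ?R = "span_equiv kX kY G (n + n') (m + m')" and ?r = "(ltensor phi phi', ltensor f f')"
  let ?K = "span_equiv kX kY G n m `` {(phi, f)}" and ?K' = "span_equiv kX kY G n' m' `` {(phi', f')}"
  have all: "?R `` {(ltensor psi psi', ltensor g g')} = ?R `` {?r}" if s: "(psi, g) \<in> ?K" and t: "(psi', g') \<in> ?K'" for psi g psi' g'
  proof -
    obtain s c where s: "lperms p s c" "psi = lcomp G phi (lperm kY p s c)" "g = lcomp G f (lperm kX p s c)"
      using cls_memE[OF s a] by metis
    obtain t d where t: "lperms p' t d" "psi' = lcomp G phi' (lperm kY p' t d)" "g' = lcomp G f' (lperm kX p' t d)"
      using cls_memE[OF t b] by metis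
    have hp: "lperm k p s c \<in> lmaps k G p p" "lperm k p' t d \<in> lmaps k G p' p'" for k
      using s(1) t(1) by (auto simp: lperms_def intro!: lperm_lmaps)
    obtain w e where w: "lperms (p + p') w e" "\<And>k. ltensor (lperm k p s c) (lperm k p' t d) = lperm k (p + p') w e"
      using ltensor_lperm[OF s(1) t(1)] by metis
    have "ltensor psi psi' = lcomp G (ltensor phi phi') (lperm kY (p + p') w e)"
      "ltensor g g' = lcomp G (ltensor f f') (lperm kX (p + p') w e)"
      unfolding s(2,3) t(2,3) ltensor_lcomp[OF hp(1) a(1) hp(2) b(1)] ltensor_lcomp[OF hp(1) a(2) hp(2) b(2)] w(2) by simp_all
    then have "((ltensor psi psi', ltensor g g'), ?r) \<in> ?R"
      using span_equivI[OF ltensor_lmaps[OF a(1) b(1)] ltensor_lmaps[OF a(2) b(2)] w(1)] by simp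
    then show ?thesis by (rule equiv_class_eq[OF span_equiv_equiv])
  qed
  have "(\<Union>(psi, g)\<in>?K. \<Union>(psi', g')\<in>?K'. ?R `` {(ltensor psi psi', ltensor g g')}) = ?R `` {?r}"
  proof (rule equalityI; rule subsetI)
    fix x assume "x \<in> (\<Union>(psi, g)\<in>?K. \<Union>(psi', g')\<in>?K'. ?R `` {(ltensor psi psi', ltensor g g')})"
    then obtain psi g psi' g' where "(psi, g) \<in> ?K" "(psi', g') \<in> ?K'" "x \<in> ?R `` {(ltensor psi psi', ltensor g g')}" by blast
    then show "x \<in> ?R `` {?r}" using all by blast
  next
    fix x assume "x \<in> ?R `` {?r}"
    then show "x \<in> (\<Union>(psi, g)\<in>?K. \<Union>(psi', g')\<in>?K'. ?R `` {(ltensor psi psi', ltensor g g')})"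
      using in_cls[OF a] in_cls[OF b] by blast
  qed
  then show ?thesis by (simp add: composite_prop_def cls_def)
qed

text \<open>\<open>X\<close> and the opposite of \<open>Y\<close> sit in the composite PROP as the
  spans with one trivial leg; \<open>incX\<close> is covariant and \<open>incY\<close>
  contravariant.\<close>

definition incX :: "fibre_kind \<Rightarrow> fibre_kind \<Rightarrow> 'a lmap \<Rightarrow> 'a span_class" where
  "incX kX kY f = cls kX kY (lsrc f) (ltgt f) (lident kY G (lsrc f), f)"

definition incY :: "fibre_kind \<Rightarrow> fibre_kind \<Rightarrow> 'a lmap \<Rightarrow> 'a span_class" where
  "incY kX kY phi = cls kX kY (ltgt phi) (lsrc phi) (phi, lident kX G (lsrc phi))"

lemma incX_eq: "f \<in> lmaps kX G n m \<Longrightarrow> incX kX kY f = cls kX kY n m (lident kY G n, f)"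
  and incY_eq: "phi \<in> lmaps kY G n m \<Longrightarrow> incY kX kY phi = cls kX kY m n (phi, lident kX G n)"
  by (simp_all add: incX_def incY_def lmapsD(1,2))

text \<open>Pulling back along an identity changes nothing. These squares make the inclusions
  functorial and factor every class of spans through its two legs.\<close>

lemma filler_trivial_X: "f \<in> lmaps kX G n m \<Longrightarrow> filler kX kY n n m m f f (lident kY G n) (lident kY G m)"
  unfolding filler_def
proof (intro conjI ballI)
  assume f: "f \<in> lmaps kX G n m"
  note r = lmaps_fun[OF f]
  show "bij_betw (\<lambda>z. (lfun (lident kY G n) z, lfun f z)) {1..n}
     {(x, y). x \<in> {1..n} \<and> y \<in> {1..m} \<and> lfun f x = lfun (lident kY G m) y}"
    by (rule bij_betwI[where g = fst]) (use r lident_sel in \<open>auto simp del: atLeastAtMost_iff One_nat_def\<close>)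
  show "map (lfun f) (lord (lident kY G n) x) = lord (lident kY G m) (lfun f x)" if "x \<in> {1..n}" for x
    using lident_sel(5)[OF that] lident_sel(5)[OF r[OF that]] by simp
  show "map (lfun (lident kY G n)) (lord f y) = lord f (lfun (lident kY G m) y)" if "y \<in> {1..m}" for y
  proof -
    have "map (lfun (lident kY G n)) (lord f y) = map (\<lambda>x. x) (lord f y)"
      using lmaps_ord_set[OF f] lident_sel(3) by (intro map_cong refl) blast
    then show ?thesis using lident_sel(3)[OF that] by simp
  qed
  show "llab f (lfun (lident kY G n) z) \<otimes> llab (lident kY G n) z = llab (lident kY G m) (lfun f z) \<otimes> llab f z" if "z \<in> {1..n}" for z
    using lident_sel(3,4)[OF that] lident_sel(4)[OF r[OF that]] lmaps_lab[OF f that] by simp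
qed auto

text \<open>The notion is invariant under reflection in the diagonal of the square, which exchanges
  the two kinds; so vertical statements follow from horizontal ones.\<close>

lemma filler_swap: "filler kX kY n m p q f1 f phi1 phi \<Longrightarrow> filler kY kX n p m q phi1 phi f1 f"
  unfolding filler_def
proof (elim conjE, intro conjI)
  assume b: "bij_betw (\<lambda>z. (lfun phi1 z, lfun f1 z)) {1..n} {(x, y). x \<in> {1..m} \<and> y \<in> {1..p} \<and> lfun f x = lfun phi y}"
  have "bij_betw prod.swap {(x, y). x \<in> {1..m} \<and> y \<in> {1..p} \<and> lfun f x = lfun phi y} {(y, x). y \<in> {1..p} \<and> x \<in> {1..m} \<and> lfun phi y = lfun f x}"
    by (rule bij_betwI[where g = prod.swap]) auto
  from bij_betw_trans[OF b this] show "bij_betw (\<lambda>z. (lfun f1 z, lfun phi1 z)) {1..n} {(x, y). x \<in> {1..p} \<and> y \<in> {1..m} \<and> lfun phi x = lfun f y}"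
    by (simp add: o_def)
qed auto

lemma filler_trivial_Y: "phi \<in> lmaps kY G n m \<Longrightarrow> filler kX kY n m n m (lident kX G n) (lident kX G m) phi phi"
  by (rule filler_swap) (rule filler_trivial_X)

lemma lbraid_lperms: "lperms (n + m) (\<lambda>x. if x \<le> n then x + m else x - n) (\<lambda>_. \<one>)"
proof -
  have "bij_betw (\<lambda>x. if x \<le> n then x + m else x - n) {1..n + m} {1..n + m}"
    by (rule bij_betwI[where g = "\<lambda>x. if x \<le> m then x + n else x - m"]) auto
  then show ?thesis by (simp add: lperms_def)
qed

lemma lbraid_lmaps: "lbraid k G n m \<in> lmaps k G (n + m) (n + m)"
  unfolding lbraid_def using lbraid_lperms by (auto simp: lperms_def intro!: lperm_lmaps)

context
  fixes L :: label_law and kX kY :: fibre_kind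
  assumes L: "L = Commuting \<or> L = Preserving \<and> comm_group G"
begin

abbreviation "CP \<equiv> composite_prop L kX kY G"
abbreviation "iX \<equiv> incX kX kY"
abbreviation "iY \<equiv> incY kX kY"

lemma incX_hom: "f \<in> lmaps kX G n m \<Longrightarrow> iX f \<in> Hom CP n m"
  unfolding incX_eq by (rule cls_arr) auto

lemma incY_hom: "f \<in> lmaps kY G n m \<Longrightarrow> iY f \<in> Hom CP m n"
  unfolding incY_eq by (rule cls_arr) auto

lemma incX_comp:
  assumes f: "f \<in> lmaps kX G n m" and g: "g \<in> lmaps kX G m l"
  shows "Comp CP (iX g) (iX f) = iX (lcomp G g f)"
  using Comp_cls[OF filler_trivial_X[OF f] lident_lmaps g L, of kY] lcomp_lident(1)[OF lident_lmaps[of kY n]]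
  by (simp add: incX_eq[OF f] incX_eq[OF g] incX_eq[OF lcomp_lmaps[OF f g]])

lemma incY_comp:
  assumes f: "f \<in> lmaps kY G n m" and g: "g \<in> lmaps kY G m l"
  shows "Comp CP (iY f) (iY g) = iY (lcomp G g f)"
  using Comp_cls[OF filler_trivial_Y[OF f] g lident_lmaps L, of kX] lcomp_lident(1)[OF lident_lmaps[of kX n]]
  by (simp add: incY_eq[OF f] incY_eq[OF g] incY_eq[OF lcomp_lmaps[OF f g]])

text \<open>The factorisation of an arbitrary arrow. Together with \<open>lmaps_generated\<close>,
  applied to both inclusions, it shows that the structure maps generate the composite PROP.\<close>

lemma incX_incY_comp:
  assumes phi: "phi \<in> lmaps kY G p n" and f: "f \<in> lmaps kX G p m"
  shows "Comp CP (iX f) (iY phi) = cls kX kY n m (phi, f)"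
  using Comp_cls[OF filler_trivial_X[OF lident_lmaps[of kX p]] phi f L] lcomp_lident(2)[OF phi] lcomp_lident(2)[OF f]
  by (simp add: incX_eq[OF f] incY_eq[OF phi])

text \<open>The distributive law: every filler yields a relation. For the cospans of the generators
  \<open>2 \<rightarrow> 1\<close> and \<open>0 \<rightarrow> 1\<close> these are the mixed axioms
  of a bimonoid.\<close>

lemma incY_incX_comp:
  assumes F: "filler kX kY n m p q f1 f phi1 phi"
  shows "Comp CP (iY phi) (iX f) = cls kX kY m p (phi1, f1)"
proof -
  have *: "f \<in> lmaps kX G m q" "phi \<in> lmaps kY G p q" "f1 \<in> lmaps kX G n p" "phi1 \<in> lmaps kY G n m" using F by (auto simp: filler_def)
  show ?thesis using Comp_cls[OF F lident_lmaps lident_lmaps L] lcomp_lident(1)[OF *(3)] lcomp_lident(1)[OF *(4)]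
    by (simp add: incX_eq[OF *(1)] incY_eq[OF *(2)])
qed

lemma incX_tensor:
  assumes f: "f \<in> lmaps kX G n m" and g: "g \<in> lmaps kX G n' m'"
  shows "TenA CP (iX f) (iX g) = iX (ltensor f g)"
  using TenA_cls[OF lident_lmaps f lident_lmaps g]
  by (simp add: incX_eq[OF f] incX_eq[OF g] incX_eq[OF ltensor_lmaps[OF f g]] lident_tensor)

lemma incY_tensor:
  assumes f: "f \<in> lmaps kY G n m" and g: "g \<in> lmaps kY G n' m'"
  shows "TenA CP (iY f) (iY g) = iY (ltensor f g)"
  using TenA_cls[OF f lident_lmaps g lident_lmaps]
  by (simp add: incY_eq[OF f] incY_eq[OF g] incY_eq[OF ltensor_lmaps[OF f g]] lident_tensor)

lemma Q_ident: "Ident CP n = iX (lident kX G n)" "Ident CP n = iY (lident kY G n)"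
  by (simp_all add: incX_eq[OF lident_lmaps] incY_eq[OF lident_lmaps] composite_prop_def composite_ident_def cls_def)

lemma Q_braid: "Braid CP n m = iX (lbraid kX G n m)"
  by (simp add: incX_eq[OF lbraid_lmaps] composite_prop_def cls_def add.commute)

lemma Q_sel: "Obj CP = UNIV" "TenO CP = (+)" "TUnit CP = 0" "Assoc CP a b c = Ident CP (a + b + c)"
  "LUnit CP n = Ident CP n" "RUnit CP n = Ident CP n"
  by (simp_all add: composite_prop_def)

lemma Q_comp_hom:
  assumes "a \<in> Hom CP n m" "b \<in> Hom CP m l"
  shows "Comp CP b a \<in> Hom CP n l"
proof -
  obtain p phi f where a: "phi \<in> lmaps kY G p n" "f \<in> lmaps kX G p m" "a = cls kX kY n m (phi, f)"
    using assms(1) by (rule cls_exhaust)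
  obtain q psi g where b: "psi \<in> lmaps kY G q m" "g \<in> lmaps kX G q l" "b = cls kX kY m l (psi, g)"
    using assms(2) by (rule cls_exhaust)
  obtain f1 phi1 where "bimorphism L kX kY G f1 f phi1 psi" using bimorphism_exists[OF a(2) b(1) L] by metis
  then obtain r where F: "filler kX kY r p q m f1 f phi1 psi" using bimorphism_imp_filler[OF _ L a(2) b(1)] by metis
  then have *: "f1 \<in> lmaps kX G r q" "phi1 \<in> lmaps kY G r p" by (auto simp: filler_def)
  show ?thesis unfolding a(3) b(3) Comp_cls[OF F a(1) b(2) L]
    by (rule cls_arr[OF lcomp_lmaps[OF *(2) a(1)] lcomp_lmaps[OF *(1) b(2)]])
qed

lemma Q_tensor_hom:
  assumes "a \<in> Hom CP n m" "b \<in> Hom CP n' m'"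
  shows "TenA CP a b \<in> Hom CP (n + n') (m + m')"
proof -
  obtain p phi f where a: "phi \<in> lmaps kY G p n" "f \<in> lmaps kX G p m" "a = cls kX kY n m (phi, f)"
    using assms(1) by (rule cls_exhaust)
  obtain q psi g where b: "psi \<in> lmaps kY G q n'" "g \<in> lmaps kX G q m'" "b = cls kX kY n' m' (psi, g)"
    using assms(2) by (rule cls_exhaust)
  show ?thesis unfolding a(3) b(3) TenA_cls[OF a(1,2) b(1,2)]
    by (rule cls_arr[OF ltensor_lmaps[OF a(1) b(1)] ltensor_lmaps[OF a(2) b(2)]])
qed

end

subsection \<open>Generation by the structure maps\<close>

text \<open>Only \<open>n = 2\<close> and \<open>n = 0\<close> serve as generators; general
  \<open>n\<close> makes associativity and the unit laws instances of the one formula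
  \<open>lcomp_lmul\<close>.\<close>

definition lmul :: "fibre_kind \<Rightarrow> nat \<Rightarrow> 'a lmap" where
  "lmul k n = \<lparr>lsrc = n, ltgt = 1, lfun = (\<lambda>x\<in>{1..n}. 1), llab = (\<lambda>x\<in>{1..n}. \<one>),
     lord = (\<lambda>i. if k = Ordered \<and> i = 1 then [1..<Suc n] else [])\<rparr>"

definition lunl :: "fibre_kind \<Rightarrow> 'a \<Rightarrow> 'a lmap" where
  "lunl k g = lperm k 1 (\<lambda>x. x) (\<lambda>_. g)"

lemma lmul_lmaps: "lmul k n \<in> lmaps k G n 1"
  by (rule lmapsI) (auto simp: lmul_def)

lemma lunl_lmaps: "g \<in> carrier G \<Longrightarrow> lunl k g \<in> lmaps k G 1 1"
  unfolding lunl_def by (rule lperm_lmaps) (auto simp: bij_betw_def)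

lemma lunl_sel: "lsrc (lunl k g) = 1" "ltgt (lunl k g) = 1" "lfun (lunl k g) 1 = 1" "llab (lunl k g) 1 = g"
  "lord (lunl k g) i = (if k = Ordered \<and> i = 1 then [1] else [])"
  by (auto simp: lunl_def lperm_def inv_into_def)

text \<open>Induction on \<open>n + m\<close>. If nothing lies over 1, a unit splits off. Otherwise
  the first element \<open>x\<close> of the fibre over 1 is brought to the front, receives its
  label, and is multiplied from the left to what the remaining map \<open>g\<close> has over
  1.\<close>

lemma lmaps_generated [consumes 1, case_names comp tensor ident braid mul unit label]:
  assumes f: "f \<in> lmaps k G n m"
    and cmp: "\<And>f g n m l. \<lbrakk>f \<in> lmaps k G n m; g \<in> lmaps k G m l; P f; P g\<rbrakk> \<Longrightarrow> P (lcomp G g f)"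
    and ten: "\<And>f g n m n' m'. \<lbrakk>f \<in> lmaps k G n m; g \<in> lmaps k G n' m'; P f; P g\<rbrakk> \<Longrightarrow> P (ltensor f g)"
    and idn: "\<And>n. P (lident k G n)" and brd: "\<And>n m. P (lbraid k G n m)"
    and mul: "P (lmul k 2)" and unt: "P (lmul k 0)" and lab: "\<And>g. g \<in> carrier G \<Longrightarrow> P (lunl k g)"
  shows "P f"
  using f
proof (induction "n + m" arbitrary: n m f rule: less_induct)
  case less
  note f = less.prems
  show ?case
  proof (cases m)
    case 0
    then have n: "n = 0" using lmaps_fun[OF f, of 1] by (cases n) auto
    have "f = lident k G 0"
      by (rule lmaps_eqI[where k = k and n = 0 and m = 0]) (use f 0 n in auto)
    then show ?thesis using idn by simp
  next
    case (Suc m')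
    \<comment> \<open>In the unordered case the increasing enumeration serves as an auxiliary order
      of the fibre.\<close>
    define o1 where "o1 = (if k = Ordered then lord f 1 else filter (\<lambda>x. lfun f x = 1) [1..<Suc n])"
    have o1: "distinct o1" "set o1 = {x \<in> {1..n}. lfun f x = 1}" "k = Ordered \<Longrightarrow> o1 = lord f 1"
      using lmaps_ord(1,2)[OF f, of 1] Suc by (auto simp: o1_def)
    show ?thesis
    proof (cases o1)
      case Nil
      then have no: "lfun f x \<noteq> 1" if "x \<in> {1..n}" for x using o1(2) Nil that by auto
      define g where "g = \<lparr>lsrc = n, ltgt = m', lfun = (\<lambda>x\<in>{1..n}. lfun f x - 1), llab = llab f,
        lord = (\<lambda>i. if k = Ordered \<and> i \<in> {1..m'} then lord f (Suc i) else [])\<rparr>"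
      have fS: "lfun f x = Suc (lfun f x - 1) \<and> lfun f x - 1 \<in> {1..m'}" if "x \<in> {1..n}" for x
        using lmaps_fun[OF f that] no[OF that] Suc by auto
      have g: "g \<in> lmaps k G n m'"
      proof (rule lmapsI)
        fix i assume k: "k = Ordered" and i: "i \<in> {1..m'}"
        then have "Suc i \<in> {1..m}" using Suc by auto
        note o = lmaps_ord(1,2)[OF f k this]
        have "{x \<in> {1..n}. lfun f x = Suc i} = {x \<in> {1..n}. lfun f x - 1 = i}" using fS by fastforce
        then show "distinct (lord g i) \<and> set (lord g i) = {x \<in> {1..n}. lfun g x = i}"
          using o k i by (simp add: g_def cong: conj_cong)
      qed (use fS lmapsD[OF f] in \<open>auto simp: g_def simp del: atLeastAtMost_iff One_nat_def\<close>)
      have "f = ltensor (lmul k 0) g"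
      proof (rule lmaps_eqI[OF f])
        show "ltensor (lmul k 0) g \<in> lmaps k G n m" using ltensor_lmaps[OF lmul_lmaps[of k 0] g] Suc by simp
        show "lfun f x = lfun (ltensor (lmul k 0) g) x" "llab f x = llab (ltensor (lmul k 0) g) x" if "x \<in> {1..n}" for x
          using that fS[OF that] by (simp_all add: ltensor_def lmul_def g_def)
        show "lord f i = lord (ltensor (lmul k 0) g) i" if "k = Ordered" "i \<in> {1..m}" for i
        proof (cases "i = 1")
          case True
          then show ?thesis using that(1) o1(3) Nil by (simp add: ltensor_def lmul_def g_def)
        next
          case False
          then show ?thesis using that Suc by (auto simp: ltensor_def lmul_def g_def map_idI)
        qed
      qed
      moreover have "P g" by (rule less.hyps[OF _ g]) (simp add: Suc)
      ultimately show ?thesis using ten[OF lmul_lmaps g unt] by simp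
    next
      case (Cons x xs)
      have x: "x \<in> {1..n}" "lfun f x = 1" using o1(2) Cons by auto
      then obtain n' where n: "n = Suc n'" by (cases n) auto
      \<comment> \<open>\<open>dl\<close> skips the position \<open>x\<close> and \<open>dr\<close>
        closes the gap: mutually inverse renumberings of the elements other than
        \<open>x\<close>.\<close>
      define dl where "dl z = (if z < x then z else Suc z)" for z
      define dr where "dr w = (if w < x then w else w - 1)" for w
      have dl: "dl z \<in> {1..n}" "dl z \<noteq> x" "dr (dl z) = z" if "z \<in> {1..n'}" for z
        using that n by (auto simp: dl_def dr_def)
      have dr: "dr w \<in> {1..n'}" "dl (dr w) = w" if "w \<in> {1..n}" "w \<noteq> x" for w
        using that n x(1) by (auto simp: dl_def dr_def)
      \<comment> \<open>The element \<open>x\<close> is the head of the fibre over 1, so its removal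
        leaves \<open>xs\<close> there and changes no other fibre.\<close>
      define lo where "lo i = (if i = 1 then xs else lord f i)" for i
      have lo: "distinct (lo i)" "set (lo i) = {w \<in> {1..n}. lfun f w = i \<and> w \<noteq> x}" if "k = Ordered" "i \<in> {1..m}" for i
        using o1 Cons lmaps_ord(1,2)[OF f that] x that(1) by (auto simp: lo_def)
      define g where "g = \<lparr>lsrc = n', ltgt = m, lfun = (\<lambda>z\<in>{1..n'}. lfun f (dl z)), llab = (\<lambda>z\<in>{1..n'}. llab f (dl z)),
        lord = (\<lambda>i. if k = Ordered \<and> i \<in> {1..m} then map dr (lo i) else [])\<rparr>"
      have g: "g \<in> lmaps k G n' m"
      proof (rule lmapsI)
        fix i assume k: "k = Ordered" and i: "i \<in> {1..m}"
        have "inj_on dr (set (lo i))" by (rule inj_on_inverseI[where g = dl]) (use dr lo[OF k i] in blast)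
        then have "distinct (map dr (lo i))" using lo[OF k i] by (simp add: distinct_map)
        moreover have "set (map dr (lo i)) = {z \<in> {1..n'}. lfun f (dl z) = i}"
        proof (rule equalityI; rule subsetI)
          fix z assume "z \<in> set (map dr (lo i))"
          then obtain w where w: "w \<in> {1..n}" "w \<noteq> x" "lfun f w = i" "z = dr w" using lo(2)[OF k i] by auto
          then show "z \<in> {z \<in> {1..n'}. lfun f (dl z) = i}" using dr[OF w(1,2)] by simp
        next
          fix z assume "z \<in> {z \<in> {1..n'}. lfun f (dl z) = i}"
          then have "dl z \<in> set (lo i)" "z = dr (dl z)" using dl[of z] lo(2)[OF k i] by auto
          then show "z \<in> set (map dr (lo i))" by (metis imageI set_map)
        qed
        ultimately show "distinct (lord g i) \<and> set (lord g i) = {z \<in> {1..n'}. lfun g z = i}"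
          using k i by (simp add: g_def cong: conj_cong)
      qed (use lmaps_fun[OF f dl(1)] lmaps_lab[OF f dl(1)] in \<open>auto simp: g_def simp del: atLeastAtMost_iff One_nat_def\<close>)
      let ?a = "llab f x"
      \<comment> \<open>\<open>B\<close> brings \<open>x\<close> to position 1, \<open>U\<close>
        applies its label next to \<open>g\<close>, and \<open>M\<close> multiplies the first two
        outputs.\<close>
      define B where "B = ltensor (lbraid k G (x - 1) 1) (lident k G (n - x))"
      define U where "U = ltensor (lunl k ?a) g"
      define M where "M = ltensor (lmul k 2) (lident k G m')"
      have a: "?a \<in> carrier G" using lmaps_lab[OF f x(1)] .
      have BB: "B \<in> lmaps k G n n"
        using ltensor_lmaps[OF lbraid_lmaps[of k "x - 1" 1] lident_lmaps[of k "n - x"]] x(1) by (simp add: B_def)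
      have UU: "U \<in> lmaps k G n (Suc m)" using ltensor_lmaps[OF lunl_lmaps[OF a] g] n by (simp add: U_def)
      have MM: "M \<in> lmaps k G (Suc m) m" using ltensor_lmaps[OF lmul_lmaps[of k 2] lident_lmaps[of k m']] Suc by (simp add: M_def)
      have Bsel: "lfun B y = (if y = x then 1 else Suc (dr y))" "llab B y = \<one>" if "y \<in> {1..n}" for y
        using that x(1) by (auto simp: B_def ltensor_def lbraid_def lperm_def lident_def dr_def)
      have Bord: "lord B i = (if i = 1 then [x] else [dl (i - 1)])" if "k = Ordered" "i \<in> {1..n}" for i
      proof -
        have "{y \<in> {1..n}. lfun B y = i} = {if i = 1 then x else dl (i - 1)}"
        proof (cases "i = 1")
          case True
          have "y = x" if y: "y \<in> {1..n}" "lfun B y = 1" for y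
          proof (rule ccontr)
            assume "y \<noteq> x"
            then show False using Bsel(1)[OF y(1)] y(2) dr(1)[OF y(1)] by simp
          qed
          then have "{y \<in> {1..n}. lfun B y = 1} \<subseteq> {x}" by blast
          moreover have "x \<in> {y \<in> {1..n}. lfun B y = 1}" using Bsel(1)[OF x(1)] x(1) by simp
          ultimately show ?thesis unfolding True if_P[OF refl] by blast
        next
          case False
          then have "i - 1 \<in> {1..n'}" "i = Suc (i - 1)" using that(2) n by auto
          note i = this
          show ?thesis
          proof (rule equalityI; rule subsetI)
            fix y assume "y \<in> {y \<in> {1..n}. lfun B y = i}"
            then have y: "y \<in> {1..n}" "lfun B y = i" by blast+
            then have "y \<noteq> x" "dr y = i - 1" using Bsel(1)[OF y(1)] False by (auto split: if_splits)
            then show "y \<in> {if i = 1 then x else dl (i - 1)}" using dr(2)[OF y(1)] False by simp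
          next
            fix y assume "y \<in> {if i = 1 then x else dl (i - 1)}"
            then have "y = dl (i - 1)" using False by simp
            then show "y \<in> {y \<in> {1..n}. lfun B y = i}" using dl[OF i(1)] i(2) Bsel(1)[of y] by simp
          qed
        qed
        then have "set (lord B i) = {if i = 1 then x else dl (i - 1)}" "distinct (lord B i)"
          using lmaps_ord(1,2)[OF BB that] by simp_all
        then show ?thesis by (cases "lord B i" rule: list.exhaust; cases "tl (lord B i)") (auto split: if_splits)
      qed
      have Usel: "lfun U 1 = 1" "llab U 1 = ?a" "z \<in> {1..n'} \<Longrightarrow> lfun U (Suc z) = Suc (lfun f (dl z))"
        "z \<in> {1..n'} \<Longrightarrow> llab U (Suc z) = llab f (dl z)" for z
        using lunl_sel[of k ?a] by (auto simp: U_def ltensor_def g_def)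
      have Msel: "lfun M i = (if i = 1 then 1 else i - 1)" "llab M i = \<one>" if "i \<in> {1..Suc m}" for i
      proof -
        have "\<not> i \<le> 2 \<Longrightarrow> i - 2 \<in> {1..m'}" using that Suc by auto
        then show "lfun M i = (if i = 1 then 1 else i - 1)" "llab M i = \<one>"
          using that Suc lident_sel(3,4)[of "i - 2" m' k] by (auto simp: M_def ltensor_def lmul_def lident_sel(1))
      qed
      have "f = lcomp G M (lcomp G U B)"
      proof (rule lmaps_eqI[OF f lcomp_lmaps[OF lcomp_lmaps[OF BB UU] MM]])
        fix y assume y: "y \<in> {1..n}"
        have fy: "lfun f y \<in> {1..m}" "llab f y \<in> carrier G" using lmaps_fun[OF f y] lmaps_lab[OF f y] .
        have s: "lsrc B = n" "lsrc U = n" using lmapsD(1)[OF BB] lmapsD(1)[OF UU] .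
        have UB: "lfun U (lfun B y) = (if y = x then 1 else Suc (lfun f y))" "llab U (lfun B y) = llab f y"
          using Bsel(1)[OF y] Usel dr[OF y] by simp_all
        then have r: "lfun U (lfun B y) \<in> {1..Suc m}" using fy by auto
        show "lfun f y = lfun (lcomp G M (lcomp G U B)) y"
          using y s UB Msel(1)[OF r] x(2) fy by (simp add: lcomp_def)
        show "llab f y = llab (lcomp G M (lcomp G U B)) y"
          using y s UB Msel(2)[OF r] Bsel(2)[OF y] fy by (simp add: lcomp_def)
      next
        fix i assume k: "k = Ordered" and i: "i \<in> {1..m}"
        have Uo: "lord U (Suc j) = map (\<lambda>z. Suc (dr z)) (lo j)" if "j \<in> {1..m}" for j
          using that k lunl_sel[of k ?a] by (auto simp: U_def ltensor_def g_def)
        have U1: "lord U 1 = [1]" using k lunl_sel[of k ?a] by (simp add: U_def ltensor_def)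
        have bk: "concat (map (lord B) (map (\<lambda>z. Suc (dr z)) (lo j))) = lo j" if "j \<in> {1..m}" for j
        proof -
          have "map (lord B) (map (\<lambda>z. Suc (dr z)) (lo j)) = map (\<lambda>z. [z]) (lo j)"
            unfolding map_map
          proof (intro map_cong refl)
            fix z assume "z \<in> set (lo j)"
            then have z: "z \<in> {1..n}" "z \<noteq> x" using lo(2)[OF k that] by auto
            then have "Suc (dr z) \<in> {1..n}" "Suc (dr z) \<noteq> 1" using dr(1)[OF z] n by auto
            then show "(lord B \<circ> (\<lambda>z. Suc (dr z))) z = [z]" using Bord[OF k] dr(2)[OF z] by simp
          qed
          then show ?thesis by (simp only: concat_map_singleton map_ident)
        qed
        have M1: "lord M i = (if i = 1 then [1, Suc 1] else [Suc i])"
        proof -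
          have "i \<noteq> 1 \<Longrightarrow> i - 1 \<in> {1..m'}" using i Suc by auto
          then show ?thesis using k i Suc lident_sel(5)[of "i - 1" m' k]
            by (auto simp: M_def ltensor_def lmul_def lident_sel(1) numeral_2_eq_2)
        qed
        have "1 \<in> {1..n}" "1 \<in> {1..m}" using x(1) Suc by auto
        note B1 = Bord[OF k this(1)] and U2 = Uo[OF this(2)] and b1 = bk[OF this(2)]
        show "lord f i = lord (lcomp G M (lcomp G U B)) i"
        proof (cases "i = 1")
          case True
          have "lord f i = x # lo 1" using o1(3)[OF k] Cons True by (simp add: lo_def)
          then show ?thesis using M1 True U1 U2 B1 b1 by (simp add: lcomp_def del: One_nat_def)
        next
          case False
          have "lord f i = lo i" using False by (simp add: lo_def)
          then show ?thesis using M1 False Uo[OF i] bk[OF i] by (simp add: lcomp_def)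
        qed
      qed
      moreover have "P g" by (rule less.hyps[OF _ g]) (simp add: n)
      then have "P U" using ten[OF lunl_lmaps[OF a] g] lab[OF a] unfolding U_def by blast
      moreover have "P B" using ten[OF lbraid_lmaps lident_lmaps] brd idn unfolding B_def by blast
      moreover have "P M" using ten[OF lmul_lmaps lident_lmaps] mul idn unfolding M_def by blast
      ultimately show ?thesis using cmp[OF lcomp_lmaps[OF BB UU] MM] cmp[OF BB UU] by simp
    qed
  qed
qed

end

section \<open>Evaluation of labelled maps\<close>

declare upt_Suc [simp del]

text \<open>A default order of the fibres, increasing where none is given. Under
  \<open>kcomm\<close> any other admissible choice has the same value, by
  \<open>M_eq\<close>.\<close>

definition ordr :: "fibre_kind \<Rightarrow> 'g lmap \<Rightarrow> nat \<Rightarrow> nat list" where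
  "ordr k f i = (if k = Ordered then lord f i else filter (\<lambda>x. lfun f x = i) [1..<Suc (lsrc f)])"

text \<open>The admissible choices of orders: forced in the ordered case, free in the unordered one.
  The class is closed under composition, whereas a composite of increasing orders need not be
  increasing.\<close>

definition okord :: "fibre_kind \<Rightarrow> nat \<Rightarrow> nat \<Rightarrow> 'g lmap \<Rightarrow> (nat \<Rightarrow> nat list) \<Rightarrow> bool" where
  "okord k n m f l \<longleftrightarrow> (\<forall>i\<in>{1..m}. distinct (l i) \<and> set (l i) = {x \<in> {1..n}. lfun f x = i} \<and> (k = Ordered \<longrightarrow> l i = lord f i))"

lemma okordD:
  assumes "okord k n m f l" "i \<in> {1..m}"
  shows "distinct (l i)" "set (l i) = {x \<in> {1..n}. lfun f x = i}" "k = Ordered \<Longrightarrow> l i = lord f i"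
  using assms unfolding okord_def by blast+

lemma okord_mem: "\<lbrakk>okord k n m f l; i \<in> {1..m}; x \<in> set (l i)\<rbrakk> \<Longrightarrow> x \<in> {1..n} \<and> lfun f x = i"
  using okordD(2)[of k n m f l i] by auto

lemma okord_in: "\<lbrakk>okord k n m f l; i \<in> {1..m}; x \<in> {1..n}; lfun f x = i\<rbrakk> \<Longrightarrow> x \<in> set (l i)"
  using okordD(2)[of k n m f l i] by auto

lemma okord_ordr: "f \<in> lmaps k G n m \<Longrightarrow> okord k n m f (ordr k f)"
  using lmaps_ord(1,2)[of f k G n m] lmapsD(1)[of f k G n m] by (auto simp: okord_def ordr_def)

lemma set_rng: "set [1..<Suc n] = {1..n}"
  by auto

text \<open>The fibres over \<open>1, ..., m\<close> partition the source, so their concatenation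
  lists every input exactly once. This is what makes the sorting permutation in \<open>Mn\<close>
  well formed.\<close>

lemma okord_mset:
  assumes f: "f \<in> lmaps k G n m" and l: "okord k n m f l"
  shows "mset [1..<Suc n] = mset (concat (map l [1..<Suc m]))"
proof -
  have d: "distinct (concat (map l is))" if "distinct is" "set is \<subseteq> {1..m}" for "is"
    using that
  proof (induction "is")
    case (Cons i "is")
    have "set (l i) \<inter> set (concat (map l is)) = {}"
    proof (rule ccontr)
      assume "set (l i) \<inter> set (concat (map l is)) \<noteq> {}"
      then obtain x j where x: "x \<in> set (l i)" "j \<in> set is" "x \<in> set (l j)" by auto
      have "i \<in> {1..m}" "j \<in> {1..m}" using Cons.prems x(2) by auto
      from okord_mem[OF l this(1) x(1)] okord_mem[OF l this(2) x(3)] show False using Cons.prems(1) x(2) by simp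
    qed
    then show ?case using Cons okordD(1)[OF l, of i] by simp
  qed simp
  have "distinct (concat (map l [1..<Suc m]))" by (rule d) auto
  moreover have "set (concat (map l [1..<Suc m])) = {1..n}"
  proof (rule equalityI; rule subsetI)
    fix x assume "x \<in> set (concat (map l [1..<Suc m]))"
    then obtain i where "i \<in> {1..m}" "x \<in> set (l i)" unfolding set_concat set_map set_rng by blast
    then show "x \<in> {1..n}" using okord_mem[OF l] by blast
  next
    fix x assume x: "x \<in> {1..n}"
    then have "x \<in> set (l (lfun f x))" using okord_in[OF l lmaps_fun[OF f x]] by blast
    then show "x \<in> set (concat (map l [1..<Suc m]))" using lmaps_fun[OF f x] set_rng by (auto simp del: upt_Suc)
  qed
  ultimately show ?thesis by (subst set_eq_iff_mset_eq_distinct[symmetric]) (auto simp: set_rng simp del: upt_Suc)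
qed

lemma okord_lcomp:
  assumes f: "f \<in> lmaps k G n m" and g: "g \<in> lmaps k G m l"
    and lf: "okord k n m f lf" and lg: "okord k m l g lg"
  shows "okord k n l (lcomp G g f) (\<lambda>i. concat (map lf (lg i)))"
  unfolding okord_def
proof (intro ballI conjI impI)
  fix i assume i: "i \<in> {1..l}"
  note gi = okordD[OF lg i]
  have sub: "j \<in> {1..m}" if "j \<in> set (lg i)" for j using okord_mem[OF lg i that] by blast
  have d: "distinct (concat (map lf js))" if "distinct js" "set js \<subseteq> {1..m}" for js
    using that
  proof (induction js)
    case (Cons j js)
    have "set (lf j) \<inter> set (concat (map lf js)) = {}"
    proof (rule ccontr)
      assume "set (lf j) \<inter> set (concat (map lf js)) \<noteq> {}"
      then obtain x j' where x: "x \<in> set (lf j)" "j' \<in> set js" "x \<in> set (lf j')" by auto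
      have "j \<in> {1..m}" "j' \<in> {1..m}" using Cons.prems x(2) by auto
      from okord_mem[OF lf this(1) x(1)] okord_mem[OF lf this(2) x(3)] show False using Cons.prems(1) x(2) by simp
    qed
    then show ?case using Cons okordD(1)[OF lf, of j] by simp
  qed simp
  show "distinct (concat (map lf (lg i)))" by (rule d) (use gi sub in auto)
  show "set (concat (map lf (lg i))) = {x \<in> {1..n}. lfun (lcomp G g f) x = i}"
  proof (rule equalityI; rule subsetI)
    fix x assume "x \<in> set (concat (map lf (lg i)))"
    then obtain j where j: "j \<in> set (lg i)" "x \<in> set (lf j)" by auto
    then show "x \<in> {x \<in> {1..n}. lfun (lcomp G g f) x = i}"
      using okordD(2)[OF lf sub[OF j(1)]] gi(2) lmapsD(1)[OF f] by (simp add: lcomp_def)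
  next
    fix x assume "x \<in> {x \<in> {1..n}. lfun (lcomp G g f) x = i}"
    then have x: "x \<in> {1..n}" "lfun g (lfun f x) = i" using lmapsD(1)[OF f] by (auto simp: lcomp_def)
    then have "lfun f x \<in> set (lg i)" "x \<in> set (lf (lfun f x))"
      using okord_in[OF lg i lmaps_fun[OF f x(1)]] okord_in[OF lf lmaps_fun[OF f x(1)]] by blast+
    then show "x \<in> set (concat (map lf (lg i)))" by auto
  qed
  assume k: "k = Ordered"
  have "concat (map lf (lg i)) = concat (map (lord f) (lg i))"
    using okordD(3)[OF lf sub k] by (intro arg_cong[where f = concat] map_cong) auto
  then show "concat (map lf (lg i)) = lord (lcomp G g f) i" using gi(3)[OF k] by (simp add: lcomp_def)
qed

context gmon begin

definition M :: "fibre_kind \<Rightarrow> 'g lmap \<Rightarrow> 'e" where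
  "M k f = Mn [1..<Suc (lsrc f)] [1..<Suc (ltgt f)] (ordr k f) (llab f)"

text \<open>Commutativity is demanded exactly where orders are absent, which lets both kinds be
  treated by one evaluation.\<close>

definition kcomm :: "fibre_kind \<Rightarrow> bool" where
  "kcomm k \<longleftrightarrow> (k = Unordered \<longrightarrow> mu \<odot> br (Suc 0) (Suc 0) = mu)"

text \<open>In the unordered case this is \<open>Mn_perm\<close>. It is what lets functoriality
  follow from \<open>Mn_cmp\<close>, where the fibres of a composite arrive in blocks instead of
  their default order.\<close>

lemma M_eq:
  assumes f: "f \<in> lmaps k G n m" and l: "okord k n m f l" and k: "kcomm k"
  shows "M k f = Mn [1..<Suc n] [1..<Suc m] l (llab f)"
proof (cases k)
  case Ordered
  have "ordr k f i = l i" if "i \<in> set [1..<Suc m]" for i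
    using okordD(3)[OF l _ Ordered] that unfolding set_rng by (simp add: ordr_def Ordered)
  then show ?thesis unfolding M_def lmapsD(1,2)[OF f] by (intro Mn_cong) auto
next
  case Unordered
  interpret comm_gmon ar dm cd "(\<odot>)" "(\<oslash>)" idn br G mu eta rho
    by unfold_locales (use k Unordered in \<open>simp add: kcomm_def\<close>)
  show ?thesis unfolding M_def lmapsD(1,2)[OF f]
  proof (rule Mn_perm)
    show "mset [1..<Suc n] = mset (concat (map (ordr k f) [1..<Suc m]))" using okord_mset[OF f okord_ordr[OF f]] .
    fix i assume "i \<in> set [1..<Suc m]"
    then have i: "i \<in> {1..m}" unfolding set_rng .
    show "mset (ordr k f i) = mset (l i)"
      using okordD(1,2)[OF l i] okordD(1,2)[OF okord_ordr[OF f] i] set_eq_iff_mset_eq_distinct by blast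
  next
    fix x assume "x \<in> set [1..<Suc n]"
    then show "llab f x \<in> carrier G" unfolding set_rng by (rule lmaps_lab[OF f])
  qed simp
qed

lemma M_hom:
  assumes f: "f \<in> lmaps k G n m"
  shows "hom (M k f) n m"
  unfolding hom_def M_def lmapsD(1,2)[OF f]
  using Mn_ar[OF okord_mset[OF f okord_ordr[OF f]], of "llab f"] lmaps_lab[OF f] unfolding set_rng by simp

lemma M_lcomp:
  assumes f: "f \<in> lmaps k G n m" and g: "g \<in> lmaps k G m l" and k: "kcomm k"
  shows "M k (lcomp G g f) = M k g \<odot> M k f"
proof -
  note of' = okord_ordr[OF f] and og = okord_ordr[OF g]
  have "M k g \<odot> M k f = Mn [1..<Suc n] [1..<Suc l] (\<lambda>i. concat (map (ordr k f) (ordr k g i))) (llab (lcomp G g f))"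
    unfolding M_def lmapsD(1,2)[OF f] lmapsD(1,2)[OF g]
  proof (rule Mn_cmp)
    show "mset [1..<Suc n] = mset (concat (map (ordr k f) [1..<Suc m]))" using okord_mset[OF f of'] .
    show "mset [1..<Suc m] = mset (concat (map (ordr k g) [1..<Suc l]))" using okord_mset[OF g og] .
    show "llab f x \<in> carrier G" if "x \<in> set [1..<Suc n]" for x using that unfolding set_rng by (rule lmaps_lab[OF f])
    show "llab g x \<in> carrier G" if "x \<in> set [1..<Suc m]" for x using that unfolding set_rng by (rule lmaps_lab[OF g])
    fix i x assume i: "i \<in> set [1..<Suc m]" and x: "x \<in> set (ordr k f i)"
    then have "x \<in> {1..n}" "lfun f x = i" using okord_mem[OF of'] unfolding set_rng by blast+
    then show "llab (lcomp G g f) x = llab g i \<otimes> llab f x" using lmapsD(1)[OF f] by (simp add: lcomp_def)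
  qed auto
  then show ?thesis using M_eq[OF lcomp_lmaps[OF f g] okord_lcomp[OF f g of' og] k] by simp
qed

lemma okord_lperm:
  assumes "lperms p s c"
  shows "okord k p p (lperm k p s c) (\<lambda>i. [inv_into {1..p} s i])"
  using inv_bij(3) assms unfolding okord_def lperms_def
  by (auto simp: lperm_def cong: conj_cong simp del: atLeastAtMost_iff One_nat_def)

lemma M_lident: "kcomm k \<Longrightarrow> M k (lident k G n) = idn n"
proof -
  assume k: "kcomm k"
  have "okord k n n (lident k G n) (\<lambda>x. [x])"
    using lident_sel(3,5)[of _ n k] by (auto simp: okord_def simp del: atLeastAtMost_iff One_nat_def)
  then have "M k (lident k G n) = Mn [1..<Suc n] [1..<Suc n] (\<lambda>x. [x]) (llab (lident k G n))"
    by (rule M_eq[OF lident_lmaps _ k])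
  also have "\<dots> = Mn [1..<Suc n] [1..<Suc n] (\<lambda>x. [x]) (\<lambda>_. \<one>)"
    by (rule Mn_cong) (use lident_sel(4)[of _ n k] in \<open>simp_all only: set_rng list.set singleton_iff\<close>)
  also have "\<dots> = idn n" by (subst Mn_id) auto
  finally show ?thesis .
qed

lemma rng_add: "[1..<Suc (n + m)] = [1..<Suc n] @ map ((+) n) [1..<Suc m]"
proof -
  have "[1..<Suc (n + m)] = [1..<Suc n] @ [Suc n..<Suc n + m]" using upt_add_eq_append[of 1 "Suc n" m] by simp
  also have "[Suc n..<Suc n + m] = map ((+) n) [1..<Suc m]" by (rule nth_equalityI) auto
  finally show ?thesis .
qed

text \<open>The inputs and outputs of the second factor are those of \<open>g\<close> shifted by
  \<open>n\<close> and \<open>m\<close>; \<open>Mn_append\<close> separates the factors, and the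
  renamings \<open>Mn_map_out\<close> and \<open>Mn_map_in\<close> remove the shifts.\<close>

lemma M_ltensor:
  assumes f: "f \<in> lmaps k G n m" and g: "g \<in> lmaps k G n' m'" and k: "kcomm k"
  shows "M k (ltensor f g) = M k f \<oslash> M k g"
proof -
  note s = lmapsD(1,2)[OF f] lmapsD(1,2)[OF g] and fg = ltensor_lmaps[OF f g]
  note of' = okord_ordr[OF f] and og = okord_ordr[OF g]
  define l where "l i = (if i \<le> m then ordr k f i else map ((+) n) (ordr k g (i - m)))" for i
  have l1: "l i = ordr k f i" if "i \<in> {1..m}" for i using that by (simp add: l_def)
  have l2: "l (m + i) = map ((+) n) (ordr k g i)" if "i \<in> {1..m'}" for i using that by (simp add: l_def)
  have sf: "x \<in> {1..n}" if "i \<in> {1..m}" "x \<in> set (ordr k f i)" for i x using okord_mem[OF of' that] by blast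
  have sg: "x \<in> {1..n'}" if "i \<in> {1..m'}" "x \<in> set (ordr k g i)" for i x using okord_mem[OF og that] by blast
  have t1: "lfun (ltensor f g) x = lfun f x" "llab (ltensor f g) x = llab f x" if "x \<in> {1..n}" for x
    using that by (simp_all add: ltensor_def s)
  have t2: "lfun (ltensor f g) (n + x) = m + lfun g x" "llab (ltensor f g) (n + x) = llab g x" if "x \<in> {1..n'}" for x
    using that by (simp_all add: ltensor_def s)
  have split: "(\<exists>y\<in>{1..n'}. x = n + y) \<or> x \<in> {1..n}" if "x \<in> {1..n + n'}" for x
    using that by (cases "x \<le> n") (auto intro!: bexI[of _ "x - n"])
  have ok: "okord k (n + n') (m + m') (ltensor f g) l"
    unfolding okord_def
  proof (intro ballI conjI impI)
    fix i assume i: "i \<in> {1..m + m'}"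
    consider "i \<in> {1..m}" | j where "j \<in> {1..m'}" "i = m + j"
    proof (cases "i \<le> m")
      case True then show ?thesis using that(1) i by simp
    next
      case False
      then have "i - m \<in> {1..m'}" "i = m + (i - m)" using i by auto
      then show ?thesis by (rule that(2))
    qed
    then have "distinct (l i) \<and> set (l i) = {x \<in> {1..n + n'}. lfun (ltensor f g) x = i} \<and> (k = Ordered \<longrightarrow> l i = lord (ltensor f g) i)"
    proof cases
      case 1
      have "{x \<in> {1..n + n'}. lfun (ltensor f g) x = i} = {x \<in> {1..n}. lfun f x = i}"
      proof (rule equalityI; rule subsetI)
        fix x assume "x \<in> {x \<in> {1..n + n'}. lfun (ltensor f g) x = i}"
        then have x: "x \<in> {1..n + n'}" "lfun (ltensor f g) x = i" by blast+
        have "x \<in> {1..n}"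
        proof (rule ccontr)
          assume "x \<notin> {1..n}"
          then obtain y where y: "y \<in> {1..n'}" "x = n + y" using split[OF x(1)] by blast
          then show False using x(2) t2(1)[OF y(1)] lmaps_fun[OF g y(1)] 1 by simp
        qed
        then show "x \<in> {x \<in> {1..n}. lfun f x = i}" using x(2) t1 by simp
      qed (use t1 in auto)
      then show ?thesis using okordD[OF of' 1] l1[OF 1] 1 by (simp add: ltensor_def s)
    next
      case 2
      have "{x \<in> {1..n + n'}. lfun (ltensor f g) x = i} = (+) n ` {x \<in> {1..n'}. lfun g x = j}"
      proof (rule equalityI; rule subsetI)
        fix x assume "x \<in> {x \<in> {1..n + n'}. lfun (ltensor f g) x = i}"
        then have x: "x \<in> {1..n + n'}" "lfun (ltensor f g) x = i" by blast+
        have "x \<notin> {1..n}" using t1(1) lmaps_fun[OF f] x(2) 2 by force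
        then obtain y where y: "y \<in> {1..n'}" "x = n + y" using split[OF x(1)] by blast
        then show "x \<in> (+) n ` {x \<in> {1..n'}. lfun g x = j}" using x(2) t2(1)[OF y(1)] 2 by auto
      next
        fix x assume "x \<in> (+) n ` {x \<in> {1..n'}. lfun g x = j}"
        then obtain y where y: "y \<in> {1..n'}" "x = n + y" "lfun g y = j" by blast
        then show "x \<in> {x \<in> {1..n + n'}. lfun (ltensor f g) x = i}" using t2(1)[OF y(1)] 2 by simp
      qed
      then show ?thesis using okordD[OF og 2(1)] l2[OF 2(1)] 2 by (simp add: ltensor_def s distinct_map)
    qed
    then show "distinct (l i)" "set (l i) = {x \<in> {1..n + n'}. lfun (ltensor f g) x = i}" "k = Ordered \<Longrightarrow> l i = lord (ltensor f g) i"
      by blast+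
  qed
  let ?a = "llab (ltensor f g)"
  have c1: "map l [1..<Suc m] = map (ordr k f) [1..<Suc m]" using l1 by (intro map_cong refl) (simp only: set_rng)
  have c2: "map l (map ((+) m) [1..<Suc m']) = map (map ((+) n)) (map (ordr k g) [1..<Suc m'])"
    unfolding map_map using l2 by (intro map_cong refl) (simp only: set_rng o_def)
  have m2: "mset (map ((+) n) [1..<Suc n']) = mset (concat (map l (map ((+) m) [1..<Suc m'])))"
    unfolding c2 map_concat[symmetric] mset_map using okord_mset[OF g og] by simp
  have "M k (ltensor f g) = Mn ([1..<Suc n] @ map ((+) n) [1..<Suc n']) ([1..<Suc m] @ map ((+) m) [1..<Suc m']) l ?a"
    using M_eq[OF fg ok k] unfolding rng_add .
  also have "\<dots> = Mn [1..<Suc n] [1..<Suc m] l ?a \<oslash> Mn (map ((+) n) [1..<Suc n']) (map ((+) m) [1..<Suc m']) l ?a"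
  proof (rule Mn_append)
    show "mset [1..<Suc n] = mset (concat (map l [1..<Suc m]))" unfolding c1 using okord_mset[OF f of'] .
    show "distinct ([1..<Suc n] @ map ((+) n) [1..<Suc n'])" unfolding rng_add[symmetric] by simp
    show "?a x \<in> carrier G" if "x \<in> set ([1..<Suc n] @ map ((+) n) [1..<Suc n'])" for x
      using that unfolding rng_add[symmetric] set_rng by (rule lmaps_lab[OF fg])
  qed (rule m2)
  also have "Mn [1..<Suc n] [1..<Suc m] l ?a = M k f"
    unfolding M_def s by (rule Mn_cong) (use l1 t1(2) sf in \<open>simp_all only: set_rng\<close>)
  also have "Mn (map ((+) n) [1..<Suc n']) (map ((+) m) [1..<Suc m']) l ?a = Mn (map ((+) n) [1..<Suc n']) [1..<Suc m'] (\<lambda>i. l (m + i)) ?a"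
    by (rule Mn_map_out)
  also have "\<dots> = Mn (map ((+) n) [1..<Suc n']) [1..<Suc m'] (\<lambda>i. map ((+) n) (ordr k g i)) ?a"
    by (rule Mn_cong) (use l2 in \<open>simp_all only: set_rng\<close>)
  also have "\<dots> = Mn [1..<Suc n'] [1..<Suc m'] (ordr k g) (\<lambda>x. ?a (n + x))"
    by (rule Mn_map_in) (use okord_mset[OF g og] in auto)
  also have "\<dots> = M k g"
    unfolding M_def s by (rule Mn_cong) (use t2(2) sg in \<open>simp_all only: set_rng\<close>)
  finally show ?thesis .
qed

text \<open>All fibres are singletons with label \<open>\<one>\<close>, so only the sorting
  permutation remains. It exchanges two blocks, which is \<open>wp_swap_append\<close>.\<close>

lemma M_lbraid: "kcomm k \<Longrightarrow> M k (lbraid k G n m) = br n m"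
proof -
  assume k: "kcomm k"
  define s where "s = (\<lambda>x. if x \<le> n then x + m else x - n)"
  let ?t = "inv_into {1..n + m} s"
  have s: "bij_betw s {1..n + m} {1..n + m}" using lbraid_lperms unfolding lperms_def s_def by blast
  have t: "?t i = (if i \<le> m then i + n else i - m)" if "i \<in> {1..n + m}" for i
    by (rule inv_into_f_eq[OF bij_betw_imp_inj_on[OF s]]) (use that in \<open>auto simp: s_def\<close>)
  have "M k (lbraid k G n m) = Mn [1..<Suc (n + m)] [1..<Suc (n + m)] (\<lambda>i. [?t i]) (llab (lbraid k G n m))"
    using M_eq[OF lbraid_lmaps okord_lperm[OF lbraid_lperms, of k, folded lbraid_def] k, of n m] unfolding s_def .
  also have "\<dots> = Mn [1..<Suc (n + m)] [1..<Suc (n + m)] (\<lambda>i. [?t i]) (\<lambda>_. \<one>)"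
  proof (rule Mn_cong[OF refl])
    fix i x assume "i \<in> set [1..<Suc (n + m)]" "x \<in> set [?t i]"
    then have "x \<in> {1..n + m}" using inv_bij(1)[OF s] unfolding set_rng by (simp del: atLeastAtMost_iff One_nat_def)
    then show "llab (lbraid k G n m) x = \<one>" by (simp add: lbraid_def lperm_def)
  qed
  also have "\<dots> = wp1 [1..<Suc (n + m)] (map ?t [1..<Suc (n + m)])"
  proof -
    have r: "(\<lambda>i. mulw (map (\<lambda>_. \<one>) [?t i])) = (\<lambda>i. idn (Suc 0))" by (simp add: rho_one mu_unit fun_eq_iff)
    have "distinct (map ?t [1..<Suc (n + m)])"
      using bij_betw_inv_into[OF s] unfolding distinct_map set_rng bij_betw_def by simp
    moreover have "set (map ?t [1..<Suc (n + m)]) = set [1..<Suc (n + m)]"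
      using bij_betw_inv_into[OF s] unfolding set_map set_rng bij_betw_def by blast
    ultimately have m: "mset [1..<Suc (n + m)] = mset (map ?t [1..<Suc (n + m)])"
      using set_eq_iff_mset_eq_distinct distinct_upt by blast
    have "sum_list (map (\<lambda>i. Suc 0) [1..<Suc (n + m)]) = n + m" by (subst sum_list_triv) auto
    then show ?thesis unfolding Mn_def r tens_idn concat_map_singleton
      using wp_hom[OF m, of "\<lambda>_. Suc 0"] unfolding wd_1 by (simp add: idn_cmp)
  qed
  also have "map ?t [1..<Suc (n + m)] = map ((+) n) [1..<Suc m] @ [1..<Suc n]"
  proof -
    have "map ?t [1..<Suc (n + m)] = map ?t [1..<Suc m] @ map ?t (map ((+) m) [1..<Suc n])"
      unfolding add.commute[of n m] rng_add by simp
    also have "map ?t [1..<Suc m] = map ((+) n) [1..<Suc m]"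
      using t by (intro map_cong refl) (auto simp: add.commute simp del: One_nat_def)
    also have "map ?t (map ((+) m) [1..<Suc n]) = map (\<lambda>x. x) [1..<Suc n]"
      unfolding map_map using t by (intro map_cong refl) (auto simp del: One_nat_def)
    finally show ?thesis by simp
  qed
  also have "wp1 [1..<Suc (n + m)] (map ((+) n) [1..<Suc m] @ [1..<Suc n]) = br n m"
  proof -
    have "distinct ([1..<Suc n] @ map ((+) n) [1..<Suc m])" unfolding rng_add[symmetric] by simp
    from wp_swap_append[OF this, of "\<lambda>_. Suc 0"] show ?thesis unfolding rng_add wd_1 by simp
  qed
  finally show ?thesis .
qed

lemma M_lmul: "kcomm k \<Longrightarrow> M k (lmul k 2) = mu" "kcomm k \<Longrightarrow> M k (lmul k 0) = eta"
proof -
  have *: "M k (lmul k n) = mulw (map (\<lambda>_. \<one>) [1..<Suc n])" if k: "kcomm k" for n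
  proof -
    have "okord k n 1 (lmul k n) (\<lambda>_. [1..<Suc n])" by (auto simp: okord_def lmul_def)
    then have "M k (lmul k n) = Mn [1..<Suc n] [1..<Suc 1] (\<lambda>_. [1..<Suc n]) (llab (lmul k n))"
      by (rule M_eq[OF lmul_lmaps _ k])
    also have "\<dots> = Mn [1..<Suc n] [1 :: nat] (\<lambda>_. [1..<Suc n]) (\<lambda>_. \<one>)"
    proof -
      have "Mn [1..<Suc n] [1 :: nat] (\<lambda>_. [1..<Suc n]) (llab (lmul k n)) = Mn [1..<Suc n] [1 :: nat] (\<lambda>_. [1..<Suc n]) (\<lambda>_. \<one>)"
        by (rule Mn_cong) (auto simp: lmul_def)
      moreover have "[1..<Suc 1] = [1 :: nat]" by (simp add: upt_Suc)
      ultimately show ?thesis by simp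
    qed
    also have "\<dots> = mulw (map (\<lambda>_. \<one>) [1..<Suc n])"
      unfolding Mn_def by (simp add: ten_idn0 cmp_idn del: upt_Suc)
    finally show ?thesis .
  qed
  show "M k (lmul k 2) = mu" if "kcomm k"
  proof -
    have "[1..<Suc 2] = [1, Suc 1]" by (simp add: numeral_2_eq_2 upt_Suc)
    then show ?thesis unfolding *[OF that] by (simp add: rho_one mu_unit ten_idn cmp_idn)
  qed
  show "M k (lmul k 0) = eta" if "kcomm k" unfolding *[OF that] by simp
qed

lemma M_lunl:
  assumes k: "kcomm k" and g: "g \<in> carrier G"
  shows "M k (lunl k g) = rho g"
proof -
  have "okord k 1 1 (lunl k g) (\<lambda>_. [1])" by (auto simp: okord_def lunl_def lperm_def inv_into_def)
  then have "M k (lunl k g) = Mn [1..<Suc 1] [1..<Suc 1] (\<lambda>_. [1]) (llab (lunl k g))"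
    by (rule M_eq[OF lunl_lmaps[OF g] _ k])
  moreover have "[1..<Suc 1] = [1 :: nat]" by (simp add: upt_Suc)
  ultimately show ?thesis using g lunl_sel(4)[of k g] by (simp add: Mn_def ten_idn0 mu_eta_cmp cmp_idn)
qed

end

section \<open>Evaluation of spans in a bimonoid\<close>

context gbim begin

abbreviation C :: "fibre_kind \<Rightarrow> 'g lmap \<Rightarrow> 'e" where "C \<equiv> op.M"

lemma op_hom: "op.hom f n m \<longleftrightarrow> hom f m n"
  by (auto simp: hom_def op.hom_def)

lemma C_hom: "f \<in> lmaps k G n m \<Longrightarrow> hom (C k f) m n"
  using op.M_hom op_hom by blast

text \<open>The map \<open>c\<close> recovers a point of the corner from its two projections. Over
  each point of the base the corner is an array, and the fibres of the two legs are its columns and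
  rows, enumerated as the fibres of \<open>f\<close> and \<open>phi\<close>.\<close>

lemma filler_corner:
  assumes F: "filler kX kY n m p q f1 f phi1 phi"
  defines "c \<equiv> inv_into {1..n} (\<lambda>z. (lfun phi1 z, lfun f1 z))"
  shows "okord kX n p f1 (\<lambda>y. map c (map (\<lambda>x. (x, y)) (ordr kX f (lfun phi y))))"
    and "okord kY n m phi1 (\<lambda>x. map c (map (\<lambda>y. (x, y)) (ordr kY phi (lfun f x))))"
    and "\<And>y. y \<in> {1..p} \<Longrightarrow> map (\<lambda>z. (lfun phi1 z, lfun f1 z)) (map c (map (\<lambda>x. (x, y)) (ordr kX f (lfun phi y)))) = map (\<lambda>x. (x, y)) (ordr kX f (lfun phi y))"
    and "\<And>x. x \<in> {1..m} \<Longrightarrow> map (\<lambda>z. (lfun phi1 z, lfun f1 z)) (map c (map (\<lambda>y. (x, y)) (ordr kY phi (lfun f x)))) = map (\<lambda>y. (x, y)) (ordr kY phi (lfun f x))"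
proof -
  let ?B = "\<lambda>z. (lfun phi1 z, lfun f1 z)"
  let ?D = "{(x, y). x \<in> {1..m} \<and> y \<in> {1..p} \<and> lfun f x = lfun phi y}"
  note F = F[unfolded filler_def]
  have f1: "f1 \<in> lmaps kX G n p" and phi1: "phi1 \<in> lmaps kY G n m" and f: "f \<in> lmaps kX G m q" and phi: "phi \<in> lmaps kY G p q"
    and B: "bij_betw ?B {1..n} ?D" using F by blast+
  have c: "c (x, y) \<in> {1..n}" "lfun phi1 (c (x, y)) = x" "lfun f1 (c (x, y)) = y"
    if "x \<in> {1..m}" "y \<in> {1..p}" "lfun f x = lfun phi y" for x y
  proof -
    have D: "(x, y) \<in> ?D" using that by blast
    show "c (x, y) \<in> {1..n}" using bij_betw_apply[OF bij_betw_inv_into[OF B] D] by (simp add: c_def)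
    show "lfun phi1 (c (x, y)) = x" "lfun f1 (c (x, y)) = y" using bij_betw_inv_into_right[OF B D] by (simp_all add: c_def)
  qed
  have cB: "c (lfun phi1 z, lfun f1 z) = z" if "z \<in> {1..n}" for z
    using bij_betw_inv_into_left[OF B that] by (simp add: c_def)
  have eq: "lfun f (lfun phi1 z) = lfun phi (lfun f1 z)" if "z \<in> {1..n}" for z
    using bij_betw_apply[OF B that] by blast
  note okf = okord_ordr[OF f] and okp = okord_ordr[OF phi]
  have mf: "x \<in> {1..m} \<and> lfun f x = lfun phi y" if "y \<in> {1..p}" "x \<in> set (ordr kX f (lfun phi y))" for x y
    using okord_mem[OF okf lmaps_fun[OF phi that(1)] that(2)] by blast
  have mp: "y \<in> {1..p} \<and> lfun phi y = lfun f x" if "x \<in> {1..m}" "y \<in> set (ordr kY phi (lfun f x))" for x y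
    using okord_mem[OF okp lmaps_fun[OF f that(1)] that(2)] by blast
  show b1: "map ?B (map c (map (\<lambda>x. (x, y)) (ordr kX f (lfun phi y)))) = map (\<lambda>x. (x, y)) (ordr kX f (lfun phi y))" if y: "y \<in> {1..p}" for y
    unfolding map_map by (intro map_cong refl) (use mf[OF y] c y in \<open>simp del: atLeastAtMost_iff One_nat_def\<close>)
  show b2: "map ?B (map c (map (\<lambda>y. (x, y)) (ordr kY phi (lfun f x)))) = map (\<lambda>y. (x, y)) (ordr kY phi (lfun f x))" if x: "x \<in> {1..m}" for x
    unfolding map_map by (intro map_cong refl) (use mp[OF x] c x in \<open>simp del: atLeastAtMost_iff One_nat_def\<close>)
  show "okord kX n p f1 (\<lambda>y. map c (map (\<lambda>x. (x, y)) (ordr kX f (lfun phi y))))"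
    unfolding okord_def
  proof (intro ballI conjI impI)
    fix y assume y: "y \<in> {1..p}"
    let ?l = "map c (map (\<lambda>x. (x, y)) (ordr kX f (lfun phi y)))"
    have "distinct (map ?B ?l)" unfolding b1[OF y] using okordD(1)[OF okf lmaps_fun[OF phi y]] by (simp add: distinct_map inj_on_def)
    then show "distinct ?l" by (simp only: distinct_map)
    show "set ?l = {z \<in> {1..n}. lfun f1 z = y}"
    proof (rule equalityI; rule subsetI)
      fix z assume "z \<in> set ?l"
      then obtain x where "x \<in> set (ordr kX f (lfun phi y))" "z = c (x, y)" by auto
      then show "z \<in> {z \<in> {1..n}. lfun f1 z = y}" using mf[OF y] c y by blast
    next
      fix z assume "z \<in> {z \<in> {1..n}. lfun f1 z = y}"
      then have z: "z \<in> {1..n}" "lfun f1 z = y" by blast+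
      then have "lfun phi1 z \<in> set (ordr kX f (lfun phi y))"
        using okord_in[OF okf lmaps_fun[OF phi y] lmaps_fun[OF phi1 z(1)]] eq[OF z(1)] by blast
      moreover have "z = c (lfun phi1 z, y)" using cB[OF z(1)] z(2) by simp
      ultimately show "z \<in> set ?l" by auto
    qed
    assume k: "kX = Ordered"
    have "lord f1 y = map (\<lambda>z. c (?B z)) (lord f1 y)"
      using lmaps_ord_set[OF f1] cB by (intro map_idI[symmetric]) blast
    also have "\<dots> = map c (map (\<lambda>x. (x, y)) (map (lfun phi1) (lord f1 y)))"
      using lmaps_ord_set[OF f1] unfolding map_map o_def by (intro map_cong refl) auto
    also have "map (lfun phi1) (lord f1 y) = lord f (lfun phi y)" using F y by blast
    also have "\<dots> = ordr kX f (lfun phi y)" using k by (simp add: ordr_def)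
    finally show "?l = lord f1 y" by simp
  qed
  show "okord kY n m phi1 (\<lambda>x. map c (map (\<lambda>y. (x, y)) (ordr kY phi (lfun f x))))"
    unfolding okord_def
  proof (intro ballI conjI impI)
    fix x assume x: "x \<in> {1..m}"
    let ?l = "map c (map (\<lambda>y. (x, y)) (ordr kY phi (lfun f x)))"
    have "distinct (map ?B ?l)" unfolding b2[OF x] using okordD(1)[OF okp lmaps_fun[OF f x]] by (simp add: distinct_map inj_on_def)
    then show "distinct ?l" by (simp only: distinct_map)
    show "set ?l = {z \<in> {1..n}. lfun phi1 z = x}"
    proof (rule equalityI; rule subsetI)
      fix z assume "z \<in> set ?l"
      then obtain y where "y \<in> set (ordr kY phi (lfun f x))" "z = c (x, y)" by auto
      then show "z \<in> {z \<in> {1..n}. lfun phi1 z = x}" using mp[OF x] c x by fastforce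
    next
      fix z assume "z \<in> {z \<in> {1..n}. lfun phi1 z = x}"
      then have z: "z \<in> {1..n}" "lfun phi1 z = x" by blast+
      then have "lfun f1 z \<in> set (ordr kY phi (lfun f x))"
        using okord_in[OF okp lmaps_fun[OF f x] lmaps_fun[OF f1 z(1)]] eq[OF z(1)] by simp
      moreover have "z = c (x, lfun f1 z)" using cB[OF z(1)] z(2) by simp
      ultimately show "z \<in> set ?l" by auto
    qed
    assume k: "kY = Ordered"
    have "lord phi1 x = map (\<lambda>z. c (?B z)) (lord phi1 x)"
      using lmaps_ord_set[OF phi1] cB by (intro map_idI[symmetric]) blast
    also have "\<dots> = map c (map (\<lambda>y. (x, y)) (map (lfun f1) (lord phi1 x)))"
      using lmaps_ord_set[OF phi1] unfolding map_map o_def by (intro map_cong refl) auto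
    also have "map (lfun f1) (lord phi1 x) = lord phi (lfun f x)" using F x by blast
    also have "\<dots> = ordr kY phi (lfun f x)" using k by (simp add: ordr_def)
    finally show "?l = lord phi1 x" by simp
  qed
qed

text \<open>This is \<open>Cn_Mn_pairs\<close> for the corner named by pairs. The two resulting
  evaluations belong to \<open>f1\<close> and \<open>phi1\<close> in the orders of
  \<open>filler_corner\<close>, which are admissible and hence give the values \<open>M\<close> and
  \<open>C\<close>.\<close>

lemma C_M_filler:
  assumes F: "filler kX kY n m p q f1 f phi1 phi" and kX: "kcomm kX" and kY: "op.kcomm kY"
  shows "C kY phi \<odot> M kX f = M kX f1 \<odot> C kY phi1"
proof -
  let ?B = "\<lambda>z. (lfun phi1 z, lfun f1 z)"
  let ?D = "{(x, y). x \<in> {1..m} \<and> y \<in> {1..p} \<and> lfun f x = lfun phi y}"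
  note FD = F[unfolded filler_def]
  have f1: "f1 \<in> lmaps kX G n p" and phi1: "phi1 \<in> lmaps kY G n m" and f: "f \<in> lmaps kX G m q" and phi: "phi \<in> lmaps kY G p q"
    and B: "bij_betw ?B {1..n} ?D" using FD by blast+
  define c where "c = inv_into {1..n} ?B"
  define k where "k y = map (\<lambda>x. (x, y)) (ordr kX f (lfun phi y))" for y
  define l where "l x = map (\<lambda>y. (x, y)) (ordr kY phi (lfun f x))" for x
  note corner = filler_corner[OF F, folded c_def, folded k_def l_def]
  have cB: "c (?B z) = z" if "z \<in> {1..n}" for z using bij_betw_inv_into_left[OF B that] by (simp add: c_def)
  \<comment> \<open>The corner points are renamed by their two projections; injectivity of the
    renaming makes this invisible to the evaluations.\<close>
  let ?zs = "map ?B [1..<Suc n]"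
  have inj: "inj_on ?B (set [1..<Suc n])" unfolding set_rng using B by (rule bij_betw_imp_inj_on)
  have zmem: "\<exists>z\<in>{1..n}. w = ?B z" if "w \<in> set ?zs" for w using that unfolding set_map set_rng by blast
  have mz1: "mset ?zs = mset (concat (map k [1..<Suc p]))"
  proof -
    have "mset ?zs = mset (map ?B (concat (map (\<lambda>y. map c (k y)) [1..<Suc p])))"
      unfolding mset_map okord_mset[OF f1 corner(1)] ..
    also have "map ?B (concat (map (\<lambda>y. map c (k y)) [1..<Suc p])) = concat (map k [1..<Suc p])"
      unfolding map_concat map_map o_def using corner(3) unfolding map_map o_def
      by (intro arg_cong[where f = concat] map_cong refl) (simp only: set_rng)
    finally show ?thesis .
  qed
  have mz2: "mset ?zs = mset (concat (map l [1..<Suc m]))"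
  proof -
    have "mset ?zs = mset (map ?B (concat (map (\<lambda>y. map c (l y)) [1..<Suc m])))"
      unfolding mset_map okord_mset[OF phi1 corner(2)] ..
    also have "map ?B (concat (map (\<lambda>y. map c (l y)) [1..<Suc m])) = concat (map l [1..<Suc m])"
      unfolding map_concat map_map o_def using corner(4) unfolding map_map o_def
      by (intro arg_cong[where f = concat] map_cong refl) (simp only: set_rng)
    finally show ?thesis .
  qed
  let ?a = "\<lambda>w. llab f1 (c w)" and ?b = "\<lambda>w. llab phi1 (c w)"
  have main: "Cn [1..<Suc p] [1..<Suc q] (ordr kY phi) (llab phi) \<odot> Mn [1..<Suc m] [1..<Suc q] (ordr kX f) (llab f) =
    Mn ?zs [1..<Suc p] k ?a \<odot> Cn ?zs [1..<Suc m] l ?b"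
  proof (rule Cn_Mn_pairs)
    show "mset [1..<Suc m] = mset (concat (map (ordr kX f) [1..<Suc q]))" by (rule okord_mset[OF f okord_ordr[OF f]])
    show "mset [1..<Suc p] = mset (concat (map (ordr kY phi) [1..<Suc q]))" by (rule okord_mset[OF phi okord_ordr[OF phi]])
    show "distinct ?zs" using inj by (simp add: distinct_map)
    show "k y = map (\<lambda>x. (x, y)) (ordr kX f i)" if "i \<in> set [1..<Suc q]" "y \<in> set (ordr kY phi i)" for i y
    proof -
      have "lfun phi y = i" using okord_mem[OF okord_ordr[OF phi] _ that(2)] that(1) unfolding set_rng by blast
      then show ?thesis by (simp add: k_def)
    qed
    show "l x = map (\<lambda>y. (x, y)) (ordr kY phi i)" if "i \<in> set [1..<Suc q]" "x \<in> set (ordr kX f i)" for i x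
    proof -
      have "lfun f x = i" using okord_mem[OF okord_ordr[OF f] _ that(2)] that(1) unfolding set_rng by blast
      then show ?thesis by (simp add: l_def)
    qed
    show "llab f x \<in> carrier G" if "x \<in> set [1..<Suc m]" for x using that unfolding set_rng by (rule lmaps_lab[OF f])
    show "llab phi x \<in> carrier G" if "x \<in> set [1..<Suc p]" for x using that unfolding set_rng by (rule lmaps_lab[OF phi])
    show "?a w \<in> carrier G" if "w \<in> set ?zs" for w using zmem[OF that] cB lmaps_lab[OF f1] by auto
    show "?b w \<in> carrier G" if "w \<in> set ?zs" for w using zmem[OF that] cB lmaps_lab[OF phi1] by auto
    show "llab f x \<otimes> ?b (x, y) = llab phi y \<otimes> ?a (x, y)" if xy: "(x, y) \<in> set ?zs" for x y
    proof -
      obtain z where z: "z \<in> {1..n}" "(x, y) = ?B z" using zmem[OF xy] by blast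
      have "llab f (lfun phi1 z) \<otimes> llab phi1 z = llab phi (lfun f1 z) \<otimes> llab f1 z" using FD z(1) by blast
      then show ?thesis using z(2) cB[OF z(1)] by simp
    qed
  qed (use mz1 mz2 in simp_all)
  have e1: "Mn ?zs [1..<Suc p] k ?a = M kX f1"
  proof -
    have "Mn ?zs [1..<Suc p] k ?a = Mn ?zs [1..<Suc p] (\<lambda>y. map ?B (map c (k y))) ?a"
      by (rule Mn_cong) (use corner(3) in \<open>simp_all only: set_rng\<close>)
    also have "\<dots> = Mn [1..<Suc n] [1..<Suc p] (\<lambda>y. map c (k y)) (\<lambda>z. ?a (?B z))"
      by (rule Mn_map_in[OF okord_mset[OF f1 corner(1)] inj])
    also have "\<dots> = Mn [1..<Suc n] [1..<Suc p] (\<lambda>y. map c (k y)) (llab f1)"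
    proof (rule Mn_cong[OF refl])
      fix i z assume "i \<in> set [1..<Suc p]" "z \<in> set (map c (k i))"
      then have "z \<in> {1..n}" using okord_mem[OF corner(1)] unfolding set_rng by blast
      then show "?a (?B z) = llab f1 z" using cB by simp
    qed
    also have "\<dots> = M kX f1" by (rule M_eq[OF f1 corner(1) kX, symmetric])
    finally show ?thesis .
  qed
  have e2: "Cn ?zs [1..<Suc m] l ?b = C kY phi1"
  proof -
    have "Cn ?zs [1..<Suc m] l ?b = Cn ?zs [1..<Suc m] (\<lambda>y. map ?B (map c (l y))) ?b"
      by (rule op.Mn_cong) (use corner(4) in \<open>simp_all only: set_rng\<close>)
    also have "\<dots> = Cn [1..<Suc n] [1..<Suc m] (\<lambda>y. map c (l y)) (\<lambda>z. ?b (?B z))"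
      by (rule op.Mn_map_in[OF okord_mset[OF phi1 corner(2)] inj])
    also have "\<dots> = Cn [1..<Suc n] [1..<Suc m] (\<lambda>y. map c (l y)) (llab phi1)"
    proof (rule op.Mn_cong[OF refl])
      fix i z assume "i \<in> set [1..<Suc m]" "z \<in> set (map c (l i))"
      then have "z \<in> {1..n}" using okord_mem[OF corner(2)] unfolding set_rng by blast
      then show "?b (?B z) = llab phi1 z" using cB by simp
    qed
    also have "\<dots> = C kY phi1" by (rule op.M_eq[OF phi1 corner(2) kY, symmetric])
    finally show ?thesis .
  qed
  show ?thesis using main unfolding e1 e2 M_def op.M_def lmapsD(1,2)[OF f] lmapsD(1,2)[OF phi] .
qed

text \<open>A labelled permutation and the same permutation read backwards have inverse values. For
  this reason equivalent spans have the same value.\<close>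

lemma M_C_lperm:
  assumes h: "lperms p s c" and kX: "kcomm kX" and kY: "op.kcomm kY"
  shows "M kX (lperm kX p s c) \<odot> C kY (lperm kY p s c) = idn p"
proof -
  let ?t = "inv_into {1..p} s" and ?d = "\<lambda>x. inv (c (inv_into {1..p} s x))"
  have s: "bij_betw s {1..p} {1..p}" "c \<in> {1..p} \<rightarrow> carrier G" using h by (auto simp: lperms_def)
  have t: "bij_betw ?t {1..p} {1..p}" using s(1) by (rule bij_betw_inv_into)
  have d: "?d \<in> {1..p} \<rightarrow> carrier G" using s(2) inv_bij(1)[OF s(1)] by (auto simp del: atLeastAtMost_iff)
  let ?h = "\<lambda>k. lperm k p s c" and ?g = "lperm kX p ?t ?d"
  have hm: "?h k \<in> lmaps k G p p" for k by (rule lperm_lmaps[OF s])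
  have gm: "?g \<in> lmaps kX G p p" by (rule lperm_lmaps[OF t d])
  have sr: "s x \<in> {1..p}" "?t (s x) = x" "c x \<in> carrier G" if "x \<in> {1..p}" for x
    using bij_betw_apply[OF s(1) that] bij_betw_inv_into_left[OF s(1) that] s(2) that by (auto simp del: atLeastAtMost_iff)
  have "lcomp G (?h kX) ?g = lident kX G p"
  proof -
    have b: "bij_betw (s \<circ> ?t) {1..p} {1..p}" using t s(1) by (rule bij_betw_trans)
    have "lcomp G (?h kX) ?g = lperm kX p (s \<circ> ?t) (\<lambda>x. c (?t x) \<otimes> ?d x)"
      by (rule lcomp_lperm_lperm[OF t s(1) d s(2)])
    also have "\<dots> = lident kX G p" unfolding lident_def
      by (rule lperm_cong[OF b]) (use s(2) inv_bij(1,2)[OF s(1)] in \<open>auto simp: Pi_iff simp del: atLeastAtMost_iff One_nat_def\<close>)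
    finally show ?thesis .
  qed
  then have MM: "M kX (?h kX) \<odot> M kX ?g = idn p"
    using M_lcomp[OF gm hm kX] M_lident[OF kX, of p] by simp
  \<comment> \<open>The square with the permutation on both sides into the base and identities on
    the other two sides is a filler, since the permutation is injective. It yields the composite in
    one order; the inverse permutation yields a right inverse of \<open>M\<close>, which must then
    coincide with \<open>C\<close>.\<close>
  have "filler kX kY p p p p (lident kX G p) (?h kX) (lident kY G p) (?h kY)"
    unfolding filler_def
  proof (intro conjI ballI)
    have hf: "lfun (?h k) x = s x" "llab (?h k) x = c x" if "x \<in> {1..p}" for k x using that by (simp_all add: lperm_def)
    have i: "inj_on s {1..p}" using s(1) by (rule bij_betw_imp_inj_on)
    show "bij_betw (\<lambda>z. (lfun (lident kY G p) z, lfun (lident kX G p) z)) {1..p}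
       {(x, y). x \<in> {1..p} \<and> y \<in> {1..p} \<and> lfun (?h kX) x = lfun (?h kY) y}"
      by (rule bij_betwI[where g = fst])
        (use lident_sel(3) hf i in \<open>auto dest: inj_onD simp del: atLeastAtMost_iff One_nat_def\<close>)
    have ho: "lord (?h k) (s x) = (if k = Ordered then [x] else [])" if "x \<in> {1..p}" for k x
      using sr[OF that] by (simp add: lperm_def)
    show "map (lfun (lident kX G p)) (lord (lident kY G p) x) = lord (?h kY) (lfun (?h kX) x)" if "x \<in> {1..p}" for x
      using lident_sel(3,5)[OF that] hf[OF that] ho[OF that] by simp
    show "map (lfun (lident kY G p)) (lord (lident kX G p) x) = lord (?h kX) (lfun (?h kY) x)" if "x \<in> {1..p}" for x
      using lident_sel(3,5)[OF that] hf[OF that] ho[OF that] by simp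
    show "llab (?h kX) (lfun (lident kY G p) z) \<otimes> llab (lident kY G p) z = llab (?h kY) (lfun (lident kX G p) z) \<otimes> llab (lident kX G p) z" if "z \<in> {1..p}" for z
      using lident_sel(3,4)[OF that] hf[OF that] by simp
  qed (use hm in auto)
  from C_M_filler[OF this kX kY] have CM: "C kY (?h kY) \<odot> M kX (?h kX) = idn p"
    using M_lident[OF kX, of p] op.M_lident[OF kY, of p] by (simp add: idn_cmp)
  note hh = M_hom[OF hm, of kX] C_hom[OF hm, of kY] M_hom[OF gm]
  have "C kY (?h kY) = M kX ?g"
    by (rule inverse_unique[where f = "M kX (?h kX)"]) (use hh CM MM in \<open>simp_all add: hom_def\<close>)
  then show ?thesis using MM by simp
qed

definition ev :: "fibre_kind \<Rightarrow> fibre_kind \<Rightarrow> 'g span \<Rightarrow> 'e" where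
  "ev kX kY s = M kX (snd s) \<odot> C kY (fst s)"

text \<open>The middle component of an arrow is its class of spans. The value is taken at an
  arbitrary representative, and \<open>evc_cls\<close> shows that the choice is immaterial.\<close>

definition evc :: "fibre_kind \<Rightarrow> fibre_kind \<Rightarrow> 'g span_class \<Rightarrow> 'e" where
  "evc kX kY a = ev kX kY (SOME s. s \<in> fst (snd a))"

context
  fixes kX kY :: fibre_kind
  assumes kX: "kcomm kX" and kY: "op.kcomm kY"
begin

text \<open>Another representative inserts the forward and the backward value of one labelled
  permutation between the two evaluations; they cancel by \<open>M_C_lperm\<close>.\<close>

lemma evc_cls:
  assumes phi: "phi \<in> lmaps kY G p n" and f: "f \<in> lmaps kX G p m"
  shows "evc kX kY (cls kX kY n m (phi, f)) = M kX f \<odot> C kY phi"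
proof -
  let ?K = "span_equiv kX kY G n m `` {(phi, f)}"
  have e: "ev kX kY s = M kX f \<odot> C kY phi" if sK: "s \<in> ?K" for s
  proof -
    obtain phi' f' where s: "s = (phi', f')" by (cases s)
    obtain t c where t: "lperms p t c" "phi' = lcomp G phi (lperm kY p t c)" "f' = lcomp G f (lperm kX p t c)"
      using cls_memE[OF sK[unfolded s] phi f] by metis
    have h: "lperm k p t c \<in> lmaps k G p p" for k using t(1) by (auto simp: lperms_def intro!: lperm_lmaps)
    have "ev kX kY s = (M kX f \<odot> M kX (lperm kX p t c)) \<odot> (C kY (lperm kY p t c) \<odot> C kY phi)"
      unfolding ev_def s t fst_conv snd_conv M_lcomp[OF h f kX] op.M_lcomp[OF h phi kY] ..
    also have "\<dots> = M kX f \<odot> (M kX (lperm kX p t c) \<odot> C kY (lperm kY p t c)) \<odot> C kY phi"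
      using M_hom[OF f] M_hom[OF h, of kX] C_hom[OF h, of kY] C_hom[OF phi] by (simp add: hom_def cmp_assoc)
    also have "\<dots> = M kX f \<odot> C kY phi"
      unfolding M_C_lperm[OF t(1) kX kY] using C_hom[OF phi] by (simp add: hom_def idn_cmp)
    finally show ?thesis .
  qed
  have "(SOME s. s \<in> ?K) \<in> ?K" using in_cls[OF phi f] by (rule someI)
  from e[OF this] show ?thesis by (simp add: evc_def cls_def)
qed

lemma evc_hom:
  assumes "a \<in> Hom (composite_prop L kX kY G) n m"
  shows "hom (evc kX kY a) n m"
proof -
  obtain p phi f where a: "phi \<in> lmaps kY G p n" "f \<in> lmaps kX G p m" "a = cls kX kY n m (phi, f)"
    using assms by (rule cls_exhaust)
  show ?thesis unfolding a(3) evc_cls[OF a(1,2)] by (rule hom_cmp[OF C_hom[OF a(1)] M_hom[OF a(2)]])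
qed

text \<open>Composition of spans exchanges the inner legs by a filler; on values the same exchange
  is \<open>C_M_filler\<close>.\<close>

lemma evc_comp:
  assumes L: "L = Commuting \<or> L = Preserving \<and> comm_group G"
    and "a \<in> Hom (composite_prop L kX kY G) n m" "b \<in> Hom (composite_prop L kX kY G) m l"
  shows "evc kX kY (Comp (composite_prop L kX kY G) b a) = evc kX kY b \<odot> evc kX kY a"
proof -
  obtain p phi f where a: "phi \<in> lmaps kY G p n" "f \<in> lmaps kX G p m" "a = cls kX kY n m (phi, f)"
    using assms(2) by (rule cls_exhaust)
  obtain q psi g where b: "psi \<in> lmaps kY G q m" "g \<in> lmaps kX G q l" "b = cls kX kY m l (psi, g)"
    using assms(3) by (rule cls_exhaust)
  obtain f1 phi1 where "bimorphism L kX kY G f1 f phi1 psi" using bimorphism_exists[OF a(2) b(1) L] by metis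
  then obtain r where F: "filler kX kY r p q m f1 f phi1 psi" using bimorphism_imp_filler[OF _ L a(2) b(1)] by metis
  then have *: "f1 \<in> lmaps kX G r q" "phi1 \<in> lmaps kY G r p" by (auto simp: filler_def)
  note h = M_hom[OF b(2)] M_hom[OF *(1)] C_hom[OF *(2)] C_hom[OF a(1)] M_hom[OF a(2)] C_hom[OF b(1)]
  have "evc kX kY (Comp (composite_prop L kX kY G) b a) = M kX g \<odot> (M kX f1 \<odot> C kY phi1) \<odot> C kY phi"
    unfolding a(3) b(3) Comp_cls[OF F a(1) b(2) L] evc_cls[OF lcomp_lmaps[OF *(2) a(1)] lcomp_lmaps[OF *(1) b(2)]]
      M_lcomp[OF *(1) b(2) kX] op.M_lcomp[OF *(2) a(1) kY]
    using h by (simp add: hom_def cmp_assoc)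
  also have "\<dots> = evc kX kY b \<odot> evc kX kY a"
    unfolding a(3) b(3) C_M_filler[OF F kX kY, symmetric] evc_cls[OF a(1,2)] evc_cls[OF b(1,2)]
    using h by (simp add: hom_def cmp_assoc)
  finally show ?thesis .
qed

lemma evc_tensor:
  assumes "a \<in> Hom (composite_prop L kX kY G) n m" "b \<in> Hom (composite_prop L kX kY G) n' m'"
  shows "evc kX kY (TenA (composite_prop L kX kY G) a b) = evc kX kY a \<oslash> evc kX kY b"
proof -
  obtain p phi f where a: "phi \<in> lmaps kY G p n" "f \<in> lmaps kX G p m" "a = cls kX kY n m (phi, f)"
    using assms(1) by (rule cls_exhaust)
  obtain q psi g where b: "psi \<in> lmaps kY G q n'" "g \<in> lmaps kX G q m'" "b = cls kX kY n' m' (psi, g)"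
    using assms(2) by (rule cls_exhaust)
  note h = C_hom[OF a(1)] M_hom[OF a(2)] C_hom[OF b(1)] M_hom[OF b(2)]
  show ?thesis
    unfolding a(3) b(3) TenA_cls[OF a(1,2) b(1,2)] evc_cls[OF a(1,2)] evc_cls[OF b(1,2)]
      evc_cls[OF ltensor_lmaps[OF a(1) b(1)] ltensor_lmaps[OF a(2) b(2)]] M_ltensor[OF a(2) b(2) kX] op.M_ltensor[OF a(1) b(1) kY]
    using h by (simp add: hom_def interchange)
qed

lemma evc_incX: "f \<in> lmaps kX G n m \<Longrightarrow> evc kX kY (incX kX kY f) = M kX f"
  using M_hom[of f kX n m] by (simp add: incX_eq evc_cls[OF lident_lmaps] op.M_lident[OF kY] cmp_idn hom_def)

lemma evc_incY: "f \<in> lmaps kY G n m \<Longrightarrow> evc kX kY (incY kX kY f) = C kY f"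
  using C_hom[of f kY n m] by (simp add: incY_eq evc_cls[OF _ lident_lmaps] M_lident[OF kX] idn_cmp hom_def)

end

end

section \<open>Arrow calculus in symmetric monoidal categories\<close>

context category begin

lemma arr_comp: "\<lbrakk>f \<in> Arr C; g \<in> Arr C; Cod C f = Dom C g\<rbrakk> \<Longrightarrow> g \<cdot> f \<in> Arr C"
  and dom_comp: "\<lbrakk>f \<in> Arr C; g \<in> Arr C; Cod C f = Dom C g\<rbrakk> \<Longrightarrow> Dom C (g \<cdot> f) = Dom C f"
  and cod_comp: "\<lbrakk>f \<in> Arr C; g \<in> Arr C; Cod C f = Dom C g\<rbrakk> \<Longrightarrow> Cod C (g \<cdot> f) = Cod C g"
  using comp_closed[of f "Dom C f" "Cod C f" g "Cod C g"] by (auto simp: Hom_def)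

lemma comp_assoc_arr: "\<lbrakk>f \<in> Arr C; g \<in> Arr C; h \<in> Arr C; Cod C f = Dom C g; Cod C g = Dom C h\<rbrakk> \<Longrightarrow> (h \<cdot> g) \<cdot> f = h \<cdot> g \<cdot> f"
  using comp_assoc[of f "Dom C f" "Cod C f" g "Cod C g" h "Cod C h"] by (auto simp: Hom_def)

lemma ident_arr: "a \<in> Obj C \<Longrightarrow> Ident C a \<in> Arr C" "a \<in> Obj C \<Longrightarrow> Dom C (Ident C a) = a" "a \<in> Obj C \<Longrightarrow> Cod C (Ident C a) = a"
  using ident_closed[of a] by (auto simp: Hom_def)

lemma ident_comp: "\<lbrakk>f \<in> Arr C; Cod C f = a\<rbrakk> \<Longrightarrow> Ident C a \<cdot> f = f"
  and comp_ident: "\<lbrakk>f \<in> Arr C; Dom C f = a\<rbrakk> \<Longrightarrow> f \<cdot> Ident C a = f"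
  using comp_ident_left[of f "Dom C f" a] comp_ident_right[of f a "Cod C f"] by (auto simp: Hom_def)

lemma inverse_arrows_unique: "\<lbrakk>inverse_arrows C f g; inverse_arrows C f h\<rbrakk> \<Longrightarrow> g = h"
  unfolding inverse_arrows_def Hom_def mem_Collect_eq by (metis comp_assoc_arr comp_ident ident_comp)

lemma inverse_inv_arrow: "iso_arrow C f \<Longrightarrow> inverse_arrows C f (inv_arrow C f)"
  unfolding iso_arrow_def inv_arrow_def by (metis inverse_arrows_unique theI)

lemma inv_arrow_eq: "inverse_arrows C f g \<Longrightarrow> inv_arrow C f = g"
  using inverse_inv_arrow inverse_arrows_unique unfolding iso_arrow_def by blast

lemma iso_arr:
  assumes "iso_arrow C f"
  shows "f \<in> Arr C" "inv_arrow C f \<in> Arr C" "Dom C (inv_arrow C f) = Cod C f" "Cod C (inv_arrow C f) = Dom C f"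
    "inv_arrow C f \<cdot> f = Ident C (Dom C f)" "f \<cdot> inv_arrow C f = Ident C (Cod C f)"
  using inverse_inv_arrow[OF assms] by (auto simp: inverse_arrows_def Hom_def)

lemma inv_comp_cancel:
  assumes "iso_arrow C f" "x \<in> Arr C"
  shows "Cod C x = Dom C f \<Longrightarrow> inv_arrow C f \<cdot> f \<cdot> x = x" "Cod C x = Cod C f \<Longrightarrow> f \<cdot> inv_arrow C f \<cdot> x = x"
proof -
  note i = iso_arr[OF assms(1)]
  show "inv_arrow C f \<cdot> f \<cdot> x = x" if "Cod C x = Dom C f"
  proof -
    have "inv_arrow C f \<cdot> f \<cdot> x = (inv_arrow C f \<cdot> f) \<cdot> x"
      by (rule comp_assoc_arr[symmetric]) (use assms(2) i that in simp_all)
    then show ?thesis unfolding i(5) using ident_comp[OF assms(2) that] by simp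
  qed
  show "f \<cdot> inv_arrow C f \<cdot> x = x" if "Cod C x = Cod C f"
  proof -
    have "f \<cdot> inv_arrow C f \<cdot> x = (f \<cdot> inv_arrow C f) \<cdot> x"
      by (rule comp_assoc_arr[symmetric]) (use assms(2) i that in simp_all)
    then show ?thesis unfolding i(6) using ident_comp[OF assms(2) that] by simp
  qed
qed

lemma iso_cancel_right:
  assumes eq: "x \<cdot> e = y \<cdot> e" and e: "iso_arrow C e" and a: "x \<in> Arr C" "y \<in> Arr C" "Dom C x = Cod C e" "Dom C y = Cod C e"
  shows "x = y"
proof -
  have "x = (x \<cdot> e) \<cdot> inv_arrow C e" using a(1,3) iso_arr[OF e] by (simp add: comp_assoc_arr comp_ident)
  also have "\<dots> = (y \<cdot> e) \<cdot> inv_arrow C e" unfolding eq ..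
  also have "\<dots> = y" using a(2,4) iso_arr[OF e] by (simp add: comp_assoc_arr comp_ident)
  finally show ?thesis .
qed

lemma iso_cancel_left:
  assumes eq: "e \<cdot> x = e \<cdot> y" and e: "iso_arrow C e" and a: "x \<in> Arr C" "y \<in> Arr C" "Cod C x = Dom C e" "Cod C y = Dom C e"
  shows "x = y"
proof -
  have "x = inv_arrow C e \<cdot> e \<cdot> x" using inv_comp_cancel(1)[OF e a(1,3)] by simp
  also have "\<dots> = inv_arrow C e \<cdot> e \<cdot> y" unfolding eq ..
  also have "\<dots> = y" using inv_comp_cancel(1)[OF e a(2,4)] .
  finally show ?thesis .
qed

lemma iso_comp:
  assumes f: "iso_arrow C f" and g: "iso_arrow C g" and "Cod C f = Dom C g"
  shows "iso_arrow C (g \<cdot> f)"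
  unfolding iso_arrow_def inverse_arrows_def
  by (rule exI[of _ "inv_arrow C f \<cdot> inv_arrow C g"])
    (use assms iso_arr[OF f] iso_arr[OF g] in \<open>simp add: Hom_def arr_comp dom_comp cod_comp comp_assoc_arr inv_comp_cancel\<close>)

lemma iso_inv: "iso_arrow C f \<Longrightarrow> iso_arrow C (inv_arrow C f)"
  unfolding iso_arrow_def[of C "inv_arrow C f"] inverse_arrows_def
  by (rule exI[of _ f]) (simp add: iso_arr Hom_def)

lemma iso_ident: "a \<in> Obj C \<Longrightarrow> iso_arrow C (Ident C a)"
  unfolding iso_arrow_def inverse_arrows_def
  by (rule exI[of _ "Ident C a"]) (simp add: ident_arr Hom_def ident_comp)

end

context symmetric_monoidal_category begin

lemma ten_arr_simps: "\<lbrakk>f \<in> Arr C; g \<in> Arr C\<rbrakk> \<Longrightarrow> f \<boxtimes> g \<in> Arr C"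
  "\<lbrakk>f \<in> Arr C; g \<in> Arr C\<rbrakk> \<Longrightarrow> Dom C (f \<boxtimes> g) = Dom C f \<boxdot> Dom C g" "\<lbrakk>f \<in> Arr C; g \<in> Arr C\<rbrakk> \<Longrightarrow> Cod C (f \<boxtimes> g) = Cod C f \<boxdot> Cod C g"
  using ten_arr[of f "Dom C f" "Cod C f" g "Dom C g" "Cod C g"] by (auto simp: Hom_def)

lemma ten_interchange: "\<lbrakk>f \<in> Arr C; f' \<in> Arr C; g \<in> Arr C; g' \<in> Arr C; Cod C f = Dom C f'; Cod C g = Dom C g'\<rbrakk> \<Longrightarrow>
    (f' \<boxtimes> g') \<cdot> (f \<boxtimes> g) = (f' \<cdot> f) \<boxtimes> (g' \<cdot> g)"
  using ten_comp[of f "Dom C f" "Cod C f" f' "Cod C f'" g "Dom C g" "Cod C g" g' "Cod C g'"] by (auto simp: Hom_def)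

lemma ten_interchange_comp: "\<lbrakk>f \<in> Arr C; f' \<in> Arr C; g \<in> Arr C; g' \<in> Arr C; x \<in> Arr C; Cod C f = Dom C f'; Cod C g = Dom C g';
    Cod C x = Dom C f \<boxdot> Dom C g\<rbrakk> \<Longrightarrow> (f' \<boxtimes> g') \<cdot> (f \<boxtimes> g) \<cdot> x = ((f' \<cdot> f) \<boxtimes> (g' \<cdot> g)) \<cdot> x"
  by (simp add: comp_assoc_arr[symmetric] ten_arr_simps ten_interchange)

lemma assoc_simps:
  assumes "a \<in> Obj C" "b \<in> Obj C" "c \<in> Obj C"
  shows "Assoc C a b c \<in> Arr C" "Dom C (Assoc C a b c) = (a \<boxdot> b) \<boxdot> c" "Cod C (Assoc C a b c) = a \<boxdot> b \<boxdot> c" "iso_arrow C (Assoc C a b c)"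
  using assoc_arr[OF assms] by (auto simp: Hom_def)

lemma lunit_simps: "a \<in> Obj C \<Longrightarrow> LUnit C a \<in> Arr C" "a \<in> Obj C \<Longrightarrow> Dom C (LUnit C a) = TUnit C \<boxdot> a" "a \<in> Obj C \<Longrightarrow> Cod C (LUnit C a) = a"
    "a \<in> Obj C \<Longrightarrow> iso_arrow C (LUnit C a)"
  and runit_simps: "a \<in> Obj C \<Longrightarrow> RUnit C a \<in> Arr C" "a \<in> Obj C \<Longrightarrow> Dom C (RUnit C a) = a \<boxdot> TUnit C" "a \<in> Obj C \<Longrightarrow> Cod C (RUnit C a) = a"
    "a \<in> Obj C \<Longrightarrow> iso_arrow C (RUnit C a)"
  using lunit_arr[of a] runit_arr[of a] by (auto simp: Hom_def)

lemma braid_simps: "\<lbrakk>a \<in> Obj C; b \<in> Obj C\<rbrakk> \<Longrightarrow> Braid C a b \<in> Arr C" "\<lbrakk>a \<in> Obj C; b \<in> Obj C\<rbrakk> \<Longrightarrow> Dom C (Braid C a b) = a \<boxdot> b"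
    "\<lbrakk>a \<in> Obj C; b \<in> Obj C\<rbrakk> \<Longrightarrow> Cod C (Braid C a b) = b \<boxdot> a"
  using braid_arr[of a b] by (auto simp: Hom_def)

lemmas arrow_simps = arr_comp dom_comp cod_comp comp_assoc_arr ident_arr ident_comp comp_ident iso_arr inv_comp_cancel
  ten_arr_simps assoc_simps lunit_simps runit_simps braid_simps unit_obj ten_obj dom_closed cod_closed ten_ident

lemma assoc_nat_arr: "\<lbrakk>f \<in> Arr C; g \<in> Arr C; h \<in> Arr C\<rbrakk> \<Longrightarrow>
    Assoc C (Cod C f) (Cod C g) (Cod C h) \<cdot> ((f \<boxtimes> g) \<boxtimes> h) = (f \<boxtimes> g \<boxtimes> h) \<cdot> Assoc C (Dom C f) (Dom C g) (Dom C h)"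
  using assoc_natural[of f _ _ g _ _ h] by (auto simp: Hom_def)

lemma braid_nat_arr: "\<lbrakk>f \<in> Arr C; g \<in> Arr C\<rbrakk> \<Longrightarrow> Braid C (Cod C f) (Cod C g) \<cdot> (f \<boxtimes> g) = (g \<boxtimes> f) \<cdot> Braid C (Dom C f) (Dom C g)"
  using braid_natural[of f _ _ g] by (auto simp: Hom_def)

lemma lunit_nat_arr: "f \<in> Arr C \<Longrightarrow> LUnit C (Cod C f) \<cdot> (Ident C (TUnit C) \<boxtimes> f) = f \<cdot> LUnit C (Dom C f)"
  and runit_nat_arr: "f \<in> Arr C \<Longrightarrow> RUnit C (Cod C f) \<cdot> (f \<boxtimes> Ident C (TUnit C)) = f \<cdot> RUnit C (Dom C f)"
  using lunit_natural[of f] runit_natural[of f] by (auto simp: Hom_def)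

lemma iso_ten:
  assumes f: "iso_arrow C f" and g: "iso_arrow C g"
  shows "iso_arrow C (f \<boxtimes> g)"
  unfolding iso_arrow_def inverse_arrows_def
  by (rule exI[of _ "inv_arrow C f \<boxtimes> inv_arrow C g"])
    (use iso_arr[OF f] iso_arr[OF g] in \<open>simp add: Hom_def ten_arr_simps ten_interchange ten_ident dom_closed cod_closed\<close>)

end

section \<open>Strictification by a coherent family of objects\<close>

text \<open>The data of a strong monoidal functor from the discrete monoidal category of natural
  numbers: no naturality enters, only the coherence of \<open>c\<close> and
  \<open>u\<close>.\<close>

locale tensor_family = symmetric_monoidal_category S
  for S :: "('o, 'a, 'z) smc_scheme" (structure) +
  fixes T :: "nat \<Rightarrow> 'o" and u :: 'a and c :: "nat \<Rightarrow> nat \<Rightarrow> 'a"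
  assumes T_obj [simp]: "T n \<in> Obj S"
    and u_hom: "u \<in> Hom S (TUnit S) (T 0)" and u_iso: "iso_arrow S u"
    and c_hom: "c m n \<in> Hom S (T m \<boxdot> T n) (T (m + n))" and c_iso: "iso_arrow S (c m n)"
    and c_assoc: "c (k + m) n \<cdot> (c k m \<boxtimes> Ident S (T n)) = c k (m + n) \<cdot> (Ident S (T k) \<boxtimes> c m n) \<cdot> Assoc S (T k) (T m) (T n)"
    and c_lunit: "c 0 n \<cdot> (u \<boxtimes> Ident S (T n)) = LUnit S (T n)"
    and c_runit: "c n 0 \<cdot> (Ident S (T n) \<boxtimes> u) = RUnit S (T n)"
begin

lemma c_simps: "c m n \<in> Arr S" "Dom S (c m n) = T m \<boxdot> T n" "Cod S (c m n) = T (m + n)"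
  using c_hom[of m n] by (auto simp: Hom_def)

lemma u_simps: "u \<in> Arr S" "Dom S u = TUnit S" "Cod S u = T 0"
  using u_hom by (auto simp: Hom_def)

lemmas fam_simps = arrow_simps c_simps u_simps c_iso u_iso ten_interchange ten_interchange_comp

text \<open>Arrows from \<open>T n\<close> to \<open>T m\<close> are stored together with
  \<open>n\<close> and \<open>m\<close>: \<open>T\<close> may fail to be injective, and then the
  arities cannot be recovered from the objects.\<close>

definition arE :: "nat \<times> 'a \<times> nat \<Rightarrow> bool" where
  "arE = (\<lambda>(n, f, m). f \<in> Arr S \<and> Dom S f = T n \<and> Cod S f = T m)"
definition dmE :: "nat \<times> 'a \<times> nat \<Rightarrow> nat" where "dmE = fst"
definition cdE :: "nat \<times> 'a \<times> nat \<Rightarrow> nat" where "cdE = (\<lambda>e. snd (snd e))"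
definition cmpE :: "nat \<times> 'a \<times> nat \<Rightarrow> nat \<times> 'a \<times> nat \<Rightarrow> nat \<times> 'a \<times> nat" where
  "cmpE = (\<lambda>(_, g, l) (n, f, _). (n, g \<cdot> f, l))"
definition tenE :: "nat \<times> 'a \<times> nat \<Rightarrow> nat \<times> 'a \<times> nat \<Rightarrow> nat \<times> 'a \<times> nat" where
  "tenE = (\<lambda>(n, f, m) (n', f', m'). (n + n', c m m' \<cdot> (f \<boxtimes> f') \<cdot> inv_arrow S (c n n'), m + m'))"
definition idE :: "nat \<Rightarrow> nat \<times> 'a \<times> nat" where "idE n = (n, Ident S (T n), n)"
definition brE :: "nat \<Rightarrow> nat \<Rightarrow> nat \<times> 'a \<times> nat" where
  "brE m n = (m + n, c n m \<cdot> Braid S (T m) (T n) \<cdot> inv_arrow S (c m n), n + m)"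

lemmas E_defs = arE_def dmE_def cdE_def cmpE_def tenE_def idE_def brE_def

lemma c_assoc_comp:
  assumes "x \<in> Arr S" "Cod S x = (T k \<boxdot> T m) \<boxdot> T n"
  shows "c (k + m) n \<cdot> (c k m \<boxtimes> Ident S (T n)) \<cdot> x = c k (m + n) \<cdot> (Ident S (T k) \<boxtimes> c m n) \<cdot> Assoc S (T k) (T m) (T n) \<cdot> x"
proof -
  have "c (k + m) n \<cdot> (c k m \<boxtimes> Ident S (T n)) \<cdot> x = (c (k + m) n \<cdot> (c k m \<boxtimes> Ident S (T n))) \<cdot> x"
    using assms by (simp add: fam_simps)
  then show ?thesis unfolding c_assoc using assms by (simp add: fam_simps)
qed

lemma c3_iso: "iso_arrow S (c (k + m) n \<cdot> (c k m \<boxtimes> Ident S (T n)))"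
  by (intro iso_comp iso_ten c_iso iso_ident) (simp_all add: fam_simps)

text \<open>Both sides are compared after precomposition with the isomorphism that joins three
  factors from the left. There \<open>c_assoc\<close> introduces the associator, and its naturality
  moves the three arrows across.\<close>

lemma tenE_assoc:
  assumes "arE e" "arE e'" "arE e''"
  shows "tenE (tenE e e') e'' = tenE e (tenE e' e'')"
proof -
  obtain n f m n' f' m' n'' f'' m'' where e: "e = (n, f, m)" "e' = (n', f', m')" "e'' = (n'', f'', m'')"
    by (metis prod_cases3)
  have f: "f \<in> Arr S" "Dom S f = T n" "Cod S f = T m" "f' \<in> Arr S" "Dom S f' = T n'" "Cod S f' = T m'"
    "f'' \<in> Arr S" "Dom S f'' = T n''" "Cod S f'' = T m''"
    using assms by (auto simp: e arE_def)
  let ?L = "c (m + m') m'' \<cdot> ((c m m' \<cdot> (f \<boxtimes> f') \<cdot> inv_arrow S (c n n')) \<boxtimes> f'') \<cdot> inv_arrow S (c (n + n') n'')"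
  let ?R = "c m (m' + m'') \<cdot> (f \<boxtimes> (c m' m'' \<cdot> (f' \<boxtimes> f'') \<cdot> inv_arrow S (c n' n''))) \<cdot> inv_arrow S (c n (n' + n''))"
  let ?c = "c (n + n') n'' \<cdot> (c n n' \<boxtimes> Ident S (T n''))"
  have "?L \<cdot> ?c = c (m + m') m'' \<cdot> ((c m m' \<cdot> (f \<boxtimes> f')) \<boxtimes> f'')"
    using f by (simp add: fam_simps)
  also have "\<dots> = c (m + m') m'' \<cdot> (c m m' \<boxtimes> Ident S (T m'')) \<cdot> ((f \<boxtimes> f') \<boxtimes> f'')"
    using f by (simp add: fam_simps)
  also have "\<dots> = c m (m' + m'') \<cdot> (Ident S (T m) \<boxtimes> c m' m'') \<cdot> Assoc S (T m) (T m') (T m'') \<cdot> ((f \<boxtimes> f') \<boxtimes> f'')"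
    by (rule c_assoc_comp) (use f in \<open>simp_all add: fam_simps\<close>)
  also have "Assoc S (T m) (T m') (T m'') \<cdot> ((f \<boxtimes> f') \<boxtimes> f'') = (f \<boxtimes> f' \<boxtimes> f'') \<cdot> Assoc S (T n) (T n') (T n'')"
    using assoc_nat_arr[OF f(1,4,7)] f by simp
  also have "c m (m' + m'') \<cdot> (Ident S (T m) \<boxtimes> c m' m'') \<cdot> (f \<boxtimes> f' \<boxtimes> f'') \<cdot> Assoc S (T n) (T n') (T n'') = ?R \<cdot> ?c"
    unfolding c_assoc using f by (simp add: fam_simps)
  finally have "?L = ?R"
    by (rule iso_cancel_right[OF _ c3_iso]) (use f in \<open>simp_all add: fam_simps add.assoc\<close>)
  then show ?thesis by (simp add: e E_defs add.assoc)
qed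

text \<open>Precomposition with \<open>u\<close> in the slot of \<open>T 0\<close> turns
  \<open>c 0 n\<close> and \<open>c n 0\<close> into the unit isomorphisms of \<open>S\<close>,
  whose naturality gives the claim.\<close>

lemma tenE_id0:
  assumes "arE e"
  shows "tenE (idE 0) e = e" "tenE e (idE 0) = e"
proof -
  obtain n f m where e: "e = (n, f, m)" by (metis prod_cases3)
  have f: "f \<in> Arr S" "Dom S f = T n" "Cod S f = T m" using assms by (auto simp: e arE_def)
  have i: "iso_arrow S (u \<boxtimes> Ident S (T n))" "iso_arrow S (Ident S (T n) \<boxtimes> u)" by (intro iso_ten u_iso iso_ident T_obj)+
  have "(c 0 m \<cdot> (Ident S (T 0) \<boxtimes> f)) \<cdot> (u \<boxtimes> Ident S (T n)) = (c 0 m \<cdot> (u \<boxtimes> Ident S (T m))) \<cdot> (Ident S (TUnit S) \<boxtimes> f)"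
    using f by (simp add: fam_simps)
  also have "\<dots> = f \<cdot> LUnit S (T n)" unfolding c_lunit using lunit_nat_arr[OF f(1)] f by simp
  also have "\<dots> = (f \<cdot> c 0 n) \<cdot> (u \<boxtimes> Ident S (T n))" using c_lunit[of n] f by (simp add: fam_simps del: ten_interchange)
  finally have "c 0 m \<cdot> (Ident S (T 0) \<boxtimes> f) = f \<cdot> c 0 n"
    by (rule iso_cancel_right[OF _ i(1)]) (use f in \<open>simp_all add: fam_simps\<close>)
  then have "(c 0 m \<cdot> (Ident S (T 0) \<boxtimes> f)) \<cdot> inv_arrow S (c 0 n) = f" using f by (simp add: fam_simps)
  then show "tenE (idE 0) e = e" using f by (simp add: e E_defs fam_simps)
  have "(c m 0 \<cdot> (f \<boxtimes> Ident S (T 0))) \<cdot> (Ident S (T n) \<boxtimes> u) = (c m 0 \<cdot> (Ident S (T m) \<boxtimes> u)) \<cdot> (f \<boxtimes> Ident S (TUnit S))"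
    using f by (simp add: fam_simps)
  also have "\<dots> = f \<cdot> RUnit S (T n)" unfolding c_runit using runit_nat_arr[OF f(1)] f by simp
  also have "\<dots> = (f \<cdot> c n 0) \<cdot> (Ident S (T n) \<boxtimes> u)" using c_runit[of n] f by (simp add: fam_simps del: ten_interchange)
  finally have "c m 0 \<cdot> (f \<boxtimes> Ident S (T 0)) = f \<cdot> c n 0"
    by (rule iso_cancel_right[OF _ i(2)]) (use f in \<open>simp_all add: fam_simps\<close>)
  then have "(c m 0 \<cdot> (f \<boxtimes> Ident S (T 0))) \<cdot> inv_arrow S (c n 0) = f" using f by (simp add: fam_simps)
  then show "tenE e (idE 0) = e" using f by (simp add: e E_defs fam_simps)
qed

text \<open>The hexagon of \<open>S\<close>, transported along \<open>c\<close>. The uses of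
  \<open>c_assoc\<close> supply the associators that the strict hexagon hides.\<close>

lemma brE_add: "brE k (m + n) = cmpE (tenE (idE m) (brE k n)) (tenE (brE k m) (idE n))"
proof -
  let ?K = "T k" and ?M = "T m" and ?N = "T n"
  let ?L = "c (m + n) k \<cdot> Braid S ?K (T (m + n)) \<cdot> inv_arrow S (c k (m + n))"
  let ?R1 = "c m (n + k) \<cdot> (Ident S ?M \<boxtimes> (c n k \<cdot> Braid S ?K ?N \<cdot> inv_arrow S (c k n))) \<cdot> inv_arrow S (c m (k + n))"
  let ?R2 = "c (m + k) n \<cdot> ((c m k \<cdot> Braid S ?K ?M \<cdot> inv_arrow S (c k m)) \<boxtimes> Ident S ?N) \<cdot> inv_arrow S (c (k + m) n)"
  let ?c = "c (k + m) n \<cdot> (c k m \<boxtimes> Ident S ?N)"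
  have bn: "Braid S ?K (T (m + n)) \<cdot> (Ident S ?K \<boxtimes> c m n) = (c m n \<boxtimes> Ident S ?K) \<cdot> Braid S ?K (?M \<boxdot> ?N)"
    using braid_nat_arr[of "Ident S ?K" "c m n"] by (simp add: fam_simps)
  have hx: "Assoc S ?M ?N ?K \<cdot> Braid S ?K (?M \<boxdot> ?N) \<cdot> Assoc S ?K ?M ?N
      = (Ident S ?M \<boxtimes> Braid S ?K ?N) \<cdot> Assoc S ?M ?K ?N \<cdot> (Braid S ?K ?M \<boxtimes> Ident S ?N)"
    by (rule hexagon) simp_all
  have "?L \<cdot> ?c = c (m + n) k \<cdot> (Braid S ?K (T (m + n)) \<cdot> (Ident S ?K \<boxtimes> c m n)) \<cdot> Assoc S ?K ?M ?N"
    unfolding c_assoc by (simp add: fam_simps)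
  also have "\<dots> = c (m + n) k \<cdot> (c m n \<boxtimes> Ident S ?K) \<cdot> Braid S ?K (?M \<boxdot> ?N) \<cdot> Assoc S ?K ?M ?N"
    unfolding bn by (simp add: fam_simps)
  also have "\<dots> = c m (n + k) \<cdot> (Ident S ?M \<boxtimes> c n k) \<cdot> Assoc S ?M ?N ?K \<cdot> Braid S ?K (?M \<boxdot> ?N) \<cdot> Assoc S ?K ?M ?N"
    by (rule c_assoc_comp) (simp_all add: fam_simps)
  also have "\<dots> = c m (n + k) \<cdot> (Ident S ?M \<boxtimes> (c n k \<cdot> Braid S ?K ?N)) \<cdot> Assoc S ?M ?K ?N \<cdot> (Braid S ?K ?M \<boxtimes> Ident S ?N)"
    unfolding hx by (simp add: fam_simps)
  also have "\<dots> = ?R1 \<cdot> c m (k + n) \<cdot> (Ident S ?M \<boxtimes> c k n) \<cdot> Assoc S ?M ?K ?N \<cdot> (Braid S ?K ?M \<boxtimes> Ident S ?N)"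
    by (simp add: fam_simps)
  also have "c m (k + n) \<cdot> (Ident S ?M \<boxtimes> c k n) \<cdot> Assoc S ?M ?K ?N \<cdot> (Braid S ?K ?M \<boxtimes> Ident S ?N) =
     c (m + k) n \<cdot> (c m k \<boxtimes> Ident S ?N) \<cdot> (Braid S ?K ?M \<boxtimes> Ident S ?N)"
    by (rule c_assoc_comp[symmetric]) (simp_all add: fam_simps)
  also have "?R1 \<cdot> \<dots> = (?R1 \<cdot> ?R2) \<cdot> ?c"
    by (simp add: fam_simps add.assoc)
  finally have "?L = ?R1 \<cdot> ?R2"
    by (rule iso_cancel_right[OF _ c3_iso]) (simp_all add: fam_simps add.assoc)
  then show ?thesis by (simp add: E_defs add.assoc)
qed

sublocale E: strict_prop arE dmE cdE cmpE tenE idE brE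
proof
  fix e e' e'' f f' :: "nat \<times> 'a \<times> nat" and m n k a b a' b' :: nat
  show "arE (idE n)" "dmE (idE n) = n" "cdE (idE n) = n" by (simp_all add: E_defs fam_simps)
  show "arE (brE m n)" "dmE (brE m n) = m + n" "cdE (brE m n) = n + m" by (simp_all add: E_defs fam_simps)
  show "arE (cmpE e' e)" "dmE (cmpE e' e) = dmE e" "cdE (cmpE e' e) = cdE e'" if "arE e" "arE e'" "cdE e = dmE e'"
    using that by (auto simp: E_defs fam_simps split: prod.splits)
  show "cmpE (cmpE e'' e') e = cmpE e'' (cmpE e' e)" if "arE e" "arE e'" "arE e''" "cdE e = dmE e'" "cdE e' = dmE e''"
    using that by (auto simp: E_defs fam_simps split: prod.splits)
  show "cmpE (idE n) e = e" if "arE e" "cdE e = n" using that by (auto simp: E_defs fam_simps split: prod.splits)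
  show "cmpE e (idE n) = e" if "arE e" "dmE e = n" using that by (auto simp: E_defs fam_simps split: prod.splits)
  show "arE (tenE e e')" "dmE (tenE e e') = dmE e + dmE e'" "cdE (tenE e e') = cdE e + cdE e'" if "arE e" "arE e'"
    using that by (auto simp: E_defs fam_simps split: prod.splits)
  show "tenE (tenE e e') e'' = tenE e (tenE e' e'')" if "arE e" "arE e'" "arE e''" using that by (rule tenE_assoc)
  show "tenE (idE 0) e = e" "tenE e (idE 0) = e" if "arE e" using that by (simp_all add: tenE_id0)
  show "tenE (idE m) (idE n) = idE (m + n)" by (simp add: E_defs fam_simps)
  show "cmpE (tenE e' f') (tenE e f) = tenE (cmpE e' e) (cmpE f' f)"
    if "arE e" "arE e'" "arE f" "arE f'" "cdE e = dmE e'" "cdE f = dmE f'"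
    using that by (auto simp: E_defs fam_simps split: prod.splits)
  show "cmpE (brE a' b') (tenE e f) = cmpE (tenE f e) (brE a b)"
    if H: "arE e" "arE f" "dmE e = a" "cdE e = a'" "dmE f = b" "cdE f = b'"
  proof -
    obtain x y where e: "e = (a, x, a')" "f = (b, y, b')" using H by (auto simp: E_defs split: prod.splits)
    have xy: "x \<in> Arr S" "Dom S x = T a" "Cod S x = T a'" "y \<in> Arr S" "Dom S y = T b" "Cod S y = T b'"
      using H by (auto simp: e arE_def)
    have "(Braid S (T a') (T b') \<cdot> (x \<boxtimes> y)) \<cdot> inv_arrow S (c a b) = ((y \<boxtimes> x) \<cdot> Braid S (T a) (T b)) \<cdot> inv_arrow S (c a b)"
      using braid_nat_arr[OF xy(1,4)] xy by simp
    then show ?thesis using xy by (simp add: e E_defs fam_simps)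
  qed
  show "cmpE (brE n m) (brE m n) = idE (m + n)"
  proof -
    have "(Braid S (T n) (T m) \<cdot> Braid S (T m) (T n)) \<cdot> inv_arrow S (c m n) = inv_arrow S (c m n)"
      using symmetry[of "T m" "T n"] by (simp add: fam_simps)
    then show ?thesis by (simp add: E_defs fam_simps)
  qed
  show "brE a (b + k) = cmpE (tenE (idE b) (brE a k)) (tenE (brE a b) (idE k))" by (rule brE_add)
qed

text \<open>A presentation of an object \<open>a\<close> is an isomorphism from \<open>a\<close> to some \<open>T n\<close>. Conjugating with
  presentations turns every structure arrow of \<open>S\<close> into an arrow of the strict PROP.\<close>

definition pres :: "nat \<times> 'a \<Rightarrow> 'o \<Rightarrow> bool" where
  "pres p a \<longleftrightarrow> iso_arrow S (snd p) \<and> Dom S (snd p) = a \<and> Cod S (snd p) = T (fst p)"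

definition pten :: "nat \<times> 'a \<Rightarrow> nat \<times> 'a \<Rightarrow> nat \<times> 'a" where
  "pten p q = (fst p + fst q, c (fst p) (fst q) \<cdot> (snd p \<boxtimes> snd q))"

definition rep :: "nat \<times> 'a \<Rightarrow> nat \<times> 'a \<Rightarrow> 'a \<Rightarrow> nat \<times> 'a \<times> nat \<Rightarrow> bool" where
  "rep p q f e \<longleftrightarrow> pres p (Dom S f) \<and> pres q (Cod S f) \<and> f \<in> Arr S \<and> e = (fst p, snd q \<cdot> f \<cdot> inv_arrow S (snd p), fst q)"

lemma pres_ten:
  assumes "pres p a" "pres q b"
  shows "pres (pten p q) (a \<boxdot> b)"
proof -
  have "iso_arrow S (c (fst p) (fst q) \<cdot> (snd p \<boxtimes> snd q))"
    by (intro iso_comp iso_ten c_iso) (use assms in \<open>simp_all add: pres_def fam_simps\<close>)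
  then show ?thesis using assms by (simp add: pres_def pten_def fam_simps)
qed

lemma inv_pten:
  assumes "pres p a" "pres q b"
  shows "inv_arrow S (snd (pten p q)) = (inv_arrow S (snd p) \<boxtimes> inv_arrow S (snd q)) \<cdot> inv_arrow S (c (fst p) (fst q))"
proof (rule inv_arrow_eq)
  have i: "iso_arrow S (snd p)" "iso_arrow S (snd q)" using assms by (simp_all add: pres_def)
  show "inverse_arrows S (snd (pten p q)) ((inv_arrow S (snd p) \<boxtimes> inv_arrow S (snd q)) \<cdot> inv_arrow S (c (fst p) (fst q)))"
    using assms i iso_arr[OF i(1)] iso_arr[OF i(2)] unfolding inverse_arrows_def Hom_def pten_def pres_def
    by (auto simp: fam_simps)
qed

lemma rep_ar: "rep p q f e \<Longrightarrow> arE e \<and> dmE e = fst p \<and> cdE e = fst q"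
  unfolding rep_def pres_def by (auto simp: E_defs fam_simps)

lemma rep_exists: "\<lbrakk>pres p a; pres q b; f \<in> Hom S a b\<rbrakk> \<Longrightarrow> rep p q f (fst p, snd q \<cdot> f \<cdot> inv_arrow S (snd p), fst q)"
  by (simp add: rep_def Hom_def)

text \<open>Conjugation with isomorphisms is injective, so an equation in \<open>S\<close> holds if
  and only if it holds for representatives in the strict PROP. The bimonoid diagrams are decided in
  this way.\<close>

lemma rep_eq_iff:
  assumes "rep p q f e" "rep p q f' e'"
  shows "f = f' \<longleftrightarrow> e = e'"
proof
  assume "e = e'"
  then have "snd q \<cdot> f \<cdot> inv_arrow S (snd p) = snd q \<cdot> f' \<cdot> inv_arrow S (snd p)" using assms by (simp add: rep_def)
  then have "f \<cdot> inv_arrow S (snd p) = f' \<cdot> inv_arrow S (snd p)"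
    by (rule iso_cancel_left[where e = "snd q"]) (use assms in \<open>simp_all add: rep_def pres_def fam_simps\<close>)
  then show "f = f'"
    by (rule iso_cancel_right[where e = "inv_arrow S (snd p)"]) (use assms in \<open>simp_all add: rep_def pres_def fam_simps iso_inv\<close>)
qed (use assms in \<open>simp add: rep_def\<close>)

lemma rep_comp:
  assumes "rep p q f e" "rep q r g e'"
  shows "rep p r (g \<cdot> f) (cmpE e' e)"
  using assms unfolding rep_def pres_def by (auto simp: E_defs fam_simps)

lemma rep_ten:
  assumes a: "rep p q f e" and b: "rep p' q' g e'"
  shows "rep (pten p p') (pten q q') (f \<boxtimes> g) (tenE e e')"
proof -
  have p: "pres p (Dom S f)" "pres q (Cod S f)" "pres p' (Dom S g)" "pres q' (Cod S g)" "f \<in> Arr S" "g \<in> Arr S"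
    using a b by (auto simp: rep_def)
  have i: "iso_arrow S (snd p)" "iso_arrow S (snd p')" "iso_arrow S (snd q)" "iso_arrow S (snd q')" using p by (simp_all add: pres_def)
  have d: "Dom S (snd p) = Dom S f" "Cod S (snd p) = T (fst p)" "Dom S (snd q) = Cod S f" "Cod S (snd q) = T (fst q)"
    "Dom S (snd p') = Dom S g" "Cod S (snd p') = T (fst p')" "Dom S (snd q') = Cod S g" "Cod S (snd q') = T (fst q')"
    using p by (simp_all add: pres_def)
  have "snd (pten q q') \<cdot> (f \<boxtimes> g) \<cdot> inv_arrow S (snd (pten p p')) =
     c (fst q) (fst q') \<cdot> ((snd q \<cdot> f \<cdot> inv_arrow S (snd p)) \<boxtimes> (snd q' \<cdot> g \<cdot> inv_arrow S (snd p'))) \<cdot> inv_arrow S (c (fst p) (fst p'))"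
    unfolding inv_pten[OF p(1,3)] using i d p(5,6) by (simp add: pten_def fam_simps)
  then show ?thesis
    using a b pres_ten[OF p(1,3)] pres_ten[OF p(2,4)] p(5,6) by (simp add: rep_def E_defs fam_simps) (simp add: pten_def)
qed

lemma repI:
  assumes "pres p (Dom S f)" "pres q (Cod S f)" "f \<in> Arr S" "x \<in> Arr S" "Dom S x = T (fst p)" "Cod S x = T (fst q)"
    "x \<cdot> snd p = snd q \<cdot> f"
  shows "rep p q f (fst p, x, fst q)"
proof -
  have i: "iso_arrow S (snd p)" "iso_arrow S (snd q)" using assms by (simp_all add: pres_def)
  have "snd q \<cdot> f \<cdot> inv_arrow S (snd p) = (snd q \<cdot> f) \<cdot> inv_arrow S (snd p)"
    using assms i unfolding pres_def by (simp add: fam_simps)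
  also have "\<dots> = x" unfolding assms(7)[symmetric] using assms(1,4,5) i unfolding pres_def by (simp add: fam_simps)
  finally show ?thesis using assms by (simp add: rep_def)
qed

lemma rep_ident: "pres p a \<Longrightarrow> rep p p (Ident S a) (idE (fst p))"
proof -
  assume p: "pres p a"
  then have i: "iso_arrow S (snd p)" and a: "a \<in> Obj S" using dom_closed[OF iso_arr(1)] by (auto simp: pres_def)
  show ?thesis unfolding idE_def
    by (rule repI) (use p i a in \<open>simp_all add: pres_def fam_simps\<close>)
qed

text \<open>The presentations of a triple product with its two bracketings differ exactly by the
  associator, by \<open>c_assoc\<close>. So the associator is represented by an identity, and the
  unit isomorphisms behave alike.\<close>

lemma rep_assoc:
  assumes "pres p a" "pres q b" "pres r d"
  shows "rep (pten (pten p q) r) (pten p (pten q r)) (Assoc S a b d) (idE (fst p + fst q + fst r))"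
proof -
  have o: "a \<in> Obj S" "b \<in> Obj S" "d \<in> Obj S" using assms dom_closed[OF iso_arr(1)] by (auto simp: pres_def)
  have i: "iso_arrow S (snd p)" "iso_arrow S (snd q)" "iso_arrow S (snd r)" using assms by (simp_all add: pres_def)
  have dd: "Dom S (snd p) = a" "Cod S (snd p) = T (fst p)" "Dom S (snd q) = b" "Cod S (snd q) = T (fst q)"
    "Dom S (snd r) = d" "Cod S (snd r) = T (fst r)" using assms by (simp_all add: pres_def)
  have "snd (pten (pten p q) r) = c (fst p + fst q) (fst r) \<cdot> (c (fst p) (fst q) \<boxtimes> Ident S (T (fst r))) \<cdot> ((snd p \<boxtimes> snd q) \<boxtimes> snd r)"
    using i dd by (simp add: pten_def fam_simps)
  also have "\<dots> = c (fst p) (fst q + fst r) \<cdot> (Ident S (T (fst p)) \<boxtimes> c (fst q) (fst r)) \<cdot> Assoc S (T (fst p)) (T (fst q)) (T (fst r)) \<cdot> ((snd p \<boxtimes> snd q) \<boxtimes> snd r)"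
    by (rule c_assoc_comp) (use i dd in \<open>simp_all add: fam_simps\<close>)
  also have "Assoc S (T (fst p)) (T (fst q)) (T (fst r)) \<cdot> ((snd p \<boxtimes> snd q) \<boxtimes> snd r) = (snd p \<boxtimes> snd q \<boxtimes> snd r) \<cdot> Assoc S a b d"
    using assoc_nat_arr[of "snd p" "snd q" "snd r"] iso_arr(1)[OF i(1)] iso_arr(1)[OF i(2)] iso_arr(1)[OF i(3)] dd by simp
  also have "c (fst p) (fst q + fst r) \<cdot> (Ident S (T (fst p)) \<boxtimes> c (fst q) (fst r)) \<cdot> (snd p \<boxtimes> snd q \<boxtimes> snd r) \<cdot> Assoc S a b d = snd (pten p (pten q r)) \<cdot> Assoc S a b d"
    using i dd o by (simp add: pten_def fam_simps)
  finally have e: "Ident S (T (fst p + fst q + fst r)) \<cdot> snd (pten (pten p q) r) = snd (pten p (pten q r)) \<cdot> Assoc S a b d"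
    using i dd o by (simp add: pten_def fam_simps add.assoc)
  have "rep (pten (pten p q) r) (pten p (pten q r)) (Assoc S a b d) (fst (pten (pten p q) r), Ident S (T (fst p + fst q + fst r)), fst (pten p (pten q r)))"
    by (rule repI) (use e o pres_ten[OF pres_ten[OF assms(1,2)] assms(3)] pres_ten[OF assms(1) pres_ten[OF assms(2,3)]] in
      \<open>simp_all add: fam_simps\<close>, simp_all add: pten_def fam_simps add.assoc)
  then show ?thesis by (simp add: idE_def pten_def add.assoc)
qed

lemma pres_u: "pres (0, u) (TUnit S)"
  by (simp add: pres_def u_simps u_iso)

lemma rep_lunit:
  assumes "pres p a"
  shows "rep (pten (0, u) p) p (LUnit S a) (idE (fst p))"
proof -
  have i: "iso_arrow S (snd p)" and d: "Dom S (snd p) = a" "Cod S (snd p) = T (fst p)" and o: "a \<in> Obj S"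
    using assms dom_closed[OF iso_arr(1)] by (auto simp: pres_def)
  have "c 0 (fst p) \<cdot> (u \<boxtimes> snd p) = (c 0 (fst p) \<cdot> (u \<boxtimes> Ident S (T (fst p)))) \<cdot> (Ident S (TUnit S) \<boxtimes> snd p)"
    using i d by (simp add: fam_simps)
  also have "\<dots> = snd p \<cdot> LUnit S a" unfolding c_lunit using lunit_nat_arr[OF iso_arr(1)[OF i]] d by simp
  finally have "rep (pten (0, u) p) p (LUnit S a) (fst (pten (0, u) p), Ident S (T (fst p)), fst p)"
    by (intro repI) (use o i d assms pres_ten[OF pres_u assms] in \<open>simp_all add: fam_simps\<close>, simp_all add: pten_def fam_simps)
  then show ?thesis by (simp add: idE_def pten_def)
qed

lemma rep_runit:
  assumes "pres p a"
  shows "rep (pten p (0, u)) p (RUnit S a) (idE (fst p))"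
proof -
  have i: "iso_arrow S (snd p)" and d: "Dom S (snd p) = a" "Cod S (snd p) = T (fst p)" and o: "a \<in> Obj S"
    using assms dom_closed[OF iso_arr(1)] by (auto simp: pres_def)
  have "c (fst p) 0 \<cdot> (snd p \<boxtimes> u) = (c (fst p) 0 \<cdot> (Ident S (T (fst p)) \<boxtimes> u)) \<cdot> (snd p \<boxtimes> Ident S (TUnit S))"
    using i d by (simp add: fam_simps)
  also have "\<dots> = snd p \<cdot> RUnit S a" unfolding c_runit using runit_nat_arr[OF iso_arr(1)[OF i]] d by simp
  finally have "rep (pten p (0, u)) p (RUnit S a) (fst (pten p (0, u)), Ident S (T (fst p)), fst p)"
    by (intro repI) (use o i d assms pres_ten[OF assms pres_u] in \<open>simp_all add: fam_simps\<close>, simp_all add: pten_def fam_simps)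
  then show ?thesis by (simp add: idE_def pten_def)
qed

lemma rep_braid:
  assumes "pres p a" "pres q b"
  shows "rep (pten p q) (pten q p) (Braid S a b) (brE (fst p) (fst q))"
proof -
  have i: "iso_arrow S (snd p)" "iso_arrow S (snd q)" using assms by (simp_all add: pres_def)
  have d: "Dom S (snd p) = a" "Cod S (snd p) = T (fst p)" "Dom S (snd q) = b" "Cod S (snd q) = T (fst q)" using assms by (simp_all add: pres_def)
  have o: "a \<in> Obj S" "b \<in> Obj S" using assms dom_closed[OF iso_arr(1)] by (auto simp: pres_def)
  let ?x = "c (fst q) (fst p) \<cdot> Braid S (T (fst p)) (T (fst q)) \<cdot> inv_arrow S (c (fst p) (fst q))"
  have "?x \<cdot> c (fst p) (fst q) \<cdot> (snd p \<boxtimes> snd q) = c (fst q) (fst p) \<cdot> (Braid S (T (fst p)) (T (fst q)) \<cdot> (snd p \<boxtimes> snd q))"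
    using i d by (simp add: fam_simps)
  also have "Braid S (T (fst p)) (T (fst q)) \<cdot> (snd p \<boxtimes> snd q) = (snd q \<boxtimes> snd p) \<cdot> Braid S a b"
    using braid_nat_arr[OF iso_arr(1)[OF i(1)] iso_arr(1)[OF i(2)]] d by simp
  finally have e: "?x \<cdot> c (fst p) (fst q) \<cdot> (snd p \<boxtimes> snd q) = (c (fst q) (fst p) \<cdot> (snd q \<boxtimes> snd p)) \<cdot> Braid S a b"
    using i d o by (simp add: fam_simps)
  have "rep (pten p q) (pten q p) (Braid S a b) (fst (pten p q), ?x, fst (pten q p))"
    by (rule repI) (use e o pres_ten[OF assms] pres_ten[OF assms(2,1)] in \<open>simp_all add: fam_simps\<close>, simp_all add: pten_def fam_simps)
  then show ?thesis by (simp add: brE_def pten_def)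
qed

text \<open>An isomorphism represented by an identity is a mere change of presentation, and so is
  its inverse.\<close>

lemma rep_inv:
  assumes "rep p q f (idE n)" "iso_arrow S f"
  shows "rep q p (inv_arrow S f) (idE n)"
proof -
  have a: "pres p (Dom S f)" "pres q (Cod S f)" "f \<in> Arr S" "fst p = n" "fst q = n" "snd q \<cdot> f \<cdot> inv_arrow S (snd p) = Ident S (T n)"
    using assms(1) by (auto simp: rep_def idE_def)
  have i: "iso_arrow S (snd p)" "iso_arrow S (snd q)" using a by (simp_all add: pres_def)
  have "(snd q \<cdot> f \<cdot> inv_arrow S (snd p)) \<cdot> snd p = snd q \<cdot> f" using a(1-3) i unfolding pres_def by (simp add: fam_simps)
  then have e: "snd p = snd q \<cdot> f" unfolding a(6) using a(1,4) i unfolding pres_def by (simp add: fam_simps)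
  have "rep q p (inv_arrow S f) (fst q, Ident S (T n), fst p)"
  proof (rule repI)
    have "snd p \<cdot> inv_arrow S f = snd q" unfolding e using a(2,3) assms(2) i unfolding pres_def by (simp add: fam_simps)
    then show "Ident S (T n) \<cdot> snd q = snd p \<cdot> inv_arrow S f" using a(2,5) i unfolding pres_def by (simp add: fam_simps)
  qed (use a assms(2) in \<open>simp_all add: iso_arr ident_arr\<close>)
  then show ?thesis using a(4,5) by (simp add: idE_def)
qed

end

section \<open>Bimonoids in terms of representatives\<close>

context tensor_family begin

definition tr :: "nat \<times> 'a \<Rightarrow> nat \<times> 'a \<Rightarrow> 'a \<Rightarrow> nat \<times> 'a \<times> nat" where
  "tr p q f = (fst p, snd q \<cdot> f \<cdot> inv_arrow S (snd p), fst q)"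

lemma rep_tr: "\<lbrakk>pres p a; pres q b; f \<in> Hom S a b\<rbrakk> \<Longrightarrow> rep p q f (tr p q f)"
  unfolding tr_def by (rule rep_exists)

context
  fixes A :: 'o and j \<mu> \<eta> \<Delta> \<epsilon> :: 'a and mu eta del eps :: "nat \<times> 'a \<times> nat"
  assumes P: "pres (Suc 0, j) A"
    and rm: "rep (pten (Suc 0, j) (Suc 0, j)) (Suc 0, j) \<mu> mu" and re: "rep (0, u) (Suc 0, j) \<eta> eta"
    and rd: "rep (Suc 0, j) (pten (Suc 0, j) (Suc 0, j)) \<Delta> del" and rp: "rep (Suc 0, j) (0, u) \<epsilon> eps"
begin

lemma A_obj: "A \<in> Obj S"
  using P dom_closed[OF iso_arr(1)] by (auto simp: pres_def)

lemma struct_ar [simp]: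
  "arE mu" "dmE mu = Suc (Suc 0)" "cdE mu = Suc 0" "arE eta" "dmE eta = 0" "cdE eta = Suc 0"
  "arE del" "dmE del = Suc 0" "cdE del = Suc (Suc 0)" "arE eps" "dmE eps = Suc 0" "cdE eps = 0"
  using rep_ar[OF rm] rep_ar[OF re] rep_ar[OF rd] rep_ar[OF rp] by (simp_all add: pten_def)

lemma struct_hom: "\<mu> \<in> Hom S (A \<boxdot> A) A" "\<eta> \<in> Hom S (TUnit S) A" "\<Delta> \<in> Hom S A (A \<boxdot> A)" "\<epsilon> \<in> Hom S A (TUnit S)"
proof -
  have u: "a = b" if "pres p a" "pres p b" for p a b using that by (simp add: pres_def)
  have "pres (pten (Suc 0, j) (Suc 0, j)) (A \<boxdot> A)" using P by (intro pres_ten)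
  then show "\<mu> \<in> Hom S (A \<boxdot> A) A" "\<eta> \<in> Hom S (TUnit S) A" "\<Delta> \<in> Hom S A (A \<boxdot> A)" "\<epsilon> \<in> Hom S A (TUnit S)"
    using rm re rd rp P pres_u u unfolding rep_def Hom_def by blast+
qed

lemmas rI = rep_ident[OF P, simplified]

text \<open>The axiom takes its strict form because the associator is represented by an identity.
  The equivalences that follow have the same reason.\<close>

lemma assoc_iff: "\<mu> \<cdot> (\<mu> \<boxtimes> Ident S A) = \<mu> \<cdot> (Ident S A \<boxtimes> \<mu>) \<cdot> Assoc S A A A \<longleftrightarrow>
    cmpE mu (tenE mu (idE (Suc 0))) = cmpE mu (tenE (idE (Suc 0)) mu)"
  using rep_eq_iff[OF rep_comp[OF rep_ten[OF rm rI] rm] rep_comp[OF rep_comp[OF rep_assoc[OF P P P] rep_ten[OF rI rm]] rm]]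
  by (simp add: E.cmp_idn)

lemma unit_iff: "\<mu> \<cdot> (\<eta> \<boxtimes> Ident S A) = LUnit S A \<longleftrightarrow> cmpE mu (tenE eta (idE (Suc 0))) = idE (Suc 0)"
    "\<mu> \<cdot> (Ident S A \<boxtimes> \<eta>) = RUnit S A \<longleftrightarrow> cmpE mu (tenE (idE (Suc 0)) eta) = idE (Suc 0)"
  using rep_eq_iff[OF rep_comp[OF rep_ten[OF re rI] rm] rep_lunit[OF P]] rep_eq_iff[OF rep_comp[OF rep_ten[OF rI re] rm] rep_runit[OF P]]
  by simp_all

lemma coassoc_iff: "Assoc S A A A \<cdot> (\<Delta> \<boxtimes> Ident S A) \<cdot> \<Delta> = (Ident S A \<boxtimes> \<Delta>) \<cdot> \<Delta> \<longleftrightarrow>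
    cmpE (tenE del (idE (Suc 0))) del = cmpE (tenE (idE (Suc 0)) del) del"
  using rep_eq_iff[OF rep_comp[OF rep_comp[OF rd rep_ten[OF rd rI]] rep_assoc[OF P P P]] rep_comp[OF rd rep_ten[OF rI rd]]]
  by (simp add: E.idn_cmp)

lemma counit_iff: "LUnit S A \<cdot> (\<epsilon> \<boxtimes> Ident S A) \<cdot> \<Delta> = Ident S A \<longleftrightarrow> cmpE (tenE eps (idE (Suc 0))) del = idE (Suc 0)"
    "RUnit S A \<cdot> (Ident S A \<boxtimes> \<epsilon>) \<cdot> \<Delta> = Ident S A \<longleftrightarrow> cmpE (tenE (idE (Suc 0)) eps) del = idE (Suc 0)"
  using rep_eq_iff[OF rep_comp[OF rep_comp[OF rd rep_ten[OF rp rI]] rep_lunit[OF P]] rI]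
    rep_eq_iff[OF rep_comp[OF rep_comp[OF rd rep_ten[OF rI rp]] rep_runit[OF P]] rI]
  by (simp_all add: E.idn_cmp)

text \<open>All associators of the interchange are represented by identities, so only the braiding
  of the two middle strands is left.\<close>

lemma rep_middle: "rep (pten (pten (Suc 0, j) (Suc 0, j)) (pten (Suc 0, j) (Suc 0, j))) (pten (pten (Suc 0, j) (Suc 0, j)) (pten (Suc 0, j) (Suc 0, j)))
    (middle_interchange S A A A A) (tenE (idE (Suc 0)) (tenE (brE (Suc 0) (Suc 0)) (idE (Suc 0))))"
proof -
  let ?P = "(Suc 0, j)"
  have AA: "pres (pten ?P ?P) (A \<boxdot> A)" using P by (intro pres_ten)
  have i: "iso_arrow S (Assoc S A A (A \<boxdot> A))" "iso_arrow S (Assoc S A A A)" using A_obj by (simp_all add: assoc_simps ten_obj)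
  have fsts: "fst (pten p q) = fst p + fst q" for p q by (simp add: pten_def)
  note r1 = rep_assoc[OF P P AA] and r2 = rep_inv[OF rep_assoc[OF P P P] i(2)] and r3 = rep_ten[OF rep_braid[OF P P] rI]
  note r4 = rep_comp[OF rep_comp[OF r2 r3] rep_assoc[OF P P P]]
  note r5 = rep_comp[OF rep_comp[OF r1 rep_ten[OF rI r4]] rep_inv[OF r1 i(1)]]
  have "cmpE (idE (fst ?P + fst ?P + fst (pten ?P ?P)))
     (cmpE (tenE (idE (Suc 0)) (cmpE (idE (fst ?P + fst ?P + fst ?P)) (cmpE (tenE (brE (fst ?P) (fst ?P)) (idE (Suc 0))) (idE (fst ?P + fst ?P + fst ?P)))))
       (idE (fst ?P + fst ?P + fst (pten ?P ?P)))) = tenE (idE (Suc 0)) (tenE (brE (Suc 0) (Suc 0)) (idE (Suc 0)))"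
    by (simp add: fsts E.idn_cmp E.cmp_idn)
  moreover have "middle_interchange S A A A A = inv_arrow S (Assoc S A A (A \<boxdot> A)) \<cdot>
     (Ident S A \<boxtimes> (Assoc S A A A \<cdot> (Braid S A A \<boxtimes> Ident S A) \<cdot> inv_arrow S (Assoc S A A A))) \<cdot> Assoc S A A (A \<boxdot> A)"
    by (simp add: middle_interchange_def)
  ultimately show ?thesis using r5 by (metis (no_types, lifting))
qed

lemma comult_mult_iff: "\<Delta> \<cdot> \<mu> = (\<mu> \<boxtimes> \<mu>) \<cdot> middle_interchange S A A A A \<cdot> (\<Delta> \<boxtimes> \<Delta>) \<longleftrightarrow>
    cmpE del mu = cmpE (tenE mu mu) (cmpE (tenE (idE (Suc 0)) (tenE (brE (Suc 0) (Suc 0)) (idE (Suc 0)))) (tenE del del))"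
  by (rule rep_eq_iff[OF rep_comp[OF rm rd] rep_comp[OF rep_comp[OF rep_ten[OF rd rd] rep_middle] rep_ten[OF rm rm]]])

lemma comult_unit_iff: "\<Delta> \<cdot> \<eta> = (\<eta> \<boxtimes> \<eta>) \<cdot> inv_arrow S (LUnit S (TUnit S)) \<longleftrightarrow> cmpE del eta = tenE eta eta"
  using rep_eq_iff[OF rep_comp[OF re rd] rep_comp[OF rep_inv[OF rep_lunit[OF pres_u] lunit_simps(4)[OF unit_obj]] rep_ten[OF re re]]]
  by (simp add: E.cmp_idn)

lemma counit_mult_iff: "\<epsilon> \<cdot> \<mu> = LUnit S (TUnit S) \<cdot> (\<epsilon> \<boxtimes> \<epsilon>) \<longleftrightarrow> cmpE eps mu = tenE eps eps"
  using rep_eq_iff[OF rep_comp[OF rm rp] rep_comp[OF rep_ten[OF rp rp] rep_lunit[OF pres_u]]]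
  by (simp add: E.idn_cmp)

lemma counit_unit_iff: "\<epsilon> \<cdot> \<eta> = Ident S (TUnit S) \<longleftrightarrow> cmpE eps eta = idE 0"
  using rep_eq_iff[OF rep_comp[OF re rp] rep_ident[OF pres_u]] by simp

lemma comm_iff: "\<mu> \<cdot> Braid S A A = \<mu> \<longleftrightarrow> cmpE mu (brE (Suc 0) (Suc 0)) = mu"
    "Braid S A A \<cdot> \<Delta> = \<Delta> \<longleftrightarrow> cmpE (brE (Suc 0) (Suc 0)) del = del"
  using rep_eq_iff[OF rep_comp[OF rep_braid[OF P P] rm] rm] rep_eq_iff[OF rep_comp[OF rd rep_braid[OF P P]] rd] by simp_all

lemma morphism_iff:
  assumes rf: "rep (Suc 0, j) (Suc 0, j) f e"
  shows "f \<cdot> \<mu> = \<mu> \<cdot> (f \<boxtimes> f) \<longleftrightarrow> cmpE e mu = cmpE mu (tenE e e)"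
    "f \<cdot> \<eta> = \<eta> \<longleftrightarrow> cmpE e eta = eta"
    "(f \<boxtimes> f) \<cdot> \<Delta> = \<Delta> \<cdot> f \<longleftrightarrow> cmpE (tenE e e) del = cmpE del e"
    "\<epsilon> \<cdot> f = \<epsilon> \<longleftrightarrow> cmpE eps e = eps"
  by (rule rep_eq_iff[OF rep_comp[OF rm rf] rep_comp[OF rep_ten[OF rf rf] rm]],
    rule rep_eq_iff[OF rep_comp[OF re rf] re],
    rule rep_eq_iff[OF rep_comp[OF rd rep_ten[OF rf rf]] rep_comp[OF rf rd]],
    rule rep_eq_iff[OF rep_comp[OF rf rp] rp])

text \<open>The bridge between \<open>S\<close> and the strict PROP. From left to right it extracts
  a bimonoid from an algebra; from right to left it makes the evaluation of spans available for a
  given bimonoid.\<close>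

lemma gbim_iff:
  fixes G :: "('g, 'w) monoid_scheme"
  assumes G: "group G" and rr: "\<And>g. g \<in> carrier G \<Longrightarrow> rep (Suc 0, j) (Suc 0, j) (r g) (rho g)"
  defines "B \<equiv> \<lparr>bobj = A, bmult = \<mu>, bunit = \<eta>, bcomult = \<Delta>, bcounit = \<epsilon>\<rparr>"
  shows "gbim arE dmE cdE cmpE tenE idE brE G mu eta rho del eps \<longleftrightarrow>
    bimonoid S B \<and> (\<forall>g\<in>carrier G. bimonoid_morphism S B B (r g)) \<and>
    (\<forall>g\<in>carrier G. \<forall>h\<in>carrier G. r (g \<otimes>\<^bsub>G\<^esub> h) = r g \<cdot> r h) \<and> r \<one>\<^bsub>G\<^esub> = Ident S A"
    (is "?L \<longleftrightarrow> ?R")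
proof -
  interpret G: group G by (rule G)
  have rar: "arE (rho g)" "dmE (rho g) = Suc 0" "cdE (rho g) = Suc 0" if "g \<in> carrier G" for g
    using rep_ar[OF rr[OF that]] by simp_all
  have rhom: "r g \<in> Hom S A A" if "g \<in> carrier G" for g
    using rr[OF that] P unfolding rep_def pres_def Hom_def by auto
  have act: "r (g \<otimes>\<^bsub>G\<^esub> h) = r g \<cdot> r h \<longleftrightarrow> cmpE (rho g) (rho h) = rho (g \<otimes>\<^bsub>G\<^esub> h)" if "g \<in> carrier G" "h \<in> carrier G" for g h
    using rep_eq_iff[OF rr[OF G.m_closed[OF that]] rep_comp[OF rr[OF that(2)] rr[OF that(1)]]] by auto
  have one: "r \<one>\<^bsub>G\<^esub> = Ident S A \<longleftrightarrow> rho \<one>\<^bsub>G\<^esub> = idE (Suc 0)"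
    using rep_eq_iff[OF rr[OF G.one_closed] rI] .
  note iffs = assoc_iff unit_iff coassoc_iff counit_iff comult_mult_iff comult_unit_iff counit_mult_iff counit_unit_iff
  show ?thesis
  proof
    assume ?L
    then interpret g: gbim arE dmE cdE cmpE tenE idE brE G mu eta rho del eps .
    have "bimonoid S B"
      unfolding B_def by unfold_locales
        (use A_obj struct_hom g.mu_assoc g.mu_unit g.op.mu_assoc g.op.mu_unit g.del_mu g.del_eta g.eps_mu g.eps_eta in \<open>simp_all add: iffs\<close>)
    moreover have "bimonoid_morphism S B B (r g)" if g: "g \<in> carrier G" for g
      using rhom[OF g] g.rho_mu[OF g] g.rho_eta[OF g] g.op.rho_mu[OF G.inv_closed[OF g]] g.op.rho_eta[OF G.inv_closed[OF g]] g
      by (simp add: bimonoid_morphism_def B_def morphism_iff[OF rr[OF g]])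
    ultimately show ?R using g.rho_rho g.rho_one act one by blast
  next
    assume R: ?R
    then interpret b: bimonoid S B by blast
    have bm: "cmpE mu (tenE mu (idE (Suc 0))) = cmpE mu (tenE (idE (Suc 0)) mu)"
      "cmpE mu (tenE eta (idE (Suc 0))) = idE (Suc 0)" "cmpE mu (tenE (idE (Suc 0)) eta) = idE (Suc 0)"
      "cmpE (tenE del (idE (Suc 0))) del = cmpE (tenE (idE (Suc 0)) del) del"
      "cmpE (tenE eps (idE (Suc 0))) del = idE (Suc 0)" "cmpE (tenE (idE (Suc 0)) eps) del = idE (Suc 0)"
      "cmpE del mu = cmpE (tenE mu mu) (cmpE (tenE (idE (Suc 0)) (tenE (brE (Suc 0) (Suc 0)) (idE (Suc 0)))) (tenE del del))"
      "cmpE del eta = tenE eta eta" "cmpE eps mu = tenE eps eps" "cmpE eps eta = idE 0"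
      using b.mult_assoc b.mult_lunit b.mult_runit b.comult_coassoc b.comult_lcounit b.comult_rcounit b.comult_mult b.comult_unit b.counit_mult b.counit_unit
      unfolding B_def bimon.simps iffs .
    have mor: "cmpE (rho g) mu = cmpE mu (tenE (rho g) (rho g))" "cmpE (rho g) eta = eta"
      "cmpE (tenE (rho g) (rho g)) del = cmpE del (rho g)" "cmpE eps (rho g) = eps" if "g \<in> carrier G" for g
    proof -
      have "bimonoid_morphism S B B (r g)" using R that by blast
      then show "cmpE (rho g) mu = cmpE mu (tenE (rho g) (rho g))" "cmpE (rho g) eta = eta"
        "cmpE (tenE (rho g) (rho g)) del = cmpE del (rho g)" "cmpE eps (rho g) = eps"
        unfolding bimonoid_morphism_def B_def bimon.simps morphism_iff[OF rr[OF that]] by simp_all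
    qed
    have rr': "cmpE (rho g) (rho h) = rho (g \<otimes>\<^bsub>G\<^esub> h)" if "g \<in> carrier G" "h \<in> carrier G" for g h using R act that by blast
    have r1: "rho \<one>\<^bsub>G\<^esub> = idE (Suc 0)" using R one by blast
    interpret O: strict_prop arE cdE dmE "\<lambda>f g. cmpE g f" tenE idE "\<lambda>m n. brE n m" by (rule E.strict_prop_op)
    have o: "gmon arE cdE dmE (\<lambda>f g. cmpE g f) tenE idE (\<lambda>m n. brE n m) G del eps (\<lambda>g. rho (inv\<^bsub>G\<^esub> g))"
      by unfold_locales (use bm mor rr' r1 rar in \<open>simp_all add: G.inv_mult_group\<close>)
    show ?L
      by unfold_locales (use bm mor rr' r1 rar o in \<open>simp_all add: G.inv_mult_group\<close>)
  qed
qed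

end

end

subsection \<open>Tensor powers\<close>

context symmetric_monoidal_category begin

text \<open>Tensoring with the unit object is faithful, since \<open>LUnit\<close> makes it
  naturally isomorphic to the identity functor.\<close>

lemma lunit_ten_cancel:
  assumes "f \<in> Arr C" "g \<in> Arr C" "Dom C f = Dom C g" "Cod C f = Cod C g" "Ident C (TUnit C) \<boxtimes> f = Ident C (TUnit C) \<boxtimes> g"
  shows "f = g"
proof (rule iso_cancel_right[OF _ lunit_simps(4)])
  show "f \<cdot> LUnit C (Dom C f) = g \<cdot> LUnit C (Dom C f)"
    using lunit_nat_arr[OF assms(1)] lunit_nat_arr[OF assms(2)] assms(3-5) by simp
qed (use assms in \<open>simp_all add: arrow_simps\<close>)

lemma runit_ten_cancel:
  assumes "f \<in> Arr C" "g \<in> Arr C" "Dom C f = Dom C g" "Cod C f = Cod C g" "f \<boxtimes> Ident C (TUnit C) = g \<boxtimes> Ident C (TUnit C)"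
  shows "f = g"
proof (rule iso_cancel_right[OF _ runit_simps(4)])
  show "f \<cdot> RUnit C (Dom C f) = g \<cdot> RUnit C (Dom C f)"
    using runit_nat_arr[OF assms(1)] runit_nat_arr[OF assms(2)] assms(3-5) by simp
qed (use assms in \<open>simp_all add: arrow_simps\<close>)

text \<open>Kelly's consequence of pentagon and triangle. The equation is tensored with the unit on
  the left and precomposed with associators; the pentagon for two units, \<open>a\<close> and
  \<open>b\<close> and two triangles then identify both sides.\<close>

lemma lunit_ten:
  assumes a: "a \<in> Obj C" and b: "b \<in> Obj C"
  shows "LUnit C (a \<boxdot> b) \<cdot> Assoc C (TUnit C) a b = LUnit C a \<boxtimes> Ident C b"
proof (rule lunit_ten_cancel)
  let ?I = "TUnit C" and ?i = "Ident C (TUnit C)"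
  let ?e = "Assoc C ?I (?I \<boxdot> a) b \<cdot> (Assoc C ?I ?I a \<boxtimes> Ident C b)"
  note o = a b unit_obj
  have e: "iso_arrow C ?e" by (intro iso_comp iso_ten iso_ident assoc_simps) (use o in \<open>simp_all add: arrow_simps\<close>)
  have p: "(?i \<boxtimes> Assoc C ?I a b) \<cdot> Assoc C ?I (?I \<boxdot> a) b \<cdot> (Assoc C ?I ?I a \<boxtimes> Ident C b) = Assoc C ?I ?I (a \<boxdot> b) \<cdot> Assoc C (?I \<boxdot> ?I) a b"
    by (rule pentagon) (use o in simp_all)
  have t: "(?i \<boxtimes> LUnit C (a \<boxdot> b)) \<cdot> Assoc C ?I ?I (a \<boxdot> b) = RUnit C ?I \<boxtimes> Ident C (a \<boxdot> b)"
    "(?i \<boxtimes> LUnit C a) \<cdot> Assoc C ?I ?I a = RUnit C ?I \<boxtimes> Ident C a"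
    by (rule triangle; use o in \<open>simp add: ten_obj\<close>)+
  have n1: "(RUnit C ?I \<boxtimes> Ident C (a \<boxdot> b)) \<cdot> Assoc C (?I \<boxdot> ?I) a b = Assoc C ?I a b \<cdot> ((RUnit C ?I \<boxtimes> Ident C a) \<boxtimes> Ident C b)"
    using assoc_nat_arr[of "RUnit C ?I" "Ident C a" "Ident C b"] o by (simp add: arrow_simps)
  have n2: "Assoc C ?I a b \<cdot> ((?i \<boxtimes> LUnit C a) \<boxtimes> Ident C b) = (?i \<boxtimes> (LUnit C a \<boxtimes> Ident C b)) \<cdot> Assoc C ?I (?I \<boxdot> a) b"
    using assoc_nat_arr[of ?i "LUnit C a" "Ident C b"] o by (simp add: arrow_simps)
  have "(?i \<boxtimes> (LUnit C (a \<boxdot> b) \<cdot> Assoc C ?I a b)) \<cdot> ?e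
     = (?i \<boxtimes> LUnit C (a \<boxdot> b)) \<cdot> ((?i \<boxtimes> Assoc C ?I a b) \<cdot> Assoc C ?I (?I \<boxdot> a) b \<cdot> (Assoc C ?I ?I a \<boxtimes> Ident C b))"
    using o by (simp add: arrow_simps ten_interchange_comp)
  also have "\<dots> = ((?i \<boxtimes> LUnit C (a \<boxdot> b)) \<cdot> Assoc C ?I ?I (a \<boxdot> b)) \<cdot> Assoc C (?I \<boxdot> ?I) a b"
    unfolding p using o by (simp add: arrow_simps)
  also have "\<dots> = Assoc C ?I a b \<cdot> (((?i \<boxtimes> LUnit C a) \<cdot> Assoc C ?I ?I a) \<boxtimes> Ident C b)"
    unfolding t n1 ..
  also have "\<dots> = (Assoc C ?I a b \<cdot> ((?i \<boxtimes> LUnit C a) \<boxtimes> Ident C b)) \<cdot> (Assoc C ?I ?I a \<boxtimes> Ident C b)"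
    using o by (simp add: arrow_simps ten_interchange)
  also have "\<dots> = (?i \<boxtimes> (LUnit C a \<boxtimes> Ident C b)) \<cdot> ?e"
    unfolding n2 using o by (simp add: arrow_simps)
  finally show "?i \<boxtimes> (LUnit C (a \<boxdot> b) \<cdot> Assoc C ?I a b) = ?i \<boxtimes> (LUnit C a \<boxtimes> Ident C b)"
    by (rule iso_cancel_right[OF _ e]) (use o in \<open>simp_all add: arrow_simps\<close>)
qed (use a b in \<open>simp_all add: arrow_simps\<close>)

text \<open>The mirror image of \<open>lunit_ten\<close>: the pentagon for \<open>a\<close>,
  \<open>b\<close> and two units, after tensoring with the unit on the right.\<close>

lemma runit_ten:
  assumes a: "a \<in> Obj C" and b: "b \<in> Obj C"
  shows "(Ident C a \<boxtimes> RUnit C b) \<cdot> Assoc C a b (TUnit C) = RUnit C (a \<boxdot> b)"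
proof (rule runit_ten_cancel)
  let ?I = "TUnit C" and ?i = "Ident C (TUnit C)"
  note o = a b unit_obj
  have e: "iso_arrow C (Assoc C a b ?I)" by (use o in \<open>simp add: arrow_simps\<close>)
  have p: "(Ident C a \<boxtimes> Assoc C b ?I ?I) \<cdot> Assoc C a (b \<boxdot> ?I) ?I \<cdot> (Assoc C a b ?I \<boxtimes> ?i) = Assoc C a b (?I \<boxdot> ?I) \<cdot> Assoc C (a \<boxdot> b) ?I ?I"
    by (rule pentagon) (use o in simp_all)
  have t: "(Ident C b \<boxtimes> LUnit C ?I) \<cdot> Assoc C b ?I ?I = RUnit C b \<boxtimes> ?i"
    "(Ident C (a \<boxdot> b) \<boxtimes> LUnit C ?I) \<cdot> Assoc C (a \<boxdot> b) ?I ?I = RUnit C (a \<boxdot> b) \<boxtimes> ?i"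
    by (rule triangle; use o in \<open>simp add: ten_obj\<close>)+
  have n1: "Assoc C a b ?I \<cdot> (Ident C (a \<boxdot> b) \<boxtimes> LUnit C ?I) = (Ident C a \<boxtimes> (Ident C b \<boxtimes> LUnit C ?I)) \<cdot> Assoc C a b (?I \<boxdot> ?I)"
    using assoc_nat_arr[of "Ident C a" "Ident C b" "LUnit C ?I"] o by (simp add: arrow_simps)
  have n2: "Assoc C a b ?I \<cdot> ((Ident C a \<boxtimes> RUnit C b) \<boxtimes> ?i) = (Ident C a \<boxtimes> (RUnit C b \<boxtimes> ?i)) \<cdot> Assoc C a (b \<boxdot> ?I) ?I"
    using assoc_nat_arr[of "Ident C a" "RUnit C b" ?i] o by (simp add: arrow_simps)
  have "Assoc C a b ?I \<cdot> (((Ident C a \<boxtimes> RUnit C b) \<cdot> Assoc C a b ?I) \<boxtimes> ?i)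
     = (Assoc C a b ?I \<cdot> ((Ident C a \<boxtimes> RUnit C b) \<boxtimes> ?i)) \<cdot> (Assoc C a b ?I \<boxtimes> ?i)"
    using o by (simp add: arrow_simps ten_interchange)
  also have "\<dots> = (Ident C a \<boxtimes> ((Ident C b \<boxtimes> LUnit C ?I) \<cdot> Assoc C b ?I ?I)) \<cdot> Assoc C a (b \<boxdot> ?I) ?I \<cdot> (Assoc C a b ?I \<boxtimes> ?i)"
    unfolding n2 t using o by (simp add: arrow_simps)
  also have "\<dots> = (Ident C a \<boxtimes> (Ident C b \<boxtimes> LUnit C ?I)) \<cdot> ((Ident C a \<boxtimes> Assoc C b ?I ?I) \<cdot> Assoc C a (b \<boxdot> ?I) ?I \<cdot> (Assoc C a b ?I \<boxtimes> ?i))"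
    using o by (simp add: arrow_simps ten_interchange_comp)
  also have "\<dots> = ((Ident C a \<boxtimes> (Ident C b \<boxtimes> LUnit C ?I)) \<cdot> Assoc C a b (?I \<boxdot> ?I)) \<cdot> Assoc C (a \<boxdot> b) ?I ?I"
    unfolding p using o by (simp add: arrow_simps)
  also have "\<dots> = Assoc C a b ?I \<cdot> ((Ident C (a \<boxdot> b) \<boxtimes> LUnit C ?I) \<cdot> Assoc C (a \<boxdot> b) ?I ?I)"
    unfolding n1[symmetric] using o by (simp add: arrow_simps)
  finally have "Assoc C a b ?I \<cdot> (((Ident C a \<boxtimes> RUnit C b) \<cdot> Assoc C a b ?I) \<boxtimes> ?i) = Assoc C a b ?I \<cdot> (RUnit C (a \<boxdot> b) \<boxtimes> ?i)"
    unfolding t .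
  then show "((Ident C a \<boxtimes> RUnit C b) \<cdot> Assoc C a b ?I) \<boxtimes> ?i = RUnit C (a \<boxdot> b) \<boxtimes> ?i"
    by (rule iso_cancel_left[OF _ e]) (use o in \<open>simp_all add: arrow_simps\<close>)
qed (use a b in \<open>simp_all add: arrow_simps\<close>)

text \<open>Naturality of \<open>LUnit\<close> at itself identifies \<open>LUnit\<close> of the
  square of the unit with a tensor of \<open>LUnit\<close>; \<open>lunit_ten\<close> and the
  triangle then compare both isomorphisms after tensoring with the unit.\<close>

lemma lunit_eq_runit: "LUnit C (TUnit C) = RUnit C (TUnit C)"
proof (rule runit_ten_cancel)
  let ?I = "TUnit C" and ?i = "Ident C (TUnit C)"
  note o = unit_obj
  have "LUnit C ?I \<cdot> LUnit C (?I \<boxdot> ?I) = LUnit C ?I \<cdot> (?i \<boxtimes> LUnit C ?I)"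
    using lunit_nat_arr[OF lunit_simps(1)[OF o]] o by (simp add: arrow_simps)
  then have "LUnit C (?I \<boxdot> ?I) = ?i \<boxtimes> LUnit C ?I"
    by (rule iso_cancel_left[OF _ lunit_simps(4)[OF o]]) (use o in \<open>simp_all add: arrow_simps\<close>)
  then show "LUnit C ?I \<boxtimes> ?i = RUnit C ?I \<boxtimes> ?i"
    using lunit_ten[OF o o] triangle[OF o o] by simp
qed (use unit_obj in \<open>simp_all add: arrow_simps\<close>)

text \<open>Powers are bracketed to the right and end in the unit object. So the first power is
  \<open>a \<boxdot> TUnit C\<close> and not \<open>a\<close>, and \<open>a\<close> itself enters
  through \<open>RUnit\<close>.\<close>

primrec tpow :: "'o \<Rightarrow> nat \<Rightarrow> 'o" where
  "tpow a 0 = TUnit C"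
| "tpow a (Suc n) = a \<boxdot> tpow a n"

primrec tpow_join :: "'o \<Rightarrow> nat \<Rightarrow> nat \<Rightarrow> 'a" where
  "tpow_join a 0 n = LUnit C (tpow a n)"
| "tpow_join a (Suc m) n = (Ident C a \<boxtimes> tpow_join a m n) \<cdot> Assoc C a (tpow a m) (tpow a n)"

lemma tpow_obj: "a \<in> Obj C \<Longrightarrow> tpow a n \<in> Obj C"
  by (induction n) (simp_all add: unit_obj ten_obj)

lemma tpow_join_arr: "a \<in> Obj C \<Longrightarrow> tpow_join a m n \<in> Arr C \<and> Dom C (tpow_join a m n) = tpow a m \<boxdot> tpow a n \<and>
    Cod C (tpow_join a m n) = tpow a (m + n) \<and> iso_arrow C (tpow_join a m n)"
proof (induction m)
  case (Suc m)
  have "iso_arrow C ((Ident C a \<boxtimes> tpow_join a m n) \<cdot> Assoc C a (tpow a m) (tpow a n))"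
    by (intro iso_comp iso_ten) (use Suc tpow_obj in \<open>simp_all add: arrow_simps iso_ident\<close>)
  then show ?case using Suc tpow_obj by (simp add: arrow_simps)
qed (simp add: arrow_simps tpow_obj)

text \<open>For associativity the base case is \<open>lunit_ten\<close> and the induction step is
  the pentagon. The right unit law comes from \<open>lunit_eq_runit\<close> and
  \<open>runit_ten\<close>, as the recursion of \<open>tpow_join\<close> only sees the left
  factor.\<close>

lemma tensor_family_tpow:
  assumes a: "a \<in> Obj C"
  shows "tensor_family C (tpow a) (Ident C (TUnit C)) (tpow_join a)"
proof
  note o = a tpow_obj[OF a] unit_obj
  note s = tpow_join_arr[OF a, THEN conjunct1] tpow_join_arr[OF a, THEN conjunct2, THEN conjunct1]
    tpow_join_arr[OF a, THEN conjunct2, THEN conjunct2, THEN conjunct1] tpow_join_arr[OF a, THEN conjunct2, THEN conjunct2, THEN conjunct2]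
  show "tpow a n \<in> Obj C" for n using o by simp
  show "Ident C (TUnit C) \<in> Hom C (TUnit C) (tpow a 0)" "iso_arrow C (Ident C (TUnit C))"
    using ident_closed[OF unit_obj] iso_ident[OF unit_obj] by simp_all
  show "tpow_join a m n \<in> Hom C (tpow a m \<boxdot> tpow a n) (tpow a (m + n))" "iso_arrow C (tpow_join a m n)" for m n
    using s by (simp_all add: Hom_def)
  show "tpow_join a 0 n \<cdot> (Ident C (TUnit C) \<boxtimes> Ident C (tpow a n)) = LUnit C (tpow a n)" for n
    using o by (simp add: arrow_simps)
  show "tpow_join a n 0 \<cdot> (Ident C (tpow a n) \<boxtimes> Ident C (TUnit C)) = RUnit C (tpow a n)" for n
  proof -
    have "tpow_join a n 0 = RUnit C (tpow a n)"
      by (induction n) (use o in \<open>simp_all add: lunit_eq_runit runit_ten\<close>)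
    then show ?thesis using o by (simp add: arrow_simps)
  qed
  fix k m n
  let ?T = "tpow a" and ?c = "tpow_join a"
  show "?c (k + m) n \<cdot> (?c k m \<boxtimes> Ident C (?T n)) = ?c k (m + n) \<cdot> (Ident C (?T k) \<boxtimes> ?c m n) \<cdot> Assoc C (?T k) (?T m) (?T n)"
  proof (induction k)
    case 0
    have "?c 0 (m + n) \<cdot> (Ident C (?T 0) \<boxtimes> ?c m n) \<cdot> Assoc C (?T 0) (?T m) (?T n)
      = (LUnit C (?T (m + n)) \<cdot> (Ident C (TUnit C) \<boxtimes> ?c m n)) \<cdot> Assoc C (TUnit C) (?T m) (?T n)"
      using o s by (simp add: arrow_simps)
    also have "\<dots> = ?c m n \<cdot> (LUnit C (?T m \<boxdot> ?T n) \<cdot> Assoc C (TUnit C) (?T m) (?T n))"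
      using lunit_nat_arr[OF s(1)[of m n]] o s by (simp add: arrow_simps)
    also have "\<dots> = ?c m n \<cdot> (LUnit C (?T m) \<boxtimes> Ident C (?T n))" using o by (simp add: lunit_ten)
    finally show ?case by simp
  next
    case (Suc k)
    let ?A = "Assoc C a (?T k) (?T m)" and ?i = "Ident C a"
    have n1: "Assoc C a (?T (k + m)) (?T n) \<cdot> ((?i \<boxtimes> ?c k m) \<boxtimes> Ident C (?T n)) = (?i \<boxtimes> (?c k m \<boxtimes> Ident C (?T n))) \<cdot> Assoc C a (?T k \<boxdot> ?T m) (?T n)"
      using assoc_nat_arr[of ?i "?c k m" "Ident C (?T n)"] o s by (simp add: arrow_simps)
    have n2: "Assoc C a (?T k) (?T (m + n)) \<cdot> (Ident C (a \<boxdot> ?T k) \<boxtimes> ?c m n) = (?i \<boxtimes> (Ident C (?T k) \<boxtimes> ?c m n)) \<cdot> Assoc C a (?T k) (?T m \<boxdot> ?T n)"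
      using assoc_nat_arr[of ?i "Ident C (?T k)" "?c m n"] o s by (simp add: arrow_simps)
    have p: "(?i \<boxtimes> Assoc C (?T k) (?T m) (?T n)) \<cdot> Assoc C a (?T k \<boxdot> ?T m) (?T n) \<cdot> (?A \<boxtimes> Ident C (?T n)) = Assoc C a (?T k) (?T m \<boxdot> ?T n) \<cdot> Assoc C (a \<boxdot> ?T k) (?T m) (?T n)"
      by (rule pentagon) (use o in simp_all)
    have "?c (Suc k + m) n \<cdot> (?c (Suc k) m \<boxtimes> Ident C (?T n)) =
       (?i \<boxtimes> ?c (k + m) n) \<cdot> (Assoc C a (?T (k + m)) (?T n) \<cdot> ((?i \<boxtimes> ?c k m) \<boxtimes> Ident C (?T n))) \<cdot> (?A \<boxtimes> Ident C (?T n))"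
      using o s by (simp add: arrow_simps ten_interchange)
    also have "\<dots> = (?i \<boxtimes> (?c (k + m) n \<cdot> (?c k m \<boxtimes> Ident C (?T n)))) \<cdot> Assoc C a (?T k \<boxdot> ?T m) (?T n) \<cdot> (?A \<boxtimes> Ident C (?T n))"
      unfolding n1 using o s by (simp add: arrow_simps ten_interchange_comp)
    also have "\<dots> = (?i \<boxtimes> ?c k (m + n)) \<cdot> (?i \<boxtimes> (Ident C (?T k) \<boxtimes> ?c m n)) \<cdot> ((?i \<boxtimes> Assoc C (?T k) (?T m) (?T n)) \<cdot> Assoc C a (?T k \<boxdot> ?T m) (?T n) \<cdot> (?A \<boxtimes> Ident C (?T n)))"
      unfolding Suc using o s by (simp add: arrow_simps ten_interchange_comp add.assoc)
    also have "\<dots> = (?i \<boxtimes> ?c k (m + n)) \<cdot> (((?i \<boxtimes> (Ident C (?T k) \<boxtimes> ?c m n)) \<cdot> Assoc C a (?T k) (?T m \<boxdot> ?T n)) \<cdot> Assoc C (a \<boxdot> ?T k) (?T m) (?T n))"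
      unfolding p using o s by (simp add: arrow_simps)
    also have "\<dots> = ?c (Suc k) (m + n) \<cdot> (Ident C (?T (Suc k)) \<boxtimes> ?c m n) \<cdot> Assoc C (?T (Suc k)) (?T m) (?T n)"
      unfolding n2[symmetric] using o s by (simp add: arrow_simps)
    finally show ?case .
  qed
qed

end

context group begin

subsection \<open>Relations between the structure maps\<close>

lemma lmul_sel: "lsrc (lmul k n) = n" "ltgt (lmul k n) = 1" "x \<in> {1..n} \<Longrightarrow> lfun (lmul k n) x = 1" "x \<in> {1..n} \<Longrightarrow> llab (lmul k n) x = \<one>"
  "lord (lmul k n) i = (if k = Ordered \<and> i = 1 then [1..<Suc n] else [])"
  by (auto simp: lmul_def)

lemma set_12: "{1..2::nat} = {1, 2}" and upt_12: "[1..<Suc 2] = [1, 2]"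
  by (auto simp: upt_Suc numeral_2_eq_2)

lemma lmul_1: "lmul k 1 = lident k G 1"
  by (rule lmaps_eqI[OF lmul_lmaps lident_lmaps]) (auto simp: lmul_sel lident_sel upt_Suc)

lemma ltensor_11: "\<lbrakk>f \<in> lmaps k G a 1; g \<in> lmaps k G b 1\<rbrakk> \<Longrightarrow> ltensor f g \<in> lmaps k G (a + b) 2"
  by (drule (1) ltensor_lmaps) (simp only: one_add_one)

lemma ltensor_lunl: "g \<in> carrier G \<Longrightarrow> ltensor (lunl k g) (lunl k g) \<in> lmaps k G 2 2"
  using ltensor_11[OF lunl_lmaps[of g k] lunl_lmaps[of g k]] by (simp only: one_add_one)

lemma lbraid_11: "lbraid k G 1 1 \<in> lmaps k G 2 2"
  using lbraid_lmaps[of k 1 1] by (simp only: one_add_one)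

text \<open>Associativity and the unit laws of the generators at once: both bracketings of three
  factors are \<open>lmul k 3\<close>, and a unit contributes 0 to the sum.\<close>

lemma lcomp_lmul: "lcomp G (lmul k 2) (ltensor (lmul k a) (lmul k b)) = lmul k (a + b)"
proof (rule lmaps_eqI)
  show "lcomp G (lmul k 2) (ltensor (lmul k a) (lmul k b)) \<in> lmaps k G (a + b) 1"
    by (rule lcomp_lmaps[OF ltensor_11[OF lmul_lmaps lmul_lmaps] lmul_lmaps])
  show "lmul k (a + b) \<in> lmaps k G (a + b) 1" by (rule lmul_lmaps)
  fix x assume x: "x \<in> {1..a + b}"
  then have "lfun (ltensor (lmul k a) (lmul k b)) x \<in> {1..2}" "llab (ltensor (lmul k a) (lmul k b)) x = \<one>"
    by (auto simp: ltensor_def lmul_def)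
  then show "lfun (lcomp G (lmul k 2) (ltensor (lmul k a) (lmul k b))) x = lfun (lmul k (a + b)) x"
    "llab (lcomp G (lmul k 2) (ltensor (lmul k a) (lmul k b))) x = llab (lmul k (a + b)) x"
    using x by (auto simp: lcomp_def lmul_sel) (auto simp: ltensor_def lmul_def)
next
  fix i :: nat assume k: "k = Ordered" and i: "i \<in> {1..1}"
  have "map (\<lambda>x. a + x) [1..<Suc b] = [Suc a..<Suc (a + b)]"
    by (rule nth_equalityI) auto
  then have "lord (lcomp G (lmul k 2) (ltensor (lmul k a) (lmul k b))) i = [1..<Suc a] @ [Suc a..<Suc (a + b)]"
    using k i upt_12 by (simp add: lcomp_def lmul_sel ltensor_def)
  also have "\<dots> = [1..<Suc (a + b)]" using upt_add_eq_append[of 1 "Suc a" b] by simp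
  finally show "lord (lcomp G (lmul k 2) (ltensor (lmul k a) (lmul k b))) i = lord (lmul k (a + b)) i"
    using k i by (simp add: lmul_sel)
qed

lemma lcomp_lunl:
  assumes "g \<in> carrier G" "h \<in> carrier G"
  shows "lcomp G (lunl k g) (lunl k h) = lunl k (g \<otimes> h)"
  by (rule lmaps_eqI[OF lcomp_lmaps[OF lunl_lmaps lunl_lmaps] lunl_lmaps]) (use assms lunl_sel(3,4)[of k g] lunl_sel(3,4)[of k h] lunl_sel(3,4)[of k "g \<otimes> h"] in \<open>auto simp: lcomp_def lunl_sel(1,2,5)\<close>)

lemma lunl_one: "lunl k \<one> = lident k G 1"
  by (simp add: lunl_def lident_def)

lemma lunl_lmul:
  assumes g: "g \<in> carrier G"
  shows "lcomp G (lunl k g) (lmul k 0) = lmul k 0"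
    "lcomp G (lunl k g) (lmul k 2) = lcomp G (lmul k 2) (ltensor (lunl k g) (lunl k g))"
proof -
  show "lcomp G (lunl k g) (lmul k 0) = lmul k 0"
    by (rule lmaps_eqI[OF lcomp_lmaps[OF lmul_lmaps lunl_lmaps[OF g]] lmul_lmaps]) (auto simp: lcomp_def lunl_sel lmul_sel)
  show "lcomp G (lunl k g) (lmul k 2) = lcomp G (lmul k 2) (ltensor (lunl k g) (lunl k g))"
  proof (rule lmaps_eqI[OF lcomp_lmaps[OF lmul_lmaps lunl_lmaps[OF g]]])
    show "lcomp G (lmul k 2) (ltensor (lunl k g) (lunl k g)) \<in> lmaps k G 2 1"
      by (rule lcomp_lmaps[OF ltensor_lunl[OF g] lmul_lmaps])
    fix x :: nat assume "x \<in> {1..2}"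
    then have "x = 1 \<or> x = 2" by auto
    then show "lfun (lcomp G (lunl k g) (lmul k 2)) x = lfun (lcomp G (lmul k 2) (ltensor (lunl k g) (lunl k g))) x"
      "llab (lcomp G (lunl k g) (lmul k 2)) x = llab (lcomp G (lmul k 2) (ltensor (lunl k g) (lunl k g))) x"
      using g lunl_sel[of k g] by (auto simp: lcomp_def lmul_def ltensor_def)
  next
    fix i :: nat assume "k = Ordered" "i \<in> {1..1}"
    then show "lord (lcomp G (lunl k g) (lmul k 2)) i = lord (lcomp G (lmul k 2) (ltensor (lunl k g) (lunl k g))) i"
      using upt_12 by (simp add: lcomp_def lmul_sel lunl_sel ltensor_def)
  qed
qed

text \<open>Without orders the two elements of the fibre are interchangeable; for ordered fibres the
  two sides would differ in the order of the fibre.\<close>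

lemma lmul_lbraid: "lcomp G (lmul Unordered 2) (lbraid Unordered G 1 1) = lmul Unordered 2"
proof (rule lmaps_eqI[where k = Unordered and n = 2 and m = 1])
  show "lcomp G (lmul Unordered 2) (lbraid Unordered G 1 1) \<in> lmaps Unordered G 2 1" by (rule lcomp_lmaps[OF lbraid_11 lmul_lmaps])
  fix x :: nat assume "x \<in> {1..2}"
  then have "x = 1 \<or> x = 2" by auto
  then show "lfun (lcomp G (lmul Unordered 2) (lbraid Unordered G 1 1)) x = lfun (lmul Unordered 2) x"
    "llab (lcomp G (lmul Unordered 2) (lbraid Unordered G 1 1)) x = llab (lmul Unordered 2) x"
    by (auto simp: lcomp_def lmul_def lbraid_def lperm_def)
qed (simp_all only: lmul_lmaps fibre_kind.distinct)

text \<open>Precomposing both legs of the span with trivial left leg and right label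
  \<open>inv g\<close> with the label \<open>g\<close> moves the label to the left leg. So reading a
  label backwards inverts it, in accordance with the dual action.\<close>

lemma incY_lunl:
  assumes g: "g \<in> carrier G"
  shows "incY kX kY (lunl kY g) = incX kX kY (lunl kX (inv g))"
proof -
  have p: "lperms 1 (\<lambda>x. x) (\<lambda>_. g)" using g by (auto simp: lperms_def bij_betw_def)
  have "((lcomp G (lident kY G 1) (lunl kY g), lcomp G (lunl kX (inv g)) (lunl kX g)), (lident kY G 1, lunl kX (inv g))) \<in> span_equiv kX kY G 1 1"
    using span_equivI[OF lident_lmaps lunl_lmaps[OF inv_closed[OF g]] p] unfolding lunl_def .
  then have "((lunl kY g, lident kX G 1), (lident kY G 1, lunl kX (inv g))) \<in> span_equiv kX kY G 1 1"
    using g by (simp only: lcomp_lident(1)[OF lunl_lmaps] lcomp_lunl inv_closed l_inv lunl_one)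
  then show ?thesis
    unfolding incY_eq[OF lunl_lmaps[OF g]] incX_eq[OF lunl_lmaps[OF inv_closed[OF g]]] by (rule cls_eq)
qed

text \<open>The pullback of \<open>0 \<rightarrow> 1\<close> along \<open>2 \<rightarrow> 1\<close>
  is empty: the coproduct of the unit is a pair of units. Reflected by \<open>filler_swap\<close>,
  it is the axiom for the counit of a product.\<close>

lemma filler_lmul_0: "filler kX kY 0 0 2 1 (ltensor (lmul kX 0) (lmul kX 0)) (lmul kX 0) (lident kY G 0) (lmul kY 2)"
  unfolding filler_def
  by (intro conjI lident_lmaps lmul_lmaps ltensor_11[OF lmul_lmaps lmul_lmaps, of _ 0 0, unfolded add_0])
    (auto simp: bij_betw_def ltensor_def lmul_sel)

lemma filler_lmul_0_0: "filler kX kY 0 0 0 1 (lident kX G 0) (lmul kX 0) (lident kY G 0) (lmul kY 0)"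
  unfolding filler_def
  by (intro conjI lident_lmaps lmul_lmaps) (auto simp: bij_betw_def)

lemma lfun_middle:
  "map (lfun (ltensor (lident k G 1) (ltensor (lbraid k G 1 1) (lident k G 1)))) [1, 2, 3, 4] = [1, 3, 2, 4]"
  by (simp add: ltensor_def lbraid_def lident_def lperm_def)

lemma lord_middle:
  assumes "k = Ordered"
  shows "map (lord (ltensor (lident k G 1) (ltensor (lbraid k G 1 1) (lident k G 1)))) [1, 2, 3, 4] = [[1], [3], [2], [4]]"
proof -
  have s: "{1..2::nat} = {1, 2}" by auto
  have "inj_on (\<lambda>x. if x \<le> 1 then x + 1 else x - 1) {1..2::nat}" unfolding s by (auto simp: inj_on_def)
  from inv_into_f_f[OF this, of 1] inv_into_f_f[OF this, of 2]
  have i: "inv_into {1..2::nat} (\<lambda>x. if x \<le> 1 then x + 1 else x - 1) (Suc 1) = 1" "inv_into {1..2::nat} (\<lambda>x. if x \<le> 1 then x + 1 else x - 1) 1 = 2" by auto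
  have "lord (lbraid k G 1 1) 1 = [2]" "lord (lbraid k G 1 1) 2 = [1]" using assms i[unfolded One_nat_def numeral_2_eq_2] unfolding numeral_2_eq_2 by (simp_all add: lbraid_def lperm_def)
  moreover have "lord (lident k G 1) 1 = [1]" using assms by (simp add: lident_sel)
  moreover have "ltgt (lbraid k G 1 1) = 2" "lsrc (lbraid k G 1 1) = 2" by (simp_all add: lbraid_def lperm_def)
  ultimately show ?thesis using lident_sel(1,2)[of k 1] by (simp add: ltensor_def)
qed

text \<open>The pullback of two copies of \<open>2 \<rightarrow> 1\<close> is a 2 by 2 array. Its
  points are numbered along the fibres of the vertical leg, so the horizontal leg has to exchange
  the points 2 and 3; this is the middle interchange of the bimonoid axiom.\<close>

lemma filler_lmul_2:
  "filler kX kY 4 2 2 1 (lcomp G (ltensor (lmul kX 2) (lmul kX 2)) (ltensor (lident kX G 1) (ltensor (lbraid kX G 1 1) (lident kX G 1))))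
     (lmul kX 2) (ltensor (lmul kY 2) (lmul kY 2)) (lmul kY 2)"
    (is "filler _ _ _ _ _ _ (lcomp G ?m ?b) _ ?c _")
proof -
  have b: "?b \<in> lmaps kX G 4 4" using ltensor_lmaps[OF lident_lmaps[of kX 1] ltensor_lmaps[OF lbraid_11 lident_lmaps[of kX 1]]] by simp
  have mm: "ltensor (lmul k 2) (lmul k 2) \<in> lmaps k G 4 2" for k using ltensor_11[OF lmul_lmaps[of k 2] lmul_lmaps[of k 2]] by simp
  have lc: "lcomp G ?m ?b \<in> lmaps kX G 4 2" by (rule lcomp_lmaps[OF b mm])
  have s4: "{1..4::nat} = {1, 2, 3, 4}" by auto
  have m: "map (lfun (ltensor (lmul k 2) (lmul k 2))) [1, 2, 3, 4] = [1, 1, 2, 2]" "map (llab (ltensor (lmul k 2) (lmul k 2))) [1, 2, 3, 4] = [\<one>, \<one>, \<one>, \<one>]" for k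
    by (simp_all add: ltensor_def lmul_def)
  have o: "lord (ltensor (lmul k 2) (lmul k 2)) 1 = (if k = Ordered then [1, 2] else [])" "lord (ltensor (lmul k 2) (lmul k 2)) 2 = (if k = Ordered then [3, 4] else [])" for k
    using upt_12 by (simp_all add: ltensor_def lmul_def)
  have lb: "map (llab ?b) [1, 2, 3, 4] = [\<one>, \<one>, \<one>, \<one>]" by (simp add: ltensor_def lbraid_def lident_def lperm_def)
  have f1: "map (lfun (lcomp G ?m ?b)) [1, 2, 3, 4] = [1, 2, 1, 2]" "map (llab (lcomp G ?m ?b)) [1, 2, 3, 4] = [\<one>, \<one>, \<one>, \<one>]"
    using lfun_middle[of kX] lb m[of kX] lmapsD(1)[OF b] by (simp_all add: lcomp_def)
  have fo: "lord (lcomp G ?m ?b) 1 = (if kX = Ordered then [1, 3] else [])" "lord (lcomp G ?m ?b) 2 = (if kX = Ordered then [2, 4] else [])"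
    using lord_middle[of kX] o[of kX] by (simp_all add: lcomp_def)
  have two: "map (lfun (lmul k 2)) [1, 2] = [1, 1]" "map (llab (lmul k 2)) [1, 2] = [\<one>, \<one>]" for k by (simp_all add: lmul_def)
  have "bij_betw (\<lambda>z. (lfun ?c z, lfun (lcomp G ?m ?b) z)) {1..4} {(x, y). x \<in> {1..2} \<and> y \<in> {1..2} \<and> lfun (lmul kX 2) x = lfun (lmul kY 2) y}"
  proof -
    have "{(x, y). x \<in> {1..2} \<and> y \<in> {1..2} \<and> lfun (lmul kX 2) x = lfun (lmul kY 2) y} = {(1, 1), (1, 2), (2, 1), (2, 2)}"
      unfolding set_12 using two[of kX] two[of kY] by auto
    then show ?thesis unfolding s4 bij_betw_def using m[of kY] f1 by (simp add: inj_on_def)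
  qed
  moreover have "\<forall>x\<in>{1..2}. map (lfun (lcomp G ?m ?b)) (lord ?c x) = lord (lmul kY 2) (lfun (lmul kX 2) x)"
    unfolding set_12 using o[of kY] f1 two[of kX] upt_12 by (simp add: lmul_sel)
  moreover have "\<forall>x\<in>{1..2}. map (lfun ?c) (lord (lcomp G ?m ?b) x) = lord (lmul kX 2) (lfun (lmul kY 2) x)"
    unfolding set_12 using fo m[of kY] two[of kY] upt_12 by (simp add: lmul_sel)
  moreover have "\<forall>z\<in>{1..4}. llab (lmul kX 2) (lfun ?c z) \<otimes> llab ?c z = llab (lmul kY 2) (lfun (lcomp G ?m ?b) z) \<otimes> llab (lcomp G ?m ?b) z"
    unfolding s4 using m[of kY] f1 two[of kX] two[of kY] by simp
  ultimately show ?thesis unfolding filler_def using lc mm lmul_lmaps by blast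
qed

end

subsection \<open>Representations of labelled maps give G-monoids\<close>

text \<open>A strict monoidal functor from labelled maps of one kind to a strict PROP. It is
  instantiated for \<open>incX\<close>, and for \<open>incY\<close> in the opposite PROP.\<close>

locale lmap_rep = strict_prop ar dm cd cmp ten idn br + group G
  for ar :: "'e \<Rightarrow> bool" and dm cd :: "'e \<Rightarrow> nat"
    and cmp :: "'e \<Rightarrow> 'e \<Rightarrow> 'e" (infixr "\<odot>" 60)
    and ten :: "'e \<Rightarrow> 'e \<Rightarrow> 'e" (infixr "\<oslash>" 70)
    and idn :: "nat \<Rightarrow> 'e" and br :: "nat \<Rightarrow> nat \<Rightarrow> 'e"
    and G :: "('g, 'y) monoid_scheme" (structure) +
  fixes k :: fibre_kind and R :: "'g lmap \<Rightarrow> 'e"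
  assumes R_hom: "f \<in> lmaps k G n m \<Longrightarrow> hom (R f) n m"
    and R_comp: "\<lbrakk>f \<in> lmaps k G n m; g \<in> lmaps k G m l\<rbrakk> \<Longrightarrow> R (lcomp G g f) = R g \<odot> R f"
    and R_ten: "\<lbrakk>f \<in> lmaps k G n m; g \<in> lmaps k G n' m'\<rbrakk> \<Longrightarrow> R (ltensor f g) = R f \<oslash> R g"
    and R_ident: "R (lident k G n) = idn n"
begin

text \<open>Each axiom is the image of a relation between labelled maps; associativity and the unit
  laws are the instances \<open>2 + 1\<close>, \<open>1 + 2\<close>, \<open>0 + 1\<close> and
  \<open>1 + 0\<close> of \<open>lcomp_lmul\<close>.\<close>

lemma rep_gmon:
  assumes rho: "\<And>g. g \<in> carrier G \<Longrightarrow> rho g = R (lunl k g)"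
  shows "gmon ar dm cd cmp ten idn br G (R (lmul k 2)) (R (lmul k 0)) rho"
proof -
  have h: "ar (R (lmul k n))" "dm (R (lmul k n)) = n" "cd (R (lmul k n)) = Suc 0" for n
    using R_hom[OF lmul_lmaps[of k n]] by (simp_all add: hom_def)
  have r: "ar (rho g)" "dm (rho g) = Suc 0" "cd (rho g) = Suc 0" if "g \<in> carrier G" for g
    using R_hom[OF lunl_lmaps[OF that, of k]] rho[OF that] by (simp_all add: hom_def)
  have ml: "R (lmul k 2) \<odot> (R (lmul k a) \<oslash> R (lmul k b)) = R (lmul k (a + b))" for a b
  proof -
    have t: "ltensor (lmul k a) (lmul k b) \<in> lmaps k G (a + b) 2"
      by (rule ltensor_11[OF lmul_lmaps lmul_lmaps])
    show ?thesis unfolding lcomp_lmul[symmetric] R_comp[OF t lmul_lmaps] R_ten[OF lmul_lmaps lmul_lmaps] ..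
  qed
  have m1: "R (lmul k (Suc 0)) = idn (Suc 0)" using lmul_1[of k] R_ident[of 1] by simp
  have rm: "rho g \<odot> R (lmul k 2) = R (lmul k 2) \<odot> (rho g \<oslash> rho g)" "rho g \<odot> R (lmul k 0) = R (lmul k 0)" if g: "g \<in> carrier G" for g
  proof -
    note l = lunl_lmaps[OF g, of k]
    note t = ltensor_lunl[OF g, of k]
    show "rho g \<odot> R (lmul k 2) = R (lmul k 2) \<odot> (rho g \<oslash> rho g)"
      unfolding rho[OF g] R_comp[OF lmul_lmaps l, symmetric] R_ten[OF l l, symmetric] R_comp[OF t lmul_lmaps, symmetric] lunl_lmul(2)[OF g] ..
    show "rho g \<odot> R (lmul k 0) = R (lmul k 0)"
      unfolding rho[OF g] R_comp[OF lmul_lmaps l, symmetric] lunl_lmul(1)[OF g] ..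
  qed
  have rr: "rho g \<odot> rho h = rho (g \<otimes> h)" if "g \<in> carrier G" "h \<in> carrier G" for g h
    unfolding rho[OF that(1)] rho[OF that(2)] rho[OF m_closed[OF that]] lcomp_lunl[OF that, symmetric]
    by (rule R_comp[OF lunl_lmaps[OF that(2)] lunl_lmaps[OF that(1)], symmetric])
  have r1: "rho \<one> = idn (Suc 0)" unfolding rho[OF one_closed] lunl_one using R_ident[of 1] by simp
  note mls = ml[of 2 1] ml[of 1 2] ml[of 0 1] ml[of 1 0]
  show ?thesis
    by unfold_locales (use h r mls rm rr r1 in \<open>simp_all add: m1 numeral_3_eq_3\<close>)
qed

lemma rep_comm:
  assumes "k = Unordered" "R (lbraid k G 1 1) = br 1 1"
  shows "R (lmul k 2) \<odot> br (Suc 0) (Suc 0) = R (lmul k 2)"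
proof -
  have "R (lmul k 2) = R (lmul k 2) \<odot> R (lbraid k G 1 1)"
    unfolding R_comp[OF lbraid_11 lmul_lmaps, symmetric] using lmul_lbraid assms(1) by simp
  then show ?thesis using assms(2) by simp
qed

end

context group begin

text \<open>Precomposing both legs with the block permutation carries the braiding from the right
  leg to the left one and inverts it, hence the exchanged indices.\<close>

lemma incY_lbraid: "incY kX kY (lbraid kY G n m) = incX kX kY (lbraid kX G m n)"
proof -
  let ?s = "\<lambda>n m x :: nat. if x \<le> n then x + m else x - n"
  have b: "lperms (n + m) (?s n m) (\<lambda>_. \<one>)" "bij_betw (?s m n) {1..n + m} {1..n + m}"
    using lbraid_lperms[of n m] lbraid_lperms[of m n] by (simp_all add: lperms_def add.commute)
  have s: "bij_betw (?s n m) {1..n + m} {1..n + m}" using b(1) by (simp add: lperms_def)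
  have B: "lbraid kX G m n = lperm kX (n + m) (?s m n) (\<lambda>_. \<one>)" by (simp add: lbraid_def add.commute)
  have "lcomp G (lbraid kX G m n) (lperm kX (n + m) (?s n m) (\<lambda>_. \<one>)) = lperm kX (n + m) (?s m n \<circ> ?s n m) (\<lambda>x. \<one> \<otimes> \<one>)"
    unfolding B by (rule lcomp_lperm_lperm[OF s b(2)]) auto
  also have "\<dots> = lident kX G (n + m)" unfolding lident_def
    by (rule lperm_cong[OF bij_betw_trans[OF s b(2)]]) auto
  finally have i: "lcomp G (lbraid kX G m n) (lperm kX (n + m) (?s n m) (\<lambda>_. \<one>)) = lident kX G (n + m)" .
  have X: "lbraid kX G m n \<in> lmaps kX G (n + m) (n + m)" using lbraid_lmaps[of kX m n] by (simp add: add.commute)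
  have "((lcomp G (lident kY G (n + m)) (lbraid kY G n m), lident kX G (n + m)), (lident kY G (n + m), lbraid kX G m n)) \<in> span_equiv kX kY G (n + m) (n + m)"
    using span_equivI[OF lident_lmaps X b(1), of kY] unfolding i lbraid_def[of kY] .
  then show ?thesis
    unfolding incY_eq[OF lbraid_lmaps] incX_eq[OF X] lcomp_lident(1)[OF lbraid_lmaps] by (rule cls_eq)
qed

end

subsection \<open>The bimonoid of an algebra\<close>

locale composite_algebra = group G + symmetric_monoidal_category S + symmetric_monoidal_functor "composite_prop L kX kY G" S F
  for G :: "('g, 'y) monoid_scheme" and S :: "('o, 'a, 'z) smc_scheme" (structure)
    and L :: label_law and kX kY :: fibre_kind and F :: "(nat, 'g span_class, 'o, 'a) mfnctr" +
  assumes L: "L = Commuting \<or> L = Preserving \<and> comm_group G"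
begin

abbreviation "Q \<equiv> composite_prop L kX kY G"
abbreviation "jX \<equiv> incX kX kY"
abbreviation "jY \<equiv> incY kX kY"

lemmas Q_simps = Q_sel[OF L, where kX = kX and kY = kY]
lemmas jX_hom = incX_hom[OF L, where kX = kX and kY = kY] and jY_hom = incY_hom[OF L, where kX = kX and kY = kY]
lemmas jX_comp = incX_comp[OF L, where kX = kX and kY = kY] and jY_comp = incY_comp[OF L, where kX = kX and kY = kY]
lemmas jX_ten = incX_tensor[OF L, where kX = kX and kY = kY] and jY_ten = incY_tensor[OF L, where kX = kX and kY = kY]
lemmas Q_id = Q_ident[OF L, where kX = kX and kY = kY]
lemmas Q_br = Q_braid[OF L, where kX = kX and kY = kY]
lemmas Q_XY = incX_incY_comp[OF L, where kX = kX and kY = kY]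
lemmas Q_YX = incY_incX_comp[OF L, where kX = kX and kY = kY]

lemma F_id: "amap F (Ident Q n) = Ident S (omap F n)"
  by (rule amap_ident) (simp add: Q_simps)

lemma F_obj: "omap F n \<in> Obj S"
  using omap_closed by (auto simp: Q_simps)

lemma unit_map_hom: "unit_map F \<in> Hom S (TUnit S) (omap F 0)" and ten_map_hom: "ten_map F m n \<in> Hom S (omap F m \<boxdot> omap F n) (omap F (m + n))"
    and ten_map_iso: "iso_arrow S (ten_map F m n)"
  using unit_map(1) ten_map[of m n] by (simp_all add: Q_simps)

sublocale tensor_family S "omap F" "unit_map F" "ten_map F"
proof
  note s = F_obj unit_map_hom ten_map_hom ten_map_iso unit_map(2)
  have a: "ten_map F m n \<in> Arr S" "Dom S (ten_map F m n) = omap F m \<boxdot> omap F n" "Cod S (ten_map F m n) = omap F (m + n)"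
    "unit_map F \<in> Arr S" "Dom S (unit_map F) = TUnit S" "Cod S (unit_map F) = omap F 0" for m n
    using ten_map_hom[of m n] unit_map_hom by (auto simp: Hom_def)
  show "omap F n \<in> Obj S" "unit_map F \<in> Hom S (TUnit S) (omap F 0)" "iso_arrow S (unit_map F)"
    "ten_map F m n \<in> Hom S (omap F m \<boxdot> omap F n) (omap F (m + n))" "iso_arrow S (ten_map F m n)" for m n
    using s by simp_all
  show "ten_map F (k + m) n \<cdot> (ten_map F k m \<boxtimes> Ident S (omap F n)) =
     ten_map F k (m + n) \<cdot> (Ident S (omap F k) \<boxtimes> ten_map F m n) \<cdot> Assoc S (omap F k) (omap F m) (omap F n)" for k m n
    using preserves_assoc[of k m n] s(1) a by (simp add: Q_simps F_id arrow_simps add.assoc)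
  show "ten_map F 0 n \<cdot> (unit_map F \<boxtimes> Ident S (omap F n)) = LUnit S (omap F n)"
    "ten_map F n 0 \<cdot> (Ident S (omap F n) \<boxtimes> unit_map F) = RUnit S (omap F n)" for n
    using preserves_lunit[of n] preserves_runit[of n] s(1) a by (simp_all add: Q_simps F_id arrow_simps)
qed

text \<open>The functor \<open>F\<close> seen in the strict PROP of its own values. There the
  conjugation with \<open>ten_map\<close> makes it strict monoidal, so it restricts to
  representations of labelled maps.\<close>

definition EF :: "'g span_class \<Rightarrow> nat \<times> 'a \<times> nat" where
  "EF a = (Dom Q a, amap F a, Cod Q a)"

lemma EF_hom: "a \<in> Hom Q n m \<Longrightarrow> E.hom (EF a) n m"
  unfolding E.hom_def using amap_closed[of a n m] by (auto simp: EF_def E_defs Hom_def)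

lemma EF_comp: "\<lbrakk>a \<in> Hom Q n m; b \<in> Hom Q m l\<rbrakk> \<Longrightarrow> EF (Comp Q b a) = cmpE (EF b) (EF a)"
  using amap_comp[of a n m b l] Q_comp_hom[OF L, of a kX kY n m b l] by (auto simp: EF_def E_defs Hom_def)

lemma EF_ten:
  assumes a: "a \<in> Hom Q n m" and b: "b \<in> Hom Q n' m'"
  shows "EF (TenA Q a b) = tenE (EF a) (EF b)"
proof -
  have s: "amap F a \<in> Arr S" "Dom S (amap F a) = omap F n" "Cod S (amap F a) = omap F m"
    "amap F b \<in> Arr S" "Dom S (amap F b) = omap F n'" "Cod S (amap F b) = omap F m'"
    "amap F (TenA Q a b) \<in> Arr S" "Dom S (amap F (TenA Q a b)) = omap F (n + n')" "Cod S (amap F (TenA Q a b)) = omap F (m + m')"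
    using amap_closed[OF a] amap_closed[OF b] amap_closed[OF Q_tensor_hom[OF L a b]] by (auto simp: Hom_def)
  have "ten_map F m m' \<cdot> (amap F a \<boxtimes> amap F b) \<cdot> inv_arrow S (ten_map F n n') = (ten_map F m m' \<cdot> (amap F a \<boxtimes> amap F b)) \<cdot> inv_arrow S (ten_map F n n')"
    using s by (simp add: fam_simps)
  also have "\<dots> = amap F (TenA Q a b)"
    unfolding ten_map_natural[OF a b] using s by (simp add: fam_simps)
  finally show ?thesis using a b Q_tensor_hom[OF L a b] by (simp add: EF_def tenE_def Hom_def)
qed

lemma EF_ident: "EF (jX (lident kX G n)) = idE n" "EF (jY (lident kY G n)) = idE n"
  using F_id[of n] jX_hom[OF lident_lmaps[of kX n]] unfolding Q_id(2)[symmetric] Q_id(1)[symmetric]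
  by (auto simp: EF_def idE_def Hom_def)

lemma EF_braid: "EF (jX (lbraid kX G n m)) = brE n m" "EF (jY (lbraid kY G n m)) = brE m n"
proof -
  have x: "EF (jX (lbraid kX G n m)) = brE n m" for n m
  proof -
    have "jX (lbraid kX G n m) \<in> Hom Q (n + m) (n + m)" by (rule jX_hom[OF lbraid_lmaps])
    note h = this amap_closed[OF this]
    have "amap F (jX (lbraid kX G n m)) = (amap F (jX (lbraid kX G n m)) \<cdot> ten_map F n m) \<cdot> inv_arrow S (ten_map F n m)"
      using h(2) by (simp add: fam_simps Hom_def)
    also have "\<dots> = ten_map F m n \<cdot> Braid S (omap F n) (omap F m) \<cdot> inv_arrow S (ten_map F n m)"
      using preserves_braid[of n m] by (simp add: fam_simps Q_simps Q_br)
    finally show ?thesis using h(1) by (simp add: EF_def brE_def Hom_def add.commute)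
  qed
  show "EF (jX (lbraid kX G n m)) = brE n m" "EF (jY (lbraid kY G n m)) = brE m n" using x incY_lbraid by simp_all
qed

lemma lmap_rep_X: "lmap_rep arE dmE cdE cmpE tenE idE brE G kX (\<lambda>f. EF (jX f))"
proof unfold_locales
  show "E.hom (EF (jX f)) n m" if "f \<in> lmaps kX G n m" for f n m using EF_hom[OF jX_hom[OF that]] .
  show "EF (jX (lcomp G g f)) = cmpE (EF (jX g)) (EF (jX f))" if "f \<in> lmaps kX G n m" "g \<in> lmaps kX G m l" for f g n m l
    using EF_comp[OF jX_hom[OF that(1)] jX_hom[OF that(2)]] unfolding jX_comp[OF that] .
  show "EF (jX (ltensor f g)) = tenE (EF (jX f)) (EF (jX g))" if "f \<in> lmaps kX G n m" "g \<in> lmaps kX G n' m'" for f g n m n' m'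
    using EF_ten[OF jX_hom[OF that(1)] jX_hom[OF that(2)]] unfolding jX_ten[OF that] .
qed (rule EF_ident)

text \<open>Contravariance of \<open>incY\<close> makes it a representation in the opposite PROP;
  the monoid obtained there is the comonoid of the algebra.\<close>

lemma lmap_rep_Y: "lmap_rep arE cdE dmE (\<lambda>f g. cmpE g f) tenE idE (\<lambda>m n. brE n m) G kY (\<lambda>f. EF (jY f))"
proof -
  interpret O: strict_prop arE cdE dmE "\<lambda>f g. cmpE g f" tenE idE "\<lambda>m n. brE n m" by (rule E.strict_prop_op)
  have oh: "O.hom f n m \<longleftrightarrow> E.hom f m n" for f n m by (auto simp: O.hom_def E.hom_def)
  show ?thesis
  proof unfold_locales
    show "O.hom (EF (jY f)) n m" if "f \<in> lmaps kY G n m" for f n m unfolding oh using EF_hom[OF jY_hom[OF that]] .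
    show "EF (jY (lcomp G g f)) = cmpE (EF (jY f)) (EF (jY g))" if "f \<in> lmaps kY G n m" "g \<in> lmaps kY G m l" for f g n m l
      using EF_comp[OF jY_hom[OF that(2)] jY_hom[OF that(1)]] unfolding jY_comp[OF that] .
    show "EF (jY (ltensor f g)) = tenE (EF (jY f)) (EF (jY g))" if "f \<in> lmaps kY G n m" "g \<in> lmaps kY G n' m'" for f g n m n' m'
      using EF_ten[OF jY_hom[OF that(1)] jY_hom[OF that(2)]] unfolding jY_ten[OF that] .
  qed (rule EF_ident)
qed

definition "muF \<equiv> EF (jX (lmul kX 2))"
definition "etaF \<equiv> EF (jX (lmul kX 0))"
definition "rhoF g \<equiv> EF (jX (lunl kX g))"
definition "delF \<equiv> EF (jY (lmul kY 2))"
definition "epsF \<equiv> EF (jY (lmul kY 0))"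

lemma rhoF_inv: "g \<in> carrier G \<Longrightarrow> rhoF (inv\<^bsub>G\<^esub> g) = EF (jY (lunl kY g))"
  by (simp add: rhoF_def incY_lunl)

lemma EF_filler:
  assumes F: "filler kX kY n m p q f1 f phi1 phi"
  shows "cmpE (EF (jY phi)) (EF (jX f)) = cmpE (EF (jX f1)) (EF (jY phi1))"
proof -
  have a: "f1 \<in> lmaps kX G n p" "f \<in> lmaps kX G m q" "phi1 \<in> lmaps kY G n m" "phi \<in> lmaps kY G p q" using F by (auto simp: filler_def)
  show ?thesis
    unfolding EF_comp[OF jX_hom[OF a(2)] jY_hom[OF a(4)], symmetric] EF_comp[OF jY_hom[OF a(3)] jX_hom[OF a(1)], symmetric]
      Q_YX[OF F] Q_XY[OF a(3,1)] ..
qed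

text \<open>Monoid, comonoid and actions come from the two representations. The four mixed axioms
  come from the four fillers of cospans of generators.\<close>

lemma gbim_F: "gbim arE dmE cdE cmpE tenE idE brE G muF etaF rhoF delF epsF"
proof -
  interpret X: lmap_rep arE dmE cdE cmpE tenE idE brE G kX "\<lambda>f. EF (jX f)" by (rule lmap_rep_X)
  interpret Y: lmap_rep arE cdE dmE "\<lambda>f g. cmpE g f" tenE idE "\<lambda>m n. brE n m" G kY "\<lambda>f. EF (jY f)" by (rule lmap_rep_Y)
  have g: "gmon arE dmE cdE cmpE tenE idE brE G muF etaF rhoF"
    unfolding muF_def etaF_def by (rule X.rep_gmon) (simp add: rhoF_def)
  then interpret gmon arE dmE cdE cmpE tenE idE brE G muF etaF rhoF .
  have o: "gmon arE cdE dmE (\<lambda>f g. cmpE g f) tenE idE (\<lambda>m n. brE n m) G delF epsF (\<lambda>g. rhoF (inv\<^bsub>G\<^esub> g))"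
    unfolding delF_def epsF_def by (rule Y.rep_gmon) (rule rhoF_inv)
  note l = lmul_lmaps and i = lident_lmaps and t = ltensor_lmaps
  let ?b = "ltensor (lident kX G 1) (ltensor (lbraid kX G 1 1) (lident kX G 1))"
  have b: "?b \<in> lmaps kX G 4 4" using t[OF i[of kX 1] t[OF lbraid_11 i[of kX 1]]] by simp
  have m: "ltensor (lmul kX 2) (lmul kX 2) \<in> lmaps kX G 4 2" using ltensor_11[OF l[of kX 2] l[of kX 2]] by simp
  have "EF (jX ?b) = tenE (idE (Suc 0)) (tenE (brE (Suc 0) (Suc 0)) (idE (Suc 0)))"
    using X.R_ten[OF i[of kX 1] t[OF lbraid_lmaps[of kX 1 1] i[of kX 1]]] X.R_ten[OF lbraid_lmaps[of kX 1 1] i[of kX 1]]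
    by (simp add: EF_ident EF_braid)
  moreover have "cmpE delF muF = cmpE (cmpE (tenE muF muF) (EF (jX ?b))) (tenE delF delF)"
    using EF_filler[OF filler_lmul_2] unfolding X.R_comp[OF b m] X.R_ten[OF l l] Y.R_ten[OF l l] muF_def delF_def .
  moreover have "E.hom (EF (jX ?b)) 4 4" by (rule X.R_hom[OF b])
  moreover have d: "arE delF" "dmE delF = Suc 0" "cdE delF = Suc (Suc 0)" "arE epsF" "dmE epsF = Suc 0" "cdE epsF = 0"
    using gmon.mu_ar[OF o] gmon.eta_ar[OF o] by simp_all
  ultimately have 1: "cmpE delF muF = cmpE (tenE muF muF) (cmpE (tenE (idE (Suc 0)) (tenE (brE (Suc 0) (Suc 0)) (idE (Suc 0)))) (tenE delF delF))"
    by (simp add: E.cmp_assoc)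
  have e: "arE etaF" "dmE etaF = 0" "arE muF" "dmE muF = Suc (Suc 0)" by simp_all
  have 2: "cmpE delF etaF = tenE etaF etaF"
    using EF_filler[OF filler_lmul_0] e unfolding X.R_ten[OF l l] muF_def delF_def etaF_def EF_ident
    by (simp add: E.cmp_idn)
  have 3: "cmpE epsF muF = tenE epsF epsF"
    using EF_filler[OF filler_swap[OF filler_lmul_0]] d unfolding Y.R_ten[OF l l] muF_def epsF_def EF_ident
    by (simp add: E.idn_cmp)
  have 4: "cmpE epsF etaF = idE 0"
    using EF_filler[OF filler_lmul_0_0] unfolding etaF_def epsF_def EF_ident by (simp add: E.idn_cmp)
  show ?thesis by (rule gbim.intro[OF g gbim_axioms.intro[OF o 1 2 3 4]])
qed

lemma comm_F: "kX = Unordered \<Longrightarrow> cmpE muF (brE (Suc 0) (Suc 0)) = muF"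
  and cocomm_F: "kY = Unordered \<Longrightarrow> cmpE (brE (Suc 0) (Suc 0)) delF = delF"
  unfolding muF_def delF_def
  by (fact lmap_rep.rep_comm[OF lmap_rep_X _ EF_braid(1)] lmap_rep.rep_comm[OF lmap_rep_Y _ EF_braid(2)])+

text \<open>The images of the generators start or end at \<open>omap F 2\<close> and
  \<open>omap F 0\<close>; \<open>ten_map\<close> and \<open>unit_map\<close> convert these objects
  into the tensor square and the unit object.\<close>

definition bimon_F :: "('o, 'a) bimon" where
  "bimon_F = \<lparr>bobj = omap F 1, bmult = amap F (jX (lmul kX 2)) \<cdot> ten_map F 1 1, bunit = amap F (jX (lmul kX 0)) \<cdot> unit_map F,
     bcomult = inv_arrow S (ten_map F 1 1) \<cdot> amap F (jY (lmul kY 2)), bcounit = inv_arrow S (unit_map F) \<cdot> amap F (jY (lmul kY 0))\<rparr>"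

abbreviation "pF \<equiv> (Suc 0, Ident S (omap F (Suc 0)))"

lemma pres_pF: "pres pF (omap F (Suc 0))"
  by (simp add: pres_def iso_ident arrow_simps)

lemma inv_ident: "inv_arrow S (Ident S (omap F n)) = Ident S (omap F n)"
  by (rule inv_arrow_eq) (simp add: inverse_arrows_def Hom_def arrow_simps)

lemma F_arr:
  "amap F (jX (lmul kX n)) \<in> Arr S" "Dom S (amap F (jX (lmul kX n))) = omap F n" "Cod S (amap F (jX (lmul kX n))) = omap F (Suc 0)"
  "amap F (jY (lmul kY n)) \<in> Arr S" "Dom S (amap F (jY (lmul kY n))) = omap F (Suc 0)" "Cod S (amap F (jY (lmul kY n))) = omap F n"
  using amap_closed[OF jX_hom[OF lmul_lmaps]] amap_closed[OF jY_hom[OF lmul_lmaps]] by (simp_all add: Hom_def)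

text \<open>With the identity as presentation of arity 1, the comparison arrows in
  \<open>bimon_F\<close> cancel against those of the presentations, and the images of the generators
  under \<open>EF\<close> are left.\<close>

lemma rep_F:
  "rep (pten pF pF) pF (bmult bimon_F) muF" "rep (0, unit_map F) pF (bunit bimon_F) etaF"
  "rep pF (pten pF pF) (bcomult bimon_F) delF" "rep pF (0, unit_map F) (bcounit bimon_F) epsF"
  "g \<in> carrier G \<Longrightarrow> rep pF pF (amap F (jX (lunl kX g))) (rhoF g)"
proof -
  have EX: "EF (jX f) = (n, amap F (jX f), m)" if "f \<in> lmaps kX G n m" for f n m using jX_hom[OF that] by (simp add: EF_def Hom_def)
  have EY: "EF (jY f) = (m, amap F (jY f), n)" if "f \<in> lmaps kY G n m" for f n m using jY_hom[OF that] by (simp add: EF_def Hom_def)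
  have pp: "pten pF pF = (2, ten_map F (Suc 0) (Suc 0))" by (simp add: pten_def fam_simps)
  have p2: "pres (2, ten_map F (Suc 0) (Suc 0)) (omap F (Suc 0) \<boxdot> omap F (Suc 0))"
    using pres_ten[OF pres_pF pres_pF] unfolding pp .
  have a2: "amap F (jX (lmul kX 2)) \<in> Arr S" "Dom S (amap F (jX (lmul kX 2))) = omap F (Suc (Suc 0))" "amap F (jY (lmul kY 2)) \<in> Arr S" "Cod S (amap F (jY (lmul kY 2))) = omap F (Suc (Suc 0))"
    using F_arr(1,2,4,6)[of 2] by (simp_all add: numeral_2_eq_2)
  show "rep (pten pF pF) pF (bmult bimon_F) muF" unfolding pp
    using F_arr(1-3)[of 2] p2 pres_pF a2 by (simp add: rep_def bimon_F_def muF_def EX[OF lmul_lmaps] fam_simps)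
  show "rep pF (pten pF pF) (bcomult bimon_F) delF" unfolding pp
    using F_arr(4-6)[of 2] p2 pres_pF a2 by (simp add: rep_def bimon_F_def delF_def EY[OF lmul_lmaps] fam_simps inv_ident)
  show "rep (0, unit_map F) pF (bunit bimon_F) etaF"
    using F_arr(1-3)[of 0] pres_u pres_pF by (simp add: rep_def bimon_F_def etaF_def EX[OF lmul_lmaps] fam_simps)
  show "rep pF (0, unit_map F) (bcounit bimon_F) epsF"
    using F_arr(4-6)[of 0] pres_u pres_pF by (simp add: rep_def bimon_F_def epsF_def EY[OF lmul_lmaps] fam_simps inv_ident)
  show "rep pF pF (amap F (jX (lunl kX g))) (rhoF g)" if "g \<in> carrier G"
    using amap_closed[OF jX_hom[OF lunl_lmaps[OF that]]] pres_pF
    by (simp add: rep_def rhoF_def EX[OF lunl_lmaps[OF that]] fam_simps inv_ident Hom_def)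
qed

lemma bimon_F_eq: "bimon_F = \<lparr>bobj = omap F (Suc 0), bmult = bmult bimon_F, bunit = bunit bimon_F, bcomult = bcomult bimon_F, bcounit = bcounit bimon_F\<rparr>"
  by (simp add: bimon_F_def)

lemma bobj_F: "bobj bimon_F = omap F (Suc 0)"
  by (simp add: bimon_F_def)

lemma bimonoid_F:
  shows "bimonoid S bimon_F" and "g \<in> carrier G \<Longrightarrow> bimonoid_morphism S bimon_F bimon_F (amap F (jX (lunl kX g)))"
    and "\<lbrakk>g \<in> carrier G; h \<in> carrier G\<rbrakk> \<Longrightarrow> amap F (jX (lunl kX (g \<otimes>\<^bsub>G\<^esub> h))) = amap F (jX (lunl kX g)) \<cdot> amap F (jX (lunl kX h))"
    and "amap F (jX (lunl kX \<one>\<^bsub>G\<^esub>)) = Ident S (omap F 1)"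
  using gbim_iff[OF pres_pF rep_F(1-4) is_group rep_F(5), THEN iffD1, OF _ gbim_F] unfolding bimon_F_eq[symmetric] by auto

lemma comm_bimon_F: "kX = Unordered \<Longrightarrow> commutative_bimonoid S bimon_F" and cocomm_bimon_F: "kY = Unordered \<Longrightarrow> cocommutative_bimonoid S bimon_F"
  unfolding commutative_bimonoid_def cocommutative_bimonoid_def bobj_F comm_iff[OF pres_pF rep_F(1-4)]
  by (fact comm_F cocomm_F)+

end

subsection \<open>Morphisms of algebras\<close>

locale tensor_family_pair = tensor_family S T u c + T': tensor_family S T' u' c'
  for S :: "('o, 'a, 'z) smc_scheme" (structure) and T :: "nat \<Rightarrow> 'o" and u :: 'a and c :: "nat \<Rightarrow> nat \<Rightarrow> 'a"
    and T' :: "nat \<Rightarrow> 'o" and u' :: 'a and c' :: "nat \<Rightarrow> nat \<Rightarrow> 'a"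
begin

lemmas pair_simps = fam_simps T'.c_simps T'.u_simps T'.c_iso T'.u_iso

text \<open>A monoidal transformation is determined by its component at 1. This is the candidate
  with component \<open>f\<close> there, built by splitting off one tensor factor at a time.\<close>

primrec ext :: "'a \<Rightarrow> nat \<Rightarrow> 'a" where
  "ext f 0 = u' \<cdot> inv_arrow S u"
| "ext f (Suc n) = c' 1 n \<cdot> (f \<boxtimes> ext f n) \<cdot> inv_arrow S (c 1 n)"

text \<open>The monoidality of a transformation, separated from its naturality.\<close>

definition compatible :: "(nat \<Rightarrow> 'a) \<Rightarrow> bool" where
  "compatible t \<longleftrightarrow> (\<forall>n. t n \<in> Hom S (T n) (T' n)) \<and> t 0 \<cdot> u = u' \<and> (\<forall>m n. t (m + n) \<cdot> c m n = c' m n \<cdot> (t m \<boxtimes> t n))"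

context
  fixes f :: 'a
  assumes f: "f \<in> Hom S (T 1) (T' 1)"
begin

lemma f_ar: "f \<in> Arr S" "Dom S f = T (Suc 0)" "Cod S f = T' (Suc 0)"
  using f by (auto simp: Hom_def)

lemma ext_hom: "ext f n \<in> Arr S \<and> Dom S (ext f n) = T n \<and> Cod S (ext f n) = T' n"
  by (induction n) (use f_ar in \<open>simp_all add: pair_simps\<close>)

lemmas ext_ar = ext_hom[THEN conjunct1] ext_hom[THEN conjunct2, THEN conjunct1] ext_hom[THEN conjunct2, THEN conjunct2]

text \<open>Induction on \<open>m\<close>. The base case compares the left unit laws of both
  families; the step rebrackets with \<open>c_assoc\<close> in the source and in the target and uses
  naturality of the associator in between.\<close>

lemma ext_ten: "ext f (m + n) \<cdot> c m n = c' m n \<cdot> (ext f m \<boxtimes> ext f n)"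
proof (induction m)
  case 0
  let ?t = "ext f n"
  have e: "iso_arrow S (u \<boxtimes> Ident S (T n))" by (intro iso_ten u_iso iso_ident) simp
  have "(?t \<cdot> c 0 n) \<cdot> (u \<boxtimes> Ident S (T n)) = ?t \<cdot> LUnit S (T n)"
    unfolding c_lunit[symmetric] using ext_ar by (simp add: pair_simps)
  also have "\<dots> = LUnit S (T' n) \<cdot> (Ident S (TUnit S) \<boxtimes> ?t)" using lunit_nat_arr[OF ext_ar(1)[of n]] ext_ar by simp
  also have "\<dots> = (c' 0 n \<cdot> (ext f 0 \<boxtimes> ?t)) \<cdot> (u \<boxtimes> Ident S (T n))"
    unfolding T'.c_lunit[symmetric] using ext_ar by (simp add: pair_simps)
  finally have "?t \<cdot> c 0 n = c' 0 n \<cdot> (ext f 0 \<boxtimes> ?t)"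
    by (rule iso_cancel_right[OF _ e]) (use ext_ar in \<open>simp_all add: pair_simps\<close>)
  then show ?case by simp
next
  case (Suc m)
  let ?t = "ext f" and ?i = "Ident S (T 1)" and ?n = "Ident S (T n)"
  have e: "iso_arrow S (c 1 m \<boxtimes> ?n)" by (intro iso_ten c_iso iso_ident) simp
  have tS: "?t (Suc k) \<cdot> c 1 k = c' 1 k \<cdot> (f \<boxtimes> ?t k)" for k using ext_ar f_ar by (simp add: pair_simps)
  have "(?t (Suc m + n) \<cdot> c (Suc m) n) \<cdot> (c 1 m \<boxtimes> ?n) = ?t (Suc m + n) \<cdot> (c (1 + m) n \<cdot> (c 1 m \<boxtimes> ?n))"
    using ext_ar[of "Suc m + n"] by (simp add: pair_simps del: ext.simps)
  also have "\<dots> = (?t (Suc (m + n)) \<cdot> c 1 (m + n)) \<cdot> ((?i \<boxtimes> c m n) \<cdot> Assoc S (T 1) (T m) (T n))"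
    unfolding c_assoc using ext_ar[of "Suc (m + n)"] by (simp add: pair_simps del: ext.simps)
  also have "\<dots> = c' 1 (m + n) \<cdot> (f \<boxtimes> (?t (m + n) \<cdot> c m n)) \<cdot> Assoc S (T 1) (T m) (T n)"
    unfolding tS using ext_ar f_ar by (simp add: pair_simps del: ext.simps)
  also have "\<dots> = c' 1 (m + n) \<cdot> (Ident S (T' 1) \<boxtimes> c' m n) \<cdot> ((f \<boxtimes> (?t m \<boxtimes> ?t n)) \<cdot> Assoc S (T 1) (T m) (T n))"
    unfolding Suc using ext_ar f_ar by (simp add: pair_simps del: ext.simps)
  also have "\<dots> = (c' 1 (m + n) \<cdot> (Ident S (T' 1) \<boxtimes> c' m n) \<cdot> Assoc S (T' 1) (T' m) (T' n)) \<cdot> ((f \<boxtimes> ?t m) \<boxtimes> ?t n)"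
    using assoc_nat_arr[OF f_ar(1) ext_ar(1)[of m] ext_ar(1)[of n]] ext_ar f_ar by (simp add: pair_simps del: ext.simps)
  also have "\<dots> = c' (Suc m) n \<cdot> ((c' 1 m \<cdot> (f \<boxtimes> ?t m)) \<boxtimes> ?t n)"
    unfolding T'.c_assoc[symmetric] using ext_ar f_ar by (simp add: pair_simps del: ext.simps)
  also have "\<dots> = (c' (Suc m) n \<cdot> (?t (Suc m) \<boxtimes> ?t n)) \<cdot> (c 1 m \<boxtimes> ?n)"
    unfolding tS[symmetric] using ext_ar[of "Suc m"] ext_ar[of n] by (simp add: pair_simps del: ext.simps)
  finally show ?case
    by (rule iso_cancel_right[OF _ e]) (use ext_ar[of "Suc m"] ext_ar[of "Suc m + n"] ext_ar[of n] in \<open>simp_all add: pair_simps del: ext.simps\<close>)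
qed

lemma ext_unit: "ext f 0 \<cdot> u = u'"
  by (simp add: pair_simps)

text \<open>By definition this component is \<open>f\<close> tensored with the comparison of units;
  the right unit laws of the two families remove the extra factor.\<close>

lemma ext_1: "ext f 1 = f"
proof -
  have e: "iso_arrow S (RUnit S (T 1))" by (simp add: runit_simps)
  have "ext f 1 \<cdot> RUnit S (T 1) = (ext f (1 + 0) \<cdot> c 1 0) \<cdot> (Ident S (T 1) \<boxtimes> u)"
    unfolding c_runit[symmetric] using ext_ar[of 1] by (simp add: pair_simps del: ext.simps)
  also have "\<dots> = (c' 1 0 \<cdot> (Ident S (T' 1) \<boxtimes> u')) \<cdot> (f \<boxtimes> Ident S (TUnit S))"
    using f_ar ext_ar[of 0] by (simp add: pair_simps)
  also have "\<dots> = f \<cdot> RUnit S (T 1)"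
    unfolding T'.c_runit using runit_nat_arr[OF f_ar(1)] f_ar by simp
  finally show ?thesis
    by (rule iso_cancel_right[OF _ e]) (use f_ar ext_ar[of 1] in \<open>simp_all add: pair_simps del: ext.simps\<close>)
qed

lemma compatible_ext: "compatible (ext f)"
  unfolding compatible_def using ext_hom ext_unit ext_ten by (auto simp: Hom_def simp del: ext.simps)

end

text \<open>The components are forced one after the other, because \<open>u\<close> and
  \<open>c 1 n\<close> are isomorphisms and can be cancelled.\<close>

lemma compatible_unique:
  assumes s: "compatible s" and t: "compatible t" and "s 1 = t 1"
  shows "s n = t n"
proof (induction n)
  have a: "s n \<in> Arr S" "Dom S (s n) = T n" "Cod S (s n) = T' n" "t n \<in> Arr S" "Dom S (t n) = T n" "Cod S (t n) = T' n" for n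
    using s t by (auto simp: compatible_def Hom_def)
  {
    case 0
    have "s 0 \<cdot> u = t 0 \<cdot> u" using s t by (simp add: compatible_def)
    then show ?case by (rule iso_cancel_right[OF _ u_iso]) (use a in \<open>simp_all add: pair_simps\<close>)
  next
    case (Suc n)
    have "s (1 + n) \<cdot> c 1 n = t (1 + n) \<cdot> c 1 n"
      using s t assms(3) Suc unfolding compatible_def by metis
    then have "s (1 + n) = t (1 + n)" by (rule iso_cancel_right[OF _ c_iso]) (use a in \<open>simp_all add: pair_simps\<close>)
    then show ?case by simp
  }
qed

text \<open>Naturality with respect to one arrow, phrased for representatives. In this form it is
  stable under composition and tensor products and holds for braidings, so it passes from generators
  to all arrows.\<close>

definition intertwines :: "(nat \<Rightarrow> 'a) \<Rightarrow> nat \<times> 'a \<times> nat \<Rightarrow> nat \<times> 'a \<times> nat \<Rightarrow> bool" where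
  "intertwines t e e' \<longleftrightarrow> arE e \<and> T'.arE e' \<and> fst e' = fst e \<and> snd (snd e') = snd (snd e) \<and>
     t (snd (snd e)) \<cdot> fst (snd e) = fst (snd e') \<cdot> t (fst e)"

context
  fixes t :: "nat \<Rightarrow> 'a"
  assumes t: "compatible t"
begin

lemma t_ar: "t n \<in> Arr S" "Dom S (t n) = T n" "Cod S (t n) = T' n"
  using t by (auto simp: compatible_def Hom_def)

lemma t_unit: "t 0 \<cdot> u = u'" and t_ten: "t (m + n) \<cdot> c m n = c' m n \<cdot> (t m \<boxtimes> t n)"
  using t by (auto simp: compatible_def)

lemma t_ten_inv: "inv_arrow S (c' m n) \<cdot> t (m + n) = (t m \<boxtimes> t n) \<cdot> inv_arrow S (c m n)"
proof -
  have "inv_arrow S (c' m n) \<cdot> t (m + n) = inv_arrow S (c' m n) \<cdot> (t (m + n) \<cdot> c m n) \<cdot> inv_arrow S (c m n)"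
    using t_ar by (simp add: pair_simps)
  also have "\<dots> = (t m \<boxtimes> t n) \<cdot> inv_arrow S (c m n)" unfolding t_ten using t_ar by (simp add: pair_simps)
  finally show ?thesis .
qed

lemma intertwines_cmp:
  assumes "intertwines t e e'" "intertwines t g g'" "snd (snd e) = fst g"
  shows "intertwines t (cmpE g e) (T'.cmpE g' e')"
proof -
  obtain n x m x' where e: "e = (n, x, m)" "e' = (n, x', m)" using assms(1) by (cases e; cases e') (auto simp: intertwines_def)
  obtain y l y' where g: "g = (m, y, l)" "g' = (m, y', l)" using assms(2,3) e by (cases g; cases g') (auto simp: intertwines_def)
  have a: "x \<in> Arr S" "Dom S x = T n" "Cod S x = T m" "x' \<in> Arr S" "Dom S x' = T' n" "Cod S x' = T' m"
    "y \<in> Arr S" "Dom S y = T m" "Cod S y = T l" "y' \<in> Arr S" "Dom S y' = T' m" "Cod S y' = T' l"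
    and h: "t m \<cdot> x = x' \<cdot> t n" "t l \<cdot> y = y' \<cdot> t m"
    using assms unfolding e g by (simp_all add: intertwines_def E_defs T'.E_defs)
  have "t l \<cdot> y \<cdot> x = (t l \<cdot> y) \<cdot> x" using a t_ar by (simp add: pair_simps)
  also have "\<dots> = y' \<cdot> (t m \<cdot> x)" unfolding h(2) using a t_ar by (simp add: pair_simps)
  also have "\<dots> = (y' \<cdot> x') \<cdot> t n" unfolding h(1) using a t_ar by (simp add: pair_simps)
  finally show ?thesis using a unfolding e g by (simp add: intertwines_def E_defs T'.E_defs arrow_simps)
qed

lemma intertwines_ten:
  assumes "intertwines t e e'" "intertwines t g g'"
  shows "intertwines t (tenE e g) (T'.tenE e' g')"
proof -
  obtain n x m x' where e: "e = (n, x, m)" "e' = (n, x', m)" using assms(1) by (cases e; cases e') (auto simp: intertwines_def)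
  obtain k y l y' where g: "g = (k, y, l)" "g' = (k, y', l)" using assms(2) by (cases g; cases g') (auto simp: intertwines_def)
  have a: "x \<in> Arr S" "Dom S x = T n" "Cod S x = T m" "x' \<in> Arr S" "Dom S x' = T' n" "Cod S x' = T' m"
    "y \<in> Arr S" "Dom S y = T k" "Cod S y = T l" "y' \<in> Arr S" "Dom S y' = T' k" "Cod S y' = T' l"
    and h: "t m \<cdot> x = x' \<cdot> t n" "t l \<cdot> y = y' \<cdot> t k"
    using assms unfolding e g by (simp_all add: intertwines_def E_defs T'.E_defs)
  have "t (m + l) \<cdot> c m l \<cdot> (x \<boxtimes> y) \<cdot> inv_arrow S (c n k) = (t (m + l) \<cdot> c m l) \<cdot> (x \<boxtimes> y) \<cdot> inv_arrow S (c n k)"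
    using a t_ar by (simp add: pair_simps)
  also have "\<dots> = c' m l \<cdot> ((t m \<cdot> x) \<boxtimes> (t l \<cdot> y)) \<cdot> inv_arrow S (c n k)"
    unfolding t_ten using a t_ar by (simp add: pair_simps)
  also have "\<dots> = c' m l \<cdot> (x' \<boxtimes> y') \<cdot> ((t n \<boxtimes> t k) \<cdot> inv_arrow S (c n k))"
    unfolding h using a t_ar by (simp add: pair_simps)
  also have "\<dots> = (c' m l \<cdot> (x' \<boxtimes> y') \<cdot> inv_arrow S (c' n k)) \<cdot> t (n + k)"
    unfolding t_ten_inv[symmetric] using a t_ar by (simp add: pair_simps)
  finally show ?thesis using a unfolding e g by (simp add: intertwines_def E_defs T'.E_defs arrow_simps c_simps T'.c_simps c_iso T'.c_iso)
qed

lemma intertwines_id: "intertwines t (idE n) (T'.idE n)"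
  using t_ar by (simp add: intertwines_def E_defs T'.E_defs arrow_simps)

lemma intertwines_br: "intertwines t (brE m n) (T'.brE m n)"
proof -
  have "t (n + m) \<cdot> c n m \<cdot> Braid S (T m) (T n) \<cdot> inv_arrow S (c m n) = (t (n + m) \<cdot> c n m) \<cdot> Braid S (T m) (T n) \<cdot> inv_arrow S (c m n)"
    using t_ar by (simp add: pair_simps)
  also have "\<dots> = c' n m \<cdot> ((t n \<boxtimes> t m) \<cdot> Braid S (T m) (T n)) \<cdot> inv_arrow S (c m n)"
    unfolding t_ten using t_ar by (simp add: pair_simps)
  also have "\<dots> = c' n m \<cdot> Braid S (T' m) (T' n) \<cdot> ((t m \<boxtimes> t n) \<cdot> inv_arrow S (c m n))"
    using braid_nat_arr[OF t_ar(1)[of m] t_ar(1)[of n], symmetric] t_ar by (simp add: pair_simps)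
  also have "\<dots> = (c' n m \<cdot> Braid S (T' m) (T' n) \<cdot> inv_arrow S (c' m n)) \<cdot> t (m + n)"
    unfolding t_ten_inv[symmetric] using t_ar by (simp add: pair_simps)
  finally show ?thesis by (simp add: intertwines_def E_defs T'.E_defs arrow_simps c_simps T'.c_simps c_iso T'.c_iso)
qed

end

end

locale composite_algebra_pair = composite_algebra G S L kX kY F + F': composite_algebra G S L kX kY F'
  for G :: "('g, 'y) monoid_scheme" and S :: "('o, 'a, 'z) smc_scheme" (structure)
    and L :: label_law and kX kY :: fibre_kind and F F' :: "(nat, 'g span_class, 'o, 'a) mfnctr"
begin

sublocale tensor_family_pair S "omap F" "unit_map F" "ten_map F" "omap F'" "unit_map F'" "ten_map F'" ..

lemma monoidal_nat_transf_iff: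
  "monoidal_nat_transf Q S F F' t \<longleftrightarrow> compatible t \<and> (\<forall>n m. \<forall>a\<in>Hom Q n m. t m \<cdot> amap F a = amap F' a \<cdot> t n)"
  by (auto simp: monoidal_nat_transf_def nat_transf_def compatible_def Q_simps Hom_def)

definition equivariant :: "'a \<Rightarrow> bool" where
  "equivariant f \<longleftrightarrow> bimonoid_morphism S bimon_F F'.bimon_F f \<and>
     (\<forall>g\<in>carrier G. f \<cdot> amap F (jX (lunl kX g)) = amap F' (jX (lunl kX g)) \<cdot> f)"

lemma intertwines_EF:
  assumes "compatible t" "a \<in> Hom Q n m"
  shows "intertwines t (EF a) (F'.EF a) \<longleftrightarrow> t m \<cdot> amap F a = amap F' a \<cdot> t n"
  using EF_hom[OF assms(2)] F'.EF_hom[OF assms(2)] assms(2)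
  unfolding E.hom_def F'.E.hom_def by (simp add: intertwines_def EF_def F'.EF_def Hom_def)

text \<open>The structure arrows of \<open>bimon_F\<close> contain the invertible comparisons
  \<open>ten_map\<close> and \<open>unit_map\<close>. Compatibility of \<open>t\<close> moves them
  across, and their cancellation leaves naturality at the four structure maps.\<close>

lemma bimonoid_morphism_iff:
  assumes t: "compatible t"
  shows "bimonoid_morphism S bimon_F F'.bimon_F (t 1) \<longleftrightarrow>
    t 1 \<cdot> amap F (jX (lmul kX 2)) = amap F' (jX (lmul kX 2)) \<cdot> t 2 \<and> t 1 \<cdot> amap F (jX (lmul kX 0)) = amap F' (jX (lmul kX 0)) \<cdot> t 0 \<and>
    t 2 \<cdot> amap F (jY (lmul kY 2)) = amap F' (jY (lmul kY 2)) \<cdot> t 1 \<and> t 0 \<cdot> amap F (jY (lmul kY 0)) = amap F' (jY (lmul kY 0)) \<cdot> t 1"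
proof -
  let ?c = "ten_map F 1 1" and ?c' = "ten_map F' 1 1" and ?u = "unit_map F" and ?u' = "unit_map F'"
  let ?m = "amap F (jX (lmul kX 2))" and ?m' = "amap F' (jX (lmul kX 2))" and ?e = "amap F (jX (lmul kX 0))" and ?e' = "amap F' (jX (lmul kX 0))"
  let ?d = "amap F (jY (lmul kY 2))" and ?d' = "amap F' (jY (lmul kY 2))" and ?p = "amap F (jY (lmul kY 0))" and ?p' = "amap F' (jY (lmul kY 0))"
  note ta = t_ar[OF t] and fa = F_arr F'.F_arr
  have ca: "?c \<in> Arr S" "Dom S ?c = omap F (Suc 0) \<boxdot> omap F (Suc 0)" "Cod S ?c = omap F 2"
    "?c' \<in> Arr S" "Dom S ?c' = omap F' (Suc 0) \<boxdot> omap F' (Suc 0)" "Cod S ?c' = omap F' 2" "iso_arrow S ?c" "iso_arrow S ?c'"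
    using c_simps[of 1 1] F'.c_simps[of 1 1] c_iso[of 1 1] F'.c_iso[of 1 1] by (simp_all add: numeral_2_eq_2)
  note s = arrow_simps u_simps F'.u_simps u_iso F'.u_iso ta fa ca
  have tt: "t 2 \<cdot> ?c = ?c' \<cdot> (t 1 \<boxtimes> t 1)" "inv_arrow S ?c' \<cdot> t 2 = (t 1 \<boxtimes> t 1) \<cdot> inv_arrow S ?c"
    using t_ten[OF t, of 1 1] t_ten_inv[OF t, of 1 1] by (simp_all only: one_add_one)
  have 1: "t 1 \<cdot> (?m \<cdot> ?c) = (?m' \<cdot> ?c') \<cdot> (t 1 \<boxtimes> t 1) \<longleftrightarrow> t 1 \<cdot> ?m = ?m' \<cdot> t 2"
  proof -
    have "t 1 \<cdot> (?m \<cdot> ?c) = (t 1 \<cdot> ?m) \<cdot> ?c" using s by simp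
    moreover have "(?m' \<cdot> ?c') \<cdot> (t 1 \<boxtimes> t 1) = ?m' \<cdot> (?c' \<cdot> (t 1 \<boxtimes> t 1))" using s by simp
    moreover have "\<dots> = (?m' \<cdot> t 2) \<cdot> ?c" unfolding tt(1)[symmetric] using s by simp
    moreover have "t 1 \<cdot> ?m = ?m' \<cdot> t 2" if "(t 1 \<cdot> ?m) \<cdot> ?c = (?m' \<cdot> t 2) \<cdot> ?c"
      by (rule iso_cancel_right[OF that ca(7)]) (use s in simp_all)
    ultimately show ?thesis by metis
  qed
  have 2: "t 1 \<cdot> (?e \<cdot> ?u) = ?e' \<cdot> ?u' \<longleftrightarrow> t 1 \<cdot> ?e = ?e' \<cdot> t 0"
  proof -
    have "t 1 \<cdot> (?e \<cdot> ?u) = (t 1 \<cdot> ?e) \<cdot> ?u" using s by simp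
    moreover have "?e' \<cdot> ?u' = (?e' \<cdot> t 0) \<cdot> ?u" unfolding t_unit[OF t, symmetric] using s by simp
    moreover have "t 1 \<cdot> ?e = ?e' \<cdot> t 0" if "(t 1 \<cdot> ?e) \<cdot> ?u = (?e' \<cdot> t 0) \<cdot> ?u"
      by (rule iso_cancel_right[OF that u_iso]) (use s in simp_all)
    ultimately show ?thesis by metis
  qed
  have 3: "(t 1 \<boxtimes> t 1) \<cdot> (inv_arrow S ?c \<cdot> ?d) = (inv_arrow S ?c' \<cdot> ?d') \<cdot> t 1 \<longleftrightarrow> t 2 \<cdot> ?d = ?d' \<cdot> t 1"
  proof -
    have "(t 1 \<boxtimes> t 1) \<cdot> (inv_arrow S ?c \<cdot> ?d) = ((t 1 \<boxtimes> t 1) \<cdot> inv_arrow S ?c) \<cdot> ?d" using s by simp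
    moreover have "\<dots> = inv_arrow S ?c' \<cdot> (t 2 \<cdot> ?d)" unfolding tt(2)[symmetric] using s by simp
    moreover have "(inv_arrow S ?c' \<cdot> ?d') \<cdot> t 1 = inv_arrow S ?c' \<cdot> (?d' \<cdot> t 1)" using s by simp
    moreover have "t 2 \<cdot> ?d = ?d' \<cdot> t 1" if "inv_arrow S ?c' \<cdot> (t 2 \<cdot> ?d) = inv_arrow S ?c' \<cdot> (?d' \<cdot> t 1)"
      by (rule iso_cancel_left[OF that iso_inv[OF ca(8)]]) (use s in simp_all)
    ultimately show ?thesis by metis
  qed
  have 4: "(inv_arrow S ?u' \<cdot> ?p') \<cdot> t 1 = inv_arrow S ?u \<cdot> ?p \<longleftrightarrow> t 0 \<cdot> ?p = ?p' \<cdot> t 1"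
  proof -
    have "inv_arrow S ?u = inv_arrow S ?u' \<cdot> (t 0 \<cdot> ?u) \<cdot> inv_arrow S ?u" unfolding t_unit[OF t] using s by simp
    then have "inv_arrow S ?u = inv_arrow S ?u' \<cdot> t 0" using s by simp
    then have "inv_arrow S ?u \<cdot> ?p = inv_arrow S ?u' \<cdot> (t 0 \<cdot> ?p)" using s by simp
    moreover have "(inv_arrow S ?u' \<cdot> ?p') \<cdot> t 1 = inv_arrow S ?u' \<cdot> (?p' \<cdot> t 1)" using s by simp
    moreover have "t 0 \<cdot> ?p = ?p' \<cdot> t 1" if "inv_arrow S ?u' \<cdot> (t 0 \<cdot> ?p) = inv_arrow S ?u' \<cdot> (?p' \<cdot> t 1)"
      by (rule iso_cancel_left[OF that iso_inv[OF F'.u_iso]]) (use s in simp_all)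
    ultimately show ?thesis by metis
  qed
  have "t 1 \<in> Hom S (omap F 1) (omap F' 1)" using ta by (simp add: Hom_def)
  then show ?thesis unfolding bimonoid_morphism_def bimon_F_def F'.bimon_F_def bimon.simps 1 2 3 4 by simp
qed

text \<open>Naturality spreads from the generators by \<open>lmaps_generated\<close>, separately for
  the two inclusions, and to all arrows by the factorisation of spans. Labels read backwards are
  covered because they are inverse labels.\<close>

lemma equivariant_iff:
  assumes t: "compatible t"
  shows "equivariant (t 1) \<longleftrightarrow> (\<forall>n m. \<forall>a\<in>Hom Q n m. t m \<cdot> amap F a = amap F' a \<cdot> t n)"
proof
  note l2 = lmul_lmaps
  assume "\<forall>n m. \<forall>a\<in>Hom Q n m. t m \<cdot> amap F a = amap F' a \<cdot> t n"
  then have n: "t m \<cdot> amap F a = amap F' a \<cdot> t n" if "a \<in> Hom Q n m" for a n m using that by blast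
  have "bimonoid_morphism S bimon_F F'.bimon_F (t 1)"
    unfolding bimonoid_morphism_iff[OF t]
    by (intro conjI n) (rule jX_hom[OF lmul_lmaps] jY_hom[OF lmul_lmaps])+
  then show "equivariant (t 1)" unfolding equivariant_def using n[OF jX_hom[OF lunl_lmaps]] by blast
next
  assume e: "equivariant (t 1)"
  note b = e[unfolded equivariant_def bimonoid_morphism_iff[OF t]]
  have g: "intertwines t (EF (jX (lmul kX 2))) (F'.EF (jX (lmul kX 2)))" "intertwines t (EF (jX (lmul kX 0))) (F'.EF (jX (lmul kX 0)))"
    "intertwines t (EF (jY (lmul kY 2))) (F'.EF (jY (lmul kY 2)))" "intertwines t (EF (jY (lmul kY 0))) (F'.EF (jY (lmul kY 0)))"
    unfolding intertwines_EF[OF t jX_hom[OF lmul_lmaps]] intertwines_EF[OF t jY_hom[OF lmul_lmaps]] using b by blast+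
  have r: "intertwines t (EF (jX (lunl kX g))) (F'.EF (jX (lunl kX g)))" if "g \<in> carrier G" for g
    unfolding intertwines_EF[OF t jX_hom[OF lunl_lmaps[OF that]]] using b that by blast
  have cmp: "intertwines t (EF (Comp Q b a)) (F'.EF (Comp Q b a))"
    if "a \<in> Hom Q n m" "b \<in> Hom Q m l" "intertwines t (EF a) (F'.EF a)" "intertwines t (EF b) (F'.EF b)" for a b n m l
    unfolding EF_comp[OF that(1,2)] F'.EF_comp[OF that(1,2)]
    by (rule intertwines_cmp[OF t that(3,4)]) (use that(1,2) in \<open>simp add: EF_def Hom_def\<close>)
  have ten: "intertwines t (EF (TenA Q a b)) (F'.EF (TenA Q a b))"
    if "a \<in> Hom Q n m" "b \<in> Hom Q n' m'" "intertwines t (EF a) (F'.EF a)" "intertwines t (EF b) (F'.EF b)" for a b n m n' m'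
    unfolding EF_ten[OF that(1,2)] F'.EF_ten[OF that(1,2)] by (rule intertwines_ten[OF t that(3,4)])
  have X: "intertwines t (EF (jX f)) (F'.EF (jX f))" if "f \<in> lmaps kX G n m" for f n m
    using that
  proof (induction rule: lmaps_generated)
    case (comp f g n m l)
    then show ?case using cmp[OF jX_hom[OF comp(1)] jX_hom[OF comp(2)]] jX_comp[OF comp(1,2)] by simp
  next
    case (tensor f g n m n' m')
    then show ?case using ten[OF jX_hom[OF tensor(1)] jX_hom[OF tensor(2)]] jX_ten[OF tensor(1,2)] by simp
  qed (simp_all only: EF_ident EF_braid F'.EF_ident F'.EF_braid intertwines_id[OF t] intertwines_br[OF t] g r)
  have Y: "intertwines t (EF (jY f)) (F'.EF (jY f))" if "f \<in> lmaps kY G n m" for f n m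
    using that
  proof (induction rule: lmaps_generated)
    case (comp f g n m l)
    then show ?case using cmp[OF jY_hom[OF comp(2)] jY_hom[OF comp(1)]] jY_comp[OF comp(1,2)] by simp
  next
    case (tensor f g n m n' m')
    then show ?case using ten[OF jY_hom[OF tensor(1)] jY_hom[OF tensor(2)]] jY_ten[OF tensor(1,2)] by simp
  qed (simp_all only: EF_ident EF_braid F'.EF_ident F'.EF_braid intertwines_id[OF t] intertwines_br[OF t] g r incY_lunl inv_closed)
  show "\<forall>n m. \<forall>a\<in>Hom Q n m. t m \<cdot> amap F a = amap F' a \<cdot> t n"
  proof (intro allI ballI)
    fix n m a assume a: "a \<in> Hom Q n m"
    obtain p phi f where c: "phi \<in> lmaps kY G p n" "f \<in> lmaps kX G p m" "a = cls kX kY n m (phi, f)"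
      using cls_exhaust[OF a] .
    have "a = Comp Q (jX f) (jY phi)" unfolding c(3) by (rule Q_XY[OF c(1,2), symmetric])
    then have "intertwines t (EF a) (F'.EF a)" using cmp[OF jY_hom[OF c(1)] jX_hom[OF c(2)] Y[OF c(1)] X[OF c(2)]] by simp
    then show "t m \<cdot> amap F a = amap F' a \<cdot> t n" unfolding intertwines_EF[OF t a] .
  qed
qed

text \<open>Full faithfulness in elementary terms: components at 1 are equivariant, every
  equivariant arrow extends, and the extension is unique.\<close>

lemma monoidal_nat_transf_ext:
  "monoidal_nat_transf Q S F F' t \<Longrightarrow> equivariant (t 1)"
  "equivariant f \<Longrightarrow> monoidal_nat_transf Q S F F' (ext f) \<and> ext f 1 = f"
  "\<lbrakk>monoidal_nat_transf Q S F F' s; monoidal_nat_transf Q S F F' t; s 1 = t 1\<rbrakk> \<Longrightarrow> s = t"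
proof -
  show "equivariant (t 1)" if "monoidal_nat_transf Q S F F' t" for t
    using that equivariant_iff[of t] by (simp add: monoidal_nat_transf_iff)
  show "monoidal_nat_transf Q S F F' (ext f) \<and> ext f 1 = f" if e: "equivariant f"
  proof -
    have h: "f \<in> Hom S (omap F 1) (omap F' 1)" using e by (simp add: equivariant_def bimonoid_morphism_def bimon_F_def F'.bimon_F_def)
    note c = compatible_ext[OF h]
    show ?thesis using e equivariant_iff[OF c] c unfolding monoidal_nat_transf_iff ext_1[OF h] by blast
  qed
  show "s = t" if "monoidal_nat_transf Q S F F' s" "monoidal_nat_transf Q S F F' t" "s 1 = t 1"
    using compatible_unique[of s t] that by (auto simp: monoidal_nat_transf_iff)
qed

end

subsection \<open>Categories of functors and equivalences\<close>

lemma nat_transf_comp: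
  assumes "category D" "\<And>f. f \<in> Arr C \<Longrightarrow> Dom C f \<in> Obj C \<and> Cod C f \<in> Obj C"
    and "is_functor C D F" "is_functor C D F'" "is_functor C D F''"
    and s: "nat_transf C D F F' s" and t: "nat_transf C D F' F'' t"
  shows "nat_transf C D F F'' (\<lambda>a\<in>Obj C. Comp D (t a) (s a))"
  unfolding nat_transf_def
proof (intro conjI ballI)
  interpret D: category D by fact
  interpret F: is_functor C D F by fact
  interpret F': is_functor C D F' by fact
  interpret F'': is_functor C D F'' by fact
  have h: "s a \<in> Hom D (omap F a) (omap F' a)" "t a \<in> Hom D (omap F' a) (omap F'' a)" if "a \<in> Obj C" for a
    using s t that by (auto simp: nat_transf_def)
  show "(\<lambda>a\<in>Obj C. Comp D (t a) (s a)) a \<in> Hom D (omap F a) (omap F'' a)" if "a \<in> Obj C" for a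
    using D.comp_closed[OF h[OF that]] that by simp
  fix f assume f: "f \<in> Arr C"
  note o = assms(2)[OF f]
  have ho: "f \<in> Hom C (Dom C f) (Cod C f)" using f by (simp add: Hom_def)
  note a = F.amap_closed[OF ho] F'.amap_closed[OF ho] F''.amap_closed[OF ho]
  note hd = h[OF o[THEN conjunct1]] and hc = h[OF o[THEN conjunct2]]
  have "Comp D (Comp D (t (Cod C f)) (s (Cod C f))) (amap F f) = Comp D (t (Cod C f)) (Comp D (s (Cod C f)) (amap F f))"
    by (rule D.comp_assoc[OF a(1) hc])
  also have "\<dots> = Comp D (t (Cod C f)) (Comp D (amap F' f) (s (Dom C f)))" using s f by (simp add: nat_transf_def)
  also have "\<dots> = Comp D (Comp D (t (Cod C f)) (amap F' f)) (s (Dom C f))" by (rule D.comp_assoc[OF hd(1) a(2) hc(2), symmetric])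
  also have "\<dots> = Comp D (Comp D (amap F'' f) (t (Dom C f))) (s (Dom C f))" using t f by (simp add: nat_transf_def)
  also have "\<dots> = Comp D (amap F'' f) (Comp D (t (Dom C f)) (s (Dom C f)))" by (rule D.comp_assoc[OF hd a(3)])
  finally show "Comp D ((\<lambda>a\<in>Obj C. Comp D (t a) (s a)) (Cod C f)) (amap F f) = Comp D (amap F'' f) ((\<lambda>a\<in>Obj C. Comp D (t a) (s a)) (Dom C f))"
    using o by simp
qed simp

lemma nat_transf_ident:
  assumes "category D" "\<And>f. f \<in> Arr C \<Longrightarrow> Dom C f \<in> Obj C \<and> Cod C f \<in> Obj C" "is_functor C D F"
  shows "nat_transf C D F F (\<lambda>a\<in>Obj C. Ident D (omap F a))"
proof -
  interpret D: category D by fact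
  interpret F: is_functor C D F by fact
  have o: "omap F a \<in> Obj D" if "a \<in> Obj C" for a using F.omap_closed that by auto
  have "Comp D (Ident D (omap F (Cod C f))) (amap F f) = Comp D (amap F f) (Ident D (omap F (Dom C f)))" if "f \<in> Arr C" for f
  proof -
    have "amap F f \<in> Hom D (omap F (Dom C f)) (omap F (Cod C f))" by (rule F.amap_closed) (use that in \<open>simp add: Hom_def\<close>)
    then show ?thesis using D.comp_ident_left D.comp_ident_right by simp
  qed
  then show ?thesis using assms(2) o D.ident_closed by (simp add: nat_transf_def)
qed

lemma category_transf_category:
  fixes \<F> :: "('o, 'a, 'p, 'b, 'w) fnctr_scheme set"
  assumes D: "category D" and o: "\<And>f. f \<in> Arr C \<Longrightarrow> Dom C f \<in> Obj C \<and> Cod C f \<in> Obj C"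
    and fnc: "\<And>F. F \<in> \<F> \<Longrightarrow> is_functor C D F"
    and nat: "\<And>F F' t. \<lbrakk>F \<in> \<F>; F' \<in> \<F>; P F F' t\<rbrakk> \<Longrightarrow> nat_transf C D F F' t"
    and idn: "\<And>F. F \<in> \<F> \<Longrightarrow> P F F (\<lambda>a\<in>Obj C. Ident D (omap F a))"
    and cmp: "\<And>F F' F'' s t. \<lbrakk>F \<in> \<F>; F' \<in> \<F>; F'' \<in> \<F>; P F F' s; P F' F'' t\<rbrakk> \<Longrightarrow> P F F'' (\<lambda>a\<in>Obj C. Comp D (t a) (s a))"
  shows "category (transf_category C D \<F> P)"
proof -
  interpret D: category D by (rule D)
  let ?T = "transf_category C D \<F> P"
  have hom: "x \<in> Hom ?T F F' \<longleftrightarrow> (\<exists>t. x = (F, t, F') \<and> F \<in> \<F> \<and> F' \<in> \<F> \<and> P F F' t)" for x F F'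
    by (cases x) (auto simp: Hom_def transf_category_def)
  have cm: "Comp ?T (F', t, F'') (F, s, F') = (F, \<lambda>a\<in>Obj C. Comp D (t a) (s a), F'')" for F F' F'' s t
    by (simp add: transf_category_def)
  have h: "t a \<in> Hom D (omap F a) (omap F' a)" if "F \<in> \<F>" "F' \<in> \<F>" "P F F' t" "a \<in> Obj C" for F F' t a
    using nat[OF that(1-3)] that(4) by (simp add: nat_transf_def)
  have ext: "t \<in> extensional (Obj C)" if "F \<in> \<F>" "F' \<in> \<F>" "P F F' t" for F F' t
    using nat[OF that] by (simp add: nat_transf_def)
  show ?thesis
  proof
    show "Dom ?T f \<in> Obj ?T" "Cod ?T f \<in> Obj ?T" if "f \<in> Arr ?T" for f using that by (auto simp: transf_category_def)
    show "Ident ?T F \<in> Hom ?T F F" if "F \<in> Obj ?T" for F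
      using that idn unfolding hom by (simp add: transf_category_def)
    fix f g h F F' F'' F'''
    assume f: "f \<in> Hom ?T F F'"
    obtain s where s: "f = (F, s, F')" "F \<in> \<F>" "F' \<in> \<F>" "P F F' s" using f unfolding hom by blast
    show "Comp ?T (Ident ?T F') f = f" "Comp ?T f (Ident ?T F) = f"
      using D.comp_ident_left[OF h[OF s(2-4)]] D.comp_ident_right[OF h[OF s(2-4)]] extensionalityI[OF _ ext[OF s(2-4)]]
      by (auto simp: transf_category_def s(1) cong: restrict_cong intro!: extensionalityI[OF _ ext[OF s(2-4)]])
    assume g: "g \<in> Hom ?T F' F''"
    obtain t where t: "g = (F', t, F'')" "F'' \<in> \<F>" "P F' F'' t" using g unfolding hom by blast
    show "Comp ?T g f \<in> Hom ?T F F''" unfolding hom s(1) t(1) cm using cmp[OF s(2,3) t(2) s(4) t(3)] s t by simp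
    assume k: "h \<in> Hom ?T F'' F'''"
    obtain r where r: "h = (F'', r, F''')" "F''' \<in> \<F>" "P F'' F''' r" using k unfolding hom by blast
    show "Comp ?T (Comp ?T h g) f = Comp ?T h (Comp ?T g f)"
      unfolding s(1) t(1) r(1) cm
      using D.comp_assoc[OF h[OF s(2-4)] h[OF s(3) t(2,3)] h[OF t(2) r(2,3)]] by (simp cong: restrict_cong)
  qed
qed

lemma category_functor_category:
  assumes D: "category D" and o: "\<And>f. f \<in> Arr C \<Longrightarrow> Dom C f \<in> Obj C \<and> Cod C f \<in> Obj C"
  shows "category (functor_category C D)"
  unfolding functor_category_def
  by (rule category_transf_category[OF D o]) (auto intro: nat_transf_comp[OF D o] nat_transf_ident[OF D o])

lemma category_full_subcategory:
  assumes "category C"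
  shows "category (full_subcategory C P)"
proof -
  interpret category C by fact
  let ?F = "full_subcategory C P"
  have h: "f \<in> Hom ?F a b \<longleftrightarrow> f \<in> Hom C a b \<and> P a \<and> P b" for f a b by (auto simp: Hom_def full_subcategory_def)
  have s: "Comp ?F = Comp C" "Ident ?F = Ident C" "Dom ?F = Dom C" "Cod ?F = Cod C" by (simp_all add: full_subcategory_def)
  show ?thesis
    by unfold_locales (auto simp: h s comp_ident_left comp_ident_right intro: comp_closed comp_assoc ident_closed,
      auto simp: full_subcategory_def dom_closed cod_closed intro: ident_closed)
qed

lemma category_bimonoid_category:
  assumes "symmetric_monoidal_category S"
  shows "category (bimonoid_category S)"
proof -
  interpret symmetric_monoidal_category S by fact
  let ?B = "bimonoid_category S"
  have h: "x \<in> Hom ?B B B' \<longleftrightarrow> (\<exists>f. x = (B, f, B') \<and> bimonoid S B \<and> bimonoid S B' \<and> bimonoid_morphism S B B' f)" for x B B'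
    by (cases x) (auto simp: Hom_def bimonoid_category_def)
  have cm: "Comp ?B (B', g, B'') (B, f, B') = (B, Comp S g f, B'')" for B B' B'' f g by (simp add: bimonoid_category_def)
  have b: "bobj B \<in> Obj S" "bmult B \<in> Arr S" "Dom S (bmult B) = TenO S (bobj B) (bobj B)" "Cod S (bmult B) = bobj B"
    "bunit B \<in> Arr S" "Dom S (bunit B) = TUnit S" "Cod S (bunit B) = bobj B"
    "bcomult B \<in> Arr S" "Dom S (bcomult B) = bobj B" "Cod S (bcomult B) = TenO S (bobj B) (bobj B)"
    "bcounit B \<in> Arr S" "Dom S (bcounit B) = bobj B" "Cod S (bcounit B) = TUnit S" if "bimonoid S B" for B
  proof -
    interpret b: bimonoid S B by fact
    show "bobj B \<in> Obj S" "bmult B \<in> Arr S" "Dom S (bmult B) = TenO S (bobj B) (bobj B)" "Cod S (bmult B) = bobj B"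
      "bunit B \<in> Arr S" "Dom S (bunit B) = TUnit S" "Cod S (bunit B) = bobj B"
      "bcomult B \<in> Arr S" "Dom S (bcomult B) = bobj B" "Cod S (bcomult B) = TenO S (bobj B) (bobj B)"
      "bcounit B \<in> Arr S" "Dom S (bcounit B) = bobj B" "Cod S (bcounit B) = TUnit S"
      using b.mon_obj b.mult_arr b.unit_arr b.comult_arr b.counit_arr by (auto simp: Hom_def)
  qed
  have comp: "bimonoid_morphism S B B'' (Comp S g f)"
    if B: "bimonoid S B" "bimonoid S B'" "bimonoid S B''" and f: "bimonoid_morphism S B B' f" and g: "bimonoid_morphism S B' B'' g" for B B' B'' f g
  proof -
    note fb = f[unfolded bimonoid_morphism_def] and gb = g[unfolded bimonoid_morphism_def]
    have a: "f \<in> Arr S" "Dom S f = bobj B" "Cod S f = bobj B'" "g \<in> Arr S" "Dom S g = bobj B'" "Cod S g = bobj B''"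
      using fb gb by (auto simp: Hom_def)
    note s = arrow_simps ten_interchange ten_interchange_comp a b[OF B(1)] b[OF B(2)] b[OF B(3)]
    have "Comp S (Comp S g f) (bmult B) = Comp S g (Comp S f (bmult B))" using s by simp
    also have "\<dots> = Comp S (Comp S g (bmult B')) (TenA S f f)" using fb s by simp
    also have "\<dots> = Comp S (bmult B'') (TenA S (Comp S g f) (Comp S g f))" using gb s by simp
    finally have 1: "Comp S (Comp S g f) (bmult B) = Comp S (bmult B'') (TenA S (Comp S g f) (Comp S g f))" .
    have 2: "Comp S (Comp S g f) (bunit B) = bunit B''" using fb gb s by simp
    have "Comp S (TenA S (Comp S g f) (Comp S g f)) (bcomult B) = Comp S (TenA S g g) (Comp S (TenA S f f) (bcomult B))" using s by simp
    also have "\<dots> = Comp S (Comp S (TenA S g g) (bcomult B')) f" using fb s by simp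
    also have "\<dots> = Comp S (bcomult B'') (Comp S g f)" using gb s by simp
    finally have 3: "Comp S (TenA S (Comp S g f) (Comp S g f)) (bcomult B) = Comp S (bcomult B'') (Comp S g f)" .
    have "Comp S (bcounit B'') (Comp S g f) = Comp S (Comp S (bcounit B'') g) f" using s by simp
    also have "\<dots> = bcounit B" using fb gb by simp
    finally show ?thesis unfolding bimonoid_morphism_def using 1 2 3 s by (simp add: Hom_def)
  qed
  have ar: "f \<in> Hom S (bobj B) (bobj B')" if "bimonoid_morphism S B B' f" for B B' f using that by (simp add: bimonoid_morphism_def)
  show ?thesis
  proof
    show "Dom ?B f \<in> Obj ?B" "Cod ?B f \<in> Obj ?B" if "f \<in> Arr ?B" for f using that by (auto simp: bimonoid_category_def)
    show "Ident ?B B \<in> Hom ?B B B" if "B \<in> Obj ?B" for B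
    proof -
      have B: "bimonoid S B" using that by (simp add: bimonoid_category_def)
      have "bimonoid_morphism S B B (Ident S (bobj B))"
        unfolding bimonoid_morphism_def using b[OF B] by (simp add: arrow_simps Hom_def)
      then show ?thesis unfolding h using B by (simp add: bimonoid_category_def)
    qed
    fix x y z B B' B'' B'''
    assume x: "x \<in> Hom ?B B B'"
    obtain f where f: "x = (B, f, B')" "bimonoid S B" "bimonoid S B'" "bimonoid_morphism S B B' f" using x unfolding h by blast
    show "Comp ?B (Ident ?B B') x = x" "Comp ?B x (Ident ?B B) = x"
      using comp_ident_left[OF ar[OF f(4)]] comp_ident_right[OF ar[OF f(4)]] by (simp_all add: bimonoid_category_def f(1))
    assume y: "y \<in> Hom ?B B' B''"
    obtain g where g: "y = (B', g, B'')" "bimonoid S B''" "bimonoid_morphism S B' B'' g" using y unfolding h by blast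
    show "Comp ?B y x \<in> Hom ?B B B''" unfolding h f(1) g(1) cm using comp[OF f(2,3) g(2) f(4) g(3)] f g by simp
    assume z: "z \<in> Hom ?B B'' B'''"
    obtain k where k: "z = (B'', k, B''')" "bimonoid_morphism S B'' B''' k" using z unfolding h by blast
    show "Comp ?B (Comp ?B z y) x = Comp ?B z (Comp ?B y x)"
      unfolding f(1) g(1) k(1) cm using comp_assoc[OF ar[OF f(4)] ar[OF g(3)] ar[OF k(2)]] by simp
  qed
qed

text \<open>The quasi-inverse picks a preimage \<open>c d\<close> with an isomorphism
  \<open>e d\<close> for each object, and on arrows conjugates with \<open>e\<close> and lifts along
  the fully faithful functor. Equations in \<open>C\<close> are verified after applying that
  functor.\<close>

lemma equivalent_categoriesI:
  fixes C :: "('o, 'a, 'y) cat_scheme" and D :: "('p, 'b, 'z) cat_scheme" and \<Phi> :: "('o, 'a, 'p, 'b) fnctr"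
  assumes C: "category C" and D: "category D" and F: "is_functor C D \<Phi>"
    and ff: "\<And>a b. \<lbrakk>a \<in> Obj C; b \<in> Obj C\<rbrakk> \<Longrightarrow> bij_betw (amap \<Phi>) (Hom C a b) (Hom D (omap \<Phi> a) (omap \<Phi> b))"
    and es: "\<And>d. d \<in> Obj D \<Longrightarrow> \<exists>c\<in>Obj C. \<exists>e\<in>Hom D (omap \<Phi> c) d. iso_arrow D e"
  shows "equivalent_categories C D"
proof -
  interpret C: category C by (rule C)
  interpret D: category D by (rule D)
  interpret \<Phi>: is_functor C D \<Phi> by (rule F)
  obtain c e where ce: "\<And>d. d \<in> Obj D \<Longrightarrow> c d \<in> Obj C \<and> e d \<in> Hom D (omap \<Phi> (c d)) d \<and> iso_arrow D (e d)"
    using es by metis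
  have c: "c d \<in> Obj C" and eh: "e d \<in> Arr D" "Dom D (e d) = omap \<Phi> (c d)" "Cod D (e d) = d" and ei: "iso_arrow D (e d)" if "d \<in> Obj D" for d
    using ce[OF that] by (auto simp: Hom_def)
  have \<Phi>o: "omap \<Phi> a \<in> Obj D" if "a \<in> Obj C" for a using \<Phi>.omap_closed that by auto
  define lift where "lift a b g = (THE f. f \<in> Hom C a b \<and> amap \<Phi> f = g)" for a b g
  have inj: "f = f'" if "f \<in> Hom C a b" "f' \<in> Hom C a b" "amap \<Phi> f = amap \<Phi> f'" "a \<in> Obj C" "b \<in> Obj C" for f f' a b
    using ff[OF that(4,5)] that(1-3) by (auto simp: bij_betw_def inj_on_def)
  have lift: "lift a b g \<in> Hom C a b" "amap \<Phi> (lift a b g) = g" if "a \<in> Obj C" "b \<in> Obj C" "g \<in> Hom D (omap \<Phi> a) (omap \<Phi> b)" for a b g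
  proof -
    have "g \<in> amap \<Phi> ` Hom C a b" using ff[OF that(1,2)] that(3) by (simp add: bij_betw_def)
    then have "\<exists>!f. f \<in> Hom C a b \<and> amap \<Phi> f = g" using inj that by blast
    from theI'[OF this] show "lift a b g \<in> Hom C a b" "amap \<Phi> (lift a b g) = g" by (auto simp: lift_def)
  qed
  note s = D.arr_comp D.dom_comp D.cod_comp D.comp_assoc_arr D.ident_arr D.ident_comp D.comp_ident D.iso_arr[OF ei] D.inv_comp_cancel[OF ei] eh ei D.dom_closed D.cod_closed
  define conj where "conj g = Comp D (inv_arrow D (e (Cod D g))) (Comp D g (e (Dom D g)))" for g
  have conj: "conj g \<in> Hom D (omap \<Phi> (c (Dom D g))) (omap \<Phi> (c (Cod D g)))" if "g \<in> Arr D" for g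
    using that by (simp add: conj_def Hom_def s)
  define H where "H = \<lparr>omap = \<lambda>d\<in>Obj D. c d, amap = \<lambda>g\<in>Arr D. lift (c (Dom D g)) (c (Cod D g)) (conj g)\<rparr>"
  have Ho: "omap H d = c d" if "d \<in> Obj D" for d using that by (simp add: H_def)
  have Ha: "amap H g \<in> Hom C (c (Dom D g)) (c (Cod D g))" "amap \<Phi> (amap H g) = conj g" if "g \<in> Arr D" for g
    using lift[OF c[OF D.dom_closed[OF that]] c[OF D.cod_closed[OF that]] conj[OF that]] that by (simp_all add: H_def)
  have Hf: "is_functor D C H"
  proof
    show "omap H \<in> Obj D \<rightarrow>\<^sub>E Obj C" "amap H \<in> extensional (Arr D)" using c by (auto simp: H_def)
    show "amap H f \<in> Hom C (omap H a) (omap H b)" if "f \<in> Hom D a b" for f a b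
    proof -
      have f: "f \<in> Arr D" "Dom D f = a" "Cod D f = b" using that by (auto simp: Hom_def)
      show ?thesis using Ha(1)[OF f(1)] Ho D.dom_closed[OF f(1)] D.cod_closed[OF f(1)] f by simp
    qed
    show "amap H (Ident D a) = Ident C (omap H a)" if a: "a \<in> Obj D" for a
    proof (rule inj[OF _ _ _ c[OF a] c[OF a]])
      show "amap H (Ident D a) \<in> Hom C (c a) (c a)" using Ha(1)[OF D.ident_arr(1)[OF a]] D.ident_arr[OF a] by simp
      show "Ident C (omap H a) \<in> Hom C (c a) (c a)" unfolding Ho[OF a] by (rule C.ident_closed[OF c[OF a]])
      show "amap \<Phi> (amap H (Ident D a)) = amap \<Phi> (Ident C (omap H a))"
        unfolding Ha(2)[OF D.ident_arr(1)[OF a]] Ho[OF a] \<Phi>.amap_ident[OF c[OF a]] conj_def using a by (simp add: s)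
    qed
    show "amap H (Comp D g f) = Comp C (amap H g) (amap H f)" if "f \<in> Hom D a b" "g \<in> Hom D b d" for f g a b d
    proof -
      have fg: "f \<in> Arr D" "Dom D f = a" "Cod D f = b" "g \<in> Arr D" "Dom D g = b" "Cod D g = d" using that by (auto simp: Hom_def)
      have o: "a \<in> Obj D" "b \<in> Obj D" "d \<in> Obj D" using fg D.dom_closed D.cod_closed by blast+
      have gf: "Comp D g f \<in> Arr D" using fg by (simp add: s)
      have h: "amap H f \<in> Hom C (c a) (c b)" "amap H g \<in> Hom C (c b) (c d)" using Ha(1)[OF fg(1)] Ha(1)[OF fg(4)] fg by simp_all
      show ?thesis
      proof (rule inj[OF _ _ _ c[OF o(1)] c[OF o(3)]])
        show "amap H (Comp D g f) \<in> Hom C (c a) (c d)" using Ha(1)[OF gf] fg by (simp add: s)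
        show "Comp C (amap H g) (amap H f) \<in> Hom C (c a) (c d)" by (rule C.comp_closed[OF h])
        show "amap \<Phi> (amap H (Comp D g f)) = amap \<Phi> (Comp C (amap H g) (amap H f))"
          unfolding Ha(2)[OF gf] \<Phi>.amap_comp[OF h] Ha(2)[OF fg(1)] Ha(2)[OF fg(4)] conj_def using fg o by (simp add: s)
      qed
    qed
  qed
  \<comment> \<open>The unit is the lift of the inverse of \<open>e (omap \<Phi> a)\<close>; the
    lift of \<open>e (omap \<Phi> a)\<close> itself provides its inverse.\<close>
  define \<eta> where "\<eta> a = lift a (c (omap \<Phi> a)) (inv_arrow D (e (omap \<Phi> a)))" for a
  define \<eta>' where "\<eta>' a = lift (c (omap \<Phi> a)) a (e (omap \<Phi> a))" for a
  have \<eta>: "\<eta> a \<in> Hom C a (c (omap \<Phi> a))" "amap \<Phi> (\<eta> a) = inv_arrow D (e (omap \<Phi> a))" if "a \<in> Obj C" for a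
    unfolding \<eta>_def using lift[OF that c[OF \<Phi>o[OF that]]] \<Phi>o[OF that] by (simp_all add: Hom_def s)
  have \<eta>': "\<eta>' a \<in> Hom C (c (omap \<Phi> a)) a" "amap \<Phi> (\<eta>' a) = e (omap \<Phi> a)" if "a \<in> Obj C" for a
    unfolding \<eta>'_def using lift[OF c[OF \<Phi>o[OF that]] that] \<Phi>o[OF that] by (simp_all add: Hom_def s)
  have \<eta>i: "iso_arrow C (\<eta> a)" if a: "a \<in> Obj C" for a
  proof -
    note h = \<eta>(1)[OF a] \<eta>'(1)[OF a] and ca = c[OF \<Phi>o[OF a]]
    have "Comp C (\<eta>' a) (\<eta> a) = Ident C a"
      by (rule inj[OF C.comp_closed[OF h] C.ident_closed[OF a] _ a a])
        (use \<Phi>o[OF a] in \<open>simp add: \<Phi>.amap_comp[OF h] \<Phi>.amap_ident[OF a] \<eta>(2)[OF a] \<eta>'(2)[OF a] s\<close>)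
    moreover have "Comp C (\<eta> a) (\<eta>' a) = Ident C (c (omap \<Phi> a))"
      by (rule inj[OF C.comp_closed[OF h(2,1)] C.ident_closed[OF ca] _ ca ca])
        (use \<Phi>o[OF a] in \<open>simp add: \<Phi>.amap_comp[OF h(2,1)] \<Phi>.amap_ident[OF ca] \<eta>(2)[OF a] \<eta>'(2)[OF a] s\<close>)
    ultimately show ?thesis using h unfolding iso_arrow_def inverse_arrows_def by (auto simp: Hom_def)
  qed
  have 1: "\<forall>a\<in>Obj C. \<eta> a \<in> Hom C a (omap H (omap \<Phi> a)) \<and> iso_arrow C (\<eta> a)"
    using \<eta>(1) \<eta>i Ho \<Phi>o by simp
  have 2: "\<forall>f\<in>Arr C. Comp C (\<eta> (Cod C f)) f = Comp C (amap H (amap \<Phi> f)) (\<eta> (Dom C f))"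
  proof
    fix f assume f: "f \<in> Arr C"
    have h: "f \<in> Hom C (Dom C f) (Cod C f)" using f by (simp add: Hom_def)
    note o = C.dom_closed[OF f] C.cod_closed[OF f]
    have a: "amap \<Phi> f \<in> Arr D" "Dom D (amap \<Phi> f) = omap \<Phi> (Dom C f)" "Cod D (amap \<Phi> f) = omap \<Phi> (Cod C f)"
      using \<Phi>.amap_closed[OF h] by (auto simp: Hom_def)
    have hh: "amap H (amap \<Phi> f) \<in> Hom C (c (omap \<Phi> (Dom C f))) (c (omap \<Phi> (Cod C f)))" using Ha(1)[OF a(1)] a by simp
    show "Comp C (\<eta> (Cod C f)) f = Comp C (amap H (amap \<Phi> f)) (\<eta> (Dom C f))"
    proof (rule inj[OF C.comp_closed[OF h \<eta>(1)[OF o(2)]] C.comp_closed[OF \<eta>(1)[OF o(1)] hh] _ o(1) c[OF \<Phi>o[OF o(2)]]])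
      show "amap \<Phi> (Comp C (\<eta> (Cod C f)) f) = amap \<Phi> (Comp C (amap H (amap \<Phi> f)) (\<eta> (Dom C f)))"
        unfolding \<Phi>.amap_comp[OF h \<eta>(1)[OF o(2)]] \<Phi>.amap_comp[OF \<eta>(1)[OF o(1)] hh] \<eta>(2)[OF o(1)] \<eta>(2)[OF o(2)] Ha(2)[OF a(1)] conj_def
        using a \<Phi>o[OF o(1)] \<Phi>o[OF o(2)] by (simp add: s)
    qed
  qed
  have 3: "\<forall>b\<in>Obj D. e b \<in> Hom D (omap \<Phi> (omap H b)) b \<and> iso_arrow D (e b)"
    using ce Ho by simp
  have 4: "\<forall>g\<in>Arr D. Comp D (e (Cod D g)) (amap \<Phi> (amap H g)) = Comp D g (e (Dom D g))"
    using Ha(2) by (simp add: conj_def s)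
  show ?thesis unfolding equivalent_categories_def using C D F Hf 1 2 3 4 by blast
qed

subsection \<open>The algebra of a bimonoid with a group action\<close>

context tensor_family begin

text \<open>Two presentations of the same structure differ by an isomorphism, which is represented by an identity.\<close>

lemma presentation_change:
  assumes P: "pres (n, j) A" and P': "pres (n, j') A'"
  shows "rep (n, j) (n, j') (inv_arrow S j' \<cdot> j) (idE n)" "(inv_arrow S j \<cdot> j') \<cdot> (inv_arrow S j' \<cdot> j) = Ident S A"
    "inv_arrow S j' \<cdot> j \<in> Hom S A A'"
proof -
  have i: "iso_arrow S j" "Dom S j = A" "Cod S j = T n" "iso_arrow S j'" "Dom S j' = A'" "Cod S j' = T n" using P P' by (auto simp: pres_def)
  have o: "A \<in> Obj S" "A' \<in> Obj S" using i dom_closed[OF iso_arr(1)] by blast+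
  show "inv_arrow S j' \<cdot> j \<in> Hom S A A'" "(inv_arrow S j \<cdot> j') \<cdot> (inv_arrow S j' \<cdot> j) = Ident S A"
    using i o by (simp_all add: Hom_def arrow_simps)
  show "rep (n, j) (n, j') (inv_arrow S j' \<cdot> j) (idE n)"
    using i o P P' by (simp add: rep_def idE_def arrow_simps)
qed

text \<open>Two bimonoids with the same representatives are isomorphic: the change of presentation
  is represented by an identity, for which all conditions on a morphism are trivial in the strict
  PROP.\<close>

lemma bimonoid_morphism_presentation:
  assumes P: "pres (Suc 0, j) (bobj B)" and P': "pres (Suc 0, j') (bobj B')"
    and r: "rep (pten (Suc 0, j) (Suc 0, j)) (Suc 0, j) (bmult B) mu" "rep (0, u) (Suc 0, j) (bunit B) eta"
      "rep (Suc 0, j) (pten (Suc 0, j) (Suc 0, j)) (bcomult B) del" "rep (Suc 0, j) (0, u) (bcounit B) eps"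
    and r': "rep (pten (Suc 0, j') (Suc 0, j')) (Suc 0, j') (bmult B') mu" "rep (0, u) (Suc 0, j') (bunit B') eta"
      "rep (Suc 0, j') (pten (Suc 0, j') (Suc 0, j')) (bcomult B') del" "rep (Suc 0, j') (0, u) (bcounit B') eps"
  shows "bimonoid_morphism S B B' (inv_arrow S j' \<cdot> j)"
proof -
  let ?k = "inv_arrow S j' \<cdot> j"
  note k = presentation_change(1)[OF P P']
  note a = rep_ar[OF r(1)] rep_ar[OF r(2)] rep_ar[OF r(3)] rep_ar[OF r(4)]
  have fp: "fst (pten p q) = fst p + fst q" for p q by (simp add: pten_def)
  note s = a fp E.idn_cmp E.cmp_idn E.ten_idn
  have "?k \<cdot> bmult B = bmult B' \<cdot> (?k \<boxtimes> ?k)"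
    using rep_eq_iff[OF rep_comp[OF r(1) k] rep_comp[OF rep_ten[OF k k] r'(1)]] s by simp
  moreover have "?k \<cdot> bunit B = bunit B'" using rep_eq_iff[OF rep_comp[OF r(2) k] r'(2)] s by simp
  moreover have "(?k \<boxtimes> ?k) \<cdot> bcomult B = bcomult B' \<cdot> ?k"
    using rep_eq_iff[OF rep_comp[OF r(3) rep_ten[OF k k]] rep_comp[OF k r'(3)]] s by simp
  moreover have "bcounit B' \<cdot> ?k = bcounit B" using rep_eq_iff[OF rep_comp[OF k r'(4)] r(4)] s by simp
  ultimately show ?thesis using presentation_change(3)[OF P P'] by (simp add: bimonoid_morphism_def)
qed

lemma presentation_intertwines:
  assumes P: "pres (Suc 0, j) A" and P': "pres (Suc 0, j') A'"
    and r: "rep (Suc 0, j) (Suc 0, j) f e" and r': "rep (Suc 0, j') (Suc 0, j') f' e"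
  shows "(inv_arrow S j' \<cdot> j) \<cdot> f = f' \<cdot> (inv_arrow S j' \<cdot> j)"
  using rep_eq_iff[OF rep_comp[OF r presentation_change(1)[OF P P']] rep_comp[OF presentation_change(1)[OF P P'] r']] rep_ar[OF r]
  by (simp add: E.idn_cmp E.cmp_idn)

end

text \<open>Over a strict category all comparison arrows between tensor powers are identities, which
  makes the functor built from a bimonoid strict.\<close>

lemma (in symmetric_monoidal_category) tpow_strict:
  assumes st: "strict_smc C" and a: "a \<in> Obj C"
  shows "tpow a (m + n) = tpow a m \<boxdot> tpow a n \<and> tpow_join a m n = Ident C (tpow a (m + n))"
proof (induction m)
  case 0
  show ?case using st tpow_obj[OF a, of n] by (simp add: strict_smc_def)
next
  case (Suc m)
  note o = a tpow_obj[OF a]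
  have e: "Assoc C a (tpow a m) (tpow a n) = Ident C (a \<boxdot> tpow a (m + n))" "tpow a (Suc m) \<boxdot> tpow a n = a \<boxdot> tpow a (m + n)"
    unfolding Suc[THEN conjunct1] using st o by (simp_all add: strict_smc_def)
  have "tpow_join a (Suc m) n = (Ident C a \<boxtimes> Ident C (tpow a (m + n))) \<cdot> Ident C (a \<boxdot> tpow a (m + n))"
    unfolding tpow_join.simps e(1) Suc[THEN conjunct2] ..
  also have "\<dots> = Ident C (tpow a (Suc m + n))" using o by (simp add: arrow_simps)
  finally have "tpow_join a (Suc m) n = Ident C (tpow a (Suc m + n))" .
  moreover have "tpow a (Suc m + n) = tpow a (Suc m) \<boxdot> tpow a n" unfolding e(2) by simp
  ultimately show ?case by (rule conjI[rotated])
qed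

text \<open>The kinds decide what is demanded of the bimonoid: absent orders on the horizontal side
  require a commutative product, absent orders on the vertical side a cocommutative
  coproduct.\<close>

locale G_bimonoid = group G + symmetric_monoidal_category S
  for G :: "('g, 'y) monoid_scheme" and S :: "('o, 'a, 'z) smc_scheme" (structure) +
  fixes B :: "('o, 'a) bimon" and r :: "'g \<Rightarrow> 'a" and L :: label_law and kX kY :: fibre_kind
  assumes L: "L = Commuting \<or> L = Preserving \<and> comm_group G"
    and bim: "bimonoid S B" and act: "g \<in> carrier G \<Longrightarrow> bimonoid_morphism S B B (r g)"
    and act_mult: "\<lbrakk>g \<in> carrier G; h \<in> carrier G\<rbrakk> \<Longrightarrow> r (g \<otimes>\<^bsub>G\<^esub> h) = r g \<cdot> r h" and act_one: "r \<one>\<^bsub>G\<^esub> = Ident S (bobj B)"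
    and com: "kX = Unordered \<Longrightarrow> commutative_bimonoid S B" and coc: "kY = Unordered \<Longrightarrow> cocommutative_bimonoid S B"
begin

abbreviation "A \<equiv> bobj B"
abbreviation "I \<equiv> Ident S (TUnit S)"

lemma A_in: "A \<in> Obj S"
  using bim by (simp add: bimonoid_def monoid_object_def)

sublocale tensor_family S "tpow A" "I" "tpow_join A"
  by (rule tensor_family_tpow[OF A_in])

text \<open>The first tensor power is \<open>A \<boxdot> TUnit S\<close>, so the inverse of the
  right unit isomorphism presents \<open>A\<close>.\<close>

definition "pA = (Suc 0, inv_arrow S (RUnit S A))"
definition "muB = tr (pten pA pA) pA (bmult B)"
definition "etaB = tr (0, I) pA (bunit B)"
definition "delB = tr pA (pten pA pA) (bcomult B)"
definition "epsB = tr pA (0, I) (bcounit B)"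
definition "rhoB g = tr pA pA (r g)"

lemma pres_pA: "pres pA A"
  using A_in iso_inv[OF runit_simps(4)[OF A_in]] by (simp add: pres_def pA_def arrow_simps)

lemma rep_B:
  "rep (pten pA pA) pA (bmult B) muB" "rep (0, I) pA (bunit B) etaB" "rep pA (pten pA pA) (bcomult B) delB" "rep pA (0, I) (bcounit B) epsB"
  "g \<in> carrier G \<Longrightarrow> rep pA pA (r g) (rhoB g)"
proof -
  interpret b: bimonoid S B by (rule bim)
  note t = rep_tr pres_ten[OF pres_pA pres_pA] pres_pA pres_u
  show "rep (pten pA pA) pA (bmult B) muB" unfolding muB_def by (rule t(1)[OF t(2,3) b.mult_arr])
  show "rep (0, I) pA (bunit B) etaB" unfolding etaB_def by (rule t(1)[OF t(4,3) b.unit_arr])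
  show "rep pA (pten pA pA) (bcomult B) delB" unfolding delB_def by (rule t(1)[OF t(3,2) b.comult_arr])
  show "rep pA (0, I) (bcounit B) epsB" unfolding epsB_def by (rule t(1)[OF t(3,4) b.counit_arr])
  show "rep pA pA (r g) (rhoB g)" if "g \<in> carrier G" unfolding rhoB_def
    by (rule t(1)[OF t(3,3)]) (use act[OF that] in \<open>simp add: bimonoid_morphism_def\<close>)
qed

lemma bimon_eta: "\<lparr>bobj = A, bmult = bmult B, bunit = bunit B, bcomult = bcomult B, bcounit = bcounit B\<rparr> = B"
  by simp

sublocale gbim arE dmE cdE cmpE tenE idE brE G muB etaB rhoB delB epsB
proof (rule gbim_iff[OF pres_pA[unfolded pA_def] rep_B(1-4)[unfolded pA_def] is_group rep_B(5)[unfolded pA_def], THEN iffD2])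
  show "bimonoid S \<lparr>bobj = A, bmult = bmult B, bunit = bunit B, bcomult = bcomult B, bcounit = bcounit B\<rparr> \<and>
    (\<forall>g\<in>carrier G. bimonoid_morphism S \<lparr>bobj = A, bmult = bmult B, bunit = bunit B, bcomult = bcomult B, bcounit = bcounit B\<rparr>
       \<lparr>bobj = A, bmult = bmult B, bunit = bunit B, bcomult = bcomult B, bcounit = bcounit B\<rparr> (r g)) \<and>
    (\<forall>g\<in>carrier G. \<forall>h\<in>carrier G. r (g \<otimes>\<^bsub>G\<^esub> h) = r g \<cdot> r h) \<and> r \<one>\<^bsub>G\<^esub> = Ident S A"
    unfolding bimon_eta by (intro conjI ballI bim act act_mult act_one)
qed

lemma kcomm_X: "kcomm kX" and kcomm_Y: "op.kcomm kY"
  unfolding kcomm_def op.kcomm_def comm_iff[OF pres_pA[unfolded pA_def] rep_B(1-4)[unfolded pA_def], symmetric]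
  by (intro impI com[unfolded commutative_bimonoid_def] coc[unfolded cocommutative_bimonoid_def]; assumption)+

abbreviation "QB \<equiv> composite_prop L kX kY G"

text \<open>The algebra of the bimonoid: tensor powers on objects and the evaluation of spans on
  arrows. The outer components of \<open>evc\<close> are arities and are dropped.\<close>

definition J :: "(nat, 'g span_class, 'o, 'a) mfnctr" where
  "J = \<lparr>omap = tpow A, amap = \<lambda>a\<in>Arr QB. fst (snd (evc kX kY a)), unit_map = I, ten_map = tpow_join A\<rparr>"

lemma J_sel: "omap J = tpow A" "unit_map J = I" "ten_map J = tpow_join A"
  by (simp_all add: J_def)

lemma evc_J: "a \<in> Hom QB n m \<Longrightarrow> evc kX kY a = (n, amap J a, m) \<and> amap J a \<in> Hom S (tpow A n) (tpow A m)"
  using evc_hom[OF kcomm_X kcomm_Y, of a L n m] unfolding E.hom_def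
  by (cases "evc kX kY a") (auto simp: J_def E_defs Hom_def)

lemma J_ident: "amap J (Ident QB n) = Ident S (tpow A n)"
proof -
  have i: "Ident QB n = incX kX kY (lident kX G n)" by (rule Q_ident(1)[OF L])
  have "evc kX kY (Ident QB n) = idE n"
    unfolding i evc_incX[OF kcomm_X kcomm_Y lident_lmaps] by (rule M_lident[OF kcomm_X])
  moreover have "Ident QB n \<in> Hom QB n n" unfolding i by (rule incX_hom[OF L lident_lmaps])
  ultimately show ?thesis using evc_J[of "Ident QB n" n n] by (simp add: idE_def)
qed

lemma symmetric_monoidal_functor_J: "symmetric_monoidal_functor QB S J"
proof unfold_locales
  note Qs = Q_sel[OF L, where kX = kX and kY = kY]
  note o = tpow_obj[OF A_in]
  have ts: "tpow_join A m n \<in> Arr S" "Dom S (tpow_join A m n) = tpow A m \<boxdot> tpow A n" "Cod S (tpow_join A m n) = tpow A (m + n)" for m n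
    using c_simps by simp_all
  show "omap J \<in> Obj QB \<rightarrow>\<^sub>E Obj S" using o by (auto simp: J_sel Qs PiE_iff)
  show "amap J \<in> extensional (Arr QB)" by (simp add: J_def)
  show "amap J f \<in> Hom S (omap J a) (omap J b)" if "f \<in> Hom QB a b" for f a b using evc_J[OF that] by (simp add: J_sel)
  show "amap J (Ident QB a) = Ident S (omap J a)" for a by (simp add: J_ident J_sel)
  show "amap J (Comp QB g f) = amap J g \<cdot> amap J f" if "f \<in> Hom QB a b" "g \<in> Hom QB b d" for f a b g d
    using evc_comp[OF kcomm_X kcomm_Y L that] evc_J[OF that(1)] evc_J[OF that(2)] evc_J[OF Q_comp_hom[OF L that]]
    by (simp add: cmpE_def)
  show "unit_map J \<in> Hom S (TUnit S) (omap J (TUnit QB))" "iso_arrow S (unit_map J)"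
    using u_hom u_iso by (simp_all add: J_sel Qs)
  show "ten_map J a b \<in> Hom S (omap J a \<boxdot> omap J b) (omap J (TenO QB a b)) \<and> iso_arrow S (ten_map J a b)" for a b
    using c_hom c_iso by (simp add: J_sel Qs)
  show "ten_map J a b = undefined" if "a \<notin> Obj QB \<or> b \<notin> Obj QB" for a b using that by (simp add: Qs)
  show "ten_map J a' b' \<cdot> (amap J f \<boxtimes> amap J g) = amap J (TenA QB f g) \<cdot> ten_map J a b" if "f \<in> Hom QB a a'" "g \<in> Hom QB b b'" for f a a' g b b'
  proof -
    have h: "amap J f \<in> Arr S" "Dom S (amap J f) = tpow A a" "Cod S (amap J f) = tpow A a'"
      "amap J g \<in> Arr S" "Dom S (amap J g) = tpow A b" "Cod S (amap J g) = tpow A b'"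
      using evc_J[OF that(1)] evc_J[OF that(2)] by (auto simp: Hom_def)
    have "amap J (TenA QB f g) = tpow_join A a' b' \<cdot> (amap J f \<boxtimes> amap J g) \<cdot> inv_arrow S (tpow_join A a b)"
      using evc_tensor[OF kcomm_X kcomm_Y that] evc_J[OF that(1)] evc_J[OF that(2)] evc_J[OF Q_tensor_hom[OF L that]]
      by (simp add: tenE_def)
    then show ?thesis using h by (simp add: J_sel fam_simps del: tpow.simps tpow_join.simps)
  qed
  show "amap J (Assoc QB a b c) \<cdot> ten_map J (TenO QB a b) c \<cdot> (ten_map J a b \<boxtimes> Ident S (omap J c)) =
     ten_map J a (TenO QB b c) \<cdot> (Ident S (omap J a) \<boxtimes> ten_map J b c) \<cdot> Assoc S (omap J a) (omap J b) (omap J c)" for a b c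
    using c_assoc[of a b c] by (simp add: J_sel Qs J_ident fam_simps add.assoc del: tpow.simps tpow_join.simps)
  show "amap J (LUnit QB a) \<cdot> ten_map J (TUnit QB) a \<cdot> (unit_map J \<boxtimes> Ident S (omap J a)) = LUnit S (omap J a)"
    "amap J (RUnit QB a) \<cdot> ten_map J a (TUnit QB) \<cdot> (Ident S (omap J a) \<boxtimes> unit_map J) = RUnit S (omap J a)" for a
    unfolding Qs J_sel J_ident
    using c_lunit[of a] c_runit[of a] by (simp_all add: lunit_simps runit_simps ident_comp del: tpow.simps tpow_join.simps)
  show "amap J (Braid QB a b) \<cdot> ten_map J a b = ten_map J b a \<cdot> Braid S (omap J a) (omap J b)" for a b
  proof -
    have i: "Braid QB a b = incX kX kY (lbraid kX G a b)" by (rule Q_braid[OF L])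
    have "evc kX kY (Braid QB a b) = brE a b"
      unfolding i evc_incX[OF kcomm_X kcomm_Y lbraid_lmaps] by (rule M_lbraid[OF kcomm_X])
    moreover have "Braid QB a b \<in> Hom QB (a + b) (a + b)" unfolding i by (rule incX_hom[OF L lbraid_lmaps])
    ultimately have "amap J (Braid QB a b) = tpow_join A b a \<cdot> Braid S (tpow A a) (tpow A b) \<cdot> inv_arrow S (tpow_join A a b)"
      using evc_J[of "Braid QB a b" "a + b" "a + b"] by (simp add: brE_def)
    then show ?thesis by (simp add: J_sel fam_simps del: tpow.simps tpow_join.simps)
  qed
qed

lemma strict_J:
  assumes "strict_smc S"
  shows "symmetric_strict_monoidal_functor QB S J"
proof -
  interpret J: symmetric_monoidal_functor QB S J by (rule symmetric_monoidal_functor_J)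
  show ?thesis
    by unfold_locales (use tpow_strict[OF assms A_in] in \<open>simp_all add: J_sel Q_sel[OF L, where kX = kX and kY = kY]\<close>)
qed

sublocale J: composite_algebra G S L kX kY J
  by (intro composite_algebra.intro composite_algebra_axioms.intro is_group symmetric_monoidal_functor_J L)
    (rule symmetric_monoidal_category_axioms)

lemma J_structure: "J.muF = muB" "J.etaF = etaB" "J.delF = delB" "J.epsF = epsB" "g \<in> carrier G \<Longrightarrow> J.rhoF g = rhoB g"
proof -
  have e: "J.EF a = evc kX kY a" if "a \<in> Hom QB n m" for a n m
    using evc_J[OF that] that by (simp add: J.EF_def Hom_def)
  note eX = e[OF incX_hom[OF L]] evc_incX[OF kcomm_X kcomm_Y] and eY = e[OF incY_hom[OF L]] evc_incY[OF kcomm_X kcomm_Y]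
  show "J.muF = muB" "J.etaF = etaB" unfolding J.muF_def J.etaF_def eX[OF lmul_lmaps] M_lmul[OF kcomm_X] by simp_all
  show "J.delF = delB" "J.epsF = epsB" unfolding J.delF_def J.epsF_def eY[OF lmul_lmaps] op.M_lmul[OF kcomm_Y] by simp_all
  show "J.rhoF g = rhoB g" if "g \<in> carrier G" unfolding J.rhoF_def eX[OF lunl_lmaps[OF that]] M_lunl[OF kcomm_X that] ..
qed

text \<open>The bimonoid recovered from \<open>J\<close> lives on \<open>A \<boxdot> TUnit S\<close>
  and is therefore not \<open>B\<close> itself. It has the same representatives as \<open>B\<close>,
  so the change of presentation is an isomorphism that respects the actions.\<close>

lemma J_iso:
  obtains f f' where "bimonoid_morphism S J.bimon_F B f" "bimonoid_morphism S B J.bimon_F f'"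
    "f' \<cdot> f = Ident S (bobj J.bimon_F)" "f \<cdot> f' = Ident S (bobj B)"
    "\<And>g. g \<in> carrier G \<Longrightarrow> f \<cdot> amap J (incX kX kY (lunl kX g)) = r g \<cdot> f"
    "\<And>g. g \<in> carrier G \<Longrightarrow> f' \<cdot> r g = amap J (incX kX kY (lunl kX g)) \<cdot> f'"
proof -
  have "pres (Suc 0, Ident S (tpow A (Suc 0))) (bobj J.bimon_F)" using J.pres_pF unfolding J.bobj_F J_sel .
  note p = this pres_pA[unfolded pA_def]
  note rJ = J.rep_F(1-4)[unfolded J_structure J_sel] and rB = rep_B(1-4)[unfolded pA_def]
  have a: "rep (Suc 0, Ident S (tpow A (Suc 0))) (Suc 0, Ident S (tpow A (Suc 0))) (amap J (incX kX kY (lunl kX g))) (rhoB g)"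
    "rep (Suc 0, inv_arrow S (RUnit S A)) (Suc 0, inv_arrow S (RUnit S A)) (r g) (rhoB g)" if "g \<in> carrier G" for g
    using J.rep_F(5)[OF that] rep_B(5)[OF that] unfolding J_structure(5)[OF that] J_sel pA_def by blast+
  show thesis
    by (rule that[OF bimonoid_morphism_presentation[OF p rJ rB] bimonoid_morphism_presentation[OF p(2,1) rB rJ]
      presentation_change(2)[OF p] presentation_change(2)[OF p(2,1)]
      presentation_intertwines[OF p a] presentation_intertwines[OF p(2,1) a(2,1)]])
qed

end

subsection \<open>The equivalence\<close>

lemma restrict_UNIV_eq: "restrict f UNIV = f"
  by (simp add: restrict_def)

context composite_algebra_pair begin

lemma monoidal_nat_transf_comp:
  assumes "composite_algebra G S L kX kY F''" and s: "monoidal_nat_transf Q S F F' s" and t: "monoidal_nat_transf Q S F' F'' t"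
  shows "monoidal_nat_transf Q S F F'' (\<lambda>a. t a \<cdot> s a)"
proof -
  interpret H: composite_algebra G S L kX kY F'' by fact
  interpret A: composite_algebra_pair G S L kX kY F' F'' ..
  interpret B: composite_algebra_pair G S L kX kY F F'' ..
  have cs: "compatible s" "A.compatible t" and n: "\<And>n m a. a \<in> Hom Q n m \<Longrightarrow> s m \<cdot> amap F a = amap F' a \<cdot> s n" "\<And>n m a. a \<in> Hom Q n m \<Longrightarrow> t m \<cdot> amap F' a = amap F'' a \<cdot> t n"
    using s t by (auto simp: monoidal_nat_transf_iff A.monoidal_nat_transf_iff)
  note sa = t_ar[OF cs(1)] A.t_ar[OF cs(2)]
  note sm = pair_simps F'.c_simps F'.u_simps F'.c_iso F'.u_iso H.c_simps H.u_simps sa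
  have "t (m + n) \<cdot> s (m + n) \<cdot> ten_map F m n = ten_map F'' m n \<cdot> ((t m \<cdot> s m) \<boxtimes> (t n \<cdot> s n))" for m n
  proof -
    have "t (m + n) \<cdot> s (m + n) \<cdot> ten_map F m n = (t (m + n) \<cdot> ten_map F' m n) \<cdot> (s m \<boxtimes> s n)"
      unfolding t_ten[OF cs(1)] by (simp add: sm)
    then show ?thesis unfolding A.t_ten[OF cs(2)] by (simp add: sm)
  qed
  moreover have "t 0 \<cdot> s 0 \<cdot> unit_map F = unit_map F''" unfolding t_unit[OF cs(1)] A.t_unit[OF cs(2)] ..
  ultimately have "B.compatible (\<lambda>a. t a \<cdot> s a)" by (simp add: B.compatible_def Hom_def sm)
  moreover have "(t m \<cdot> s m) \<cdot> amap F a = amap F'' a \<cdot> t n \<cdot> s n" if a: "a \<in> Hom Q n m" for a n m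
  proof -
    have h: "amap F a \<in> Arr S" "Dom S (amap F a) = omap F n" "Cod S (amap F a) = omap F m" "amap F' a \<in> Arr S" "Dom S (amap F' a) = omap F' n" "Cod S (amap F' a) = omap F' m"
      "amap F'' a \<in> Arr S" "Dom S (amap F'' a) = omap F'' n" "Cod S (amap F'' a) = omap F'' m"
      using amap_closed[OF a] F'.amap_closed[OF a] H.amap_closed[OF a] by (auto simp: Hom_def)
    have "(t m \<cdot> s m) \<cdot> amap F a = t m \<cdot> (s m \<cdot> amap F a)" using h sa by (simp add: arrow_simps)
    also have "\<dots> = (t m \<cdot> amap F' a) \<cdot> s n" unfolding n(1)[OF a] using h sa by (simp add: arrow_simps)
    also have "\<dots> = amap F'' a \<cdot> t n \<cdot> s n" unfolding n(2)[OF a] using h sa by (simp add: arrow_simps)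
    finally show ?thesis .
  qed
  ultimately show ?thesis by (simp add: B.monoidal_nat_transf_iff)
qed

end

lemma (in composite_algebra) monoidal_nat_transf_ident: "monoidal_nat_transf Q S F F (\<lambda>n. Ident S (omap F n))"
proof -
  interpret P: composite_algebra_pair G S L kX kY F F ..
  have "P.compatible (\<lambda>n. Ident S (omap F n))" by (simp add: P.compatible_def Hom_def fam_simps)
  moreover have "Ident S (omap F m) \<cdot> amap F a = amap F a \<cdot> Ident S (omap F n)" if "a \<in> Hom Q n m" for a n m
    using amap_closed[OF that] by (simp add: Hom_def arrow_simps)
  ultimately show ?thesis by (simp add: P.monoidal_nat_transf_iff)
qed

text \<open>One condition for the three cases of the theorem, selected by the two kinds.\<close>

definition commutation :: "fibre_kind \<Rightarrow> fibre_kind \<Rightarrow> ('o, 'a, 'z) smc_scheme \<Rightarrow> ('o, 'a) bimon \<Rightarrow> bool" where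
  "commutation kX kY S B \<longleftrightarrow> (kX = Unordered \<longrightarrow> commutative_bimonoid S B) \<and> (kY = Unordered \<longrightarrow> cocommutative_bimonoid S B)"

text \<open>The set of functors is kept abstract so that strong and strict algebras are treated at
  once: it consists of symmetric monoidal functors and contains the algebra \<open>J\<close> of
  every bimonoid in question.\<close>

locale composite_algebras = group G + symmetric_monoidal_category S
  for G :: "('g, 'y) monoid_scheme" and S :: "('o, 'a, 'z) smc_scheme" (structure) +
  fixes L :: label_law and kX kY :: fibre_kind and \<F> :: "(nat, 'g span_class, 'o, 'a) mfnctr set"
  assumes L: "L = Commuting \<or> L = Preserving \<and> comm_group G"
    and smf: "F \<in> \<F> \<Longrightarrow> symmetric_monoidal_functor (composite_prop L kX kY G) S F"
    and J_in: "\<And>B r. G_bimonoid G S B r L kX kY \<Longrightarrow> G_bimonoid.J G S B r L kX kY \<in> \<F>"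
begin

abbreviation "\<Q> \<equiv> composite_prop L kX kY G"
abbreviation "\<A> \<equiv> transf_category \<Q> S \<F> (monoidal_nat_transf \<Q> S)"
abbreviation "\<B> \<equiv> full_subcategory (bimonoid_category S) (commutation kX kY S)"
abbreviation "\<G> \<equiv> functor_category (group_category G) \<B>"
abbreviation "bF F \<equiv> composite_algebra.bimon_F G S kX kY F"
abbreviation "act F g \<equiv> amap F (incX kX kY (lunl kX g))"

lemma algebra: "F \<in> \<F> \<Longrightarrow> composite_algebra G S L kX kY F"
  by (intro composite_algebra.intro composite_algebra_axioms.intro is_group smf L) (rule symmetric_monoidal_category_axioms)

lemma algebra_pair: "\<lbrakk>F \<in> \<F>; F' \<in> \<F>\<rbrakk> \<Longrightarrow> composite_algebra_pair G S L kX kY F F'"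
  by (intro composite_algebra_pair.intro algebra)

lemma group_category_sel: "Obj (group_category G) = UNIV" "Arr (group_category G) = carrier G" "Dom (group_category G) g = ()"
    "Cod (group_category G) g = ()" "Ident (group_category G) x = \<one>\<^bsub>G\<^esub>" "Comp (group_category G) g h = g \<otimes>\<^bsub>G\<^esub> h"
    "f \<in> Hom (group_category G) x y \<longleftrightarrow> f \<in> carrier G"
  by (auto simp: group_category_def Hom_def)

lemma B_hom: "x \<in> Hom \<B> B B' \<longleftrightarrow> (\<exists>f. x = (B, f, B') \<and> bimonoid S B \<and> bimonoid S B' \<and> commutation kX kY S B \<and> commutation kX kY S B' \<and> bimonoid_morphism S B B' f)"
  by (cases x) (auto simp: Hom_def full_subcategory_def bimonoid_category_def)

lemma B_sel: "Obj \<B> = {B. bimonoid S B \<and> commutation kX kY S B}" "Ident \<B> B = (B, Ident S (bobj B), B)" "Comp \<B> (B', g, B'') (B, f, B''') = (B, g \<cdot> f, B'')"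
  by (auto simp: full_subcategory_def bimonoid_category_def)

lemma A_hom: "x \<in> Hom \<A> F F' \<longleftrightarrow> (\<exists>t. x = (F, t, F') \<and> F \<in> \<F> \<and> F' \<in> \<F> \<and> monoidal_nat_transf \<Q> S F F' t)"
  by (cases x) (auto simp: Hom_def transf_category_def)

lemma A_sel: "Obj \<A> = \<F>" "Ident \<A> F = (F, \<lambda>n. Ident S (omap F n), F)" "Comp \<A> (F', t, F'') (F, s, F''') = (F, \<lambda>n. t n \<cdot> s n, F'')"
  by (simp_all add: transf_category_def Q_sel[OF L] restrict_UNIV_eq)

text \<open>A group is a category with one object, so a transformation has a single component: a
  bimonoid morphism that commutes with the two actions.\<close>

lemma G_hom: "x \<in> Hom \<G> M N \<longleftrightarrow> (\<exists>f. x = (M, \<lambda>_. (omap M (), f, omap N ()), N) \<and> is_functor (group_category G) \<B> M \<and> is_functor (group_category G) \<B> N \<and>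
    (omap M (), f, omap N ()) \<in> Hom \<B> (omap M ()) (omap N ()) \<and>
    (\<forall>g\<in>carrier G. Comp \<B> (omap M (), f, omap N ()) (amap M g) = Comp \<B> (amap N g) (omap M (), f, omap N ())))" (is "?L \<longleftrightarrow> ?R")
proof
  assume ?L
  then obtain s where s: "x = (M, s, N)" "is_functor (group_category G) \<B> M" "is_functor (group_category G) \<B> N" "nat_transf (group_category G) \<B> M N s"
    by (cases x) (auto simp: Hom_def functor_category_def transf_category_def)
  then have h: "s () \<in> Hom \<B> (omap M ()) (omap N ())" "\<forall>g\<in>carrier G. Comp \<B> (s ()) (amap M g) = Comp \<B> (amap N g) (s ())"
    by (auto simp: nat_transf_def group_category_sel)
  from h(1) obtain f where f: "s () = (omap M (), f, omap N ())" unfolding B_hom by blast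
  then have "s = (\<lambda>_. (omap M (), f, omap N ()))" by (auto simp: fun_eq_iff)
  then show ?R using s h f by metis
next
  assume ?R
  then show ?L by (auto simp: Hom_def functor_category_def transf_category_def nat_transf_def group_category_sel)
qed

lemma G_sel: "Obj \<G> = {M. is_functor (group_category G) \<B> M}" "Ident \<G> M = (M, \<lambda>_. Ident \<B> (omap M ()), M)"
    "Comp \<G> (M', t, M'') (M, s, M''') = (M, \<lambda>a. Comp \<B> (t a) (s a), M'')"
  by (auto simp: functor_category_def transf_category_def group_category_sel fun_eq_iff)

lemma category_A: "category \<A>"
proof (rule category_transf_category)
  show "category S" ..
  show "Dom \<Q> f \<in> Obj \<Q> \<and> Cod \<Q> f \<in> Obj \<Q>" for f by (simp add: Q_sel[OF L])
  show "is_functor \<Q> S F" if "F \<in> \<F>" for F using smf[OF that] by (simp add: symmetric_monoidal_functor_def)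
  show "nat_transf \<Q> S F F' t" if "monoidal_nat_transf \<Q> S F F' t" for F F' t using that by (simp add: monoidal_nat_transf_def)
  show "monoidal_nat_transf \<Q> S F F (\<lambda>a\<in>Obj \<Q>. Ident S (omap F a))" if "F \<in> \<F>" for F
    using composite_algebra.monoidal_nat_transf_ident[OF algebra[OF that]] by (simp add: Q_sel[OF L] restrict_UNIV_eq)
  show "monoidal_nat_transf \<Q> S F F'' (\<lambda>a\<in>Obj \<Q>. t a \<cdot> s a)"
    if "F \<in> \<F>" "F' \<in> \<F>" "F'' \<in> \<F>" "monoidal_nat_transf \<Q> S F F' s" "monoidal_nat_transf \<Q> S F' F'' t" for F F' F'' s t
    using composite_algebra_pair.monoidal_nat_transf_comp[OF algebra_pair[OF that(1,2)] algebra[OF that(3)] that(4,5)] by (simp add: Q_sel[OF L] restrict_UNIV_eq)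
qed

lemma category_B: "category \<B>"
  by (intro category_full_subcategory category_bimonoid_category) (rule symmetric_monoidal_category_axioms)

lemma category_G: "category \<G>"
  by (rule category_functor_category[OF category_B]) (simp add: group_category_sel)

definition phi :: "(nat, 'g span_class, 'o, 'a) mfnctr \<Rightarrow> (unit, 'g, ('o, 'a) bimon, ('o, 'a) bimon \<times> 'a \<times> ('o, 'a) bimon) fnctr" where
  "phi F = \<lparr>omap = \<lambda>_. bF F, amap = \<lambda>g\<in>carrier G. (bF F, act F g, bF F)\<rparr>"

lemma bF_obj:
  assumes "F \<in> \<F>"
  shows "bimonoid S (bF F)" "commutation kX kY S (bF F)" "bobj (bF F) = omap F 1"
proof -
  interpret composite_algebra G S L kX kY F by (rule algebra[OF assms])
  show "bimonoid S (bF F)" "commutation kX kY S (bF F)" "bobj (bF F) = omap F 1"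
    using bimonoid_F(1) comm_bimon_F cocomm_bimon_F bobj_F by (auto simp: commutation_def)
qed

lemma phi_functor:
  assumes F: "F \<in> \<F>"
  shows "is_functor (group_category G) \<B> (phi F)"
proof -
  interpret composite_algebra G S L kX kY F by (rule algebra[OF F])
  note b = bF_obj[OF F]
  show ?thesis
    by unfold_locales
      (use b bimonoid_F(2-4) in \<open>auto simp: phi_def group_category_sel B_sel B_hom extensional_def\<close>)
qed

lemma phi_hom:
  assumes F: "F \<in> \<F>" "F' \<in> \<F>"
  shows "x \<in> Hom \<G> (phi F) (phi F') \<longleftrightarrow>
    (\<exists>f. x = (phi F, \<lambda>_. (bF F, f, bF F'), phi F') \<and> composite_algebra_pair.equivariant G S kX kY F F' f)"
proof -
  interpret composite_algebra_pair G S L kX kY F F' by (rule algebra_pair[OF F])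
  show ?thesis
    unfolding G_hom equivariant_def using phi_functor[OF F(1)] phi_functor[OF F(2)] bF_obj[OF F(1)] bF_obj[OF F(2)]
    by (simp add: phi_def B_hom B_sel)
qed

definition Phi where
  "Phi = \<lparr>omap = \<lambda>F\<in>\<F>. phi F, amap = \<lambda>x\<in>Arr \<A>. (phi (fst x), \<lambda>_::unit. (bF (fst x), fst (snd x) 1, bF (snd (snd x))), phi (snd (snd x)))\<rparr>"

lemma Phi_sel: "F \<in> \<F> \<Longrightarrow> omap Phi F = phi F"
    "(F, t, F') \<in> Hom \<A> F F' \<Longrightarrow> amap Phi (F, t, F') = (phi F, \<lambda>_. (bF F, t 1, bF F'), phi F')"
  by (simp_all add: Phi_def Hom_def)

lemma A_homD:
  assumes "x \<in> Hom \<A> F F'"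
  obtains t where "x = (F, t, F')" "F \<in> \<F>" "F' \<in> \<F>" "monoidal_nat_transf \<Q> S F F' t" "amap Phi x = (phi F, \<lambda>_. (bF F, t 1, bF F'), phi F')"
  using assms Phi_sel(2) unfolding A_hom by (metis A_hom)

lemma Phi_functor: "is_functor \<A> \<G> Phi"
proof
  show "omap Phi \<in> Obj \<A> \<rightarrow>\<^sub>E Obj \<G>" using phi_functor by (auto simp: A_sel G_sel Phi_def)
  show "amap Phi \<in> extensional (Arr \<A>)" by (simp add: Phi_def)
  show "amap Phi x \<in> Hom \<G> (omap Phi F) (omap Phi F')" if x: "x \<in> Hom \<A> F F'" for x F F'
  proof -
    obtain t where t: "x = (F, t, F')" "F \<in> \<F>" "F' \<in> \<F>" "monoidal_nat_transf \<Q> S F F' t" "amap Phi x = (phi F, \<lambda>_. (bF F, t 1, bF F'), phi F')"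
      using x by (rule A_homD)
    show ?thesis
      unfolding Phi_sel(1)[OF t(2)] Phi_sel(1)[OF t(3)] phi_hom[OF t(2,3)] t(5)
      using composite_algebra_pair.monoidal_nat_transf_ext(1)[OF algebra_pair[OF t(2,3)] t(4)] by blast
  qed
  show "amap Phi (Ident \<A> F) = Ident \<G> (omap Phi F)" if "F \<in> Obj \<A>" for F
  proof -
    have F: "F \<in> \<F>" using that by (simp add: A_sel)
    have "Ident \<A> F \<in> Hom \<A> F F" by (rule category.ident_closed[OF category_A that])
    then have "amap Phi (Ident \<A> F) = (phi F, \<lambda>_. (bF F, Ident S (omap F 1), bF F), phi F)"
      unfolding A_sel(2) by (rule Phi_sel(2))
    then show ?thesis unfolding Phi_sel(1)[OF F] G_sel B_sel using bF_obj(3)[OF F] by (simp add: phi_def)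
  qed
  show "amap Phi (Comp \<A> y x) = Comp \<G> (amap Phi y) (amap Phi x)" if x: "x \<in> Hom \<A> F F'" and y: "y \<in> Hom \<A> F' F''" for x y F F' F''
  proof -
    obtain s where s: "x = (F, s, F')" "amap Phi x = (phi F, \<lambda>_. (bF F, s 1, bF F'), phi F')"
      using x by (rule A_homD)
    obtain t where t: "y = (F', t, F'')" "amap Phi y = (phi F', \<lambda>_. (bF F', t 1, bF F''), phi F'')"
      using y by (rule A_homD)
    have "Comp \<A> y x \<in> Hom \<A> F F''" by (rule category.comp_closed[OF category_A x y])
    then have "amap Phi (Comp \<A> y x) = (phi F, \<lambda>_. (bF F, t 1 \<cdot> s 1, bF F''), phi F'')"
      unfolding s(1) t(1) A_sel by (rule Phi_sel(2))
    then show ?thesis unfolding s(2) t(2) G_sel B_sel .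
  qed
qed

text \<open>The functor is faithful because a monoidal transformation is determined by its component
  at 1, and full because equivariant arrows extend.\<close>

lemma Phi_bij:
  assumes F: "F \<in> \<F>" "F' \<in> \<F>"
  shows "bij_betw (amap Phi) (Hom \<A> F F') (Hom \<G> (omap Phi F) (omap Phi F'))"
proof -
  interpret composite_algebra_pair G S L kX kY F F' by (rule algebra_pair[OF F])
  show ?thesis unfolding bij_betw_def
  proof
    show "inj_on (amap Phi) (Hom \<A> F F')"
    proof (rule inj_onI)
      fix x y assume x: "x \<in> Hom \<A> F F'" and y: "y \<in> Hom \<A> F F'" and e: "amap Phi x = amap Phi y"
      obtain s where s: "x = (F, s, F')" "monoidal_nat_transf \<Q> S F F' s" "amap Phi x = (phi F, \<lambda>_. (bF F, s 1, bF F'), phi F')"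
        using x by (rule A_homD)
      obtain t where t: "y = (F, t, F')" "monoidal_nat_transf \<Q> S F F' t" "amap Phi y = (phi F, \<lambda>_. (bF F, t 1, bF F'), phi F')"
        using y by (rule A_homD)
      have "s 1 = t 1" using e unfolding s(3) t(3) by (auto dest: fun_cong)
      then show "x = y" using monoidal_nat_transf_ext(3)[OF s(2) t(2)] s(1) t(1) by simp
    qed
    show "amap Phi ` Hom \<A> F F' = Hom \<G> (omap Phi F) (omap Phi F')"
    proof
      show "amap Phi ` Hom \<A> F F' \<subseteq> Hom \<G> (omap Phi F) (omap Phi F')"
        using is_functor.amap_closed[OF Phi_functor] by blast
      show "Hom \<G> (omap Phi F) (omap Phi F') \<subseteq> amap Phi ` Hom \<A> F F'"
      proof
        fix x assume "x \<in> Hom \<G> (omap Phi F) (omap Phi F')"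
        then obtain f where f: "x = (phi F, \<lambda>_. (bF F, f, bF F'), phi F')" "equivariant f"
          unfolding Phi_sel(1)[OF F(1)] Phi_sel(1)[OF F(2)] phi_hom[OF F] by blast
        note e = monoidal_nat_transf_ext(2)[OF f(2)]
        have h: "(F, ext f, F') \<in> Hom \<A> F F'" unfolding A_hom using e F by blast
        have "x = amap Phi (F, ext f, F')" unfolding Phi_sel(2)[OF h] f(1) using e by simp
        then show "x \<in> amap Phi ` Hom \<A> F F'" using h by blast
      qed
    qed
  qed
qed

text \<open>A functor \<open>N\<close> on the group amounts to a bimonoid with an action
  \<open>r\<close>; the algebra \<open>J\<close> of this pair is sent to a functor isomorphic to
  \<open>N\<close> by the arrows of \<open>J_iso\<close>.\<close>

lemma Phi_ess_surj:
  assumes N: "N \<in> Obj \<G>"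
  shows "\<exists>F\<in>Obj \<A>. \<exists>e\<in>Hom \<G> (omap Phi F) N. iso_arrow \<G> e"
proof -
  have Nf: "is_functor (group_category G) \<B> N" using N by (simp add: G_sel)
  interpret N: is_functor "group_category G" \<B> N by (rule Nf)
  let ?B = "omap N ()"
  have B: "bimonoid S ?B" "commutation kX kY S ?B" using N.omap_closed by (auto simp: group_category_sel B_sel)
  define r where "r g = fst (snd (amap N g))" for g
  have r: "amap N g = (?B, r g, ?B)" "bimonoid_morphism S ?B ?B (r g)" if "g \<in> carrier G" for g
    using N.amap_closed[of g "()" "()"] that unfolding B_hom by (auto simp: group_category_sel r_def)
  have r1: "r \<one>\<^bsub>G\<^esub> = Ident S (bobj ?B)"
    using N.amap_ident[of "()"] r(1)[OF one_closed] by (simp add: group_category_sel B_sel)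
  have rm: "r (g \<otimes>\<^bsub>G\<^esub> h) = r g \<cdot> r h" if "g \<in> carrier G" "h \<in> carrier G" for g h
    using N.amap_comp[of h "()" "()" g "()"] r(1)[OF that(1)] r(1)[OF that(2)] r(1)[OF m_closed[OF that]] that
    by (simp add: group_category_sel B_sel)
  have BC: "kX = Unordered \<Longrightarrow> commutative_bimonoid S ?B" "kY = Unordered \<Longrightarrow> cocommutative_bimonoid S ?B"
    using B(2) unfolding commutation_def by blast+
  interpret X: G_bimonoid G S ?B r L kX kY
    by (rule G_bimonoid.intro[OF is_group symmetric_monoidal_category_axioms G_bimonoid_axioms.intro[OF L B(1) r(2) rm r1 BC]])
  have J: "X.J \<in> \<F>" by (rule J_in) (rule X.G_bimonoid_axioms)
  let ?F = "X.J"
  obtain f f' where f: "bimonoid_morphism S (bF ?F) ?B f" "bimonoid_morphism S ?B (bF ?F) f'"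
    "f' \<cdot> f = Ident S (bobj (bF ?F))" "f \<cdot> f' = Ident S (bobj ?B)"
    "\<And>g. g \<in> carrier G \<Longrightarrow> f \<cdot> act ?F g = r g \<cdot> f" "\<And>g. g \<in> carrier G \<Longrightarrow> f' \<cdot> r g = act ?F g \<cdot> f'"
    using X.J_iso by metis
  have om: "omap (phi ?F) () = bF ?F" "g \<in> carrier G \<Longrightarrow> amap (phi ?F) g = (bF ?F, act ?F g, bF ?F)" for g by (simp_all add: phi_def)
  let ?e = "(phi ?F, \<lambda>_::unit. (bF ?F, f, ?B), N)" and ?e' = "(N, \<lambda>_::unit. (?B, f', bF ?F), phi ?F)"
  have e: "?e \<in> Hom \<G> (phi ?F) N"
    unfolding G_hom om using phi_functor[OF J] Nf bF_obj[OF J] B f(1,5) r(1) om(2) by (auto simp: B_hom B_sel)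
  have e': "?e' \<in> Hom \<G> N (phi ?F)"
    unfolding G_hom om using phi_functor[OF J] Nf bF_obj[OF J] B f(2,6) r(1) om(2) by (auto simp: B_hom B_sel)
  have "inverse_arrows \<G> ?e ?e'"
    unfolding inverse_arrows_def using e e' f(3,4) om(1) by (simp add: Hom_def G_sel B_sel)
  then show ?thesis using e J unfolding iso_arrow_def A_sel Phi_sel(1)[OF J, symmetric] by blast
qed

lemma equivalent: "equivalent_categories \<A> \<G>"
  by (rule equivalent_categoriesI[OF category_A category_G Phi_functor _ Phi_ess_surj]) (simp_all add: A_sel Phi_bij)

end

text \<open>The closure condition on the set of functors is
  \<open>symmetric_monoidal_functor_J\<close> for strong algebras, and \<open>strict_J\<close> for
  strict algebras over a strict category.\<close>

lemma equivalent_Alg: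
  fixes G :: "('g, 'y) monoid_scheme" and S :: "('o, 'a, 'z) smc_scheme"
  assumes G: "group G" and S: "symmetric_monoidal_category S" and L: "L = Commuting \<or> (L = Preserving \<and> comm_group G)"
  shows "equivalent_categories (Alg (composite_prop L kX kY G) S) (functor_category (group_category G) (full_subcategory (bimonoid_category S) (commutation kX kY S)))"
    and "strict_smc S \<Longrightarrow> equivalent_categories (strict_Alg (composite_prop L kX kY G) S) (functor_category (group_category G) (full_subcategory (bimonoid_category S) (commutation kX kY S)))"
proof -
  note i = composite_algebras.intro[OF G S composite_algebras_axioms.intro[OF L]]
  show "equivalent_categories (Alg (composite_prop L kX kY G) S) (functor_category (group_category G) (full_subcategory (bimonoid_category S) (commutation kX kY S)))"
    unfolding Alg_def by (rule composite_algebras.equivalent, rule i) (simp_all add: G_bimonoid.symmetric_monoidal_functor_J)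
  show "equivalent_categories (strict_Alg (composite_prop L kX kY G) S) (functor_category (group_category G) (full_subcategory (bimonoid_category S) (commutation kX kY S)))"
    if "strict_smc S" unfolding strict_Alg_def
    by (rule composite_algebras.equivalent, rule i)
      (simp_all add: G_bimonoid.strict_J that symmetric_strict_monoidal_functor.axioms(1))
qed

lemma commutation_simps:
  "commutation Unordered Ordered S = commutative_bimonoid S" "commutation Ordered Unordered S = cocommutative_bimonoid S"
  "commutation Unordered Unordered S = (\<lambda>B. commutative_bimonoid S B \<and> cocommutative_bimonoid S B)"
  by (simp_all add: commutation_def fun_eq_iff)

theorem theorem6p17:
  fixes G :: "('g, 'y) monoid_scheme"
    and S :: "('o, 'a, 'z) smc_scheme"
    and L :: label_law
  assumes "group G"
    and "symmetric_monoidal_category S"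
    and "L = Commuting \<or> (L = Preserving \<and> comm_group G)"
  shows "(equivalent_categories (Alg (Q_V L G) S) (G_commutative_bimonoids G S) \<and>
          equivalent_categories (Alg (Q_H L G) S) (G_cocommutative_bimonoids G S) \<and>
          equivalent_categories (Alg (Q_GF L G) S) (G_commutative_cocommutative_bimonoids G S)) \<and>
         (strict_smc S \<longrightarrow>
          equivalent_categories (strict_Alg (Q_V L G) S) (G_commutative_bimonoids G S) \<and>
          equivalent_categories (strict_Alg (Q_H L G) S) (G_cocommutative_bimonoids G S) \<and>
          equivalent_categories (strict_Alg (Q_GF L G) S) (G_commutative_cocommutative_bimonoids G S))"
  unfolding Q_V_def Q_H_def Q_GF_def G_commutative_bimonoids_def G_cocommutative_bimonoids_def
    G_commutative_cocommutative_bimonoids_def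
  using equivalent_Alg[OF assms, of Unordered Ordered] equivalent_Alg[OF assms, of Ordered Unordered]
    equivalent_Alg[OF assms, of Unordered Unordered]
  unfolding commutation_simps by blast

end
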